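(* Let $m\ge1$, $n_1,\dots,n_m\ge0$ integers, $0<r_{\max}<1$, $\Omega\subset\mathbb C$ a simply connected region containing $0$, $\Omega_0=\Omega\setminus\{0\}$, and let index sets $I^{(\ell)}\subseteq\{1,\dots,n_\ell\}$, $J^{(\ell+1)}\subseteq\{1,\dots,n_{\ell+1}\}$ ($1\le\ell\le m-1$) be given. Suppose $A(W^{(1)},\dots,W^{(m)};z_0,\dots,z_{m-1})$ is analytic for each $w^{(\ell)}_{i_\ell}\in\Omega_0$ and $(z_0,\dots,z_{m-1})\in\mathbb D(r_{\max})\times\mathbb D^{m-1}$, and let $H$ be the function built from $A$ as in the context. Suppose $q(w)$ is analytic for $w\in\Omega$ and satisfies the nested level curve assumption of the context. If $q(w)$ dominates $H$ at $w=0$, then the function $G(z_0,\dots,z_{m-1})$ (defined in the context for $(z_0,\dots,z_{m-1})\in\mathbb D_0(r_{\max})\times\mathbb D_0^{m-1}$) extends analytically to $(z_0,\dots,z_{m-1})\in\mathbb D(r_{\max})\times\mathbb D^{m-1}$. Moreover, $G(0,z_1,\dots,z_{m-1})$ is independent of $q$ and equals $$\prod_{\ell=2}^m\prod_{i_\ell=1}^{n_\ell}\Big[\frac1{1-z_{\ell-1}}\int_{\Sigma_\ell^{in}}\frac{dw^{(\ell)}_{i_\ell}}{2\pi i}-\frac{z_{\ell-1}}{1-z_{\ell-1}}\int_{\Sigma_\ell^{out}}\frac{dw^{(\ell)}_{i_\ell}}{2\pi i}\Big]\cdot\prod_{i_1=1}^{n_1}\int_{\Sigma_1}\frac{dw^{(1)}_{i_1}}{2\pi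 i}\;H(W^{(1)},\dots,W^{(m)};0,z_1,\dots,z_{m-1}),$$ where $\Sigma_m^{out},\dots,\Sigma_2^{out},\Sigma_1,\Sigma_2^{in},\dots,\Sigma_m^{in}$, from outside to inside, are arbitrary $2m-1$ nested simple closed (counterclockwise) contours in $\Omega$, each enclosing $0$.
   Context: $\mathbb D(r)=\{|z|<r\}$, $\mathbb D_0(r)=\{0<|z|<r\}$, $\mathbb D=\mathbb D(1)$, $\mathbb D_0=\mathbb D_0(1)$. $W^{(\ell)}=(w^{(\ell)}_1,\dots,w^{(\ell)}_{n_\ell})$; $W_I$ is the vector obtained from $W$ by keeping only the coordinates with index in $I$. For vectors, $\Delta(W)=\prod_{i<j}(w_j-w_i)$, $\Delta(W;W')=\prod_{i,i'}(w_i-w'_{i'})$ (empty products $=1$), and $\mathrm C(W;W')=\frac{\Delta(W)\Delta(W')}{\Delta(W;W')}$. $$H(W^{(1)},\dots,W^{(m)};z_0,\dots,z_{m-1})=\Big[\prod_{\ell=1}^{m-1}\mathrm C\big(W^{(\ell)}_{I^{(\ell)}};W^{(\ell+1)}_{J^{(\ell+1)}}\big)\Big]A(W^{(1)},\dots,W^{(m)};z_0,\dots,z_{m-1}).$$ Nested level curve assumption on $q$: for each $0<r<r_{\max}$, $\Gamma_r=\{w\in\Omega:|q(w)|=r\}$ is a simple closed contour enclosing $0$, and $\Gamma_r$ encloses $\Gamma_{r'}$ if $0<r'<r<r_{\max}$. (This implies $q(0)=0$.) For $|\hat z|<r_{\max}$, $\mathcal R_{\hat z}=\{w\in\Omega:q(w)=\hat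 z\}$. For $(z_0,\dots,z_{m-1})\in\mathbb D_0(r_{\max})\times\mathbb D_0^{m-1}$, with $\hat z_\ell=z_0z_1\cdots z_{\ell-1}$ ($1\le\ell\le m$), $$G(z_0,\dots,z_{m-1})=\sum_{W^{(1)}\in\mathcal R_{\hat z_1}^{n_1}}\cdots\sum_{W^{(m)}\in\mathcal R_{\hat z_m}^{n_m}}\Big[\prod_{\ell=1}^mJ(W^{(\ell)})\Big]H(W^{(1)},\dots,W^{(m)};z_0,\dots,z_{m-1}),\quad J(W^{(\ell)})=\prod_{i=1}^{n_\ell}\frac{q(w^{(\ell)}_i)}{q'(w^{(\ell)}_i)}.$$ Cauchy chain: a sequence of variables $w^{(k)}_{i_k},w^{(k+1)}_{i_{k+1}},\dots,w^{(k')}_{i_{k'}}$ with $(i_\ell,i_{\ell+1})\in I^{(\ell)}\times J^{(\ell+1)}$ for all $k\le\ell<k'$; any single variable is also a Cauchy chain. $q$ dominates $H$ at $w=0$ if for every Cauchy chain $w^{(k)}_{i_k},\dots,w^{(k')}_{i_{k'}}$ the function $q(w)\cdot A(W^{(1)},\dots,W^{(m)};z_0,\dots,z_{m-1})\big|_{w^{(k)}_{i_k}=\cdots=w^{(k')}_{i_{k'}}=w}$ is analytic at $w=0$, for any fixed values of the other variables $w^{(\ell)}_{i_\ell}$ in $\Omega_0$ and any fixed $(z_0,\dots,z_{m-1})\in\mathbb D(r_{\max})\times\mathbb D^{m-1}$. *)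

theory Defs
  imports "HOL-Complex_Analysis.Complex_Analysis"
begin

section \<open>Analytic functions of finitely many complex variables\<close>

text \<open>
  Points of \<open>\<complex>\<close>-valued coordinate space over a finite index set \<open>X\<close> are extensional functions
  \<open>X \<rightarrow>\<^sub>E UNIV\<close>.  For \<open>S\<close> relatively open in that space, the following says that \<open>f\<close> has a
  complex-linear Frechet derivative at every point of \<open>S\<close>; this is the several-variable
  counterpart of \<^const>\<open>holomorphic_on\<close>.
\<close>

definition analytic_in ::
  "'i set \<Rightarrow> (('i \<Rightarrow> complex) \<Rightarrow> complex) \<Rightarrow> ('i \<Rightarrow> complex) set \<Rightarrow> bool" where
  "analytic_in X f S \<longleftrightarrow>
     (\<forall>a\<in>S. \<exists>c. \<forall>e>0. \<exists>d>0. \<forall>x\<in>S. (\<forall>i\<in>X. norm (x i - a i) < d) \<longrightarrow>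
        norm (f x - f a - (\<Sum>i\<in>X. c i * (x i - a i))) \<le> e * (\<Sum>i\<in>X. norm (x i - a i)))"


section \<open>The variables\<close>

text \<open>
  The variable \<open>w\<^sub>i\<close> of level \<open>l\<close> is \<open>W (l, i)\<close>, with \<open>1 \<le> l \<le> m\<close> and \<open>1 \<le> i \<le> n l\<close>;
  the parameters \<open>z 0, \<dots>, z (m - 1)\<close> are indexed by \<open>{..<m}\<close>.
\<close>

definition var_idx :: "nat \<Rightarrow> (nat \<Rightarrow> nat) \<Rightarrow> (nat \<times> nat) set" where
  "var_idx m n = Sigma {1..m} (\<lambda>l. {1..n l})"

definition z_radius :: "real \<Rightarrow> nat \<Rightarrow> real" where
  "z_radius r k = (if k = 0 then r else 1)"

definition polydisc :: "nat \<Rightarrow> real \<Rightarrow> (nat \<Rightarrow> complex) set" where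
  "polydisc m r = (\<Pi>\<^sub>E k\<in>{..<m}. ball 0 (z_radius r k))"

definition punctured_polydisc :: "nat \<Rightarrow> real \<Rightarrow> (nat \<Rightarrow> complex) set" where
  "punctured_polydisc m r = (\<Pi>\<^sub>E k\<in>{..<m}. ball 0 (z_radius r k) - {0})"

definition analytic_data ::
  "complex set \<Rightarrow> nat \<Rightarrow> (nat \<Rightarrow> nat) \<Rightarrow> real
     \<Rightarrow> ((nat \<times> nat \<Rightarrow> complex) \<Rightarrow> (nat \<Rightarrow> complex) \<Rightarrow> complex) \<Rightarrow> bool" where
  "analytic_data \<Omega> m n r A \<longleftrightarrow>
     analytic_in (var_idx m n <+> {..<m}) (\<lambda>p. A (p \<circ> Inl) (p \<circ> Inr))
       (\<Pi>\<^sub>E v\<in>var_idx m n <+> {..<m}.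
          (case v of Inl _ \<Rightarrow> \<Omega> - {0} | Inr k \<Rightarrow> ball 0 (z_radius r k)))"


section \<open>The functions \<open>H\<close> and \<open>G\<close>\<close>

definition vandermonde :: "nat set \<Rightarrow> (nat \<Rightarrow> complex) \<Rightarrow> complex" where
  "vandermonde I w = (\<Prod>(i, j)\<in>{(i, j). i \<in> I \<and> j \<in> I \<and> i < j}. w j - w i)"

definition cross_prod ::
  "nat set \<Rightarrow> (nat \<Rightarrow> complex) \<Rightarrow> nat set \<Rightarrow> (nat \<Rightarrow> complex) \<Rightarrow> complex" where
  "cross_prod I w J w' = (\<Prod>i\<in>I. \<Prod>j\<in>J. w i - w' j)"

definition cauchy_factor ::
  "nat set \<Rightarrow> (nat \<Rightarrow> complex) \<Rightarrow> nat set \<Rightarrow> (nat \<Rightarrow> complex) \<Rightarrow> complex" where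
  "cauchy_factor I w J w' = vandermonde I w * vandermonde J w' / cross_prod I w J w'"

definition H_fun ::
  "nat \<Rightarrow> (nat \<Rightarrow> nat set) \<Rightarrow> (nat \<Rightarrow> nat set)
     \<Rightarrow> ((nat \<times> nat \<Rightarrow> complex) \<Rightarrow> (nat \<Rightarrow> complex) \<Rightarrow> complex)
     \<Rightarrow> (nat \<times> nat \<Rightarrow> complex) \<Rightarrow> (nat \<Rightarrow> complex) \<Rightarrow> complex" where
  "H_fun m I J A W z =
     (\<Prod>l\<in>{1..<m}. cauchy_factor (I l) (\<lambda>i. W (l, i)) (J (l + 1)) (\<lambda>j. W (l + 1, j))) * A W z"

definition roots_at :: "complex set \<Rightarrow> (complex \<Rightarrow> complex) \<Rightarrow> complex \<Rightarrow> complex set" where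
  "roots_at \<Omega> q \<zeta> = {w \<in> \<Omega>. q w = \<zeta>}"

definition z_hat :: "(nat \<Rightarrow> complex) \<Rightarrow> nat \<Rightarrow> complex" where
  "z_hat z l = (\<Prod>k<l. z k)"

definition G_fun ::
  "complex set \<Rightarrow> nat \<Rightarrow> (nat \<Rightarrow> nat) \<Rightarrow> (nat \<Rightarrow> nat set) \<Rightarrow> (nat \<Rightarrow> nat set)
     \<Rightarrow> ((nat \<times> nat \<Rightarrow> complex) \<Rightarrow> (nat \<Rightarrow> complex) \<Rightarrow> complex)
     \<Rightarrow> (complex \<Rightarrow> complex) \<Rightarrow> (nat \<Rightarrow> complex) \<Rightarrow> complex" where
  "G_fun \<Omega> m n I J A q z =
     (\<Sum>W\<in>(\<Pi>\<^sub>E (l, i)\<in>var_idx m n. roots_at \<Omega> q (z_hat z l)).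
        (\<Prod>l\<in>{1..m}. \<Prod>i\<in>{1..n l}. q (W (l, i)) / deriv q (W (l, i))) * H_fun m I J A W z)"

definition analytic_extension ::
  "nat \<Rightarrow> real \<Rightarrow> ((nat \<Rightarrow> complex) \<Rightarrow> complex) \<Rightarrow> ((nat \<Rightarrow> complex) \<Rightarrow> complex) \<Rightarrow> bool" where
  "analytic_extension m r g g' \<longleftrightarrow>
     analytic_in {..<m} g' (polydisc m r) \<and> (\<forall>z\<in>punctured_polydisc m r. g' z = g z)"


section \<open>Contours and the hypotheses on \<open>q\<close>\<close>

definition simple_closed_contour :: "(real \<Rightarrow> complex) \<Rightarrow> bool" where
  "simple_closed_contour \<gamma> \<longleftrightarrow>
     valid_path \<gamma> \<and> simple_path \<gamma> \<and> pathfinish \<gamma> = pathstart \<gamma>"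

definition level_curve :: "complex set \<Rightarrow> (complex \<Rightarrow> complex) \<Rightarrow> real \<Rightarrow> complex set" where
  "level_curve \<Omega> q r = {w \<in> \<Omega>. norm (q w) = r}"

definition nested_level_curves :: "complex set \<Rightarrow> (complex \<Rightarrow> complex) \<Rightarrow> real \<Rightarrow> bool" where
  "nested_level_curves \<Omega> q R \<longleftrightarrow>
     (\<forall>r. 0 < r \<and> r < R \<longrightarrow>
        (\<exists>\<gamma>. simple_closed_contour \<gamma> \<and> path_image \<gamma> = level_curve \<Omega> q r) \<and>
        0 \<in> inside (level_curve \<Omega> q r)) \<and>
     (\<forall>r r'. 0 < r' \<and> r' < r \<and> r < R \<longrightarrow>
        level_curve \<Omega> q r' \<subseteq> inside (level_curve \<Omega> q r))"

text \<open>The chain consists of the variables \<open>(l, ix l)\<close> for \<open>k \<le> l \<le> k'\<close>.\<close>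

definition cauchy_chain ::
  "nat \<Rightarrow> (nat \<Rightarrow> nat) \<Rightarrow> (nat \<Rightarrow> nat set) \<Rightarrow> (nat \<Rightarrow> nat set)
     \<Rightarrow> nat \<Rightarrow> nat \<Rightarrow> (nat \<Rightarrow> nat) \<Rightarrow> bool" where
  "cauchy_chain m n I J k k' ix \<longleftrightarrow>
     1 \<le> k \<and> k \<le> k' \<and> k' \<le> m \<and> (\<forall>l\<in>{k..k'}. ix l \<in> {1..n l}) \<and>
     (\<forall>l\<in>{k..<k'}. ix l \<in> I l \<and> ix (l + 1) \<in> J (l + 1))"

definition set_chain ::
  "nat \<Rightarrow> nat \<Rightarrow> (nat \<Rightarrow> nat) \<Rightarrow> complex \<Rightarrow> (nat \<times> nat \<Rightarrow> complex) \<Rightarrow> nat \<times> nat \<Rightarrow> complex" where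
  "set_chain k k' ix w W = (\<lambda>(l, i). if l \<in> {k..k'} \<and> i = ix l then w else W (l, i))"

text \<open>
  The value of \<open>A\<close> with a coordinate equal to \<open>0\<close> carries no meaning, so analyticity at \<open>0\<close> is
  that of a function agreeing with \<open>q w * A \<dots>\<close> on a punctured neighbourhood of \<open>0\<close>.  The values
  of \<open>W\<close> at the variables of the chain are overwritten, hence irrelevant.
\<close>

definition dominates_at_0 ::
  "complex set \<Rightarrow> nat \<Rightarrow> (nat \<Rightarrow> nat) \<Rightarrow> (nat \<Rightarrow> nat set) \<Rightarrow> (nat \<Rightarrow> nat set) \<Rightarrow> real
     \<Rightarrow> ((nat \<times> nat \<Rightarrow> complex) \<Rightarrow> (nat \<Rightarrow> complex) \<Rightarrow> complex)
     \<Rightarrow> (complex \<Rightarrow> complex) \<Rightarrow> bool" where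
  "dominates_at_0 \<Omega> m n I J r A q \<longleftrightarrow>
     (\<forall>k k' ix. cauchy_chain m n I J k k' ix \<longrightarrow>
        (\<forall>W\<in>var_idx m n \<rightarrow>\<^sub>E (\<Omega> - {0}). \<forall>z\<in>polydisc m r.
           \<exists>g. g analytic_on {0} \<and>
               (\<forall>\<^sub>F w in at 0. q w * A (set_chain k k' ix w W) z = g w)))"

definition admissible ::
  "complex set \<Rightarrow> nat \<Rightarrow> (nat \<Rightarrow> nat) \<Rightarrow> (nat \<Rightarrow> nat set) \<Rightarrow> (nat \<Rightarrow> nat set) \<Rightarrow> real
     \<Rightarrow> ((nat \<times> nat \<Rightarrow> complex) \<Rightarrow> (nat \<Rightarrow> complex) \<Rightarrow> complex)
     \<Rightarrow> (complex \<Rightarrow> complex) \<Rightarrow> bool" where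
  "admissible \<Omega> m n I J r A q \<longleftrightarrow>
     q analytic_on \<Omega> \<and> nested_level_curves \<Omega> q r \<and> dominates_at_0 \<Omega> m n I J r A q"


section \<open>The iterated contour integral\<close>

definition ccw_contour_around_0 :: "(real \<Rightarrow> complex) \<Rightarrow> bool" where
  "ccw_contour_around_0 \<gamma> \<longleftrightarrow>
     simple_closed_contour \<gamma> \<and> 0 \<in> inside (path_image \<gamma>) \<and> winding_number \<gamma> 0 = 1"

text \<open>The list runs from the outermost to the innermost contour.\<close>

definition nested_contours ::
  "complex set \<Rightarrow> nat \<Rightarrow> (nat \<Rightarrow> real \<Rightarrow> complex) \<Rightarrow> (real \<Rightarrow> complex) \<Rightarrow> (nat \<Rightarrow> real \<Rightarrow> complex)
     \<Rightarrow> bool" where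
  "nested_contours \<Omega> m Sout S1 Sin \<longleftrightarrow>
     (let \<Sigma> = rev (map Sout [2..<Suc m]) @ [S1] @ map Sin [2..<Suc m] in
        (\<forall>\<gamma>\<in>set \<Sigma>. ccw_contour_around_0 \<gamma> \<and> path_image \<gamma> \<subseteq> \<Omega>) \<and>
        sorted_wrt (\<lambda>\<gamma> \<gamma>'. path_image \<gamma>' \<subseteq> inside (path_image \<gamma>)) \<Sigma>)"

definition contour_mean :: "(real \<Rightarrow> complex) \<Rightarrow> (complex \<Rightarrow> complex) \<Rightarrow> complex" where
  "contour_mean \<gamma> f = contour_integral \<gamma> f / (2 * of_real pi * \<i>)"

definition level_functional ::
  "(nat \<Rightarrow> real \<Rightarrow> complex) \<Rightarrow> (real \<Rightarrow> complex) \<Rightarrow> (nat \<Rightarrow> real \<Rightarrow> complex) \<Rightarrow> (nat \<Rightarrow> complex)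
     \<Rightarrow> nat \<times> nat \<Rightarrow> (complex \<Rightarrow> complex) \<Rightarrow> complex" where
  "level_functional Sout S1 Sin z v f =
     (let l = fst v in
      if l = 1 then contour_mean S1 f
      else 1 / (1 - z (l - 1)) * contour_mean (Sin l) f
           - z (l - 1) / (1 - z (l - 1)) * contour_mean (Sout l) f)"

text \<open>Applies the functional \<open>L v\<close> in the variable \<open>v\<close> for each \<open>v\<close> in the list, the head outermost.\<close>

primrec iterate_functionals ::
  "('i \<Rightarrow> (complex \<Rightarrow> complex) \<Rightarrow> complex) \<Rightarrow> 'i list
     \<Rightarrow> (('i \<Rightarrow> complex) \<Rightarrow> complex) \<Rightarrow> ('i \<Rightarrow> complex) \<Rightarrow> complex" where
  "iterate_functionals L [] F W = F W"
| "iterate_functionals L (v # vs) F W = L v (\<lambda>w. iterate_functionals L vs F (W(v := w)))"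

definition var_list :: "nat \<Rightarrow> (nat \<Rightarrow> nat) \<Rightarrow> (nat \<times> nat) list" where
  "var_list m n =
     concat (map (\<lambda>l. map (Pair l) [1..<Suc (n l)]) [2..<Suc m]) @ map (Pair 1) [1..<Suc (n 1)]"

text \<open>
  Starting from the constant \<^const>\<open>undefined\<close> makes the fully updated \<open>W\<close> an element of
  \<open>var_idx m n \<rightarrow>\<^sub>E UNIV\<close>.
\<close>

definition limit_integral ::
  "nat \<Rightarrow> (nat \<Rightarrow> nat) \<Rightarrow> (nat \<Rightarrow> nat set) \<Rightarrow> (nat \<Rightarrow> nat set)
     \<Rightarrow> ((nat \<times> nat \<Rightarrow> complex) \<Rightarrow> (nat \<Rightarrow> complex) \<Rightarrow> complex)
     \<Rightarrow> (nat \<Rightarrow> real \<Rightarrow> complex) \<Rightarrow> (real \<Rightarrow> complex) \<Rightarrow> (nat \<Rightarrow> real \<Rightarrow> complex)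
     \<Rightarrow> (nat \<Rightarrow> complex) \<Rightarrow> complex" where
  "limit_integral m n I J A Sout S1 Sin z =
     iterate_functionals (level_functional Sout S1 Sin z) (var_list m n)
       (\<lambda>W. H_fun m I J A W z) (\<lambda>_. undefined)"

end

theory Submission
  imports Defs
begin

text \<open>
  Fix \<open>z\<close> with nonzero coordinates, and put \<open>\<zeta>\<^sub>l = z_hat z l\<close>.  In each variable of level \<open>l\<close> the sum over the roots
  of \<open>q = \<zeta>\<^sub>l\<close> with weights \<open>q / q'\<close> is compared with the functional
  sending \<open>f\<close> to \<open>a\<^sub>l \<integral>f\<close> over \<open>N\<^sub>l\<close> plus \<open>\<integral>(q / (q - \<zeta>\<^sub>l) - a\<^sub>l) f\<close> over \<open>O\<^sub>l\<close>, with \<open>a\<^sub>1 = 0\<close> and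
  \<open>a\<^sub>l = 1 / (1 - z (l - 1))\<close>, where \<open>N\<^sub>l\<close> and \<open>O\<^sub>l\<close> are the inner and outer contours.  For this \<open>a\<^sub>l\<close> the outer weight vanishes at the roots
  of level \<open>l - 1\<close>, so the poles of the Cauchy factors at the variables of level \<open>l - 1\<close> do not contribute,
  and by the residue theorem the two functionals differ by the integral of \<open>q / (q - \<zeta>\<^sub>l) f\<close> over a small
  circle around \<open>0\<close>.  Evaluating that integral by residues only produces Cauchy chains of increasing length,
  whose pole at \<open>0\<close> is removed by domination, so it vanishes after integrating the remaining variables.
  Hence \<open>G\<close> is an iterated contour integral of \<open>H\<close> in which \<open>z\<close> enters analytically, also where coordinates
  of \<open>z\<close> vanish.  At \<open>z 0 = 0\<close> all \<open>\<zeta>\<^sub>l\<close> are \<open>0\<close>, the quotient \<open>q / (q - \<zeta>\<^sub>l)\<close> becomes \<open>1\<close>, and \<open>q\<close> disappears.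
\<close>


section \<open>Bounded linear functionals on spaces of continuous functions\<close>

text \<open>The constant \<open>1 / (1 - z (l - 1))\<close> is the value of
  \<open>q / (q - z_hat z l)\<close> where \<open>q = z_hat z (l - 1)\<close>. Contours are
  exchanged for roots one variable at a time, from level 1 upwards: the lower neighbours then
  already sit at roots, while higher variables still run over both contours. The chain argument uses
  the latter: the inner weight is constant in the variable, so a residue at a variable on its inner
  contour is again an integral with the factor \<open>q / (q - z_hat z k)\<close> of the level
  \<open>k\<close> where the chain starts. Three obstacles shape the rest. Finite sums and contour
  integrals must be interchanged freely, so both are treated as bounded functionals on continuous
  functions. Variables of one level share an inner contour and may coincide there; circles with
  distinct radii keep them apart. Given contours represent \<open>G\<close> only while
  \<open>z_hat z l\<close> stays below \<open>|q|\<close> on the outer ones, that is, for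
  \<open>z 0\<close> near \<open>0\<close>; the extension to the full polydisc is glued from
  contours that are level curves of \<open>q\<close>, and the formula for arbitrary contours follows
  by uniqueness.\<close>

definition bounded_functional ::
  "complex set \<Rightarrow> ((complex \<Rightarrow> complex) \<Rightarrow> complex) \<Rightarrow> bool" where
  "bounded_functional K \<phi> \<longleftrightarrow>
     (\<forall>f g. continuous_on K f \<longrightarrow> continuous_on K g \<longrightarrow> \<phi> (\<lambda>x. f x + g x) = \<phi> f + \<phi> g) \<and>
     (\<forall>c f. continuous_on K f \<longrightarrow> \<phi> (\<lambda>x. c * f x) = c * \<phi> f) \<and>
     (\<exists>B\<ge>0. \<forall>f b. continuous_on K f \<longrightarrow> 0 \<le> b \<longrightarrow> (\<forall>x\<in>K. norm (f x) \<le> b) \<longrightarrow> norm (\<phi> f) \<le> B * b)"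

lemma bounded_functional_add:
  "bounded_functional K \<phi> \<Longrightarrow> continuous_on K f \<Longrightarrow> continuous_on K g \<Longrightarrow>
     \<phi> (\<lambda>x. f x + g x) = \<phi> f + \<phi> g"
  by (auto simp: bounded_functional_def)

lemma bounded_functional_cmult:
  "bounded_functional K \<phi> \<Longrightarrow> continuous_on K f \<Longrightarrow> \<phi> (\<lambda>x. c * f x) = c * \<phi> f"
  by (auto simp: bounded_functional_def)

lemma bounded_functional_bound:
  assumes "bounded_functional K \<phi>"
  obtains B where "B \<ge> 0"
    "\<And>f b. continuous_on K f \<Longrightarrow> 0 \<le> b \<Longrightarrow> (\<And>x. x \<in> K \<Longrightarrow> norm (f x) \<le> b) \<Longrightarrow> norm (\<phi> f) \<le> B * b"
  using assms unfolding bounded_functional_def by metis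

lemma bounded_functional_diff:
  assumes "bounded_functional K \<phi>" "continuous_on K f" "continuous_on K g"
  shows "\<phi> (\<lambda>x. f x - g x) = \<phi> f - \<phi> g"
proof -
  have "\<phi> (\<lambda>x. f x + (-1) * g x) = \<phi> f + \<phi> (\<lambda>x. (-1) * g x)"
    using assms(2,3) by (intro bounded_functional_add[OF assms(1)] continuous_intros)
  also have "\<phi> (\<lambda>x. (-1) * g x) = (-1) * \<phi> g"
    by (rule bounded_functional_cmult[OF assms(1,3)])
  finally show ?thesis by simp
qed

text \<open>Functions are total, but the bound sees only their values on \<open>K\<close>: a
  difference vanishing on \<open>K\<close> has image of norm at most \<open>B * 0\<close>. A bounded
  functional is thus a functional on continuous functions on \<open>K\<close>.\<close>

lemma bounded_functional_cong:
  assumes "bounded_functional K \<phi>" "continuous_on K f" "\<And>x. x \<in> K \<Longrightarrow> f x = g x"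
  shows "\<phi> f = \<phi> g"
proof -
  have g: "continuous_on K g" using assms(2,3) continuous_on_cong by metis
  obtain B where B: "B \<ge> 0"
    "\<And>f b. continuous_on K f \<Longrightarrow> 0 \<le> b \<Longrightarrow> (\<And>x. x \<in> K \<Longrightarrow> norm (f x) \<le> b) \<Longrightarrow> norm (\<phi> f) \<le> B * b"
    using bounded_functional_bound[OF assms(1)] by blast
  have "norm (\<phi> (\<lambda>x. f x - g x)) \<le> B * 0"
    using assms g by (intro B) (auto intro!: continuous_intros)
  then show ?thesis using bounded_functional_diff[OF assms(1,2) g] by simp
qed

lemma bounded_functional_zero:
  assumes "bounded_functional K \<phi>" "\<And>x. x \<in> K \<Longrightarrow> f x = 0"
  shows "\<phi> f = 0"
proof -
  have "\<phi> (\<lambda>x. 0 * 0) = 0 * \<phi> (\<lambda>x. 0)"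
    by (rule bounded_functional_cmult[OF assms(1)]) auto
  moreover have "\<phi> (\<lambda>x. 0) = \<phi> f"
    using assms by (intro bounded_functional_cong[OF assms(1)]) auto
  ultimately show ?thesis by simp
qed

lemma bounded_functional_sum:
  assumes "bounded_functional K \<phi>" "finite S" "\<And>s. s \<in> S \<Longrightarrow> continuous_on K (f s)"
  shows "\<phi> (\<lambda>x. \<Sum>s\<in>S. f s x) = (\<Sum>s\<in>S. \<phi> (f s))"
  using assms(2,3)
proof (induction S rule: finite_induct)
  case empty
  then show ?case by (simp add: bounded_functional_zero[OF assms(1)])
next
  case (insert s S)
  have "\<phi> (\<lambda>x. f s x + (\<Sum>s\<in>S. f s x)) = \<phi> (f s) + \<phi> (\<lambda>x. \<Sum>s\<in>S. f s x)"
    by (intro bounded_functional_add[OF assms(1)] continuous_on_sum insert.prems) auto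
  with insert show ?case by simp
qed

lemma bounded_functional_mono:
  assumes "bounded_functional K \<phi>" "K \<subseteq> K'"
  shows "bounded_functional K' \<phi>"
proof -
  obtain B where B: "B \<ge> 0"
    "\<And>f b. continuous_on K f \<Longrightarrow> 0 \<le> b \<Longrightarrow> (\<And>x. x \<in> K \<Longrightarrow> norm (f x) \<le> b) \<Longrightarrow> norm (\<phi> f) \<le> B * b"
    using bounded_functional_bound[OF assms(1)] by blast
  have c: "continuous_on K' f \<Longrightarrow> continuous_on K f" for f :: "complex \<Rightarrow> complex"
    using assms(2) continuous_on_subset by blast
  have "norm (\<phi> f) \<le> B * b" if "continuous_on K' f" "0 \<le> b" "\<forall>x\<in>K'. norm (f x) \<le> b" for f b
    using that assms(2) by (intro B(2) c) auto
  then show ?thesis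
    unfolding bounded_functional_def using B(1)
    by (intro conjI allI impI bounded_functional_add[OF assms(1)] bounded_functional_cmult[OF assms(1)] c)
       (assumption | blast)+
qed

lemma bounded_functional_plus:
  assumes "bounded_functional K \<phi>" "bounded_functional K \<psi>"
  shows "bounded_functional K (\<lambda>f. \<phi> f + \<psi> f)"
proof -
  obtain B where B: "B \<ge> 0"
    "\<And>f b. continuous_on K f \<Longrightarrow> 0 \<le> b \<Longrightarrow> (\<And>x. x \<in> K \<Longrightarrow> norm (f x) \<le> b) \<Longrightarrow> norm (\<phi> f) \<le> B * b"
    using bounded_functional_bound[OF assms(1)] by blast
  obtain C where C: "C \<ge> 0"
    "\<And>f b. continuous_on K f \<Longrightarrow> 0 \<le> b \<Longrightarrow> (\<And>x. x \<in> K \<Longrightarrow> norm (f x) \<le> b) \<Longrightarrow> norm (\<psi> f) \<le> C * b"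
    using bounded_functional_bound[OF assms(2)] by blast
  have "norm (\<phi> f + \<psi> f) \<le> (B + C) * b"
    if "continuous_on K f" "0 \<le> b" "\<forall>x\<in>K. norm (f x) \<le> b" for f b
  proof -
    have "norm (\<phi> f + \<psi> f) \<le> norm (\<phi> f) + norm (\<psi> f)" by (rule norm_triangle_ineq)
    also have "\<dots> \<le> B * b + C * b" using that by (intro add_mono B(2) C(2)) auto
    finally show ?thesis by (simp add: algebra_simps)
  qed
  moreover have "B + C \<ge> 0" using B(1) C(1) by simp
  ultimately show ?thesis
    unfolding bounded_functional_def
    using bounded_functional_add[OF assms(1)] bounded_functional_cmult[OF assms(1)]
      bounded_functional_add[OF assms(2)] bounded_functional_cmult[OF assms(2)]
    by (auto simp: algebra_simps intro!: exI[of _ "B + C"])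
qed

lemma bounded_functional_weight:
  assumes "compact K" "bounded_functional K \<phi>" "continuous_on K \<omega>"
  shows "bounded_functional K (\<lambda>f. \<phi> (\<lambda>w. \<omega> w * f w))"
proof -
  obtain B where B: "B \<ge> 0"
    "\<And>f b. continuous_on K f \<Longrightarrow> 0 \<le> b \<Longrightarrow> (\<And>x. x \<in> K \<Longrightarrow> norm (f x) \<le> b) \<Longrightarrow> norm (\<phi> f) \<le> B * b"
    using bounded_functional_bound[OF assms(2)] by blast
  have "bounded (\<omega> ` K)" using assms compact_continuous_image compact_imp_bounded by blast
  then obtain C where C: "C > 0" "\<And>x. x \<in> K \<Longrightarrow> norm (\<omega> x) \<le> C"
    by (auto simp: bounded_pos)
  have "norm (\<phi> (\<lambda>w. \<omega> w * f w)) \<le> (B * C) * b"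
    if "continuous_on K f" "0 \<le> b" "\<forall>x\<in>K. norm (f x) \<le> b" for f b
  proof -
    have "norm (\<phi> (\<lambda>w. \<omega> w * f w)) \<le> B * (C * b)"
      using that assms C by (intro B) (auto intro!: continuous_intros mult_mono simp: norm_mult less_imp_le)
    then show ?thesis by (simp add: algebra_simps)
  qed
  moreover have "\<phi> (\<lambda>w. \<omega> w * (f w + g w)) = \<phi> (\<lambda>w. \<omega> w * f w) + \<phi> (\<lambda>w. \<omega> w * g w)"
    if "continuous_on K f" "continuous_on K g" for f g
    using bounded_functional_add[OF assms(2), of "\<lambda>w. \<omega> w * f w" "\<lambda>w. \<omega> w * g w"] that assms(3)
    by (simp add: algebra_simps continuous_intros)
  moreover have "\<phi> (\<lambda>w. \<omega> w * (c * f w)) = c * \<phi> (\<lambda>w. \<omega> w * f w)"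
    if "continuous_on K f" for c f
    using bounded_functional_cmult[OF assms(2), of "\<lambda>w. \<omega> w * f w" c] that assms(3)
    by (simp add: algebra_simps continuous_intros)
  moreover have "B * C \<ge> 0" using B(1) C(1) by simp
  ultimately show ?thesis
    unfolding bounded_functional_def by blast
qed

text \<open>This puts the weighted sum over the roots of \<open>q\<close> on the same footing as a
  contour integral, so that both take part in the same interchange arguments.\<close>

lemma bounded_functional_finite_sum:
  assumes "finite K"
  shows "bounded_functional K (\<lambda>f. \<Sum>w\<in>K. c w * f w)"
proof -
  have "norm (\<Sum>w\<in>K. c w * f w) \<le> (\<Sum>w\<in>K. norm (c w)) * b"
    if "0 \<le> b" "\<forall>x\<in>K. norm (f x) \<le> b" for f :: "complex \<Rightarrow> complex" and b
    unfolding sum_distrib_right using that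
    by (intro order_trans[OF norm_sum] sum_mono) (auto simp: norm_mult intro!: mult_mono)
  moreover have "(\<Sum>w\<in>K. norm (c w)) \<ge> 0" by (simp add: sum_nonneg)
  ultimately show ?thesis
    unfolding bounded_functional_def
    by (auto simp: algebra_simps sum.distrib sum_distrib_left intro!: exI[of _ "\<Sum>w\<in>K. norm (c w)"])
qed

section \<open>Contour means as bounded functionals\<close>

lemma contour_integrable_continuous_C1:
  assumes "valid_path \<gamma>" "continuous_on {0..1} (\<lambda>t. vector_derivative \<gamma> (at t))"
    "continuous_on (path_image \<gamma>) f"
  shows "f contour_integrable_on \<gamma>"
proof -
  have "continuous_on {0..1} \<gamma>" using valid_path_imp_path[OF assms(1)] by (simp add: path_def)
  then have "continuous_on {0..1} (\<lambda>t. f (\<gamma> t))"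
    by (intro continuous_on_compose2[OF assms(3)]) (auto simp: path_image_def)
  then show ?thesis
    unfolding contour_integrable_on using assms(2)
    by (intro integrable_continuous_real continuous_intros)
qed

text \<open>Continuity of the derivative on all of \<open>{0..1}\<close> bounds it by some
  \<open>B\<close>, and the functional by \<open>B / (2 * pi)\<close>. A valid path only has a
  continuous derivative off a finite set, near which it may blow up.\<close>

lemma bounded_functional_contour_mean:
  assumes \<gamma>: "valid_path \<gamma>" and c: "continuous_on {0..1} (\<lambda>t. vector_derivative \<gamma> (at t))"
  shows "bounded_functional (path_image \<gamma>) (contour_mean \<gamma>)"
proof -
  have int: "f contour_integrable_on \<gamma>" if "continuous_on (path_image \<gamma>) f" for f
    using contour_integrable_continuous_C1[OF assms that] .
  have "bounded ((\<lambda>t. vector_derivative \<gamma> (at t)) ` {0..1})"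
    using c compact_continuous_image compact_imp_bounded by blast
  then obtain B where B: "B > 0" "\<And>t. t \<in> {0..1} \<Longrightarrow> norm (vector_derivative \<gamma> (at t)) \<le> B"
    by (auto simp: bounded_pos)
  have bd: "norm (contour_mean \<gamma> f) \<le> (B / (2 * pi)) * b"
    if f: "continuous_on (path_image \<gamma>) f" "0 \<le> b" "\<forall>x\<in>path_image \<gamma>. norm (f x) \<le> b" for f b
  proof -
    have "norm (f (\<gamma> t) * vector_derivative \<gamma> (at t)) \<le> b * B" if "t \<in> {0..1}" for t
      using B that f by (auto simp: norm_mult path_image_def intro!: mult_mono)
    moreover have "((\<lambda>t. f (\<gamma> t) * vector_derivative \<gamma> (at t)) has_integral contour_integral \<gamma> f) {0..1}"
      using has_contour_integral_integral[OF int[OF f(1)]] unfolding has_contour_integral .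
    ultimately have "norm (contour_integral \<gamma> f) \<le> b * B"
      using has_integral_bound[of "b * B" "\<lambda>t. f (\<gamma> t) * vector_derivative \<gamma> (at t)" _ 0 1] B(1) f(2)
      by simp
    then show ?thesis
      by (simp add: contour_mean_def norm_divide norm_mult field_simps)
  qed
  have "B / (2 * pi) \<ge> 0" using B(1) by simp
  then show ?thesis
    unfolding bounded_functional_def using bd
    by (intro conjI allI impI exI[of _ "B / (2 * pi)"])
       (simp_all add: contour_mean_def contour_integral_add contour_integral_lmul int add_divide_distrib)
qed

text \<open>Interchanging two bounded functionals is immediate on finite sums of products, which are
  dense by the Stone-Weierstrass theorem.\<close>

definition separable_fun :: "(complex \<times> complex \<Rightarrow> complex) \<Rightarrow> bool" where
  "separable_fun p \<longleftrightarrow> (\<exists>S a b. finite (S :: nat set) \<and> (\<forall>i\<in>S. continuous_on UNIV (a i)) \<and>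
      (\<forall>i\<in>S. continuous_on UNIV (b i)) \<and> (\<forall>x y. p (x, y) = (\<Sum>i\<in>S. a i x * b i y)))"

lemma separable_funI:
  assumes "finite (S :: 'i set)" "\<And>i. i \<in> S \<Longrightarrow> continuous_on UNIV (a i)"
    "\<And>i. i \<in> S \<Longrightarrow> continuous_on UNIV (b i)" "\<And>x y. p (x, y) = (\<Sum>i\<in>S. a i x * b i y)"
  shows "separable_fun p"
proof -
  obtain h where h: "bij_betw h {0..<card S} S"
    using ex_bij_betw_nat_finite[OF assms(1)] by blast
  have "p (x, y) = (\<Sum>i\<in>{0..<card S}. a (h i) x * b (h i) y)" for x y
    unfolding assms(4) by (rule sum.reindex_bij_betw[OF h, symmetric])
  moreover have "h i \<in> S" if "i \<in> {0..<card S}" for i using h that bij_betwE by blast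
  ultimately show ?thesis
    unfolding separable_fun_def using assms(2,3)
    by (intro exI[of _ "{0..<card S}"] exI[of _ "\<lambda>i. a (h i)"] exI[of _ "\<lambda>i. b (h i)"]) auto
qed

lemma separable_fun_add:
  assumes "separable_fun p" "separable_fun q"
  shows "separable_fun (\<lambda>x. p x + q x)"
proof -
  obtain S a b where p: "finite (S :: nat set)" "\<And>i. i \<in> S \<Longrightarrow> continuous_on UNIV (a i)"
    "\<And>i. i \<in> S \<Longrightarrow> continuous_on UNIV (b i)" "\<And>x y. p (x, y) = (\<Sum>i\<in>S. a i x * b i y)"
    using assms(1) unfolding separable_fun_def by metis
  obtain T c d where q: "finite (T :: nat set)" "\<And>i. i \<in> T \<Longrightarrow> continuous_on UNIV (c i)"
    "\<And>i. i \<in> T \<Longrightarrow> continuous_on UNIV (d i)" "\<And>x y. q (x, y) = (\<Sum>i\<in>T. c i x * d i y)"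
    using assms(2) unfolding separable_fun_def by metis
  show ?thesis
    by (rule separable_funI[of "S <+> T" "case_sum a c" "case_sum b d"])
       (use p q in \<open>auto simp: sum.Plus\<close>)
qed

lemma separable_fun_mult:
  assumes "separable_fun p" "separable_fun q"
  shows "separable_fun (\<lambda>x. p x * q x)"
proof -
  obtain S a b where p: "finite (S :: nat set)" "\<And>i. i \<in> S \<Longrightarrow> continuous_on UNIV (a i)"
    "\<And>i. i \<in> S \<Longrightarrow> continuous_on UNIV (b i)" "\<And>x y. p (x, y) = (\<Sum>i\<in>S. a i x * b i y)"
    using assms(1) unfolding separable_fun_def by metis
  obtain T c d where q: "finite (T :: nat set)" "\<And>i. i \<in> T \<Longrightarrow> continuous_on UNIV (c i)"
    "\<And>i. i \<in> T \<Longrightarrow> continuous_on UNIV (d i)" "\<And>x y. q (x, y) = (\<Sum>i\<in>T. c i x * d i y)"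
    using assms(2) unfolding separable_fun_def by metis
  have "p (x, y) * q (x, y) = (\<Sum>i\<in>S \<times> T. (a (fst i) x * c (snd i) x) * (b (fst i) y * d (snd i) y))" for x y
    unfolding p(4) q(4) sum_product sum.cartesian_product
    by (intro sum.cong) (auto simp: mult_ac)
  then show ?thesis
    by (intro separable_funI[of "S \<times> T" "\<lambda>i x. a (fst i) x * c (snd i) x" "\<lambda>i y. b (fst i) y * d (snd i) y"])
       (use p q in \<open>auto intro!: continuous_intros\<close>)
qed

lemma separable_fun_of_fst: "continuous_on UNIV a \<Longrightarrow> separable_fun (\<lambda>x. a (fst x))"
  by (rule separable_funI[of "{()}" "\<lambda>_. a" "\<lambda>_ _. 1"]) auto

lemma separable_fun_of_snd: "continuous_on UNIV a \<Longrightarrow> separable_fun (\<lambda>x. a (snd x))"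
  by (rule separable_funI[of "{()}" "\<lambda>_ _. 1" "\<lambda>_. a"]) auto

text \<open>A linear form on pairs is a form in the first component plus a form in the second; sums
  and products of separable functions stay separable.\<close>

lemma separable_fun_real_polynomial:
  "real_polynomial_function p \<Longrightarrow> separable_fun (\<lambda>x. of_real (p x))"
proof (induction rule: real_polynomial_function.induct)
  case (linear f)
  interpret bounded_linear f by fact
  have "f x = f (fst x, 0) + f (0, snd x)" for x
    using add[of "(fst x, 0)" "(0, snd x)"] by simp
  then have eq: "(\<lambda>x. of_real (f x)) = (\<lambda>x. complex_of_real (f (fst x, 0)) + of_real (f (0, snd x)))"
    by (intro ext) (metis of_real_add)
  have "continuous_on UNIV (\<lambda>x. complex_of_real (f (x, 0)))"
    "continuous_on UNIV (\<lambda>x. complex_of_real (f (0, x)))"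
    by (intro continuous_on_of_real continuous_on continuous_intros)+
  then show ?case
    unfolding eq by (intro separable_fun_add separable_fun_of_fst separable_fun_of_snd)
next
  case (const c)
  show ?case by (rule separable_fun_of_fst) auto
next
  case (add f g)
  then show ?case using separable_fun_add by simp
next
  case (mult f g)
  then show ?case using separable_fun_mult by simp
qed

lemma separable_fun_approx:
  fixes f :: "complex \<times> complex \<Rightarrow> complex"
  assumes "compact S" "continuous_on S f" "e > 0"
  shows "\<exists>p. separable_fun p \<and> (\<forall>x\<in>S. norm (f x - p x) < e)"
proof -
  obtain g where g: "polynomial_function g" "\<And>x. x \<in> S \<Longrightarrow> norm (f x - g x) < e"
    using Stone_Weierstrass_polynomial_function[OF assms] by blast
  have "real_polynomial_function (Re \<circ> g)" "real_polynomial_function (Im \<circ> g)"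
    using g(1) bounded_linear_Re bounded_linear_Im unfolding polynomial_function_def by blast+
  \<comment> \<open>The constant \<open>\<i>\<close> is written as a function of
    \<open>fst x\<close> so that \<open>separable_fun_of_fst\<close> applies to it.\<close>
  then have "separable_fun (\<lambda>x. of_real ((Re \<circ> g) x) + (\<lambda>_. \<i>) (fst x) * of_real ((Im \<circ> g) x))"
    by (intro separable_fun_add separable_fun_mult separable_fun_real_polynomial separable_fun_of_fst
        continuous_on_const)
  also have "(\<lambda>x. of_real ((Re \<circ> g) x) + (\<lambda>_. \<i>) (fst x) * of_real ((Im \<circ> g) x)) = g"
    by (auto simp: complex_eq_iff)
  finally show ?thesis using g(2) by blast
qed

section \<open>Functionals applied under a parameter: continuity, interchange, holomorphy\<close>

lemma continuous_on_slice_fst: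
  assumes "continuous_on (P \<times> K) (\<lambda>(p, w). f p w)" "p \<in> P"
  shows "continuous_on K (f p)"
proof -
  have "continuous_on K (\<lambda>w. (\<lambda>(p, w). f p w) (p, w))"
    using assms(2) by (intro continuous_on_compose2[OF assms(1)] continuous_intros) auto
  then show ?thesis by simp
qed

lemma continuous_on_slice_snd:
  assumes "continuous_on (P \<times> K) (\<lambda>(p, w). f p w)" "w \<in> K"
  shows "continuous_on P (\<lambda>p. f p w)"
proof -
  have "continuous_on P (\<lambda>p. (\<lambda>(p, w). f p w) (p, w))"
    using assms(2) by (intro continuous_on_compose2[OF assms(1)] continuous_intros) auto
  then show ?thesis by simp
qed

text \<open>By compactness of \<open>K\<close>, joint continuity makes \<open>f x\<close> uniformly
  close to \<open>f p\<close> on \<open>K\<close> for \<open>x\<close> near \<open>p\<close>, and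
  the functional is bounded in the sup norm.\<close>

lemma bounded_functional_continuous_param:
  fixes f :: "'p::topological_space \<Rightarrow> complex \<Rightarrow> complex"
  assumes "compact K" "bounded_functional K \<phi>" "continuous_on (P \<times> K) (\<lambda>(p, w). f p w)"
  shows "continuous_on P (\<lambda>p. \<phi> (f p))"
  unfolding continuous_on_def
proof (intro ballI tendstoI)
  fix p e assume p: "p \<in> P" and e: "(0::real) < e"
  obtain B where B: "B \<ge> 0"
    "\<And>f b. continuous_on K f \<Longrightarrow> 0 \<le> b \<Longrightarrow> (\<And>x. x \<in> K \<Longrightarrow> norm (f x) \<le> b) \<Longrightarrow> norm (\<phi> f) \<le> B * b"
    using bounded_functional_bound[OF assms(2)] by blast
  \<comment> \<open>Dividing by \<open>B + 1\<close> rather than \<open>B\<close> covers the case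
    \<open>B = 0\<close>; the factor 2 gives the strict inequality at the end.\<close>
  define e' where "e' = e / (2 * (B + 1))"
  have e': "e' > 0" using e B(1) by (simp add: e'_def)
  obtain X where X: "p \<in> X" "open X"
    "\<forall>x\<in>X \<inter> P. \<forall>t\<in>K. dist (case (x, t) of (p, w) \<Rightarrow> f p w) (case (p, t) of (p, w) \<Rightarrow> f p w) \<le> e'"
    using continuous_on_prod_compactE[OF assms(3,1) p e'] by metis
  have cont: "continuous_on K (f x)" if "x \<in> P" for x
    by (rule continuous_on_slice_fst[OF assms(3) that])
  have "dist (\<phi> (f x)) (\<phi> (f p)) < e" if "x \<in> X \<inter> P" for x
  proof -
    have "norm (\<phi> (\<lambda>w. f x w - f p w)) \<le> B * e'"
      using X that cont p e' by (intro B(2)) (auto intro!: continuous_intros simp: dist_norm)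
    also have "\<dots> \<le> (B + 1) * e'" using e' by simp
    also have "\<dots> = e / 2" using B(1) by (simp add: e'_def divide_simps add_nonneg_eq_0_iff)
    also have "\<dots> < e" using e by simp
    finally show ?thesis using bounded_functional_diff[OF assms(2) cont cont] that p by (simp add: dist_norm)
  qed
  then show "eventually (\<lambda>x. dist (\<phi> (f x)) (\<phi> (f p)) < e) (at p within P)"
    unfolding eventually_at_topological using X by blast
qed


text \<open>Both orders agree on a separable \<open>p\<close>. If \<open>p\<close> is uniformly
  within \<open>e\<close> of \<open>f\<close>, each side moves by at most \<open>B * C * e\<close>
  when \<open>f\<close> is replaced by \<open>p\<close>.\<close>

theorem bounded_functional_swap:
  assumes "compact K" "bounded_functional K \<phi>" "compact L" "bounded_functional L \<psi>"
    and f: "continuous_on (K \<times> L) (\<lambda>(x, y). f x y)"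
  shows "\<phi> (\<lambda>x. \<psi> (f x)) = \<psi> (\<lambda>y. \<phi> (\<lambda>x. f x y))"
proof -
  have f': "continuous_on (L \<times> K) (\<lambda>(y, x). f x y)"
  proof -
    have "continuous_on (L \<times> K) (\<lambda>u. (\<lambda>(x, y). f x y) (snd u, fst u))"
      by (intro continuous_on_compose2[OF f] continuous_intros) auto
    then show ?thesis by (simp add: case_prod_beta)
  qed
  obtain B where B: "B \<ge> 0"
    "\<And>f b. continuous_on K f \<Longrightarrow> 0 \<le> b \<Longrightarrow> (\<And>x. x \<in> K \<Longrightarrow> norm (f x) \<le> b) \<Longrightarrow> norm (\<phi> f) \<le> B * b"
    using bounded_functional_bound[OF assms(2)] by blast
  obtain C where C: "C \<ge> 0"
    "\<And>f b. continuous_on L f \<Longrightarrow> 0 \<le> b \<Longrightarrow> (\<And>x. x \<in> L \<Longrightarrow> norm (f x) \<le> b) \<Longrightarrow> norm (\<psi> f) \<le> C * b"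
    using bounded_functional_bound[OF assms(4)] by blast
  have cfx: "continuous_on L (f x)" if "x \<in> K" for x
    by (rule continuous_on_slice_fst[OF f that])
  have cfy: "continuous_on K (\<lambda>x. f x y)" if "y \<in> L" for y
    by (rule continuous_on_slice_snd[OF f that])
  have c1: "continuous_on K (\<lambda>x. \<psi> (f x))"
    by (rule bounded_functional_continuous_param[OF assms(3,4) f])
  have c2: "continuous_on L (\<lambda>y. \<phi> (\<lambda>x. f x y))"
    by (rule bounded_functional_continuous_param[OF assms(1,2) f'])
  have le: "norm (\<phi> (\<lambda>x. \<psi> (f x)) - \<psi> (\<lambda>y. \<phi> (\<lambda>x. f x y))) \<le> (2 * B * C) * e" if "e > 0" for e
  proof -
    obtain p where p: "separable_fun p" "\<forall>x\<in>K \<times> L. norm ((\<lambda>(x, y). f x y) x - p x) < e"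
      using separable_fun_approx[OF compact_Times[OF assms(1,3)] f \<open>e > 0\<close>] by blast
    have p2: "norm (f x y - p (x, y)) \<le> e" if "x \<in> K" "y \<in> L" for x y
      using bspec[OF p(2), of "(x, y)"] that by simp
    obtain S a b where ab: "finite (S :: nat set)" "\<And>i. i \<in> S \<Longrightarrow> continuous_on UNIV (a i)"
      "\<And>i. i \<in> S \<Longrightarrow> continuous_on UNIV (b i)" "\<And>x y. p (x, y) = (\<Sum>i\<in>S. a i x * b i y)"
      using p(1) unfolding separable_fun_def by metis
    have ca: "continuous_on K (a i)" and cb: "continuous_on L (b i)" if "i \<in> S" for i
      using ab(2,3)[OF that] continuous_on_subset by blast+
    have px: "continuous_on L (\<lambda>y. p (x, y))" for x
      unfolding ab(4) by (intro continuous_intros cb)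
    have py: "continuous_on K (\<lambda>x. p (x, y))" for y
      unfolding ab(4) by (intro continuous_intros ca)
    have \<psi>p: "\<psi> (\<lambda>y. p (x, y)) = (\<Sum>i\<in>S. \<psi> (b i) * a i x)" for x
    proof -
      have "\<psi> (\<lambda>y. p (x, y)) = (\<Sum>i\<in>S. \<psi> (\<lambda>y. a i x * b i y))"
        unfolding ab(4) by (intro bounded_functional_sum[OF assms(4) ab(1)] continuous_intros cb)
      also have "\<dots> = (\<Sum>i\<in>S. a i x * \<psi> (b i))"
        by (intro sum.cong refl bounded_functional_cmult[OF assms(4)] cb)
      finally show ?thesis by (simp add: mult.commute)
    qed
    have \<phi>p: "\<phi> (\<lambda>x. p (x, y)) = (\<Sum>i\<in>S. \<phi> (a i) * b i y)" for y
    proof -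
      have "\<phi> (\<lambda>x. p (x, y)) = (\<Sum>i\<in>S. \<phi> (\<lambda>x. b i y * a i x))"
        unfolding ab(4) mult.commute[of "a _ _"]
        by (intro bounded_functional_sum[OF assms(2) ab(1)] continuous_intros ca)
      also have "\<dots> = (\<Sum>i\<in>S. b i y * \<phi> (a i))"
        by (intro sum.cong refl bounded_functional_cmult[OF assms(2)] ca)
      finally show ?thesis by (simp add: mult.commute)
    qed
    have c\<psi>p: "continuous_on K (\<lambda>x. \<psi> (\<lambda>y. p (x, y)))"
      unfolding \<psi>p by (intro continuous_intros ca)
    have c\<phi>p: "continuous_on L (\<lambda>y. \<phi> (\<lambda>x. p (x, y)))"
      unfolding \<phi>p by (intro continuous_intros cb)
    have "\<phi> (\<lambda>x. \<Sum>i\<in>S. \<psi> (b i) * a i x) = (\<Sum>i\<in>S. \<phi> (\<lambda>x. \<psi> (b i) * a i x))"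
      by (intro bounded_functional_sum[OF assms(2) ab(1)] continuous_intros ca)
    also have "\<dots> = (\<Sum>i\<in>S. \<psi> (b i) * \<phi> (a i))"
      by (intro sum.cong refl bounded_functional_cmult[OF assms(2)] ca)
    also have "\<dots> = (\<Sum>i\<in>S. \<phi> (a i) * \<psi> (b i))" by (simp add: mult.commute)
    also have "\<dots> = (\<Sum>i\<in>S. \<psi> (\<lambda>y. \<phi> (a i) * b i y))"
      by (intro sum.cong refl bounded_functional_cmult[OF assms(4), symmetric] cb)
    also have "\<dots> = \<psi> (\<lambda>y. \<Sum>i\<in>S. \<phi> (a i) * b i y)"
      by (intro bounded_functional_sum[OF assms(4) ab(1), symmetric] continuous_intros cb)
    finally have eq: "\<phi> (\<lambda>x. \<psi> (\<lambda>y. p (x, y))) = \<psi> (\<lambda>y. \<phi> (\<lambda>x. p (x, y)))"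
      unfolding \<psi>p \<phi>p .
    have i1: "norm (\<psi> (f x) - \<psi> (\<lambda>y. p (x, y))) \<le> C * e" if "x \<in> K" for x
    proof -
      have "norm (\<psi> (\<lambda>y. f x y - p (x, y))) \<le> C * e"
        using that \<open>e > 0\<close> by (intro C(2) continuous_on_diff cfx[OF that] px p2) auto
      then show ?thesis using bounded_functional_diff[OF assms(4) cfx[OF that] px] by simp
    qed
    have i2: "norm (\<phi> (\<lambda>x. f x y) - \<phi> (\<lambda>x. p (x, y))) \<le> B * e" if "y \<in> L" for y
    proof -
      have "norm (\<phi> (\<lambda>x. f x y - p (x, y))) \<le> B * e"
        using that \<open>e > 0\<close> by (intro B(2) continuous_on_diff cfy[OF that] py p2) auto
      then show ?thesis using bounded_functional_diff[OF assms(2) cfy[OF that] py] by simp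
    qed
    have "norm (\<phi> (\<lambda>x. \<psi> (f x) - \<psi> (\<lambda>y. p (x, y)))) \<le> B * (C * e)"
      using i1 C(1) \<open>e > 0\<close> by (intro B(2) continuous_on_diff c1 c\<psi>p) auto
    then have j1: "norm (\<phi> (\<lambda>x. \<psi> (f x)) - \<phi> (\<lambda>x. \<psi> (\<lambda>y. p (x, y)))) \<le> B * (C * e)"
      using bounded_functional_diff[OF assms(2) c1 c\<psi>p] by simp
    have "norm (\<psi> (\<lambda>y. \<phi> (\<lambda>x. f x y) - \<phi> (\<lambda>x. p (x, y)))) \<le> C * (B * e)"
      using i2 B(1) \<open>e > 0\<close> by (intro C(2) continuous_on_diff c2 c\<phi>p) auto
    then have j2: "norm (\<psi> (\<lambda>y. \<phi> (\<lambda>x. f x y)) - \<psi> (\<lambda>y. \<phi> (\<lambda>x. p (x, y)))) \<le> C * (B * e)"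
      using bounded_functional_diff[OF assms(4) c2 c\<phi>p] by simp
    show ?thesis
      using norm_triangle_ineq4[of "\<phi> (\<lambda>x. \<psi> (f x)) - \<phi> (\<lambda>x. \<psi> (\<lambda>y. p (x, y)))"
          "\<psi> (\<lambda>y. \<phi> (\<lambda>x. f x y)) - \<psi> (\<lambda>y. \<phi> (\<lambda>x. p (x, y)))"] j1 j2 eq
      by (simp add: algebra_simps)
  qed
  have "norm (\<phi> (\<lambda>x. \<psi> (f x)) - \<psi> (\<lambda>y. \<phi> (\<lambda>x. f x y))) \<le> 0"
  proof (rule field_le_epsilon)
    fix d :: real assume "d > 0"
    then have "d / (2 * B * C + 1) > 0" using B(1) C(1) by (simp add: add_nonneg_pos)
    note * = le[OF this]
    have pos: "2 * B * C + 1 > 0" using B(1) C(1) by (simp add: add_nonneg_pos)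
    have "(2 * B * C) * (d / (2 * B * C + 1)) \<le> (2 * B * C + 1) * (d / (2 * B * C + 1))"
      using \<open>d > 0\<close> pos by (intro mult_right_mono) auto
    also have "\<dots> = d" using pos by simp
    finally have "(2 * B * C) * (d / (2 * B * C + 1)) \<le> d" .
    then show "norm (\<phi> (\<lambda>x. \<psi> (f x)) - \<psi> (\<lambda>y. \<phi> (\<lambda>x. f x y))) \<le> 0 + d"
      using * by linarith
  qed
  then show ?thesis by simp
qed


text \<open>Write \<open>f s w\<close> by Cauchy's formula over a circle around \<open>s0\<close>
  and interchange this circle mean with \<open>\<phi>\<close>. The result is the Cauchy integral of
  the continuous function \<open>\<lambda>u. \<phi> (f u)\<close>, and Cauchy integrals of
  continuous functions are differentiable.\<close>

theorem bounded_functional_holomorphic_param: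
  assumes K: "compact K" "bounded_functional K \<phi>" and U: "open U"
    and f: "continuous_on (U \<times> K) (\<lambda>(s, w). f s w)"
    and hol: "\<And>w. w \<in> K \<Longrightarrow> (\<lambda>s. f s w) holomorphic_on U"
  shows "(\<lambda>s. \<phi> (f s)) holomorphic_on U"
proof -
  have "(\<lambda>s. \<phi> (f s)) field_differentiable (at s0)" if s0: "s0 \<in> U" for s0
  proof -
    obtain r where r: "r > 0" "cball s0 r \<subseteq> U"
      using U s0 open_contains_cball by blast
    define C where "C = circlepath s0 r"
    have imC: "path_image C = sphere s0 r" using r by (simp add: C_def)
    have sphU: "sphere s0 r \<subseteq> U" using r sphere_cball by blast
    have ballU: "ball s0 r \<subseteq> U" using r ball_subset_cball by blast
    define g where "g u = \<phi> (f u)" for u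
    have g: "continuous_on U g"
      unfolding g_def by (rule bounded_functional_continuous_param[OF K f])
    \<comment> \<open>The exponent 1 matches the shape of
      \<open>Cauchy_next_derivative_circlepath\<close>, which differentiates under the
      integral.\<close>
    define G where "G s = contour_integral C (\<lambda>u. g u / (u - s) ^ 1)" for s
    have gC: "continuous_on (path_image C) g" using g sphU imC continuous_on_subset by auto
    have hasG: "((\<lambda>u. g u / (u - s) ^ 1) has_contour_integral G s) C" if "s \<in> ball s0 r" for s
    proof -
      have "continuous_on (path_image C) (\<lambda>u. g u / (u - s) ^ 1)"
        using that imC by (intro continuous_intros gC) auto
      then have "(\<lambda>u. g u / (u - s) ^ 1) contour_integrable_on C"
        unfolding C_def by (rule contour_integrable_continuous_circlepath)
      then show ?thesis unfolding G_def by (rule has_contour_integral_integral)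
    qed
    have eq: "\<phi> (f s) = G s / (2 * of_real pi * \<i>)" if s: "s \<in> ball s0 r" for s
    proof -
      have mean: "bounded_functional (path_image C) (contour_mean C)"
        unfolding C_def
        by (intro bounded_functional_contour_mean valid_path_circlepath)
           (auto simp: vector_derivative_circlepath intro!: continuous_intros)
      have cont: "continuous_on (K \<times> path_image C) (\<lambda>(w, u). f u w / (u - s))"
      proof -
        have "continuous_on (K \<times> path_image C) (\<lambda>x. (\<lambda>(s, w). f s w) (snd x, fst x))"
          using sphU imC by (intro continuous_on_compose2[OF f] continuous_intros) auto
        then have "continuous_on (K \<times> path_image C) (\<lambda>x. f (snd x) (fst x) / (snd x - s))"
          using s imC by (intro continuous_intros) auto
        then show ?thesis by (simp add: case_prod_beta)
      qed
      have cauchy: "contour_mean C (\<lambda>u. f u w / (u - s)) = f s w" if "w \<in> K" for w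
      proof -
        have "((\<lambda>u. f u w / (u - s)) has_contour_integral (2 * of_real pi * \<i> * f s w)) C"
          unfolding C_def using hol[OF that] r s
          by (intro Cauchy_integral_circlepath_simple) (auto intro: holomorphic_on_subset simp: dist_norm norm_minus_commute)
        then show ?thesis by (simp add: contour_mean_def contour_integral_unique)
      qed
      have "\<phi> (f s) = \<phi> (\<lambda>w. contour_mean C (\<lambda>u. f u w / (u - s)))"
        using cauchy s ballU
        by (intro bounded_functional_cong[OF K(2)] continuous_on_slice_fst[OF f]) auto
      also have "\<dots> = contour_mean C (\<lambda>u. \<phi> (\<lambda>w. f u w / (u - s)))"
        using imC by (intro bounded_functional_swap[OF K _ mean cont]) auto
      also have "\<dots> = contour_mean C (\<lambda>u. g u / (u - s))"
      proof (rule bounded_functional_cong[OF mean, symmetric])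
        show "continuous_on (path_image C) (\<lambda>u. g u / (u - s))"
          using s imC by (intro continuous_intros gC) auto
        show "g u / (u - s) = \<phi> (\<lambda>w. f u w / (u - s))" if "u \<in> path_image C" for u
          using bounded_functional_cmult[OF K(2) continuous_on_slice_fst[OF f], of u "1 / (u - s)"]
            that sphU imC by (auto simp: g_def)
      qed
      finally show ?thesis by (simp add: contour_mean_def G_def)
    qed
    have "(G has_field_derivative (of_nat 1 * contour_integral C (\<lambda>u. g u / (u - s0) ^ Suc 1))) (at s0)"
      unfolding C_def
      using r by (intro Cauchy_next_derivative_circlepath(2)[OF gC[unfolded C_def] hasG[unfolded C_def]]) auto
    then have "(\<lambda>s. G s / (2 * of_real pi * \<i>)) field_differentiable (at s0)"
      by (intro derivative_intros field_differentiable_divide field_differentiable_const)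
         (auto simp: field_differentiable_def)
    then show ?thesis
      using field_differentiable_transform_within[OF r(1) UNIV_I, of s0 "\<lambda>s. G s / (2 * of_real pi * \<i>)" "\<lambda>s. \<phi> (f s)"]
      by (simp add: eq dist_commute)
  qed
  then show ?thesis
    by (auto simp: holomorphic_on_def intro: field_differentiable_at_within)
qed

section \<open>Iterated functionals\<close>

lemma PiE_fun_upd_in: "W \<in> PiE V K \<Longrightarrow> v \<in> V \<Longrightarrow> w \<in> K v \<Longrightarrow> W(v := w) \<in> PiE V K"
  by (auto simp: PiE_iff extensional_def)

lemma continuous_on_fun_upd [continuous_intros]:
  fixes f :: "'a::topological_space \<Rightarrow> 'i \<Rightarrow> 'b::topological_space"
  assumes "continuous_on S f" "continuous_on S g"
  shows "continuous_on S (\<lambda>x. (f x)(v := g x))"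
proof (rule continuous_on_coordinatewise_then_product)
  fix i
  show "continuous_on S (\<lambda>x. ((f x)(v := g x)) i)"
    using assms continuous_on_product_then_coordinatewise[OF assms(1)] by (cases "i = v") auto
qed

lemma iterate_functionals_cong:
  "(\<And>v. v \<in> set vs \<Longrightarrow> L v = L' v) \<Longrightarrow> iterate_functionals L vs F W = iterate_functionals L' vs F W"
  by (induction vs arbitrary: W) auto

text \<open>Coordinates in \<open>vs\<close> are overwritten before \<open>F\<close> is evaluated.
  Hence the constant \<open>undefined\<close> may be exchanged for any point of the product set over
  the variables, where the continuity arguments apply.\<close>

lemma iterate_functionals_base_cong:
  "(\<And>u. u \<notin> set vs \<Longrightarrow> W u = W' u) \<Longrightarrow> iterate_functionals L vs F W = iterate_functionals L vs F W'"
proof (induction vs arbitrary: W W')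
  case Nil
  then have "W = W'" by auto
  then show ?case by simp
next
  case (Cons v vs)
  have "iterate_functionals L vs F (W(v := w)) = iterate_functionals L vs F (W'(v := w))" for w
    by (rule Cons.IH) (auto intro: Cons.prems)
  then show ?case by simp
qed

lemma iterate_functionals_upd:
  "v \<notin> set vs \<Longrightarrow>
     iterate_functionals L vs F (W(v := s)) = iterate_functionals L vs (\<lambda>W. F (W(v := s))) W"
  by (induction vs arbitrary: W) (auto simp: fun_upd_twist)

text \<open>The functionals themselves may depend on the parameter \<open>p\<close>, as the weights
  depend on \<open>z\<close>. In \<open>step\<close> the remaining variables are part of the
  parameter, which is what the induction on the list hands over.\<close>

lemma iterate_continuous_family:
  fixes P :: "'p::topological_space set" and K :: "'i \<Rightarrow> complex set"
  assumes step: "\<And>v f. v \<in> V \<Longrightarrow> continuous_on ((P \<times> PiE V K) \<times> K v) (\<lambda>(x, w). f x w) \<Longrightarrow>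
      continuous_on (P \<times> PiE V K) (\<lambda>x. L (fst x) v (f x))"
    and F: "continuous_on (P \<times> PiE V K) (\<lambda>(p, W). F p W)" and "set vs \<subseteq> V"
  shows "continuous_on (P \<times> PiE V K) (\<lambda>(p, W). iterate_functionals (L p) vs (F p) W)"
  using assms(3)
proof (induction vs)
  case Nil
  then show ?case using F by simp
next
  case (Cons v vs)
  then have IH: "continuous_on (P \<times> PiE V K) (\<lambda>(p, W). iterate_functionals (L p) vs (F p) W)" by simp
  have v: "v \<in> V" using Cons by simp
  define f where "f x w = iterate_functionals (L (fst x)) vs (F (fst x)) ((snd x)(v := w))" for x :: "'p \<times> ('i \<Rightarrow> complex)" and w
  have "continuous_on ((P \<times> PiE V K) \<times> K v)
      (\<lambda>y. (\<lambda>(p, W). iterate_functionals (L p) vs (F p) W) (fst (fst y), (snd (fst y))(v := snd y)))"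
    by (intro continuous_on_compose2[OF IH] continuous_intros) (auto intro!: PiE_fun_upd_in v)
  then have "continuous_on ((P \<times> PiE V K) \<times> K v) (\<lambda>(x, w). f x w)"
    by (simp add: case_prod_beta f_def)
  from step[OF v this] show ?case by (simp add: case_prod_beta f_def)
qed

text \<open>One application of a functional preserves holomorphy only for jointly continuous
  integrands, so the continuity of the inner iterated functional is carried along.\<close>

lemma iterate_holomorphic_family:
  fixes K :: "'i \<Rightarrow> complex set"
  assumes step: "\<And>v f. v \<in> V \<Longrightarrow> continuous_on ((U \<times> PiE V K) \<times> K v) (\<lambda>(x, w). f x w) \<Longrightarrow>
      continuous_on (U \<times> PiE V K) (\<lambda>x. L (fst x) v (f x))"
    and step_hol: "\<And>v f. v \<in> V \<Longrightarrow> continuous_on (U \<times> K v) (\<lambda>(s, w). f s w) \<Longrightarrow>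
      (\<And>w. w \<in> K v \<Longrightarrow> (\<lambda>s. f s w) holomorphic_on U) \<Longrightarrow> (\<lambda>s. L s v (f s)) holomorphic_on U"
    and F: "continuous_on (U \<times> PiE V K) (\<lambda>(p, W). F p W)"
      "\<And>W. W \<in> PiE V K \<Longrightarrow> (\<lambda>s. F s W) holomorphic_on U"
    and "set vs \<subseteq> V" "W \<in> PiE V K"
  shows "(\<lambda>s. iterate_functionals (L s) vs (F s) W) holomorphic_on U"
  using assms(5,6)
proof (induction vs arbitrary: W)
  case Nil
  then show ?case using F by simp
next
  case (Cons v vs)
  then have v: "v \<in> V" and vs: "set vs \<subseteq> V" by auto
  have c: "continuous_on (U \<times> PiE V K) (\<lambda>(p, W). iterate_functionals (L p) vs (F p) W)"
    by (rule iterate_continuous_family[OF step F(1) vs])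
  have "continuous_on (U \<times> K v)
      (\<lambda>y. (\<lambda>(p, W). iterate_functionals (L p) vs (F p) W) (fst y, W(v := snd y)))"
    using Cons.prems by (intro continuous_on_compose2[OF c] continuous_intros) (auto intro!: PiE_fun_upd_in v)
  then have "continuous_on (U \<times> K v) (\<lambda>(s, w). iterate_functionals (L s) vs (F s) (W(v := w)))"
    by (simp add: case_prod_beta)
  then show ?case
    unfolding iterate_functionals.simps
    by (intro step_hol v Cons.IH[OF vs] PiE_fun_upd_in Cons.prems)
qed

locale functional_system =
  fixes V :: "'i set" and K :: "'i \<Rightarrow> complex set"
    and L :: "'i \<Rightarrow> (complex \<Rightarrow> complex) \<Rightarrow> complex"
  assumes compact: "v \<in> V \<Longrightarrow> compact (K v)"
    and bounded: "v \<in> V \<Longrightarrow> bounded_functional (K v) (L v)"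
begin

lemma continuous_upd:
  assumes F: "continuous_on (PiE V K) F" and "W \<in> PiE V K" "v \<in> V"
  shows "continuous_on (K v) (\<lambda>w. F (W(v := w)))"
  using assms(2,3) by (intro continuous_on_compose2[OF F] continuous_intros) (auto intro!: PiE_fun_upd_in)

lemma continuous_upd2:
  assumes F: "continuous_on (PiE V K) F" and "v \<in> V"
  shows "continuous_on (PiE V K \<times> K v) (\<lambda>(W, w). F (W(v := w)))"
  unfolding case_prod_beta using assms(2)
  by (intro continuous_on_compose2[OF F] continuous_intros) (auto intro!: PiE_fun_upd_in)

lemma continuous_apply:
  assumes F: "continuous_on (PiE V K) F" and "v \<in> V"
  shows "continuous_on (PiE V K) (\<lambda>W. L v (\<lambda>w. F (W(v := w))))"
  by (rule bounded_functional_continuous_param[OF compact bounded continuous_upd2[OF F]]) (use assms in auto)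

lemma iterate_continuous:
  assumes F: "continuous_on (PiE V K) F" and "set vs \<subseteq> V"
  shows "continuous_on (PiE V K) (iterate_functionals L vs F)"
  using assms(2)
proof (induction vs)
  case Nil
  have "iterate_functionals L [] F = F" by auto
  then show ?case using F by simp
next
  case (Cons v vs)
  have "iterate_functionals L (v # vs) F = (\<lambda>W. L v (\<lambda>w. iterate_functionals L vs F (W(v := w))))"
    by auto
  with continuous_apply[of "iterate_functionals L vs F" v] Cons show ?case by simp
qed

lemma iterate_cong:
  assumes F: "continuous_on (PiE V K) F" and eq: "\<And>W. W \<in> PiE V K \<Longrightarrow> F W = F' W"
    and "set vs \<subseteq> V" "W \<in> PiE V K"
  shows "iterate_functionals L vs F W = iterate_functionals L vs F' W"
  using assms(3,4)
proof (induction vs arbitrary: W)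
  case Nil
  then show ?case using eq by simp
next
  case (Cons v vs)
  then have v: "v \<in> V" and vs: "set vs \<subseteq> V" by auto
  show ?case
    unfolding iterate_functionals.simps
    by (intro bounded_functional_cong[OF bounded[OF v]] continuous_upd iterate_continuous F v vs
        Cons.IH Cons.prems PiE_fun_upd_in)
qed

lemma iterate_swap:
  assumes F: "continuous_on (PiE V K) F" and v: "v \<in> V"
    and "set ys \<subseteq> V" "v \<notin> set ys" "W \<in> PiE V K"
  shows "L v (\<lambda>w. iterate_functionals L ys F (W(v := w))) =
     iterate_functionals L ys (\<lambda>W. L v (\<lambda>w. F (W(v := w)))) W"
  using assms(3-5)
proof (induction ys arbitrary: W)
  case Nil
  then show ?case by simp
next
  case (Cons u ys)
  then have u: "u \<in> V" "u \<noteq> v" and ys: "set ys \<subseteq> V" "v \<notin> set ys" and W: "W \<in> PiE V K" by auto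
  have c: "continuous_on (PiE V K) (iterate_functionals L ys F)"
    by (rule iterate_continuous[OF F ys(1)])
  have c2: "continuous_on (K v \<times> K u) (\<lambda>(w, x). iterate_functionals L ys F (W(v := w, u := x)))"
    unfolding case_prod_beta using W u v
    by (intro continuous_on_compose2[OF c] continuous_intros) (auto intro!: PiE_fun_upd_in)
  have "L v (\<lambda>w. iterate_functionals L (u # ys) F (W(v := w))) =
      L v (\<lambda>w. L u (\<lambda>x. iterate_functionals L ys F (W(v := w, u := x))))" by simp
  also have "\<dots> = L u (\<lambda>x. L v (\<lambda>w. iterate_functionals L ys F (W(v := w, u := x))))"
    by (rule bounded_functional_swap[OF compact[OF v] bounded[OF v] compact[OF u(1)] bounded[OF u(1)] c2])
  also have "\<dots> = L u (\<lambda>x. L v (\<lambda>w. iterate_functionals L ys F (W(u := x, v := w))))"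
    using u by (simp add: fun_upd_twist)
  also have "\<dots> = L u (\<lambda>x. iterate_functionals L ys (\<lambda>W. L v (\<lambda>w. F (W(v := w)))) (W(u := x)))"
  proof (rule bounded_functional_cong[OF bounded[OF u(1)]])
    show "continuous_on (K u) (\<lambda>x. L v (\<lambda>w. iterate_functionals L ys F (W(u := x, v := w))))"
      by (rule continuous_upd[OF continuous_apply[OF c v] W u(1)])
    show "L v (\<lambda>w. iterate_functionals L ys F (W(u := x, v := w))) =
        iterate_functionals L ys (\<lambda>W. L v (\<lambda>w. F (W(v := w)))) (W(u := x))" if "x \<in> K u" for x
      by (rule Cons.IH[OF ys]) (intro PiE_fun_upd_in W u that)
  qed
  finally show ?case by (simp del: fun_upd_apply)
qed

text \<open>Residue computations concern a single variable with all others frozen. Making that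
  variable innermost turns an identity for one functional into one for the iterated
  functional.\<close>

lemma iterate_move_inner:
  assumes F: "continuous_on (PiE V K) F" and v: "v \<in> set vs" and vs: "set vs \<subseteq> V" "distinct vs"
    and W: "W \<in> PiE V K"
  shows "iterate_functionals L vs F W =
     iterate_functionals L (remove1 v vs) (\<lambda>W. L v (\<lambda>w. F (W(v := w)))) W"
  using v vs W
proof (induction vs arbitrary: W)
  case Nil
  then show ?case by simp
next
  case (Cons u vs)
  then have u: "u \<in> V" and vs: "set vs \<subseteq> V" "distinct vs" by auto
  show ?case
  proof (cases "u = v")
    case True
    then show ?thesis using iterate_swap[OF F, of v vs W] Cons by (simp del: fun_upd_apply)
  next
    case False
    then have v: "v \<in> set vs" using Cons by auto
    have "L u (\<lambda>w. iterate_functionals L vs F (W(u := w))) =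
      L u (\<lambda>w. iterate_functionals L (remove1 v vs) (\<lambda>W. L v (\<lambda>w. F (W(v := w)))) (W(u := w)))"
      by (intro bounded_functional_cong[OF bounded[OF u]] continuous_upd iterate_continuous F u vs
           Cons.IH Cons.prems PiE_fun_upd_in v)
    then show ?thesis using False by (simp del: fun_upd_apply)
  qed
qed

lemma iterate_sum:
  assumes "finite S" and F: "\<And>s. s \<in> S \<Longrightarrow> continuous_on (PiE V K) (F s)"
    and "set vs \<subseteq> V" "W \<in> PiE V K"
  shows "iterate_functionals L vs (\<lambda>W. \<Sum>s\<in>S. F s W) W = (\<Sum>s\<in>S. iterate_functionals L vs (F s) W)"
  using assms(3,4)
proof (induction vs arbitrary: W)
  case Nil
  then show ?case by simp
next
  case (Cons v vs)
  then have v: "v \<in> V" and vs: "set vs \<subseteq> V" by auto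
  have "L v (\<lambda>w. iterate_functionals L vs (\<lambda>W. \<Sum>s\<in>S. F s W) (W(v := w))) =
    L v (\<lambda>w. \<Sum>s\<in>S. iterate_functionals L vs (F s) (W(v := w)))"
    by (intro bounded_functional_cong[OF bounded[OF v]] continuous_upd iterate_continuous F v vs
        Cons.IH Cons.prems PiE_fun_upd_in continuous_on_sum)
  also have "\<dots> = (\<Sum>s\<in>S. L v (\<lambda>w. iterate_functionals L vs (F s) (W(v := w))))"
    by (intro bounded_functional_sum[OF bounded[OF v] assms(1)] continuous_upd iterate_continuous F vs Cons.prems v)
  finally show ?case by simp
qed

lemma iterate_diff:
  assumes F: "continuous_on (PiE V K) F" "continuous_on (PiE V K) F'"
    and "set vs \<subseteq> V" "W \<in> PiE V K"
  shows "iterate_functionals L vs (\<lambda>W. F W - F' W) W =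
    iterate_functionals L vs F W - iterate_functionals L vs F' W"
  using assms(3,4)
proof (induction vs arbitrary: W)
  case Nil
  then show ?case by simp
next
  case (Cons v vs)
  then have v: "v \<in> V" and vs: "set vs \<subseteq> V" by auto
  have "L v (\<lambda>w. iterate_functionals L vs (\<lambda>W. F W - F' W) (W(v := w))) =
    L v (\<lambda>w. iterate_functionals L vs F (W(v := w)) - iterate_functionals L vs F' (W(v := w)))"
    by (intro bounded_functional_cong[OF bounded[OF v]] continuous_upd iterate_continuous F v vs
        Cons.IH Cons.prems PiE_fun_upd_in continuous_on_diff)
  also have "\<dots> = L v (\<lambda>w. iterate_functionals L vs F (W(v := w))) - L v (\<lambda>w. iterate_functionals L vs F' (W(v := w)))"
    by (intro bounded_functional_diff[OF bounded[OF v]] continuous_upd iterate_continuous F vs Cons.prems v)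
  finally show ?case by simp
qed

lemma iterate_cmult:
  assumes F: "continuous_on (PiE V K) F" and "set vs \<subseteq> V" "W \<in> PiE V K"
  shows "iterate_functionals L vs (\<lambda>W. c * F W) W = c * iterate_functionals L vs F W"
  using assms(2,3)
proof (induction vs arbitrary: W)
  case Nil
  then show ?case by simp
next
  case (Cons v vs)
  then have v: "v \<in> V" and vs: "set vs \<subseteq> V" by auto
  have "L v (\<lambda>w. iterate_functionals L vs (\<lambda>W. c * F W) (W(v := w))) =
    L v (\<lambda>w. c * iterate_functionals L vs F (W(v := w)))"
    by (intro bounded_functional_cong[OF bounded[OF v]] continuous_upd iterate_continuous F v vs
        Cons.IH Cons.prems PiE_fun_upd_in continuous_on_mult continuous_on_const)
  also have "\<dots> = c * L v (\<lambda>w. iterate_functionals L vs F (W(v := w)))"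
    by (intro bounded_functional_cmult[OF bounded[OF v]] continuous_upd iterate_continuous F vs Cons.prems v)
  finally show ?case by simp
qed

end

text \<open>The head variable is peeled off the product set by \<open>PiE_insert_eq\<close>. With
  \<open>c v w = q w / deriv q w\<close> the right side becomes the sum defining
  \<open>G_fun\<close>.\<close>

lemma iterate_finite_sums:
  assumes "distinct vs" "\<And>v. v \<in> set vs \<Longrightarrow> finite (R v)"
  shows "iterate_functionals (\<lambda>v f. \<Sum>w\<in>R v. c v w * f w) vs F W =
    (\<Sum>X\<in>PiE (set vs) R. (\<Prod>v\<in>set vs. c v (X v)) * F (\<lambda>u. if u \<in> set vs then X u else W u))"
  using assms
proof (induction vs arbitrary: W)
  case Nil
  then show ?case by simp
next
  case (Cons v vs)
  then have v: "v \<notin> set vs" "distinct vs" by auto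
  let ?S = "set vs"
  let ?g = "\<lambda>(w, X). X(v := w) :: 'a \<Rightarrow> complex"
  have inj: "inj_on ?g (R v \<times> PiE ?S R)"
    by (rule inj_combinator[OF v(1)])
  have eq: "(\<Prod>u\<in>insert v ?S. c u ((X(v := w)) u)) * F (\<lambda>u. if u \<in> insert v ?S then (X(v := w)) u else W u)
     = c v w * ((\<Prod>u\<in>?S. c u (X u)) * F (\<lambda>u. if u \<in> ?S then X u else (W(v := w)) u))"
    for w X
  proof -
    have "(\<Prod>u\<in>?S. c u ((X(v := w)) u)) = (\<Prod>u\<in>?S. c u (X u))"
      using v by (intro prod.cong) auto
    moreover have "(\<lambda>u. if u \<in> insert v ?S then (X(v := w)) u else W u) =
       (\<lambda>u. if u \<in> ?S then X u else (W(v := w)) u)"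
      using v by auto
    ultimately show ?thesis using v by simp
  qed
  have "(\<Sum>X\<in>PiE (insert v ?S) R. (\<Prod>u\<in>insert v ?S. c u (X u)) * F (\<lambda>u. if u \<in> insert v ?S then X u else W u)) =
    (\<Sum>(w, X)\<in>R v \<times> PiE ?S R. c v w * ((\<Prod>u\<in>?S. c u (X u)) * F (\<lambda>u. if u \<in> ?S then X u else (W(v := w)) u)))"
    unfolding PiE_insert_eq sum.reindex[OF inj] o_def
    by (intro sum.cong refl) (simp only: case_prod_beta eq)
  also have "\<dots> = (\<Sum>w\<in>R v. c v w * (\<Sum>X\<in>PiE ?S R. (\<Prod>u\<in>?S. c u (X u)) * F (\<lambda>u. if u \<in> ?S then X u else (W(v := w)) u)))"
    by (simp add: sum.cartesian_product[symmetric] sum_distrib_left)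
  finally show ?case using Cons v by (simp del: prod.insert)
qed

text \<open>A contour integral along a valid path need not be a bounded functional on continuous
  functions, since valid paths may fail to be rectifiable; on holomorphic integrands it can be
  replaced by one that is.\<close>

lemma iterate_holomorphic_replace:
  fixes K U :: "'i \<Rightarrow> complex set"
  assumes U: "\<And>v. v \<in> V \<Longrightarrow> open (U v)" and K: "\<And>v. v \<in> V \<Longrightarrow> compact (K v)" "\<And>v. v \<in> V \<Longrightarrow> K v \<subseteq> U v"
    and L': "\<And>v. v \<in> V \<Longrightarrow> bounded_functional (K v) (L' v)"
    and eq: "\<And>v f. v \<in> V \<Longrightarrow> f holomorphic_on U v \<Longrightarrow> L v f = L' v f"
    and loc: "\<And>v f g. v \<in> V \<Longrightarrow> (\<And>w. w \<in> U v \<Longrightarrow> f w = g w) \<Longrightarrow> L v f = L v g"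
    and F: "continuous_on (PiE V U) F"
      "\<And>W v. W \<in> PiE V U \<Longrightarrow> v \<in> V \<Longrightarrow> (\<lambda>w. F (W(v := w))) holomorphic_on U v"
    and "set vs \<subseteq> V" "distinct vs" "W \<in> PiE V U"
  shows "iterate_functionals L vs F W = iterate_functionals L' vs F W"
  using assms(9-11)
proof (induction vs arbitrary: W)
  case Nil
  then show ?case by simp
next
  case (Cons v vs)
  then have v: "v \<in> V" "v \<notin> set vs" and vs: "set vs \<subseteq> V" "distinct vs" and W: "W \<in> PiE V U" by auto
  have W_upd: "W(v := w) \<in> PiE V U" if "w \<in> U v" for w
    by (intro PiE_fun_upd_in W v that)
  \<comment> \<open>The base point \<open>W\<close> lies in the open sets \<open>U u\<close> but
    perhaps not in \<open>K u\<close>; adding the single point \<open>W u\<close> keeps the sets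
    compact and puts \<open>W\<close> into their product.\<close>
  define K' where "K' u = insert (W u) (K u)" for u
  have K'U: "K' u \<subseteq> U u" if "u \<in> V" for u
    using that K(2) W by (auto simp: K'_def)
  have K'c: "compact (K' u)" if "u \<in> V" for u
    using K(1)[OF that] by (auto simp: K'_def)
  have bd: "bounded_functional (K' u) (L' u)" if "u \<in> V" for u
    by (rule bounded_functional_mono[OF L'[OF that]]) (auto simp: K'_def)
  have sub: "PiE V K' \<subseteq> PiE V U" by (rule PiE_mono[OF K'U])
  have WK': "W \<in> PiE V K'" using W by (auto simp: K'_def PiE_iff)
  \<comment> \<open>With the inner functionals already bounded, the inner iterated value is
    holomorphic in the variable \<open>v\<close>. This is exactly the condition under which
    \<open>L v\<close> and \<open>L' v\<close> agree.\<close>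
  have "(\<lambda>s. iterate_functionals L' vs (\<lambda>W. F (W(v := s))) W) holomorphic_on U v"
  proof (rule iterate_holomorphic_family[of V "U v" K' "\<lambda>_. L'" "\<lambda>s W. F (W(v := s))", OF _ _ _ _ vs(1) WK'])
    show "continuous_on (U v \<times> PiE V K') (\<lambda>x. L' u (f x))"
      if "u \<in> V" "continuous_on ((U v \<times> PiE V K') \<times> K' u) (\<lambda>(x, w). f x w)" for u f
      by (rule bounded_functional_continuous_param[OF K'c bd]) (use that in auto)
    show "(\<lambda>s. L' u (f s)) holomorphic_on U v"
      if "u \<in> V" "continuous_on (U v \<times> K' u) (\<lambda>(s, w). f s w)"
        "\<And>w. w \<in> K' u \<Longrightarrow> (\<lambda>s. f s w) holomorphic_on U v" for u f
      by (rule bounded_functional_holomorphic_param[OF K'c bd U]) (use that v in auto)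
    show "continuous_on (U v \<times> PiE V K') (\<lambda>(p, W). F (W(v := p)))"
      unfolding case_prod_beta
    proof (rule continuous_on_compose2[OF F(1)])
      show "continuous_on (U v \<times> PiE V K') (\<lambda>x. (snd x)(v := fst x))"
        by (intro continuous_on_fun_upd continuous_on_fst continuous_on_snd continuous_on_id)
      show "(\<lambda>x. (snd x)(v := fst x)) ` (U v \<times> PiE V K') \<subseteq> PiE V U"
        using sub v(1) by (intro image_subsetI PiE_fun_upd_in) (auto simp: mem_Times_iff)
    qed
    show "(\<lambda>s. F (W(v := s))) holomorphic_on U v" if "W \<in> PiE V K'" for W
      using that by (intro F(2) v subsetD[OF sub])
  qed
  then have hol: "(\<lambda>w. iterate_functionals L' vs F (W(v := w))) holomorphic_on U v"
    by (simp add: iterate_functionals_upd[OF v(2)])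
  have "L v (\<lambda>w. iterate_functionals L vs F (W(v := w))) = L v (\<lambda>w. iterate_functionals L' vs F (W(v := w)))"
    by (intro loc v Cons.IH vs W_upd)
  also have "\<dots> = L' v (\<lambda>w. iterate_functionals L' vs F (W(v := w)))"
    by (rule eq[OF v(1) hol])
  finally show ?case by simp
qed


section \<open>Analytic functions of several variables\<close>

text \<open>The condition on \<open>p\<close> says that it moves along an affine line with direction
  \<open>e\<close>, so this is the chain rule with derivative the sum of \<open>c i * e i\<close>.
  It serves for one coordinate, for a chain of coordinates moving together, and for the line in the
  uniqueness argument.\<close>

lemma analytic_in_holomorphic_on_line:
  assumes an: "analytic_in X f S" and "finite X" and U: "open U" and p: "\<And>s. s \<in> U \<Longrightarrow> p s \<in> S"
    and e: "\<And>i s t. i \<in> X \<Longrightarrow> s \<in> U \<Longrightarrow> t \<in> U \<Longrightarrow> p s i - p t i = e i * (s - t)"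
  shows "(\<lambda>s. f (p s)) holomorphic_on U"
proof -
  have "(\<lambda>s. f (p s)) field_differentiable (at t)" if t: "t \<in> U" for t
  proof -
    obtain c where c: "\<And>\<epsilon>. \<epsilon> > 0 \<Longrightarrow> \<exists>d>0. \<forall>x\<in>S. (\<forall>i\<in>X. norm (x i - p t i) < d) \<longrightarrow>
        norm (f x - f (p t) - (\<Sum>i\<in>X. c i * (x i - p t i))) \<le> \<epsilon> * (\<Sum>i\<in>X. norm (x i - p t i))"
      using an p[OF t] unfolding analytic_in_def by blast
    define D where "D = (\<Sum>i\<in>X. c i * e i)"
    \<comment> \<open>The added 1 keeps \<open>M\<close> positive for a constant line.\<close>
    define M where "M = (\<Sum>i\<in>X. norm (e i)) + 1"
    have M: "M > 0" unfolding M_def by (simp add: add_nonneg_pos sum_nonneg)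
    have eM: "norm (e i) \<le> M" if "i \<in> X" for i
      using member_le_sum[of i X "\<lambda>i. norm (e i)"] that assms(2) by (simp add: M_def)
    have "((\<lambda>s. (f (p s) - f (p t)) / (s - t)) \<longlongrightarrow> D) (at t)"
    proof (rule tendstoI)
      fix \<epsilon> :: real assume \<epsilon>: "\<epsilon> > 0"
      then obtain d where d: "d > 0" "\<And>x. x \<in> S \<Longrightarrow> (\<forall>i\<in>X. norm (x i - p t i) < d) \<Longrightarrow>
        norm (f x - f (p t) - (\<Sum>i\<in>X. c i * (x i - p t i))) \<le> \<epsilon> / (2 * M) * (\<Sum>i\<in>X. norm (x i - p t i))"
        using c[of "\<epsilon> / (2 * M)"] M by auto
      obtain r where r: "r > 0" "ball t r \<subseteq> U" using U t open_contains_ball by blast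
      have "dist ((f (p s) - f (p t)) / (s - t)) D < \<epsilon>"
        if "s \<noteq> t" and st: "dist s t < min r (d / M)" for s
      proof -
        have s: "s \<in> U" using st r by (auto simp: dist_commute)
        have diff: "p s i - p t i = e i * (s - t)" if "i \<in> X" for i using e[OF that s t] .
        have "norm (p s i - p t i) < d" if "i \<in> X" for i
        proof -
          have "norm (p s i - p t i) \<le> M * norm (s - t)"
            using diff[OF that] eM[OF that] by (simp add: norm_mult mult_right_mono)
          also have "\<dots> < d" using st M by (simp add: dist_norm field_simps)
          finally show ?thesis .
        qed
        then have "norm (f (p s) - f (p t) - (\<Sum>i\<in>X. c i * (p s i - p t i))) \<le>
            \<epsilon> / (2 * M) * (\<Sum>i\<in>X. norm (p s i - p t i))"
          using d(2)[OF p[OF s]] by blast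
        also have "(\<Sum>i\<in>X. c i * (p s i - p t i)) = D * (s - t)"
          unfolding D_def sum_distrib_right by (intro sum.cong) (auto simp: diff)
        also have "(\<Sum>i\<in>X. norm (p s i - p t i)) = (M - 1) * norm (s - t)"
          unfolding M_def by (simp add: sum_distrib_right norm_mult diff)
        also have "\<epsilon> / (2 * M) * ((M - 1) * norm (s - t)) \<le> \<epsilon> / (2 * M) * (M * norm (s - t))"
          using \<epsilon> M by (intro mult_left_mono mult_right_mono) auto
        also have "\<dots> = \<epsilon> / 2 * norm (s - t)" using M by simp
        finally have *: "norm (f (p s) - f (p t) - D * (s - t)) \<le> \<epsilon> / 2 * norm (s - t)" .
        have "(f (p s) - f (p t)) / (s - t) - D = (f (p s) - f (p t) - D * (s - t)) / (s - t)"
          using that by (simp add: field_simps)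
        then have "norm ((f (p s) - f (p t)) / (s - t) - D) = norm (f (p s) - f (p t) - D * (s - t)) / norm (s - t)"
          by (simp add: norm_divide)
        also have "\<dots> \<le> \<epsilon> / 2" using * that by (simp add: divide_le_eq)
        finally show ?thesis using \<epsilon> by (simp add: dist_norm)
      qed
      then show "\<forall>\<^sub>F s in at t. dist ((f (p s) - f (p t)) / (s - t)) D < \<epsilon>"
        unfolding eventually_at using r(1) d(1) M by (intro exI[of _ "min r (d / M)"]) auto
    qed
    then have "((\<lambda>s. f (p s)) has_field_derivative D) (at t)"
      by (simp add: has_field_derivative_iff)
    then show ?thesis by (auto simp: field_differentiable_def)
  qed
  then show ?thesis
    by (auto simp: holomorphic_on_def intro: field_differentiable_at_within)
qed

lemma tendsto_fun_coordinate: "((\<lambda>x. x i) \<longlongrightarrow> a i) (at a within S)"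
  for a :: "'i \<Rightarrow> 'a::topological_space"
proof -
  have "continuous_on UNIV (\<lambda>x :: 'i \<Rightarrow> 'a. x i)" by (rule continuous_on_product_coordinates)
  then have "((\<lambda>x. x i) \<longlongrightarrow> a i) (at a)" by (simp add: continuous_on_def)
  then show ?thesis by (rule tendsto_within_subset) auto
qed

lemma analytic_in_imp_continuous_on:
  assumes an: "analytic_in X f S" and X: "finite X"
  shows "continuous_on S f"
  unfolding continuous_on_def
proof
  fix a assume a: "a \<in> S"
  obtain c where c: "\<And>\<epsilon>. \<epsilon> > 0 \<Longrightarrow> \<exists>d>0. \<forall>x\<in>S. (\<forall>i\<in>X. norm (x i - a i) < d) \<longrightarrow>
      norm (f x - f a - (\<Sum>i\<in>X. c i * (x i - a i))) \<le> \<epsilon> * (\<Sum>i\<in>X. norm (x i - a i))"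
    using an a unfolding analytic_in_def by blast
  obtain d where d: "d > 0" "\<And>x. x \<in> S \<Longrightarrow> (\<forall>i\<in>X. norm (x i - a i) < d) \<Longrightarrow>
      norm (f x - f a - (\<Sum>i\<in>X. c i * (x i - a i))) \<le> 1 * (\<Sum>i\<in>X. norm (x i - a i))"
    using c[of 1] by auto
  have near: "\<forall>\<^sub>F x in at a within S. \<forall>i\<in>X. norm (x i - a i) < d"
    using tendstoD[OF tendsto_fun_coordinate[of _ a S] d(1)]
    by (intro eventually_ball_finite[OF X]) (simp add: dist_norm)
  have "\<forall>\<^sub>F x in at a within S. x \<in> S" by (simp add: eventually_at_topological exI[of _ UNIV])
  with near have le: "\<forall>\<^sub>F x in at a within S. norm (f x - f a) \<le>
      norm (\<Sum>i\<in>X. c i * (x i - a i)) + (\<Sum>i\<in>X. norm (x i - a i))"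
  proof eventually_elim
    case (elim x)
    have "norm (f x - f a) \<le> norm (\<Sum>i\<in>X. c i * (x i - a i)) + norm (f x - f a - (\<Sum>i\<in>X. c i * (x i - a i)))"
      using norm_triangle_sub[of "f x - f a"] by simp
    then show ?case using d(2)[of x] elim by simp
  qed
  have "((\<lambda>x. norm (\<Sum>i\<in>X. c i * (x i - a i)) + (\<Sum>i\<in>X. norm (x i - a i))) \<longlongrightarrow>
      norm (\<Sum>i\<in>X. c i * (a i - a i)) + (\<Sum>i\<in>X. norm (a i - a i))) (at a within S)"
    by (intro tendsto_intros tendsto_fun_coordinate)
  then have "((\<lambda>x. norm (\<Sum>i\<in>X. c i * (x i - a i)) + (\<Sum>i\<in>X. norm (x i - a i))) \<longlongrightarrow> 0) (at a within S)"
    by simp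
  with le have "((\<lambda>x. f x - f a) \<longlongrightarrow> 0) (at a within S)"
    by (rule Lim_null_comparison)
  then show "(f \<longlongrightarrow> f a) (at a within S)" by (simp add: LIM_zero_iff)
qed

text \<open>Points of \<open>PiE X B\<close> all take the value \<open>undefined\<close> outside the
  finite set \<open>X\<close>. A neighbourhood in the product topology therefore restricts them in
  finitely many coordinates only.\<close>

lemma open_fun_contains_box:
  fixes N :: "('i \<Rightarrow> complex) set"
  assumes N: "open N" and a: "a \<in> N" "a \<in> PiE X B" and X: "finite X"
  obtains d where "d > 0" "\<And>x. x \<in> PiE X B \<Longrightarrow> (\<And>i. i \<in> X \<Longrightarrow> norm (x i - a i) < d) \<Longrightarrow> x \<in> N"
proof -
  have "openin (product_topology (\<lambda>i. euclidean) UNIV) N" using N by (simp add: open_fun_def)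
  from product_topology_open_contains_basis[OF this a(1)] obtain Y where
    Y: "a \<in> (\<Pi>\<^sub>E i\<in>UNIV. Y i)" "\<And>i. open (Y i)" "(\<Pi>\<^sub>E i\<in>UNIV. Y i) \<subseteq> N"
    by auto
  have aY: "a i \<in> Y i" for i using Y(1) by auto
  have "\<exists>e>0. ball (a i) e \<subseteq> Y i" for i using Y(2) aY open_contains_ball by blast
  then obtain e where e: "\<And>i. e i > 0" "\<And>i. ball (a i) (e i) \<subseteq> Y i" by metis
  define d where "d = Min (insert 1 (e ` X))"
  have d: "d > 0" using X e(1) by (auto simp: d_def)
  have dle: "d \<le> e i" if "i \<in> X" for i using X that by (auto simp: d_def)
  show thesis
  proof (rule that[OF d])
    fix x assume x: "x \<in> PiE X B" "\<And>i. i \<in> X \<Longrightarrow> norm (x i - a i) < d"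
    have "x i \<in> Y i" for i
    proof (cases "i \<in> X")
      case True
      then have "x i \<in> ball (a i) (e i)" using x(2)[OF True] dle[OF True] by (simp add: dist_norm norm_minus_commute)
      then show ?thesis using e(2) by blast
    next
      case False
      then have "x i = a i" using x(1) a(2) by (auto simp: PiE_iff extensional_def)
      then show ?thesis using aY by simp
    qed
    then have "x \<in> (\<Pi>\<^sub>E i\<in>UNIV. Y i)" by auto
    then show "x \<in> N" using Y(3) by blast
  qed
qed

text \<open>Around each point of the half-size ball there is a disc of radius
  \<open>\<rho> / 2\<close> inside the large one, so Cauchy's estimate bounds the derivative there
  by \<open>2 * \<eta> / \<rho>\<close>.\<close>

lemma bounded_holomorphic_lipschitz:
  assumes g: "g holomorphic_on S" "cball a \<rho> \<subseteq> S" "\<rho> > 0"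
    and bd: "\<And>s. s \<in> cball a \<rho> \<Longrightarrow> norm (g s) \<le> \<eta>" and s: "norm (s - a) < \<rho> / 2"
  shows "norm (g s - g a) \<le> 2 * \<eta> / \<rho> * norm (s - a)"
proof -
  have dg: "(g has_field_derivative deriv g u) (at u within ball a (\<rho> / 2))" if "u \<in> ball a (\<rho> / 2)" for u
  proof -
    have "g holomorphic_on ball a \<rho>" using g ball_subset_cball holomorphic_on_subset by blast
    moreover have "u \<in> ball a \<rho>" using that g(3) by auto
    ultimately show ?thesis using holomorphic_derivI[of g "ball a \<rho>" u] by auto
  qed
  have "norm (deriv g u) \<le> 2 * \<eta> / \<rho>" if u: "u \<in> ball a (\<rho> / 2)" for u
  proof -
    have sub: "cball u (\<rho> / 2) \<subseteq> cball a \<rho>"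
    proof
      fix x assume "x \<in> cball u (\<rho> / 2)"
      then show "x \<in> cball a \<rho>" using u dist_triangle[of a x u] by simp
    qed
    have "norm ((deriv ^^ 1) g u) \<le> fact 1 * \<eta> / (\<rho> / 2) ^ 1"
    proof (rule Cauchy_inequality)
      show "g holomorphic_on ball u (\<rho> / 2)"
        using g(1,2) sub ball_subset_cball by (meson holomorphic_on_subset order_trans)
      show "continuous_on (cball u (\<rho> / 2)) g"
        using g(1,2) sub by (meson holomorphic_on_imp_continuous_on holomorphic_on_subset order_trans)
      show "norm (g x) \<le> \<eta>" if "norm (u - x) = \<rho> / 2" for x
        using that sub by (intro bd) (auto simp: dist_norm)
    qed (use g in auto)
    then show ?thesis by (simp add: mult.commute)
  qed
  then show ?thesis
    using s g(3) field_differentiable_bound[of "ball a (\<rho> / 2)" g "deriv g" "2 * \<eta> / \<rho>" s a] dg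
    by (auto simp: dist_norm norm_minus_commute)
qed

text \<open>Osgood's lemma, by induction on the set \<open>Y\<close> of coordinates in which
  \<open>x\<close> may differ from \<open>a\<close>. Moving one more coordinate \<open>k\<close>
  changes \<open>f\<close> as it does at \<open>a\<close>, up to the increment of a difference
  \<open>g\<close> of two holomorphic functions; \<open>g\<close> is uniformly small by continuity,
  and Cauchy's estimate makes its increment linear in the step.\<close>

theorem analytic_in_if_separately_holomorphic:
  fixes f :: "('i \<Rightarrow> complex) \<Rightarrow> complex"
  assumes X: "finite X" and B: "\<And>i. i \<in> X \<Longrightarrow> open (B i)" and f: "continuous_on (PiE X B) f"
    and hol: "\<And>x i. x \<in> PiE X B \<Longrightarrow> i \<in> X \<Longrightarrow> (\<lambda>s. f (x(i := s))) holomorphic_on B i"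
  shows "analytic_in X f (PiE X B)"
  unfolding analytic_in_def
proof
  fix a assume a: "a \<in> PiE X B"
  define c where "c i = deriv (\<lambda>s. f (a(i := s))) (a i)" for i
  have main: "\<forall>e>0. \<exists>d>0. \<forall>x\<in>PiE X B. (\<forall>i\<in>X. norm (x i - a i) < d) \<longrightarrow> (\<forall>i\<in>X - Y. x i = a i) \<longrightarrow>
      norm (f x - f a - (\<Sum>i\<in>Y. c i * (x i - a i))) \<le> e * (\<Sum>i\<in>Y. norm (x i - a i))"
    if "finite Y" "Y \<subseteq> X" for Y
    using that
  proof (induction Y rule: finite_induct)
    case empty
    have "x = a" if "x \<in> PiE X B" "\<forall>i\<in>X. x i = a i" for x
      using that(2) by (intro PiE_ext[OF that(1) a]) auto
    then show ?case by (auto intro!: exI[of _ 1])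
  next
    case (insert k Y)
    have k: "k \<in> X" using insert by simp
    have ak: "a k \<in> B k" using a k by auto
    show ?case
    proof (intro allI impI)
      fix e :: real assume e: "e > 0"
      have "Y \<subseteq> X" using insert.prems by simp
      from insert.IH[OF this, rule_format, OF e] obtain d1 where d1: "d1 > 0"
        and d1': "\<forall>x\<in>PiE X B. (\<forall>i\<in>X. norm (x i - a i) < d1) \<longrightarrow> (\<forall>i\<in>X - Y. x i = a i) \<longrightarrow>
          norm (f x - f a - (\<Sum>i\<in>Y. c i * (x i - a i))) \<le> e * (\<Sum>i\<in>Y. norm (x i - a i))"
        by (elim exE conjE)
      obtain \<rho> where \<rho>: "\<rho> > 0" "cball (a k) \<rho> \<subseteq> B k"
        using B[OF k] ak open_contains_cball by blast
      have "((\<lambda>s. f (a(k := s))) has_field_derivative c k) (at (a k))"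
        unfolding c_def by (rule holomorphic_derivI[OF hol[OF a k] B[OF k] ak])
      then have "\<exists>d>0. \<forall>s. norm (s - a k) < d \<longrightarrow>
          norm (f (a(k := s)) - f (a(k := a k)) - c k * (s - a k)) \<le> e / 2 * norm (s - a k)"
        unfolding has_field_derivative_def has_derivative_at_alt using e half_gt_zero by blast
      then obtain d2 where d2: "d2 > 0" "\<forall>s. norm (s - a k) < d2 \<longrightarrow>
          norm (f (a(k := s)) - f a - c k * (s - a k)) \<le> e / 2 * norm (s - a k)"
        unfolding fun_upd_triv by (elim exE conjE)
      \<comment> \<open>Chosen so that the Lipschitz constant \<open>2 * \<eta> / \<rho>\<close> of
        \<open>g\<close> equals \<open>e / 2\<close>.\<close>
      define \<eta> where "\<eta> = e * \<rho> / 4"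
      have \<eta>: "\<eta> > 0" using e \<rho> by (simp add: \<eta>_def)
      have cont: "continuous_on (PiE X B \<times> cball (a k) \<rho>) (\<lambda>(x, s). f (x(k := s)))"
        unfolding case_prod_beta
      proof (rule continuous_on_compose2[OF f])
        show "continuous_on (PiE X B \<times> cball (a k) \<rho>) (\<lambda>x. (fst x)(k := snd x))"
          by (intro continuous_on_fun_upd continuous_on_fst continuous_on_snd continuous_on_id)
        show "(\<lambda>x. (fst x)(k := snd x)) ` (PiE X B \<times> cball (a k) \<rho>) \<subseteq> PiE X B"
          using \<rho>(2) k by (intro image_subsetI PiE_fun_upd_in) (auto simp: mem_Times_iff)
      qed
      obtain N where N: "a \<in> N" "open N"
        "\<forall>x\<in>N \<inter> PiE X B. \<forall>t\<in>cball (a k) \<rho>.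
            dist (case (x, t) of (x, s) \<Rightarrow> f (x(k := s))) (case (a, t) of (x, s) \<Rightarrow> f (x(k := s))) \<le> \<eta>"
        using continuous_on_prod_compactE[OF cont compact_cball a \<eta>] by metis
      obtain d3 where d3: "d3 > 0"
        "\<And>x. x \<in> PiE X B \<Longrightarrow> (\<And>i. i \<in> X \<Longrightarrow> norm (x i - a i) < d3) \<Longrightarrow> x \<in> N"
        by (rule open_fun_contains_box[OF N(2,1) a X]) auto
      define d where "d = min (min d1 d2) (min d3 (\<rho> / 2))"
      have "norm (f x - f a - (\<Sum>i\<in>insert k Y. c i * (x i - a i))) \<le> e * (\<Sum>i\<in>insert k Y. norm (x i - a i))"
        if x: "x \<in> PiE X B" "\<forall>i\<in>X. norm (x i - a i) < d" "\<forall>i\<in>X - insert k Y. x i = a i" for x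
      proof -
        have xk: "norm (x k - a k) < d" using x(2) k by auto
        define x' where "x' = x(k := a k)"
        have x': "x' \<in> PiE X B" unfolding x'_def by (intro PiE_fun_upd_in x k ak)
        have sums: "(\<Sum>i\<in>Y. c i * (x' i - a i)) = (\<Sum>i\<in>Y. c i * (x i - a i))"
          "(\<Sum>i\<in>Y. norm (x' i - a i)) = (\<Sum>i\<in>Y. norm (x i - a i))"
          using insert.hyps by (auto simp: x'_def intro!: sum.cong)
        have near: "\<forall>i\<in>X. norm (x' i - a i) < d1" and fixed: "\<forall>i\<in>X - Y. x' i = a i"
          using x(2,3) d1 by (auto simp: x'_def d_def)
        have e1: "norm (f x' - f a - (\<Sum>i\<in>Y. c i * (x i - a i))) \<le> e * (\<Sum>i\<in>Y. norm (x i - a i))"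
          using bspec[OF d1' x', THEN mp, OF near, THEN mp, OF fixed] unfolding sums .
        define g where "g s = f (x(k := s)) - f (a(k := s))" for s
        have "x \<in> N" using x by (intro d3(2)) (auto simp: d_def)
        then have "norm (g s) \<le> \<eta>" if "s \<in> cball (a k) \<rho>" for s
          using N(3) x(1) that by (auto simp: g_def dist_norm)
        moreover have "g holomorphic_on B k"
          unfolding g_def by (intro holomorphic_on_diff hol x a k)
        ultimately have "norm (g (x k) - g (a k)) \<le> 2 * \<eta> / \<rho> * norm (x k - a k)"
          using xk by (intro bounded_holomorphic_lipschitz[OF _ \<rho>(2,1)]) (auto simp: d_def)
        also have "2 * \<eta> / \<rho> = e / 2" using \<rho>(1) by (simp add: \<eta>_def)
        finally have e2: "norm (g (x k) - g (a k)) \<le> e / 2 * norm (x k - a k)" .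
        have e3: "norm (f (a(k := x k)) - f a - c k * (x k - a k)) \<le> e / 2 * norm (x k - a k)"
          using xk by (intro d2(2)[rule_format]) (auto simp: d_def)
        have "f x - f a - (\<Sum>i\<in>insert k Y. c i * (x i - a i)) =
          (f x' - f a - (\<Sum>i\<in>Y. c i * (x i - a i))) + (g (x k) - g (a k)) +
          (f (a(k := x k)) - f a - c k * (x k - a k))"
          using insert.hyps by (simp add: g_def x'_def)
        also have "norm \<dots> \<le> e * (\<Sum>i\<in>Y. norm (x i - a i)) + e / 2 * norm (x k - a k) + e / 2 * norm (x k - a k)"
          by (intro norm_add_rule_thm e1 e2 e3)
        also have "\<dots> = e * (\<Sum>i\<in>insert k Y. norm (x i - a i))"
          using insert.hyps by (simp add: algebra_simps)
        finally show ?thesis .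
      qed
      moreover have "d > 0" using d1 d2(1) d3(1) \<rho>(1) by (simp add: d_def)
      ultimately show "\<exists>d>0. \<forall>x\<in>PiE X B. (\<forall>i\<in>X. norm (x i - a i) < d) \<longrightarrow> (\<forall>i\<in>X - insert k Y. x i = a i) \<longrightarrow>
        norm (f x - f a - (\<Sum>i\<in>insert k Y. c i * (x i - a i))) \<le> e * (\<Sum>i\<in>insert k Y. norm (x i - a i))"
        by (intro exI[of _ d] conjI ballI impI) simp_all
    qed
  qed
  show "\<exists>c. \<forall>e>0. \<exists>d>0. \<forall>x\<in>PiE X B. (\<forall>i\<in>X. norm (x i - a i) < d) \<longrightarrow>
      norm (f x - f a - (\<Sum>i\<in>X. c i * (x i - a i))) \<le> e * (\<Sum>i\<in>X. norm (x i - a i))"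
    using main[OF X order_refl] by (intro exI[of _ c]) simp
qed

lemma analytic_in_subset: "analytic_in X f S \<Longrightarrow> T \<subseteq> S \<Longrightarrow> analytic_in X f T"
  unfolding analytic_in_def by (meson subsetD)

lemma polydisc_mono: "r \<le> r' \<Longrightarrow> polydisc m r \<subseteq> polydisc m r'"
  by (auto simp: polydisc_def z_radius_def intro!: PiE_mono)

lemma punctured_polydisc_mono: "r \<le> r' \<Longrightarrow> punctured_polydisc m r \<subseteq> punctured_polydisc m r'"
  by (auto simp: punctured_polydisc_def z_radius_def intro!: PiE_mono)

lemma punctured_polydisc_subset: "punctured_polydisc m r \<subseteq> polydisc m r"
  by (auto simp: polydisc_def punctured_polydisc_def intro!: PiE_mono)

text \<open>A line through \<open>z\<close> that moves exactly the vanishing coordinates of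
  \<open>z\<close> enters the punctured polydisc at once. Both functions are continuous along it, so
  their values at \<open>z\<close> are the same limit.\<close>

lemma analytic_in_polydisc_unique:
  assumes f: "analytic_in {..<m} f (polydisc m r)" and g: "analytic_in {..<m} g (polydisc m r)"
    and eq: "\<And>z. z \<in> punctured_polydisc m r \<Longrightarrow> f z = g z" and z: "z \<in> polydisc m r" and r: "r > 0"
  shows "f z = g z"
proof -
  \<comment> \<open>Coordinate \<open>0\<close> has radius \<open>r\<close> and all others radius
    \<open>1\<close>; this bound suits both.\<close>
  define \<rho> where "\<rho> = min r 1"
  define e where "e k = (if k < m \<and> z k = 0 then 1 else 0 :: complex)" for k
  define p where "p t = (\<lambda>k. if k < m then z k + e k * t else undefined)" for t
  have \<rho>: "\<rho> > 0" using r by (simp add: \<rho>_def)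
  have p0: "p 0 = z" using z by (auto simp: p_def polydisc_def PiE_iff extensional_def)
  have pk: "p t k \<in> ball 0 (z_radius r k)" if "t \<in> ball 0 \<rho>" "k < m" for t k
    using z that by (auto simp: p_def e_def polydisc_def PiE_iff z_radius_def \<rho>_def split: if_splits)
  have pin: "p t \<in> polydisc m r" if "t \<in> ball 0 \<rho>" for t
    unfolding polydisc_def by (intro PiE_I) (use pk[OF that] in \<open>auto simp: p_def\<close>)
  have ppin: "p t \<in> punctured_polydisc m r" if "t \<in> ball 0 \<rho>" "t \<noteq> 0" for t
    unfolding punctured_polydisc_def using that
    by (intro PiE_I) (use pk[OF that(1)] in \<open>auto simp: p_def e_def\<close>)
  have diff: "p s i - p t i = e i * (s - t)" if "i \<in> {..<m}" for i s t
    using that by (simp add: p_def algebra_simps)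
  have hf: "(\<lambda>t. f (p t)) holomorphic_on ball 0 \<rho>"
    by (rule analytic_in_holomorphic_on_line[OF f]) (auto intro: pin diff)
  have hg: "(\<lambda>t. g (p t)) holomorphic_on ball 0 \<rho>"
    by (rule analytic_in_holomorphic_on_line[OF g]) (auto intro: pin diff)
  have cf: "((\<lambda>t. f (p t)) \<longlongrightarrow> f (p 0)) (at 0)"
    using holomorphic_on_imp_continuous_on[OF hf] \<rho>
    by (metis continuous_on_eq_continuous_at isCont_def open_ball centre_in_ball)
  have cg: "((\<lambda>t. g (p t)) \<longlongrightarrow> g (p 0)) (at 0)"
    using holomorphic_on_imp_continuous_on[OF hg] \<rho>
    by (metis continuous_on_eq_continuous_at isCont_def open_ball centre_in_ball)
  have "\<forall>\<^sub>F t in at 0. f (p t) = g (p t)"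
    unfolding eventually_at using \<rho> eq ppin by (intro exI[of _ \<rho>]) (auto simp: dist_norm)
  then have "((\<lambda>t. g (p t)) \<longlongrightarrow> f (p 0)) (at 0)" by (rule Lim_transform_eventually[OF cf])
  from tendsto_unique[OF at_neq_bot this cg] show ?thesis using p0 by simp
qed


section \<open>Nested level curves\<close>

locale level_curves =
  fixes \<Omega> :: "complex set" and q :: "complex \<Rightarrow> complex" and R :: real
  assumes \<Omega>: "open \<Omega>" "simply_connected \<Omega>" "0 \<in> \<Omega>"
    and q_analytic: "q analytic_on \<Omega>" and R: "R > 0" and nested: "nested_level_curves \<Omega> q R"
begin

lemma q_holomorphic: "q holomorphic_on \<Omega>"
  using q_analytic analytic_imp_holomorphic by blast

lemma connected_\<Omega>: "connected \<Omega>"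
  using \<Omega>(2) simply_connected_imp_connected by blast

lemma level_contour:
  assumes "0 < r" "r < R"
  obtains \<gamma> where "valid_path \<gamma>" "simple_path \<gamma>" "pathfinish \<gamma> = pathstart \<gamma>"
    "path_image \<gamma> = level_curve \<Omega> q r"
  using assms nested unfolding nested_level_curves_def simple_closed_contour_def by metis

lemma zero_inside: "0 < r \<Longrightarrow> r < R \<Longrightarrow> 0 \<in> inside (level_curve \<Omega> q r)"
  using nested unfolding nested_level_curves_def by metis

lemma level_curve_inside:
  "0 < r' \<Longrightarrow> r' < r \<Longrightarrow> r < R \<Longrightarrow> level_curve \<Omega> q r' \<subseteq> inside (level_curve \<Omega> q r)"
  using nested unfolding nested_level_curves_def by metis

text \<open>Apart from the Jordan curve theorem, the point is that the interior stays in
  \<open>\<Omega>\<close>: in a simply connected region a loop has winding number 0 about points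
  outside \<open>\<Omega>\<close>, while a simple closed curve has winding number of modulus 1 about
  points inside it.\<close>

lemma inside_properties:
  assumes "0 < r" "r < R"
  defines "D \<equiv> inside (level_curve \<Omega> q r)"
  shows "D \<subseteq> \<Omega>" "open D" "connected D" "bounded D" "frontier D = level_curve \<Omega> q r"
    "open (outside (level_curve \<Omega> q r))" "D \<inter> outside (level_curve \<Omega> q r) = {}"
    "D \<union> outside (level_curve \<Omega> q r) = - level_curve \<Omega> q r"
proof -
  obtain \<gamma> where \<gamma>: "valid_path \<gamma>" "simple_path \<gamma>" "pathfinish \<gamma> = pathstart \<gamma>"
    "path_image \<gamma> = level_curve \<Omega> q r"
    using level_contour[OF assms(1,2)] by metis
  note J = Jordan_inside_outside[OF \<gamma>(2,3), unfolded \<gamma>(4)]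
  show "open D" "connected D" "bounded D" "frontier D = level_curve \<Omega> q r"
    "open (outside (level_curve \<Omega> q r))" "D \<inter> outside (level_curve \<Omega> q r) = {}"
    "D \<union> outside (level_curve \<Omega> q r) = - level_curve \<Omega> q r"
    using J unfolding D_def by blast+
  show "D \<subseteq> \<Omega>"
  proof (rule ccontr)
    assume "\<not> D \<subseteq> \<Omega>"
    then obtain z where z: "z \<in> D" "z \<notin> \<Omega>" by blast
    have "winding_number \<gamma> z = 0"
      using \<gamma> z by (intro simply_connected_imp_winding_number_zero[OF \<Omega>(2)])
        (auto simp: level_curve_def valid_path_imp_path)
    moreover have "norm (winding_number \<gamma> z) = 1"
      using simple_closed_path_norm_winding_number_inside[OF \<gamma>(2)] z(1) \<gamma>(4) by (simp add: D_def)
    ultimately show False by simp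
  qed
qed

lemma inside_norm_le:
  assumes "0 < r" "r < R" "w \<in> inside (level_curve \<Omega> q r)"
  shows "norm (q w) \<le> r"
proof (rule maximum_modulus_frontier[OF _ _ _ _ assms(3)])
  let ?D = "inside (level_curve \<Omega> q r)"
  note P = inside_properties[OF assms(1,2)]
  show "q holomorphic_on interior ?D"
    using q_holomorphic P(1) interior_subset by (meson holomorphic_on_subset order_trans)
  have "closure ?D \<subseteq> \<Omega>"
    using P(1,5) by (auto simp: closure_Un_frontier level_curve_def)
  then show "continuous_on (closure ?D) q"
    using q_holomorphic holomorphic_on_imp_continuous_on continuous_on_subset by blast
qed (use inside_properties[OF assms(1,2)] in \<open>auto simp: level_curve_def\<close>)

text \<open>The point \<open>0\<close> is inside every level curve, so by the maximum principle
  \<open>|q 0|\<close> is at most every admissible level.\<close>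

lemma q_0: "q 0 = 0"
proof (rule ccontr)
  assume "q 0 \<noteq> 0"
  define r where "r = min (norm (q 0)) R / 2"
  have "0 < r" "r < R" using \<open>q 0 \<noteq> 0\<close> R by (auto simp: r_def)
  then have "norm (q 0) \<le> r" using inside_norm_le zero_inside by blast
  then show False using \<open>q 0 \<noteq> 0\<close> R by (auto simp: r_def min_def split: if_splits)
qed

lemma level_curve_nonempty:
  assumes "0 < r" "r < R"
  obtains w where "w \<in> \<Omega>" "norm (q w) = r"
proof -
  obtain \<gamma> where "path_image \<gamma> = level_curve \<Omega> q r" using level_contour[OF assms] by metis
  moreover have "path_image \<gamma> \<noteq> {}" by (rule path_image_nonempty)
  ultimately show thesis using that unfolding level_curve_def by blast
qed

lemma q_nonzero_somewhere: obtains w where "w \<in> \<Omega>" "q w \<noteq> 0"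
  using level_curve_nonempty[of "R / 2"] R by force

text \<open>A point with nonzero value lies on a lower level curve, so nesting applies. A zero of
  \<open>q\<close> outside the curve would have neighbours, still outside, at which \<open>q\<close>
  is small but nonzero, and these contradict the first case.\<close>

lemma sublevel_inside:
  assumes "w \<in> \<Omega>" "norm (q w) < r" "r < R"
  shows "w \<in> inside (level_curve \<Omega> q r)"
proof (cases "q w = 0")
  case False
  then have "w \<in> level_curve \<Omega> q (norm (q w))" using assms by (simp add: level_curve_def)
  then show ?thesis using level_curve_inside[of "norm (q w)" r] assms False by auto
next
  case True
  then have r: "0 < r" using assms by simp
  note P = inside_properties[OF r assms(3)]
  show ?thesis
  proof (rule ccontr)
    assume "w \<notin> inside (level_curve \<Omega> q r)"
    moreover have "w \<notin> level_curve \<Omega> q r" using True r by (auto simp: level_curve_def)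
    ultimately have w: "w \<in> outside (level_curve \<Omega> q r)" using P(8) by blast
    obtain b where b: "b \<in> \<Omega>" "q b \<noteq> 0" by (rule q_nonzero_somewhere)
    obtain \<rho> where \<rho>: "\<rho> > 0" "ball w \<rho> \<subseteq> \<Omega>" "\<And>z. z \<in> ball w \<rho> - {w} \<Longrightarrow> q z \<noteq> 0"
      using isolated_zeros[OF q_holomorphic \<Omega>(1) connected_\<Omega> assms(1) True b] by blast
    have "isCont q w"
      using q_holomorphic assms(1) \<Omega>(1) by (metis at_within_open continuous_on_eq_continuous_within holomorphic_on_imp_continuous_on)
    then have "(q \<longlongrightarrow> 0) (at w)" using True by (simp add: isCont_def)
    then have "\<forall>\<^sub>F z in at w. norm (q z) < r" using tendstoD[of q 0 "at w" r] r by simp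
    moreover have "\<forall>\<^sub>F z in at w. z \<in> outside (level_curve \<Omega> q r)"
      using P(6) w by (rule eventually_at_in_open')
    moreover have "\<forall>\<^sub>F z in at w. z \<in> ball w \<rho> - {w}"
      using \<rho>(1) by (intro eventually_at_in_open) auto
    ultimately have "\<forall>\<^sub>F z in at w. norm (q z) < r \<and> z \<in> outside (level_curve \<Omega> q r) \<and> z \<in> ball w \<rho> - {w}"
      by eventually_elim auto
    then obtain z where z: "norm (q z) < r" "z \<in> outside (level_curve \<Omega> q r)" "z \<in> ball w \<rho> - {w}"
      using eventually_happens'[OF at_neq_bot] by blast
    have "z \<in> level_curve \<Omega> q (norm (q z))" using z \<rho> by (auto simp: level_curve_def)
    moreover have "norm (q z) > 0" using z \<rho>(3) by auto
    ultimately have "z \<in> inside (level_curve \<Omega> q r)"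
      using level_curve_inside[of "norm (q z)" r] z(1) assms(3) by blast
    then show False using z(2) P(7) by blast
  qed
qed

text \<open>Let \<open>r\<close> be below the minimum of \<open>|q|\<close> on a small circle around
  \<open>0\<close> that separates \<open>0\<close> from another zero \<open>w\<close>. The interior
  of the level curve of \<open>r\<close> is connected and contains both zeros, so it meets the
  circle, although \<open>|q|\<close> is at most \<open>r\<close> there.\<close>

lemma only_zero:
  assumes "w \<in> \<Omega>" "q w = 0"
  shows "w = 0"
proof (rule ccontr)
  assume "w \<noteq> 0"
  obtain b where b: "b \<in> \<Omega>" "q b \<noteq> 0" by (rule q_nonzero_somewhere)
  obtain \<rho> where \<rho>: "\<rho> > 0" "ball 0 \<rho> \<subseteq> \<Omega>" "\<And>z. z \<in> ball 0 \<rho> - {0} \<Longrightarrow> q z \<noteq> 0"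
    using isolated_zeros[OF q_holomorphic \<Omega>(1) connected_\<Omega> \<Omega>(3) q_0 b] by blast
  obtain s where s: "0 < s" "s < \<rho>" "s < norm w"
    using dense[of 0 "min \<rho> (norm w)"] \<rho>(1) \<open>w \<noteq> 0\<close> by auto
  have sph: "sphere 0 s \<subseteq> ball 0 \<rho> - {0}" using s by auto
  have "continuous_on (sphere 0 s) (\<lambda>z. norm (q z))"
    using q_holomorphic sph \<rho>(2)
    by (intro continuous_on_norm holomorphic_on_imp_continuous_on) (auto intro: holomorphic_on_subset)
  then obtain x where x: "x \<in> sphere 0 s" "\<And>z. z \<in> sphere 0 s \<Longrightarrow> norm (q x) \<le> norm (q z)"
    using continuous_attains_inf[of "sphere 0 s" "\<lambda>z. norm (q z)"] s(1) by auto
  have "q x \<noteq> 0" using subsetD[OF sph x(1)] by (rule \<rho>(3))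
  then obtain r where r: "0 < r" "r < R" "r < norm (q x)"
    using dense[of 0 "min (norm (q x)) R"] R by auto
  let ?D = "inside (level_curve \<Omega> q r)"
  have "0 \<in> ?D" "w \<in> ?D" using r assms q_0 \<Omega>(3) by (auto intro!: sublevel_inside)
  then have "?D \<inter> frontier (cball 0 s) \<noteq> {}"
    using s inside_properties(3)[OF r(1,2)]
    by (intro connected_Int_frontier) (auto simp: disjoint_iff)
  moreover have "frontier (cball 0 s) = sphere (0 :: complex) s" using s(1) by (simp add: frontier_cball)
  ultimately obtain z where "z \<in> ?D" "z \<in> sphere 0 s" by blast
  then show False using inside_norm_le[OF r(1,2)] x(2) r(3) by force
qed

text \<open>For \<open>r\<close> between \<open>|q w|\<close> and \<open>\<delta>\<close>, the
  interior of the level curve of \<open>r\<close> is a connected set that contains \<open>w\<close>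
  and \<open>0\<close> and avoids the path.\<close>

lemma winding_number_sublevel:
  assumes \<gamma>: "path \<gamma>" "pathfinish \<gamma> = pathstart \<gamma>" "\<And>w. w \<in> path_image \<gamma> \<Longrightarrow> norm (q w) \<ge> \<delta>"
    and "\<delta> \<le> R" "w \<in> \<Omega>" "norm (q w) < \<delta>"
  shows "winding_number \<gamma> w = winding_number \<gamma> 0"
proof -
  obtain r where r: "norm (q w) < r" "r < \<delta>" using assms(6) dense by blast
  then have r': "0 < r" "r < R" using assms(4) norm_ge_zero[of "q w"] by linarith+
  show ?thesis
  proof (rule winding_number_eq[OF \<gamma>(1,2)])
    show "w \<in> inside (level_curve \<Omega> q r)" "0 \<in> inside (level_curve \<Omega> q r)"
      using assms r r' q_0 \<Omega>(3) by (auto intro!: sublevel_inside)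
    show "connected (inside (level_curve \<Omega> q r))" by (rule inside_properties(3)[OF r'])
    show "inside (level_curve \<Omega> q r) \<inter> path_image \<gamma> = {}"
      using inside_norm_le[OF r'] \<gamma>(3) r(2) by force
  qed
qed

text \<open>The second assumption confines the solutions to a compact part of
  \<open>\<Omega>\<close>. It also excludes that \<open>g\<close> is constantly \<open>c\<close>,
  because it fails at points of the level curve of \<open>r\<close>.\<close>

lemma finite_preimage:
  assumes g: "g holomorphic_on \<Omega>" "\<And>w. w \<in> \<Omega> \<Longrightarrow> g w = c \<Longrightarrow> norm (q w) < r"
    and r: "0 < r" "r < R"
  shows "finite {w \<in> \<Omega>. g w = c}"
proof -
  let ?D = "inside (level_curve \<Omega> q r)"
  note P = inside_properties[OF r]
  have cl: "closure ?D \<subseteq> \<Omega>"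
    using P(1,5) by (auto simp: closure_Un_frontier level_curve_def)
  have "compact (closure ?D)" using P(4) by (simp add: compact_closure)
  obtain b where b: "b \<in> \<Omega>" "norm (q b) = r" using level_curve_nonempty[OF r] by blast
  have "finite {w \<in> closure ?D. g w - c = 0}"
  proof (cases "(\<lambda>w. g w - c) constant_on \<Omega>")
    case True
    then have "g w - c = g b - c" if "w \<in> \<Omega>" for w using that b(1) unfolding constant_on_def by metis
    moreover have "g b - c \<noteq> 0" using b assms(2)[of b] by auto
    ultimately have "{w \<in> closure ?D. g w - c = 0} = {}" using cl by auto
    then show ?thesis by (simp only: finite.emptyI)
  next
    case False
    then show ?thesis
      using g(1) by (intro holomorphic_compact_finite_zeros[OF _ \<Omega>(1) connected_\<Omega> \<open>compact (closure ?D)\<close> cl])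
        (auto intro!: holomorphic_intros)
  qed
  moreover have "{w \<in> \<Omega>. g w = c} \<subseteq> {w \<in> closure ?D. g w - c = 0}"
    using assms(2) sublevel_inside r closure_subset by fastforce
  ultimately show ?thesis by (rule rev_finite_subset)
qed

lemma finite_roots_at: "norm \<zeta> < R \<Longrightarrow> finite (roots_at \<Omega> q \<zeta>)"
proof -
  assume z: "norm \<zeta> < R"
  obtain r where r: "norm \<zeta> < r" "r < R" using z dense by blast
  then have "0 < r" using norm_ge_zero[of \<zeta>] by linarith
  then show ?thesis
    unfolding roots_at_def using r by (intro finite_preimage[OF q_holomorphic]) auto
qed

text \<open>Since \<open>0\<close> is the only zero of \<open>q\<close>, we have \<open>q = f ^ N\<close> with \<open>f\<close> having a simple zero at \<open>0\<close>.
  By Rouche's theorem \<open>f\<close> takes each value \<open>a\<close> with \<open>|a| ^ N < R\<close> exactly once.\<close>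

lemma power_root:
  obtains f g N where "N > 0" "f holomorphic_on \<Omega>" "g holomorphic_on \<Omega>"
    "\<And>w. w \<in> \<Omega> \<Longrightarrow> q w = f w ^ N" "\<And>w. w \<in> \<Omega> \<Longrightarrow> f w = g w * w" "\<And>w. w \<in> \<Omega> \<Longrightarrow> g w \<noteq> 0"
proof -
  obtain b where b: "b \<in> \<Omega>" "q b \<noteq> 0" by (rule q_nonzero_somewhere)
  have nc: "\<not> q constant_on \<Omega>"
  proof
    assume "q constant_on \<Omega>"
    then have "q b = q 0" using b \<Omega>(3) by (auto simp: constant_on_def)
    then show False using b q_0 by simp
  qed
  obtain g r N where g: "0 < N" "0 < r" "ball 0 r \<subseteq> \<Omega>" "g holomorphic_on ball 0 r"
    "\<And>w. w \<in> ball 0 r \<Longrightarrow> q w = (w - 0) ^ N * g w" "\<And>w. w \<in> ball 0 r \<Longrightarrow> g w \<noteq> 0"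
    by (rule holomorphic_factor_zero_nonconstant[OF q_holomorphic \<Omega>(1) connected_\<Omega> \<Omega>(3) q_0 nc]) (rule that)
  define h where "h w = (if w = 0 then g 0 else q w / w ^ N)" for w
  have "h holomorphic_on (\<Omega> - {0}) \<union> ball 0 r"
  proof (rule holomorphic_on_Un)
    have "(\<lambda>w. q w / w ^ N) holomorphic_on \<Omega> - {0}"
      using q_holomorphic by (intro holomorphic_intros) (auto intro: holomorphic_on_subset)
    then show "h holomorphic_on \<Omega> - {0}"
      by (rule holomorphic_transform) (auto simp: h_def)
    show "h holomorphic_on ball 0 r"
      by (rule holomorphic_transform[OF g(4)]) (use g(5) in \<open>auto simp: h_def\<close>)
  qed (use \<Omega>(1) in auto)
  moreover have "(\<Omega> - {0}) \<union> ball 0 r = \<Omega>" using g(2,3) by auto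
  ultimately have h: "h holomorphic_on \<Omega>" by simp
  have hnz: "h w \<noteq> 0" if "w \<in> \<Omega>" for w
    using only_zero[OF that] g(2,6) by (auto simp: h_def)
  have qh: "q w = w ^ N * h w" if "w \<in> \<Omega>" for w
    using q_0 g(1) by (auto simp: h_def)
  obtain l where l: "l holomorphic_on \<Omega>" "\<And>w. w \<in> \<Omega> \<Longrightarrow> h w = exp (l w)"
    using conjunct2[OF iffD1[OF simply_connected_eq_holomorphic_log[OF \<Omega>(1)] \<Omega>(2)], rule_format, of h] h hnz
    by blast
  define k where "k w = exp (l w / of_nat N)" for w
  have k: "k holomorphic_on \<Omega>" unfolding k_def using g(1) by (intro holomorphic_intros l) auto
  have "q w = (k w * w) ^ N" if "w \<in> \<Omega>" for w
    using qh[OF that] l(2)[OF that] g(1) by (simp add: k_def power_mult_distrib flip: exp_of_nat_mult)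
  moreover have "(\<lambda>w. k w * w) holomorphic_on \<Omega>" using k by (intro holomorphic_intros)
  ultimately show thesis
    using that[of N "\<lambda>w. k w * w" k] g(1) k by (auto simp: k_def)
qed

text \<open>In \<open>q = f ^ N\<close> the function \<open>f\<close> is injective on the sublevel
  set of \<open>R\<close>, so its derivative has no zero there, and \<open>f\<close> itself vanishes
  only where \<open>q\<close> does. Thus nonzero roots are simple and the weights
  \<open>q / q'\<close> are finite.\<close>

lemma deriv_nonzero:
  assumes w: "w \<in> \<Omega>" "q w \<noteq> 0" "norm (q w) < R"
  shows "deriv q w \<noteq> 0"
proof -
  obtain f g N where f: "N > 0" "f holomorphic_on \<Omega>" "g holomorphic_on \<Omega>"
    "\<And>w. w \<in> \<Omega> \<Longrightarrow> q w = f w ^ N" "\<And>w. w \<in> \<Omega> \<Longrightarrow> f w = g w * w" "\<And>w. w \<in> \<Omega> \<Longrightarrow> g w \<noteq> 0"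
    by (rule power_root) (rule that)
  have zorder_f: "zorder f 0 = 1"
    by (rule zorder_eqI[OF \<Omega>(1,3) f(3) f(6)[OF \<Omega>(3)]]) (auto simp: f(5))
  define D where "D = {w \<in> \<Omega>. norm (q w) < R}"
  have uniq: "w1 = w2" if "w1 \<in> D" "w2 \<in> D" "f w1 = f w2" for w1 w2
  proof -
    define a where "a = f w1"
    have aR: "norm a ^ N < R" using that(1) by (auto simp: D_def a_def f(4) norm_power)
    then obtain r where r: "norm a ^ N < r" "r < R" using dense by blast
    have r0: "0 < r" using r(1) by (meson norm_ge_zero order_le_less_trans zero_le_power)
    obtain \<gamma> where \<gamma>: "valid_path \<gamma>" "simple_path \<gamma>" "pathfinish \<gamma> = pathstart \<gamma>"
      "path_image \<gamma> = level_curve \<Omega> q r" using level_contour[OF r0 r(2)] by metis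
    define Z where "Z = {p \<in> \<Omega>. f p + (- a) = 0}"
    have Za: "norm (q p) < r" if "p \<in> \<Omega>" "f p = a" for p
      using that r by (auto simp: f(4) norm_power)
    have fin: "finite Z" using finite_preimage[OF f(2) Za r0 r(2)] by (simp add: Z_def)
    have Z0: "{p \<in> \<Omega>. f p = 0} = {0}" using f(5,6) \<Omega>(3) by auto
    have less: "norm (f z) > norm (- a)" if "z \<in> path_image \<gamma>" for z
    proof -
      have "norm (f z) ^ N = r" using that by (auto simp: \<gamma>(4) level_curve_def f(4) norm_power)
      then show ?thesis using r(1) power_less_imp_less_base[of "norm a" N "norm (f z)"] by simp
    qed
    have wn0: "\<forall>z. z \<notin> \<Omega> \<longrightarrow> winding_number \<gamma> z = 0"
      using \<gamma> by (intro allI impI simply_connected_imp_winding_number_zero[OF \<Omega>(2)])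
        (auto simp: level_curve_def valid_path_imp_path)
    \<comment> \<open>On the level curve of \<open>r\<close> we have
      \<open>|f| ^ N = r > |a| ^ N\<close>, so \<open>f\<close> and \<open>f - a\<close> have equal
      zero counts there; the only zero of \<open>f\<close> is the simple one at
      \<open>0\<close>.\<close>
    have rouche: "(\<Sum>p\<in>Z. winding_number \<gamma> p * zorder (\<lambda>p. f p + (- a)) p) =
        (\<Sum>p\<in>{p \<in> \<Omega>. f p = 0}. winding_number \<gamma> p * zorder f p)"
      unfolding Z_def
      by (rule Rouche_theorem[OF \<Omega>(1) connected_\<Omega> fin[unfolded Z_def] _ f(2) _ \<gamma>(1,3) _ _ wn0])
         (use less in \<open>auto simp: \<gamma>(4) Z0 level_curve_def\<close>)
    have wn: "winding_number \<gamma> p = winding_number \<gamma> 0" if "p \<in> Z" for p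
      using Za[of p] that \<gamma> r(2)
      by (intro winding_number_sublevel[of _ r]) (auto simp: Z_def level_curve_def valid_path_imp_path)
    have wn_ne: "winding_number \<gamma> 0 \<noteq> 0"
      using simple_closed_path_norm_winding_number_inside[OF \<gamma>(2)] zero_inside[OF r0 r(2)] \<gamma>(4)
      by (metis norm_zero zero_neq_one)
    \<comment> \<open>All zeros of \<open>f - a\<close> lie in the sublevel set of \<open>r\<close>,
      so the curve winds about each of them as it does about \<open>0\<close>, and this common
      factor cancels.\<close>
    have "winding_number \<gamma> 0 * (\<Sum>p\<in>Z. of_int (zorder (\<lambda>p. f p + (- a)) p)) = winding_number \<gamma> 0"
      using rouche unfolding Z0 by (simp add: wn zorder_f sum_distrib_left)
    then have "(\<Sum>p\<in>Z. of_int (zorder (\<lambda>p. f p + (- a)) p)) = (1 :: complex)"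
      using wn_ne by simp
    then have "(of_int (\<Sum>p\<in>Z. zorder (\<lambda>p. f p + (- a)) p) :: complex) = of_int 1" by simp
    then have sum1: "(\<Sum>p\<in>Z. zorder (\<lambda>p. f p + (- a)) p) = 1" by (simp only: of_int_eq_iff)
    obtain b where b: "b \<in> \<Omega>" "norm (q b) = r" using level_curve_nonempty[OF r0 r(2)] by blast
    have ex: "\<exists>w\<in>\<Omega>. f w + (- a) \<noteq> 0" using b Za[of b] by (intro bexI[of _ b]) auto
    have hol: "(\<lambda>p. f p + (- a)) holomorphic_on \<Omega>" by (intro holomorphic_intros f(2))
    have pos: "zorder (\<lambda>p. f p + (- a)) p > 0" if "p \<in> Z" for p
    proof -
      have p: "p \<in> \<Omega>" "f p + (- a) = 0" using that by (auto simp: Z_def)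
      show ?thesis using zorder_exist_zero[OF hol \<Omega>(1) connected_\<Omega> p(1) ex] p(2) by argo
    qed
    have "(\<Sum>p\<in>Z. 1) \<le> (\<Sum>p\<in>Z. zorder (\<lambda>p. f p + (- a)) p)"
      by (rule sum_mono) (use pos in force)
    then have "card Z \<le> 1" using sum1 by simp
    moreover have "{w1, w2} \<subseteq> Z" using that by (auto simp: Z_def D_def a_def)
    ultimately show ?thesis using fin card_mono[OF fin, of "{w1, w2}"] by (cases "w1 = w2") auto
  qed
  have D: "open D"
  proof -
    have "D = \<Omega> \<inter> q -` ball 0 R" by (auto simp: D_def)
    then show ?thesis
      using continuous_open_preimage[OF holomorphic_on_imp_continuous_on[OF q_holomorphic] \<Omega>(1) open_ball] by simp
  qed
  have df: "deriv f w \<noteq> 0"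
    using w uniq D f(2)
    by (intro holomorphic_injective_imp_regular[of f D]) (auto simp: D_def inj_on_def intro: holomorphic_on_subset)
  have "(f has_field_derivative deriv f w) (at w)"
    by (rule holomorphic_derivI[OF f(2) \<Omega>(1) w(1)])
  then have "((\<lambda>w. f w ^ N) has_field_derivative of_nat N * f w ^ (N - 1) * deriv f w) (at w)"
    by (auto intro!: derivative_eq_intros)
  then have "(q has_field_derivative of_nat N * f w ^ (N - 1) * deriv f w) (at w)"
    by (rule has_field_derivative_transform_within_open[OF _ \<Omega>(1) w(1)]) (simp add: f(4))
  moreover have "f w \<noteq> 0" using w f(1,4) by auto
  ultimately show ?thesis using df f(1) by (simp add: DERIV_imp_deriv)
qed

end


section \<open>Smooth nested contours\<close>

text \<open>The closed exterior of the outer curve is connected, unbounded and disjoint from the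
  inner curve, so it lies in an unbounded component of the complement of the inner one.\<close>

lemma nested_contours_winding:
  assumes \<gamma>: "ccw_contour_around_0 \<gamma>" and \<gamma>': "ccw_contour_around_0 \<gamma>'"
    and sub: "path_image \<gamma>' \<subseteq> inside (path_image \<gamma>)"
  shows "path_image \<gamma> \<subseteq> outside (path_image \<gamma>')"
proof
  fix w assume w: "w \<in> path_image \<gamma>"
  have s: "simple_path \<gamma>" "pathfinish \<gamma> = pathstart \<gamma>"
    using \<gamma> by (auto simp: ccw_contour_around_0_def simple_closed_contour_def)
  note J = Jordan_inside_outside[OF s]
  define T where "T = closure (outside (path_image \<gamma>))"
  have T: "T = outside (path_image \<gamma>) \<union> path_image \<gamma>"
    using J by (simp add: T_def closure_Un_frontier)
  have "connected T" using J by (simp add: T_def connected_imp_connected_closure)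
  moreover have "T \<subseteq> - path_image \<gamma>'"
    using sub J inside_no_overlap[of "path_image \<gamma>"] unfolding T by blast
  moreover have "w \<in> T" using w T by blast
  ultimately have "T \<subseteq> connected_component_set (- path_image \<gamma>') w"
    by (intro connected_component_maximal)
  moreover have "\<not> bounded T" using J T bounded_subset by blast
  ultimately have "\<not> bounded (connected_component_set (- path_image \<gamma>') w)"
    using bounded_subset by blast
  moreover have "w \<notin> path_image \<gamma>'" using \<open>T \<subseteq> - path_image \<gamma>'\<close> \<open>w \<in> T\<close> by blast
  ultimately show "w \<in> outside (path_image \<gamma>')" by (simp add: outside_def)
qed

lemma ccw_winding_number_inside:
  assumes "ccw_contour_around_0 \<gamma>" "w \<in> inside (path_image \<gamma>)"
  shows "winding_number \<gamma> w = 1"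
proof -
  have s: "simple_path \<gamma>" "0 \<in> inside (path_image \<gamma>)" "winding_number \<gamma> 0 = 1"
    using assms(1) by (auto simp: ccw_contour_around_0_def simple_closed_contour_def)
  show ?thesis
    using simple_closed_path_winding_number_inside[OF s(1)] s(2,3) assms(2)
    by (metis one_neq_neg_one)
qed

text \<open>A polynomial loop close to \<open>\<gamma>\<close> gives the same integrals of functions
  holomorphic on \<open>U\<close>. Unlike \<open>\<gamma>\<close> it certainly has a continuous
  derivative, so its contour mean is a bounded functional.\<close>

lemma polynomial_loop_approximation:
  assumes \<gamma>: "valid_path \<gamma>" "pathfinish \<gamma> = pathstart \<gamma>" and U: "open U" "path_image \<gamma> \<subseteq> U"
  obtains p where "valid_path p" "pathfinish p = pathstart p" "path_image p \<subseteq> U"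
    "continuous_on {0..1} (\<lambda>t. vector_derivative p (at t))"
    "\<And>f. f holomorphic_on U \<Longrightarrow> contour_integral p f = contour_integral \<gamma> f"
proof -
  have path: "path \<gamma>" using \<gamma>(1) by (rule valid_path_imp_path)
  obtain d where d: "0 < d" "\<And>g h. valid_path g \<and> valid_path h \<and>
      (\<forall>t \<in> {0..1}. norm (g t - \<gamma> t) < d \<and> norm (h t - \<gamma> t) < d) \<and>
      pathfinish g = pathstart g \<and> pathfinish h = pathstart h \<longrightarrow>
      path_image g \<subseteq> U \<and> path_image h \<subseteq> U \<and>
      (\<forall>f. f holomorphic_on U \<longrightarrow> contour_integral h f = contour_integral g f)"
    using contour_integral_nearby_loops[OF U(1) path U(2)] by auto
  obtain p where p: "polynomial_function p" "pathstart p = pathstart \<gamma>" "pathfinish p = pathfinish \<gamma>"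
    "\<And>t. t \<in> {0..1} \<Longrightarrow> norm (p t - \<gamma> t) < d"
    using path_approx_polynomial_function[OF path d(1)] by blast
  have vp: "valid_path p" using p(1) by (simp add: valid_path_polynomial_function)
  have *: "path_image \<gamma> \<subseteq> U \<and> path_image p \<subseteq> U \<and>
      (\<forall>f. f holomorphic_on U \<longrightarrow> contour_integral p f = contour_integral \<gamma> f)"
    by (rule d(2)[of \<gamma> p, rule_format]) (use \<gamma> vp p d(1) in auto)
  obtain p' where p': "polynomial_function p'" "\<And>x. (p has_vector_derivative p' x) (at x)"
    using has_vector_derivative_polynomial_function[OF p(1)] by blast
  have "(\<lambda>t. vector_derivative p (at t)) = p'"
    using p'(2) by (auto intro!: vector_derivative_at)
  then have "continuous_on {0..1} (\<lambda>t. vector_derivative p (at t))"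
    by (simp only: continuous_on_polymonial_function[OF p'(1)])
  then show thesis using that vp * \<gamma>(2) p(2,3) by auto
qed

lemma winding_number_eq_if_integrals_eq:
  assumes "valid_path p" "valid_path \<gamma>" "path_image p \<subseteq> U" "path_image \<gamma> \<subseteq> U" "w \<notin> U"
    and "\<And>f. f holomorphic_on U \<Longrightarrow> contour_integral p f = contour_integral \<gamma> f"
  shows "winding_number p w = winding_number \<gamma> w"
proof -
  have "(\<lambda>z. 1 / (z - w)) holomorphic_on U"
    using assms(5) by (intro holomorphic_intros) auto
  then have "contour_integral p (\<lambda>z. 1 / (z - w)) = contour_integral \<gamma> (\<lambda>z. 1 / (z - w))"
    by (rule assms(6))
  moreover have "w \<notin> path_image p" "w \<notin> path_image \<gamma>" using assms by auto
  ultimately show ?thesis using assms(1,2) by (simp add: winding_number_valid_path)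
qed

text \<open>The given contours, ordered from outside to inside, are replaced by smooth loops within
  pairwise disjoint neighbourhoods \<open>U j\<close>, so that integrals and mutual positions
  survive. The sets \<open>E j\<close> carry the constraints of the application, and winding numbers
  about points outside \<open>E j\<close> are those of the original contours.\<close>

lemma smooth_nested_contours:
  fixes \<Sigma> :: "nat \<Rightarrow> real \<Rightarrow> complex"
  assumes \<Sigma>: "\<And>j. j < M \<Longrightarrow> ccw_contour_around_0 (\<Sigma> j)"
    and nest: "\<And>i j. i < j \<Longrightarrow> j < M \<Longrightarrow> path_image (\<Sigma> j) \<subseteq> inside (path_image (\<Sigma> i))"
    and E: "\<And>j. j < M \<Longrightarrow> open (E j)" "\<And>j. j < M \<Longrightarrow> path_image (\<Sigma> j) \<subseteq> E j"
  obtains U p where "\<And>j. j < M \<Longrightarrow> open (U j)" "\<And>j. j < M \<Longrightarrow> U j \<subseteq> E j"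
    "\<And>i j. i < j \<Longrightarrow> j < M \<Longrightarrow> U i \<inter> U j = {}"
    "\<And>j. j < M \<Longrightarrow> path_image (\<Sigma> j) \<subseteq> U j"
    "\<And>j. j < M \<Longrightarrow> valid_path (p j)" "\<And>j. j < M \<Longrightarrow> pathfinish (p j) = pathstart (p j)"
    "\<And>j. j < M \<Longrightarrow> path_image (p j) \<subseteq> U j"
    "\<And>j. j < M \<Longrightarrow> continuous_on {0..1} (\<lambda>t. vector_derivative (p j) (at t))"
    "\<And>j f. j < M \<Longrightarrow> f holomorphic_on U j \<Longrightarrow> contour_integral (p j) f = contour_integral (\<Sigma> j) f"
    "\<And>i j w. i < j \<Longrightarrow> j < M \<Longrightarrow> w \<in> U i \<Longrightarrow> winding_number (p j) w = 0"
    "\<And>j w. j < M \<Longrightarrow> w \<notin> E j \<Longrightarrow> winding_number (p j) w = winding_number (\<Sigma> j) w"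
proof -
  have vs: "valid_path (\<Sigma> j)" "simple_path (\<Sigma> j)" "pathfinish (\<Sigma> j) = pathstart (\<Sigma> j)" if "j < M" for j
    using \<Sigma>[OF that] by (auto simp: ccw_contour_around_0_def simple_closed_contour_def)
  have cpt: "compact (path_image (\<Sigma> j))" if "j < M" for j
    using vs(1)[OF that] by (simp add: compact_path_image valid_path_imp_path)
  have out: "path_image (\<Sigma> i) \<subseteq> outside (path_image (\<Sigma> j))" if "i < j" "j < M" for i j
    using that by (intro nested_contours_winding \<Sigma> nest) auto
  have "\<exists>S T. open S \<and> open T \<and> path_image (\<Sigma> i) \<subseteq> S \<and> path_image (\<Sigma> j) \<subseteq> T \<and> S \<inter> T = {}"
    if "i < j" "j < M" for i j
  proof -
    have "path_image (\<Sigma> i) \<inter> path_image (\<Sigma> j) = {}"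
      using nest[OF that] inside_no_overlap[of "path_image (\<Sigma> i)"] by blast
    then show ?thesis
      using separation_normal_compact[of "path_image (\<Sigma> i)" "path_image (\<Sigma> j)"] cpt that
      by (metis compact_imp_closed less_trans)
  qed
  then obtain S T where ST: "\<And>i j. i < j \<Longrightarrow> j < M \<Longrightarrow> open (S i j) \<and> open (T i j) \<and>
      path_image (\<Sigma> i) \<subseteq> S i j \<and> path_image (\<Sigma> j) \<subseteq> T i j \<and> S i j \<inter> T i j = {}"
    by metis
  \<comment> \<open>\<open>T i j\<close> keeps away from the contours further out,
    \<open>S j k\<close> from those further in. Membership in the exterior of the inner contours
    yields the vanishing winding numbers.\<close>
  define U where "U j = E j \<inter> (\<Inter>i\<in>{..<j}. T i j) \<inter> (\<Inter>k\<in>{j<..<M}. S j k \<inter> outside (path_image (\<Sigma> k)))" for j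
  have U_open: "open (U j)" if "j < M" for j
    unfolding U_def
    using ST that E(1)[OF that] Jordan_inside_outside[OF vs(2,3)]
    by (intro open_Int open_INT ballI) auto
  have U_E: "U j \<subseteq> E j" for j by (auto simp: U_def)
  have U_disj: "U i \<inter> U j = {}" if "i < j" "j < M" for i j
  proof -
    have "U i \<subseteq> S i j" "U j \<subseteq> T i j" using that by (auto simp: U_def)
    then show ?thesis using ST[OF that] by blast
  qed
  have \<Sigma>U: "path_image (\<Sigma> j) \<subseteq> U j" if "j < M" for j
    unfolding U_def using E(2)[OF that] ST out that by (auto simp: subset_iff)
  have U_out: "U i \<subseteq> outside (path_image (\<Sigma> j))" if "i < j" "j < M" for i j
    using that by (auto simp: U_def)
  have "\<exists>p. valid_path p \<and> pathfinish p = pathstart p \<and> path_image p \<subseteq> U j \<and>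
      continuous_on {0..1} (\<lambda>t. vector_derivative p (at t)) \<and>
      (\<forall>f. f holomorphic_on U j \<longrightarrow> contour_integral p f = contour_integral (\<Sigma> j) f)" if "j < M" for j
    using polynomial_loop_approximation[OF vs(1,3)[OF that] U_open[OF that] \<Sigma>U[OF that]] by metis
  then obtain p where p: "\<And>j. j < M \<Longrightarrow> valid_path (p j) \<and> pathfinish (p j) = pathstart (p j) \<and>
      path_image (p j) \<subseteq> U j \<and> continuous_on {0..1} (\<lambda>t. vector_derivative (p j) (at t)) \<and>
      (\<forall>f. f holomorphic_on U j \<longrightarrow> contour_integral (p j) f = contour_integral (\<Sigma> j) f)"
    by metis
  have wn: "winding_number (p j) w = winding_number (\<Sigma> j) w" if "j < M" "w \<notin> U j" for j w
    using p[OF that(1)] vs[OF that(1)] \<Sigma>U[OF that(1)] that(2)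
    by (intro winding_number_eq_if_integrals_eq[of _ _ "U j"]) auto
  show thesis
  proof (rule that[of U p])
    show "winding_number (p j) w = 0" if "i < j" "j < M" "w \<in> U i" for i j w
    proof -
      have "winding_number (p j) w = winding_number (\<Sigma> j) w"
        using U_disj[OF that(1,2)] that by (intro wn) auto
      also have "\<dots> = 0"
        using U_out[OF that(1,2)] that(3) vs[OF that(2)]
        by (intro winding_number_zero_in_outside) (auto simp: valid_path_imp_path)
      finally show ?thesis .
    qed
    show "winding_number (p j) w = winding_number (\<Sigma> j) w" if "j < M" "w \<notin> E j" for j w
      using that U_E by (intro wn) auto
  qed (use p U_open U_E U_disj \<Sigma>U in auto)
qed


section \<open>Cauchy factors\<close>

text \<open>The sign collects the pairs in which \<open>i\<close> is the smaller index: there the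
  factor is \<open>w k - w i\<close>.\<close>

lemma vandermonde_remove:
  assumes "finite I" "i \<in> I"
  shows "vandermonde I w =
    (- 1) ^ card {k \<in> I. i < k} * (\<Prod>k\<in>I - {i}. w i - w k) * vandermonde (I - {i}) w"
proof -
  let ?P = "\<lambda>I :: nat set. {(a, b). a \<in> I \<and> b \<in> I \<and> a < b}"
  let ?f = "\<lambda>(a, b). w b - w a"
  let ?A = "(\<lambda>k. (k, i)) ` {k \<in> I. k < i}" and ?B = "(\<lambda>k. (i, k)) ` {k \<in> I. i < k}"
  have fin: "finite (?P J)" if "finite J" for J
    by (rule finite_subset[of _ "J \<times> J"]) (use that in auto)
  have split: "?P I = ?P (I - {i}) \<union> (?A \<union> ?B)" using assms(2) by (auto simp: not_less_iff_gr_or_eq)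
  have f1: "finite (?P (I - {i}))" by (rule fin) (use assms in simp)
  have f2: "finite (?A \<union> ?B)" using assms(1) by simp
  have disj: "?P (I - {i}) \<inter> (?A \<union> ?B) = {}" by auto
  have "vandermonde I w = prod ?f (?P (I - {i}) \<union> (?A \<union> ?B))"
    unfolding vandermonde_def by (rule arg_cong[OF split])
  also have "\<dots> = prod ?f (?P (I - {i})) * prod ?f (?A \<union> ?B)"
    by (rule prod.union_disjoint[OF f1 f2 disj])
  also have "prod ?f (?A \<union> ?B) = prod ?f ?A * prod ?f ?B"
    by (rule prod.union_disjoint) (use assms in auto)
  also have "prod ?f ?A = (\<Prod>k\<in>{k \<in> I. k < i}. w i - w k)"
    by (subst prod.reindex) (auto simp: inj_on_def)
  also have "prod ?f ?B = (\<Prod>k\<in>{k \<in> I. i < k}. (- 1) * (w i - w k))"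
    by (subst prod.reindex) (auto simp: inj_on_def)
  also have "\<dots> = (- 1) ^ card {k \<in> I. i < k} * (\<Prod>k\<in>{k \<in> I. i < k}. w i - w k)"
    unfolding prod.distrib by simp
  also have "(\<Prod>k\<in>{k \<in> I. k < i}. w i - w k) * ((- 1) ^ card {k \<in> I. i < k} * (\<Prod>k\<in>{k \<in> I. i < k}. w i - w k)) =
      (- 1) ^ card {k \<in> I. i < k} * ((\<Prod>k\<in>{k \<in> I. k < i}. w i - w k) * (\<Prod>k\<in>{k \<in> I. i < k}. w i - w k))"
    by (simp only: mult_ac)
  also have "(\<Prod>k\<in>{k \<in> I. k < i}. w i - w k) * (\<Prod>k\<in>{k \<in> I. i < k}. w i - w k) =
      (\<Prod>k\<in>{k \<in> I. k < i} \<union> {k \<in> I. i < k}. w i - w k)"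
    by (rule prod.union_disjoint[symmetric]) (use assms in auto)
  also have "{k \<in> I. k < i} \<union> {k \<in> I. i < k} = I - {i}" by auto
  finally show ?thesis by (simp add: vandermonde_def mult_ac)
qed

lemma cross_prod_remove:
  assumes "finite I" "i \<in> I" "finite J" "j \<in> J"
  shows "cross_prod I w J w' = (w i - w' j) * (\<Prod>k\<in>J - {j}. w i - w' k) *
    (\<Prod>k\<in>I - {i}. w k - w' j) * cross_prod (I - {i}) w (J - {j}) w'"
proof -
  have "cross_prod I w J w' = (\<Prod>k\<in>J. w i - w' k) * (\<Prod>a\<in>I - {i}. \<Prod>k\<in>J. w a - w' k)"
    unfolding cross_prod_def using assms by (subst prod.remove[of I i]) auto
  also have "(\<Prod>k\<in>J. w i - w' k) = (w i - w' j) * (\<Prod>k\<in>J - {j}. w i - w' k)"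
    using assms by (subst prod.remove[of J j]) auto
  also have "(\<Prod>a\<in>I - {i}. \<Prod>k\<in>J. w a - w' k) =
      (\<Prod>a\<in>I - {i}. (w a - w' j) * (\<Prod>k\<in>J - {j}. w a - w' k))"
    by (rule prod.cong) (use assms in \<open>auto simp: prod.remove[of J j]\<close>)
  finally show ?thesis by (simp add: prod.distrib cross_prod_def mult_ac)
qed

text \<open>The first two signs come from pulling one variable out of each Vandermonde product, the
  third from reversing the factors \<open>w k - w' j\<close> of the cross product.\<close>

definition residue_sign :: "nat set \<Rightarrow> nat \<Rightarrow> nat set \<Rightarrow> nat \<Rightarrow> complex" where
  "residue_sign I i J j =
     (- 1) ^ card {k \<in> I. i < k} * (- 1) ^ card {k \<in> J. j < k} * (- 1) ^ card (I - {i})"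

lemma cauchy_factor_cong:
  assumes "\<And>i. i \<in> I \<Longrightarrow> w i = v i" "\<And>j. j \<in> J \<Longrightarrow> w' j = v' j"
  shows "cauchy_factor I w J w' = cauchy_factor I v J v'"
  unfolding cauchy_factor_def vandermonde_def cross_prod_def using assms
  by (intro arg_cong2[of _ _ _ _ "(/)"] arg_cong2[of _ _ _ _ "(*)"] prod.cong refl) auto

text \<open>When \<open>w i\<close> tends to \<open>w' j\<close>, the Vandermonde factors involving
  the two variables cancel, up to sign, against the cross factors in which only one of them occurs.
  What remains is the Cauchy factor of the other variables.\<close>

lemma cauchy_factor_residue_limit:
  assumes fin: "finite I" "i \<in> I" "finite J" "j \<in> J"
    and ne: "\<And>k. k \<in> J - {j} \<Longrightarrow> w' k \<noteq> w' j" "\<And>k. k \<in> I - {i} \<Longrightarrow> w k \<noteq> w' j"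
  shows "((\<lambda>x. cauchy_factor I (w(i := x)) J w' * (x - w' j)) \<longlongrightarrow>
    residue_sign I i J j * cauchy_factor (I - {i}) w (J - {j}) w') (at (w' j))"
proof -
  let ?p = "w' j"
  define c where "c = (- 1 :: complex) ^ card {k \<in> I. i < k} * (- 1) ^ card {k \<in> J. j < k}"
  define N where "N = cauchy_factor (I - {i}) w (J - {j}) w'"
  define \<rho> where "\<rho> x = (\<Prod>k\<in>I - {i}. x - w k) * (\<Prod>k\<in>J - {j}. ?p - w' k) /
      ((\<Prod>k\<in>J - {j}. x - w' k) * (\<Prod>k\<in>I - {i}. w k - ?p))" for x
  have alg: "(s1 * P1 * V1) * (s2 * P2 * V2) / (d * Q1 * Q2 * X) * d =
      s1 * s2 * (P1 * P2 / (Q1 * Q2)) * (V1 * V2 / X)"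
    if "d \<noteq> 0" for s1 P1 V1 s2 P2 V2 d Q1 Q2 X :: complex
  proof -
    have "(s1 * P1 * V1) * (s2 * P2 * V2) / (d * Q1 * Q2 * X) * d =
        (s1 * P1 * V1) * (s2 * P2 * V2) / (Q1 * Q2 * X)"
      using that by (simp add: mult.assoc)
    then show ?thesis by (simp add: divide_inverse mult_ac)
  qed
  have nz: "(\<Prod>k\<in>J - {j}. ?p - w' k) \<noteq> 0" "(\<Prod>k\<in>I - {i}. w k - ?p) \<noteq> 0"
    using fin(1,3) ne by (force simp: prod_zero_iff)+
  have eq: "cauchy_factor I (w(i := x)) J w' * (x - ?p) = c * \<rho> x * N" if "x \<noteq> ?p" for x
  proof -
    have v: "vandermonde (I - {i}) (w(i := x)) = vandermonde (I - {i}) w"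
      unfolding vandermonde_def by (rule prod.cong) auto
    have x: "cross_prod (I - {i}) (w(i := x)) (J - {j}) w' = cross_prod (I - {i}) w (J - {j}) w'"
      unfolding cross_prod_def by (intro prod.cong) auto
    have p1: "(\<Prod>k\<in>I - {i}. x - (w(i := x)) k) = (\<Prod>k\<in>I - {i}. x - w k)"
      by (rule prod.cong) auto
    have p2: "(\<Prod>k\<in>I - {i}. (w(i := x)) k - ?p) = (\<Prod>k\<in>I - {i}. w k - ?p)"
      by (rule prod.cong) auto
    show ?thesis
      unfolding cauchy_factor_def vandermonde_remove[OF fin(1,2)] vandermonde_remove[OF fin(3,4)]
        cross_prod_remove[OF fin] v x p1 p2 c_def \<rho>_def N_def fun_upd_same
      by (rule alg) (use that in simp)
  qed
  have "(\<rho> \<longlongrightarrow> (\<Prod>k\<in>I - {i}. ?p - w k) * (\<Prod>k\<in>J - {j}. ?p - w' k) /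
      ((\<Prod>k\<in>J - {j}. ?p - w' k) * (\<Prod>k\<in>I - {i}. w k - ?p))) (at ?p)"
    unfolding \<rho>_def using nz by (intro tendsto_intros) simp
  moreover have "(\<Prod>k\<in>I - {i}. ?p - w k) = (- 1) ^ card (I - {i}) * (\<Prod>k\<in>I - {i}. w k - ?p)"
  proof -
    have "(\<Prod>k\<in>I - {i}. ?p - w k) = (\<Prod>k\<in>I - {i}. (- 1) * (w k - ?p))" by (rule prod.cong) auto
    then show ?thesis unfolding prod.distrib by simp
  qed
  ultimately have "(\<rho> \<longlongrightarrow> (- 1) ^ card (I - {i})) (at ?p)" using nz by simp
  then have "((\<lambda>x. c * \<rho> x * N) \<longlongrightarrow> c * (- 1) ^ card (I - {i}) * N) (at ?p)"
    by (intro tendsto_intros)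
  then have "((\<lambda>x. cauchy_factor I (w(i := x)) J w' * (x - ?p)) \<longlongrightarrow> c * (- 1) ^ card (I - {i}) * N) (at ?p)"
    by (rule Lim_transform_eventually)
       (auto simp: eventually_at_filter eq intro!: always_eventually)
  then show ?thesis by (simp add: residue_sign_def c_def N_def)
qed

text \<open>Exchanging the two groups changes only a sign, so a pole in a variable of the second
  group reduces to the residue formula for the first.\<close>

lemma cauchy_factor_swap:
  "cauchy_factor I w J w' = (- 1) ^ (card I * card J) * cauchy_factor J w' I w"
proof -
  have "cross_prod I w J w' = (\<Prod>i\<in>I. \<Prod>j\<in>J. (- 1) * (w' j - w i))"
    unfolding cross_prod_def by (intro prod.cong) auto
  also have "\<dots> = (- 1) ^ (card I * card J) * cross_prod J w' I w"
    unfolding cross_prod_def prod.distrib by (simp add: power_mult[symmetric] prod.swap[of _ J I] mult.commute)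
  finally have X: "cross_prod I w J w' = (- 1) ^ (card I * card J) * cross_prod J w' I w" .
  have "(- 1 :: complex) ^ (card I * card J) = 1 \<or> (- 1 :: complex) ^ (card I * card J) = - 1"
    by (cases "even (card I * card J)") auto
  then show ?thesis
    unfolding cauchy_factor_def X by (auto simp: mult.commute)
qed

lemma cauchy_factor_repeated:
  assumes "finite I" "i \<in> I" "k \<in> I" "i \<noteq> k" "w i = w k"
  shows "cauchy_factor I w J w' = 0"
proof -
  have "(\<Prod>k\<in>I - {i}. w i - w k) = 0" using assms by (auto simp: prod_zero_iff)
  then show ?thesis using vandermonde_remove[OF assms(1,2), of w] by (simp add: cauchy_factor_def)
qed

lemma continuous_on_cauchy_factor:
  assumes "\<And>i. i \<in> I \<Longrightarrow> continuous_on S (\<lambda>x. a x i)" "\<And>j. j \<in> J \<Longrightarrow> continuous_on S (\<lambda>x. b x j)"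
    and "finite I" "finite J" "\<And>x i j. x \<in> S \<Longrightarrow> i \<in> I \<Longrightarrow> j \<in> J \<Longrightarrow> a x i \<noteq> b x j"
  shows "continuous_on S (\<lambda>x. cauchy_factor I (a x) J (b x))"
  unfolding cauchy_factor_def vandermonde_def cross_prod_def case_prod_beta
  by (intro continuous_intros assms(1,2)) (use assms(3-5) in \<open>auto simp: prod_zero_iff\<close>)

lemma holomorphic_on_cauchy_factor:
  assumes "\<And>i. i \<in> I \<Longrightarrow> (\<lambda>x. a x i) holomorphic_on S" "\<And>j. j \<in> J \<Longrightarrow> (\<lambda>x. b x j) holomorphic_on S"
    and "finite I" "finite J" "\<And>x i j. x \<in> S \<Longrightarrow> i \<in> I \<Longrightarrow> j \<in> J \<Longrightarrow> a x i \<noteq> b x j"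
  shows "(\<lambda>x. cauchy_factor I (a x) J (b x)) holomorphic_on S"
  unfolding cauchy_factor_def vandermonde_def cross_prod_def case_prod_beta
  by (intro holomorphic_intros assms(1,2)) (use assms(3-5) in \<open>auto simp: prod_zero_iff\<close>)

definition cauchy_product ::
  "nat \<Rightarrow> (nat \<Rightarrow> nat set) \<Rightarrow> (nat \<Rightarrow> nat set) \<Rightarrow> (nat \<times> nat \<Rightarrow> complex) \<Rightarrow> complex" where
  "cauchy_product m I J W =
     (\<Prod>l\<in>{1..<m}. cauchy_factor (I l) (\<lambda>i. W (l, i)) (J (l + 1)) (\<lambda>j. W (l + 1, j)))"

lemma H_fun_eq: "H_fun m I J A W z = cauchy_product m I J W * A W z"
  by (simp add: H_fun_def cauchy_product_def)

definition no_collision ::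
  "nat \<Rightarrow> (nat \<Rightarrow> nat set) \<Rightarrow> (nat \<Rightarrow> nat set) \<Rightarrow> (nat \<times> nat \<Rightarrow> complex) \<Rightarrow> bool" where
  "no_collision m I J W \<longleftrightarrow>
     (\<forall>l\<in>{1..<m}. \<forall>i\<in>I l. \<forall>j\<in>J (l + 1). W (l, i) \<noteq> W (l + 1, j))"

lemma continuous_on_cauchy_product:
  assumes "\<And>v. continuous_on S (\<lambda>x. W x v)" "\<And>l. l \<in> {1..<m} \<Longrightarrow> finite (I l)"
    "\<And>l. l \<in> {1..<m} \<Longrightarrow> finite (J (l + 1))" "\<And>x. x \<in> S \<Longrightarrow> no_collision m I J (W x)"
  shows "continuous_on S (\<lambda>x. cauchy_product m I J (W x))"
  unfolding cauchy_product_def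
  by (intro continuous_on_prod continuous_on_cauchy_factor assms(1-3)) (use assms(4) in \<open>auto simp: no_collision_def\<close>)

lemma holomorphic_on_cauchy_product:
  assumes "\<And>v. (\<lambda>x. W x v) holomorphic_on S" "\<And>l. l \<in> {1..<m} \<Longrightarrow> finite (I l)"
    "\<And>l. l \<in> {1..<m} \<Longrightarrow> finite (J (l + 1))" "\<And>x. x \<in> S \<Longrightarrow> no_collision m I J (W x)"
  shows "(\<lambda>x. cauchy_product m I J (W x)) holomorphic_on S"
  unfolding cauchy_product_def
  by (intro holomorphic_on_prod holomorphic_on_cauchy_factor assms(1-3)) (use assms(4) in \<open>auto simp: no_collision_def\<close>)

section \<open>Chains of variables\<close>

definition chain_slots :: "nat \<Rightarrow> nat \<Rightarrow> (nat \<Rightarrow> nat) \<Rightarrow> (nat \<times> nat) set" where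
  "chain_slots k k' ix = (\<lambda>l. (l, ix l)) ` {k..k'}"

lemma set_chain_eq: "set_chain k k' ix w W v = (if v \<in> chain_slots k k' ix then w else W v)"
  by (cases v) (auto simp: set_chain_def chain_slots_def)

lemma set_chain_single: "set_chain l l (\<lambda>_. i) w W = W((l, i) := w)"
  by (rule ext) (auto simp: set_chain_eq chain_slots_def)

lemma chain_slots_subset: "cauchy_chain m n I J k k' ix \<Longrightarrow> chain_slots k k' ix \<subseteq> var_idx m n"
  by (auto simp: chain_slots_def cauchy_chain_def var_idx_def)

lemma set_chain_in:
  assumes "cauchy_chain m n I J k k' ix" "W \<in> PiE (var_idx m n) K"
    "\<And>v. v \<in> chain_slots k k' ix \<Longrightarrow> w \<in> K' v" "\<And>v. v \<in> var_idx m n \<Longrightarrow> v \<notin> chain_slots k k' ix \<Longrightarrow> K v \<subseteq> K' v"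
  shows "set_chain k k' ix w W \<in> PiE (var_idx m n) K'"
proof (rule PiE_I)
  fix v assume v: "v \<in> var_idx m n"
  then have "W v \<in> K v" using assms(2) by auto
  then show "set_chain k k' ix w W v \<in> K' v"
    using assms(3)[of v] assms(4)[OF v] by (auto simp: set_chain_eq)
next
  fix v assume "v \<notin> var_idx m n"
  then show "set_chain k k' ix w W v = undefined"
    using PiE_arb[OF assms(2)] chain_slots_subset[OF assms(1)] by (auto simp: set_chain_eq)
qed

lemma continuous_on_set_chain:
  assumes "continuous_on S f" "continuous_on S g"
  shows "continuous_on S (\<lambda>x. set_chain k k' ix (f x) (g x))"
proof (rule continuous_on_coordinatewise_then_product)
  fix v
  show "continuous_on S (\<lambda>x. set_chain k k' ix (f x) (g x) v)"
    using assms continuous_on_product_then_coordinatewise[OF assms(2), of v]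
    by (cases "v \<in> chain_slots k k' ix") (simp_all add: set_chain_eq)
qed

lemma holomorphic_on_set_chain: "(\<lambda>w. set_chain k k' ix w W v) holomorphic_on S"
  by (cases "v \<in> chain_slots k k' ix") (auto simp: set_chain_eq intro!: holomorphic_intros)

lemma finite_var_idx: "finite (var_idx m n)"
  by (simp add: var_idx_def)

context
  fixes \<Omega> :: "complex set" and m :: nat and n :: "nat \<Rightarrow> nat" and r :: real
    and A :: "(nat \<times> nat \<Rightarrow> complex) \<Rightarrow> (nat \<Rightarrow> complex) \<Rightarrow> complex"
  assumes data: "analytic_data \<Omega> m n r A" and \<Omega>: "open \<Omega>"
begin

text \<open>\<open>analytic_data\<close> speaks of points indexed by the disjoint union of variables
  and parameters; \<open>case_sum W z\<close> assembles such a point from its two halves.\<close>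

lemma case_sum_in_domain:
  assumes "W \<in> PiE (var_idx m n) (\<lambda>_. \<Omega> - {0})" "z \<in> polydisc m r"
  shows "case_sum W z \<in> (\<Pi>\<^sub>E v\<in>var_idx m n <+> {..<m}.
          (case v of Inl _ \<Rightarrow> \<Omega> - {0} | Inr k \<Rightarrow> ball 0 (z_radius r k)))"
proof (rule PiE_I)
  fix v assume "v \<in> var_idx m n <+> {..<m}"
  then show "case_sum W z v \<in> (case v of Inl _ \<Rightarrow> \<Omega> - {0} | Inr k \<Rightarrow> ball 0 (z_radius r k))"
    using assms by (auto simp: polydisc_def split: sum.splits)
next
  fix v assume "v \<notin> var_idx m n <+> {..<m}"
  then show "case_sum W z v = undefined"
    using assms by (cases v) (auto simp: polydisc_def PiE_iff extensional_def)
qed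

lemma A_continuous:
  "continuous_on (PiE (var_idx m n) (\<lambda>_. \<Omega> - {0}) \<times> polydisc m r) (\<lambda>(W, z). A W z)"
proof -
  note c = analytic_in_imp_continuous_on[OF data[unfolded analytic_data_def] finite_Plus[OF finite_var_idx finite_lessThan]]
  have "continuous_on (PiE (var_idx m n) (\<lambda>_. \<Omega> - {0}) \<times> polydisc m r)
     (\<lambda>x. (\<lambda>p. A (p \<circ> Inl) (p \<circ> Inr)) (case_sum (fst x) (snd x)))"
  proof (rule continuous_on_compose2[OF c])
    show "continuous_on (PiE (var_idx m n) (\<lambda>_. \<Omega> - {0}) \<times> polydisc m r) (\<lambda>x. case_sum (fst x) (snd x))"
    proof (rule continuous_on_coordinatewise_then_product)
      fix v :: "nat \<times> nat + nat"
      show "continuous_on (PiE (var_idx m n) (\<lambda>_. \<Omega> - {0}) \<times> polydisc m r) (\<lambda>x. case_sum (fst x) (snd x) v)"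
        by (cases v) (simp_all add: continuous_on_product_then_coordinatewise continuous_on_fst continuous_on_snd)
    qed
  qed (auto intro!: case_sum_in_domain)
  then show ?thesis by (simp add: case_prod_beta case_sum_o_inj)
qed

text \<open>Moving all variables of a chain together is motion along the line whose direction is the
  indicator of the chain.\<close>

lemma A_holomorphic_chain:
  assumes "cauchy_chain m n I J k k' ix" and W: "W \<in> PiE (var_idx m n) (\<lambda>_. \<Omega> - {0})" and z: "z \<in> polydisc m r"
  shows "(\<lambda>w. A (set_chain k k' ix w W) z) holomorphic_on \<Omega> - {0}"
proof -
  define e :: "nat \<times> nat + nat \<Rightarrow> complex" where
    "e = case_sum (\<lambda>v. if v \<in> chain_slots k k' ix then 1 else 0) (\<lambda>_. 0)"
  have "(\<lambda>w. (\<lambda>p. A (p \<circ> Inl) (p \<circ> Inr)) (case_sum (set_chain k k' ix w W) z)) holomorphic_on \<Omega> - {0}"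
  proof (rule analytic_in_holomorphic_on_line[OF data[unfolded analytic_data_def]
        finite_Plus[OF finite_var_idx finite_lessThan], where e = e])
    show "case_sum (set_chain k k' ix s W) z v - case_sum (set_chain k k' ix t W) z v = e v * (s - t)" for v s t
      by (cases v) (auto simp: set_chain_eq e_def)
    show "case_sum (set_chain k k' ix s W) z \<in> (\<Pi>\<^sub>E v\<in>var_idx m n <+> {..<m}.
          (case v of Inl _ \<Rightarrow> \<Omega> - {0} | Inr k \<Rightarrow> ball 0 (z_radius r k)))" if "s \<in> \<Omega> - {0}" for s
      by (rule case_sum_in_domain[OF set_chain_in[OF assms(1) W] z]) (use that in auto)
  qed (use \<Omega> in auto)
  then show ?thesis by (simp add: case_sum_o_inj)
qed

lemma A_holomorphic_param:
  assumes W: "W \<in> PiE (var_idx m n) (\<lambda>_. \<Omega> - {0})" and z: "z \<in> polydisc m r" and k: "k < m"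
  shows "(\<lambda>s. A W (z(k := s))) holomorphic_on ball 0 (z_radius r k)"
proof -
  define e :: "nat \<times> nat + nat \<Rightarrow> complex" where "e = case_sum (\<lambda>_. 0) (\<lambda>i. if i = k then 1 else 0)"
  have "(\<lambda>s. (\<lambda>p. A (p \<circ> Inl) (p \<circ> Inr)) (case_sum W (z(k := s)))) holomorphic_on ball 0 (z_radius r k)"
  proof (rule analytic_in_holomorphic_on_line[OF data[unfolded analytic_data_def]
        finite_Plus[OF finite_var_idx finite_lessThan], where e = e])
    show "case_sum W (z(k := s)) v - case_sum W (z(k := t)) v = e v * (s - t)" for v s t
      by (cases v) (auto simp: e_def)
    show "case_sum W (z(k := s)) \<in> (\<Pi>\<^sub>E v\<in>var_idx m n <+> {..<m}.
          (case v of Inl _ \<Rightarrow> \<Omega> - {0} | Inr k \<Rightarrow> ball 0 (z_radius r k)))" if "s \<in> ball 0 (z_radius r k)" for s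
    proof (rule case_sum_in_domain[OF W])
      show "z(k := s) \<in> polydisc m r"
        using z k that unfolding polydisc_def by (intro PiE_fun_upd_in) simp_all
    qed
  qed auto
  then show ?thesis by (simp add: case_sum_o_inj)
qed

end


section \<open>The iterated contour integral as a function of the parameters\<close>

lemma z_hat_Suc: "z_hat z (Suc l) = z_hat z l * z l"
  by (simp add: z_hat_def)

lemma polydisc_coordinate: "z \<in> polydisc m r \<Longrightarrow> k < m \<Longrightarrow> norm (z k) < z_radius r k"
  by (auto simp: polydisc_def PiE_iff)

text \<open>The factor \<open>z 0\<close> is below \<open>\<delta>\<close> and every further factor
  is below 1.\<close>

lemma norm_z_hat_less:
  assumes z: "z \<in> polydisc m \<delta>"
  shows "1 \<le> l \<Longrightarrow> l \<le> m \<Longrightarrow> norm (z_hat z l) < \<delta>"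
proof (induction l)
  case (Suc k)
  show ?case
  proof (cases "k = 0")
    case True
    then show ?thesis using polydisc_coordinate[OF z, of 0] Suc.prems by (simp add: z_hat_def z_radius_def)
  next
    case False
    then have "norm (z k) < 1" using polydisc_coordinate[OF z, of k] Suc.prems by (simp add: z_radius_def)
    then have "norm (z_hat z k * z k) \<le> norm (z_hat z k) * 1"
      unfolding norm_mult by (intro mult_left_mono) auto
    also have "\<dots> < \<delta>" using Suc False by simp
    finally show ?thesis by (simp add: z_hat_Suc)
  qed
qed simp

text \<open>The functionals \<open>contour_mean\<close> of \<open>inner_weight * f\<close> over the inner contour plus that of
  \<open>outer_weight * f\<close> over the outer contour reproduce the sum over the roots of \<open>q = z_hat z l\<close>
  up to an integral of \<open>q / (q - z_hat z l) * f\<close> over the inner contour.  The inner weight is chosen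
  such that for \<open>l \<ge> 2\<close> the outer weight vanishes at the roots of \<open>q = z_hat z (l - 1)\<close>.\<close>

definition inner_weight :: "(nat \<Rightarrow> complex) \<Rightarrow> nat \<Rightarrow> complex" where
  "inner_weight z l = (if l = 1 then 0 else 1 / (1 - z (l - 1)))"

definition outer_weight :: "(complex \<Rightarrow> complex) \<Rightarrow> (nat \<Rightarrow> complex) \<Rightarrow> nat \<Rightarrow> complex \<Rightarrow> complex" where
  "outer_weight q z l w = q w / (q w - z_hat z l) - inner_weight z l"

text \<open>The inner contour depends on the whole variable and not only on its level, because later
  each variable gets a circle of its own. Level 1 has a single contour, which is treated as an outer
  one.\<close>

definition weighted_functional ::
  "(complex \<Rightarrow> complex) \<Rightarrow> (nat \<Rightarrow> real \<Rightarrow> complex) \<Rightarrow> (nat \<times> nat \<Rightarrow> real \<Rightarrow> complex) \<Rightarrow> (nat \<Rightarrow> complex)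
     \<Rightarrow> nat \<times> nat \<Rightarrow> (complex \<Rightarrow> complex) \<Rightarrow> complex" where
  "weighted_functional q Oc Nc z v f =
     (if fst v = 1 then 0 else contour_mean (Nc v) (\<lambda>w. inner_weight z (fst v) * f w)) +
     contour_mean (Oc (fst v)) (\<lambda>w. outer_weight q z (fst v) w * f w)"

definition contour_support ::
  "(nat \<Rightarrow> real \<Rightarrow> complex) \<Rightarrow> (nat \<times> nat \<Rightarrow> real \<Rightarrow> complex) \<Rightarrow> nat \<times> nat \<Rightarrow> complex set" where
  "contour_support Oc Nc v =
     (if fst v = 1 then {} else path_image (Nc v)) \<union> path_image (Oc (fst v))"

definition smooth_loop :: "(real \<Rightarrow> complex) \<Rightarrow> bool" where
  "smooth_loop \<gamma> \<longleftrightarrow> valid_path \<gamma> \<and> pathfinish \<gamma> = pathstart \<gamma> \<and>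
     continuous_on {0..1} (\<lambda>t. vector_derivative \<gamma> (at t))"

lemma smooth_loopD:
  assumes "smooth_loop \<gamma>"
  shows "valid_path \<gamma>" "path \<gamma>" "pathfinish \<gamma> = pathstart \<gamma>" "compact (path_image \<gamma>)"
    "bounded_functional (path_image \<gamma>) (contour_mean \<gamma>)"
  using assms unfolding smooth_loop_def
  by (auto intro: bounded_functional_contour_mean valid_path_imp_path compact_path_image)

lemma smooth_loop_circlepath: "smooth_loop (circlepath z r)"
  unfolding smooth_loop_def by (auto simp: vector_derivative_circlepath intro!: continuous_intros)

text \<open>Nesting is recorded through disjointness and winding numbers: outer contours grow and
  inner ones shrink with the level, and every outer contour lies outside every inner one. Within
  each family only neighbouring levels are compared, since the Cauchy factors couple only these. All
  contours surround the disc of radius \<open>\<rho>\<close>, and the lower bound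
  \<open>\<delta>\<close> for \<open>|q|\<close> on the outer ones keeps the poles of
  \<open>q / (q - z_hat z l)\<close> off them.\<close>

locale contour_setup = level_curves \<Omega> q R for \<Omega> q R +
  fixes m :: nat and n :: "nat \<Rightarrow> nat" and I J :: "nat \<Rightarrow> nat set"
    and A :: "(nat \<times> nat \<Rightarrow> complex) \<Rightarrow> (nat \<Rightarrow> complex) \<Rightarrow> complex"
    and Oc Nc :: "nat \<Rightarrow> real \<Rightarrow> complex" and \<rho> \<delta> :: real
  assumes m: "m \<ge> 1"
    and I: "\<And>l. 1 \<le> l \<Longrightarrow> l < m \<Longrightarrow> I l \<subseteq> {1..n l}"
    and J: "\<And>l. 1 \<le> l \<Longrightarrow> l < m \<Longrightarrow> J (l + 1) \<subseteq> {1..n (l + 1)}"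
    and data: "analytic_data \<Omega> m n R A"
    and dom: "dominates_at_0 \<Omega> m n I J R A q"
    and \<rho>: "\<rho> > 0" "cball 0 \<rho> \<subseteq> \<Omega>"
    and \<delta>: "\<delta> > 0" "\<delta> \<le> R"
    and Oc: "\<And>l. l \<in> {1..m} \<Longrightarrow> smooth_loop (Oc l)" "\<And>l. l \<in> {1..m} \<Longrightarrow> path_image (Oc l) \<subseteq> \<Omega> - cball 0 \<rho>"
      "\<And>l w. l \<in> {1..m} \<Longrightarrow> w \<in> cball 0 \<rho> \<Longrightarrow> winding_number (Oc l) w = 1"
    and Nc: "\<And>l. l \<in> {2..m} \<Longrightarrow> smooth_loop (Nc l)" "\<And>l. l \<in> {2..m} \<Longrightarrow> path_image (Nc l) \<subseteq> \<Omega> - cball 0 \<rho>"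
      "\<And>l w. l \<in> {2..m} \<Longrightarrow> w \<in> cball 0 \<rho> \<Longrightarrow> winding_number (Nc l) w = 1"
    and OO: "\<And>l. 1 \<le> l \<Longrightarrow> l < m \<Longrightarrow> path_image (Oc l) \<inter> path_image (Oc (l + 1)) = {}"
      "\<And>l w. 1 \<le> l \<Longrightarrow> l < m \<Longrightarrow> w \<in> path_image (Oc (l + 1)) \<Longrightarrow> winding_number (Oc l) w = 0"
    and NN: "\<And>l. 2 \<le> l \<Longrightarrow> l < m \<Longrightarrow> path_image (Nc l) \<inter> path_image (Nc (l + 1)) = {}"
      "\<And>l w. 2 \<le> l \<Longrightarrow> l < m \<Longrightarrow> w \<in> path_image (Nc l) \<Longrightarrow> winding_number (Nc (l + 1)) w = 0"
    and ON: "\<And>l l'. l \<in> {1..m} \<Longrightarrow> l' \<in> {2..m} \<Longrightarrow> path_image (Oc l) \<inter> path_image (Nc l') = {}"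
      "\<And>l l' w. l \<in> {1..m} \<Longrightarrow> l' \<in> {2..m} \<Longrightarrow> w \<in> path_image (Oc l) \<Longrightarrow> winding_number (Nc l') w = 0"
    and qO: "\<And>l w. l \<in> {1..m} \<Longrightarrow> w \<in> path_image (Oc l) \<Longrightarrow> \<delta> \<le> norm (q w)"
begin

abbreviation "V \<equiv> var_idx m n"

lemma V_level: "v \<in> V \<Longrightarrow> fst v \<in> {1..m}"
  by (auto simp: var_idx_def)

lemma finite_I: "l \<in> {1..<m} \<Longrightarrow> finite (I l)"
  using I[of l] finite_subset by fastforce

lemma finite_J: "l \<in> {1..<m} \<Longrightarrow> finite (J (l + 1))"
  using J[of l] finite_subset by fastforce

lemma polydisc_subset: "polydisc m \<delta> \<subseteq> polydisc m R"
  using \<delta>(2) by (rule polydisc_mono)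

lemma weights_nonzero:
  assumes "z \<in> polydisc m \<delta>" "l \<in> {1..m}"
  shows "l \<noteq> 1 \<Longrightarrow> 1 - z (l - 1) \<noteq> 0"
    and "w \<in> path_image (Oc l) \<Longrightarrow> q w - z_hat z l \<noteq> 0"
proof -
  assume "l \<noteq> 1"
  then have "norm (z (l - 1)) < 1"
    using polydisc_coordinate[OF assms(1), of "l - 1"] assms(2) by (auto simp: z_radius_def split: if_splits)
  then show "1 - z (l - 1) \<noteq> 0" by auto
next
  assume w: "w \<in> path_image (Oc l)"
  have "norm (z_hat z l) < \<delta>" using norm_z_hat_less[OF assms(1)] assms(2) by auto
  also have "\<delta> \<le> norm (q w)" by (rule qO[OF assms(2) w])
  finally show "q w - z_hat z l \<noteq> 0" by auto
qed

lemma q_continuous: "continuous_on (path_image (Oc l)) q" if "l \<in> {1..m}"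
  using Oc(2)[OF that] holomorphic_on_imp_continuous_on[OF q_holomorphic] continuous_on_subset by blast

lemma continuous_on_outer_weight:
  assumes "z \<in> polydisc m \<delta>" "l \<in> {1..m}"
  shows "continuous_on (path_image (Oc l)) (outer_weight q z l)"
  unfolding outer_weight_def
  using weights_nonzero(2)[OF assms] by (intro continuous_intros q_continuous assms) blast

lemma bounded_weighted_functional:
  assumes z: "z \<in> polydisc m \<delta>" and v: "v \<in> V" and N': "fst v \<noteq> 1 \<Longrightarrow> smooth_loop (N' v)"
  shows "bounded_functional (contour_support Oc N' v) (weighted_functional q Oc N' z v)"
proof -
  have l: "fst v \<in> {1..m}" by (rule V_level[OF v])
  have 1: "bounded_functional (contour_support Oc N' v)
      (\<lambda>f. contour_mean (Oc (fst v)) (\<lambda>w. outer_weight q z (fst v) w * f w))"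
    by (rule bounded_functional_mono[OF bounded_functional_weight[OF smooth_loopD(4,5)[OF Oc(1)[OF l]]
          continuous_on_outer_weight[OF z l]]]) (auto simp: contour_support_def)
  show ?thesis
  proof (cases "fst v = 1")
    case True
    then have "weighted_functional q Oc N' z v =
        (\<lambda>f. contour_mean (Oc (fst v)) (\<lambda>w. outer_weight q z (fst v) w * f w))"
      by (auto simp: weighted_functional_def)
    with 1 show ?thesis by simp
  next
    case False
    have "bounded_functional (contour_support Oc N' v)
        (\<lambda>f. contour_mean (N' v) (\<lambda>w. inner_weight z (fst v) * f w))"
      by (rule bounded_functional_mono[OF bounded_functional_weight[OF smooth_loopD(4,5)[OF N'[OF False]]
            continuous_on_const]]) (use False in \<open>auto simp: contour_support_def\<close>)
    moreover have "weighted_functional q Oc N' z v =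
        (\<lambda>f. contour_mean (N' v) (\<lambda>w. inner_weight z (fst v) * f w) +
             contour_mean (Oc (fst v)) (\<lambda>w. outer_weight q z (fst v) w * f w))"
      using False by (auto simp: weighted_functional_def)
    ultimately show ?thesis using bounded_functional_plus[OF _ 1] by simp
  qed
qed

lemma compact_contour_support:
  assumes "v \<in> V" "fst v \<noteq> 1 \<Longrightarrow> smooth_loop (N' v)"
  shows "compact (contour_support Oc N' v)"
  using smooth_loopD(4)[OF Oc(1)[OF V_level[OF assms(1)]]] smooth_loopD(4)[OF assms(2)]
  by (auto simp: contour_support_def)

text \<open>The candidate for the continuation of \<open>G\<close>. Its weights stay finite when
  coordinates of \<open>z\<close> vanish, whereas the sum over roots then degenerates.\<close>

definition extension :: "(nat \<Rightarrow> complex) \<Rightarrow> complex" where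
  "extension z = iterate_functionals (weighted_functional q Oc (\<lambda>v. Nc (fst v)) z) (var_list m n)
     (\<lambda>W. H_fun m I J A W z) (\<lambda>_. undefined)"

lemma set_var_list: "set (var_list m n) = V"
proof -
  have "set (var_list m n) = (\<Union>l\<in>{2..<Suc m}. Pair l ` {1..<Suc (n l)}) \<union> Pair 1 ` {1..<Suc (n 1)}"
    by (simp add: var_list_def del: upt_Suc)
  also have "\<dots> = V"
  proof (rule set_eqI)
    fix v :: "nat \<times> nat"
    obtain l i where v: "v = (l, i)" by fastforce
    show "v \<in> (\<Union>l\<in>{2..<Suc m}. Pair l ` {1..<Suc (n l)}) \<union> Pair 1 ` {1..<Suc (n 1)} \<longleftrightarrow> v \<in> V"
      unfolding v by (cases "l = 1") (use m in \<open>auto simp: var_idx_def intro!: bexI[of _ l]\<close>)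
  qed
  finally show ?thesis .
qed

lemma distinct_var_list: "distinct (var_list m n)"
proof -
  have "distinct xs \<Longrightarrow> distinct (concat (map (\<lambda>l. map (Pair l) [1..<Suc (n l)]) xs))" for xs
    by (induction xs) (auto simp: distinct_map inj_on_def simp del: upt_Suc)
  then show ?thesis
    unfolding var_list_def by (auto simp: distinct_map inj_on_def simp del: upt_Suc)
qed

abbreviation "supp \<equiv> contour_support Oc (\<lambda>v. Nc (fst v))"

lemma supp_subset:
  assumes v: "v \<in> V"
  shows "supp v \<subseteq> \<Omega> - {0}"
proof -
  have z0: "0 \<in> cball 0 \<rho>" using \<rho>(1) by simp
  note l = V_level[OF v]
  have "path_image (Oc (fst v)) \<subseteq> \<Omega> - {0}" using Oc(2)[OF l] z0 by blast
  moreover have "path_image (Nc (fst v)) \<subseteq> \<Omega> - {0}" if "fst v \<noteq> 1"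
  proof -
    have "fst v \<in> {2..m}" using that l by auto
    from Nc(2)[OF this] show ?thesis using z0 by blast
  qed
  ultimately show ?thesis by (simp add: contour_support_def)
qed

lemma supp_smooth: "v \<in> V \<Longrightarrow> fst v \<noteq> 1 \<Longrightarrow> smooth_loop (Nc (fst v))"
  using V_level[of v] by (intro Nc(1)) auto

lemma no_collision_if_disjoint:
  assumes W: "W \<in> PiE V K"
    and disj: "\<And>l i j. (l, i) \<in> V \<Longrightarrow> (l + 1, j) \<in> V \<Longrightarrow> K (l, i) \<inter> K (l + 1, j) = {}"
  shows "no_collision m I J W"
  unfolding no_collision_def
proof (intro ballI)
  fix l i j assume l: "l \<in> {1..<m}" and i: "i \<in> I l" and j: "j \<in> J (l + 1)"
  have "(l, i) \<in> V" "(l + 1, j) \<in> V" using I[of l] J[of l] l i j by (auto simp: var_idx_def)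
  then show "W (l, i) \<noteq> W (l + 1, j)" using disj[of l i j] W by (metis PiE_mem disjoint_iff)
qed

lemma supp_no_collision:
  assumes W: "W \<in> PiE V supp"
  shows "no_collision m I J W"
proof (rule no_collision_if_disjoint[OF W])
  fix l i j assume "(l, i) \<in> V" "(l + 1, j) \<in> V"
  then have l: "1 \<le> l" "l < m" by (auto simp: var_idx_def)
  then show "supp (l, i) \<inter> supp (l + 1, j) = {}"
    using OO(1)[of l] NN(1)[of l] ON(1)[of l "l + 1"] ON(1)[of "l + 1" l]
    by (auto simp: contour_support_def)
qed

lemma H_fun_continuous:
  assumes sub: "\<And>v. v \<in> V \<Longrightarrow> K v \<subseteq> \<Omega> - {0}"
    and nc: "\<And>W. W \<in> PiE V K \<Longrightarrow> no_collision m I J W"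
  shows "continuous_on (polydisc m R \<times> PiE V K) (\<lambda>(z, W). H_fun m I J A W z)"
proof -
  have PiE_sub: "PiE V K \<subseteq> PiE V (\<lambda>_. \<Omega> - {0})" by (rule PiE_mono[OF sub])
  have 1: "continuous_on (polydisc m R \<times> PiE V K) (\<lambda>x. cauchy_product m I J (snd x))"
  proof (rule continuous_on_cauchy_product)
    show "continuous_on (polydisc m R \<times> PiE V K) (\<lambda>x. snd x v)" for v
      by (rule continuous_on_product_then_coordinatewise[OF continuous_on_snd[OF continuous_on_id]])
  qed (use finite_I finite_J nc in auto)
  have "continuous_on (polydisc m R \<times> PiE V K) (\<lambda>x. (\<lambda>(W, z). A W z) (snd x, fst x))"
  proof (rule continuous_on_compose2[OF A_continuous[OF data \<Omega>(1)]])
    show "continuous_on (polydisc m R \<times> PiE V K) (\<lambda>x. (snd x, fst x))"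
      by (intro continuous_on_Pair continuous_on_snd continuous_on_fst continuous_on_id)
    show "(\<lambda>x. (snd x, fst x)) ` (polydisc m R \<times> PiE V K) \<subseteq> PiE V (\<lambda>_. \<Omega> - {0}) \<times> polydisc m R"
      using subsetD[OF PiE_sub] by (intro image_subsetI) (simp add: mem_Times_iff)
  qed
  with 1 show ?thesis
    unfolding H_fun_eq case_prod_beta by (intro continuous_on_mult) simp_all
qed

lemma supp_nonempty: obtains W0 where "W0 \<in> PiE V supp"
proof
  show "restrict (\<lambda>v. pathstart (Oc (fst v))) V \<in> PiE V supp"
    by (auto simp: contour_support_def)
qed

lemma extension_base:
  "extension z = iterate_functionals (weighted_functional q Oc (\<lambda>v. Nc (fst v)) z) (var_list m n)
     (\<lambda>W. H_fun m I J A W z) W0" if "W0 \<in> PiE V supp" for W0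
  unfolding extension_def
  by (rule iterate_functionals_base_cong) (use that in \<open>auto simp: set_var_list dest: PiE_arb\<close>)

text \<open>The parameter space \<open>P\<close> is abstract because it is used twice: once with all
  of \<open>z\<close> varying, once with a single coordinate varying, each time together with the
  remaining variables.\<close>

lemma weighted_functional_continuous_step:
  fixes \<zeta> :: "'p::topological_space \<Rightarrow> nat \<Rightarrow> complex"
  assumes v: "v \<in> V" and \<zeta>: "continuous_on P \<zeta>" "\<zeta> ` P \<subseteq> polydisc m \<delta>"
    and f: "continuous_on (P \<times> supp v) (\<lambda>(x, w). f x w)"
  shows "continuous_on P (\<lambda>x. weighted_functional q Oc (\<lambda>v. Nc (fst v)) (\<zeta> x) v (f x))"
proof -
  define l where "l = fst v"
  have l: "l \<in> {1..m}" unfolding l_def by (rule V_level[OF v])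
  have co: "continuous_on S (\<lambda>x. \<zeta> (fst x) k)" if "S \<subseteq> P \<times> T" for S and T :: "complex set" and k
  proof -
    have "continuous_on S (\<lambda>x. \<zeta> (fst x))"
      by (rule continuous_on_compose2[OF \<zeta>(1)]) (use that in \<open>auto intro!: continuous_intros\<close>)
    then show ?thesis by (rule continuous_on_product_then_coordinatewise)
  qed
  have fO: "continuous_on (P \<times> path_image (Oc l)) (\<lambda>(x, w). f x w)"
    by (rule continuous_on_subset[OF f]) (auto simp: contour_support_def l_def)
  have 1: "continuous_on P (\<lambda>x. contour_mean (Oc l) (\<lambda>w. outer_weight q (\<zeta> x) l w * f x w))"
  proof (rule bounded_functional_continuous_param[OF smooth_loopD(4,5)[OF Oc(1)[OF l]]])
    have qc: "continuous_on (P \<times> path_image (Oc l)) (\<lambda>x. q (snd x))"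
      by (rule continuous_on_compose2[OF q_continuous[OF l]]) (auto intro!: continuous_intros)
    have zc: "continuous_on (P \<times> path_image (Oc l)) (\<lambda>x. z_hat (\<zeta> (fst x)) l)"
      unfolding z_hat_def by (intro continuous_on_prod co) auto
    have ic: "continuous_on (P \<times> path_image (Oc l)) (\<lambda>x. inner_weight (\<zeta> (fst x)) l)"
      unfolding inner_weight_def
    proof (cases "l = 1")
      case False
      then show "continuous_on (P \<times> path_image (Oc l)) (\<lambda>x. if l = 1 then 0 else 1 / (1 - \<zeta> (fst x) (l - 1)))"
        using weights_nonzero(1)[OF _ l False] \<zeta>(2)
        by (simp, intro continuous_on_divide continuous_on_diff continuous_on_const co) auto
    qed auto
    show "continuous_on (P \<times> path_image (Oc l)) (\<lambda>(x, w). outer_weight q (\<zeta> x) l w * f x w)"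
      unfolding outer_weight_def case_prod_beta
      using weights_nonzero(2)[OF _ l] \<zeta>(2) fO
      by (intro continuous_on_mult continuous_on_diff continuous_on_divide qc zc ic) (auto simp: case_prod_beta)
  qed
  show ?thesis
  proof (cases "l = 1")
    case True
    then show ?thesis using 1 by (simp add: weighted_functional_def l_def)
  next
    case False
    then have lN: "l \<in> {2..m}" using l by auto
    have fN: "continuous_on (P \<times> path_image (Nc l)) (\<lambda>(x, w). f x w)"
      by (rule continuous_on_subset[OF f]) (use False in \<open>auto simp: contour_support_def l_def\<close>)
    have "continuous_on P (\<lambda>x. contour_mean (Nc l) (\<lambda>w. inner_weight (\<zeta> x) l * f x w))"
    proof (rule bounded_functional_continuous_param[OF smooth_loopD(4,5)[OF Nc(1)[OF lN]]])
      show "continuous_on (P \<times> path_image (Nc l)) (\<lambda>(x, w). inner_weight (\<zeta> x) l * f x w)"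
        unfolding inner_weight_def case_prod_beta
        using weights_nonzero(1)[OF _ l False] \<zeta>(2) fN False
        by (simp, intro continuous_on_mult continuous_on_divide continuous_on_diff continuous_on_const co)
           (auto simp: case_prod_beta)
    qed
    with 1 False show ?thesis
      by (simp add: weighted_functional_def l_def continuous_on_add)
  qed
qed

lemma extension_continuous: "continuous_on (polydisc m \<delta>) extension"
proof -
  obtain W0 where W0: "W0 \<in> PiE V supp" by (rule supp_nonempty) (rule that)
  have "continuous_on (polydisc m \<delta> \<times> PiE V supp) (\<lambda>(z, W).
      iterate_functionals (weighted_functional q Oc (\<lambda>v. Nc (fst v)) z) (var_list m n) (\<lambda>W. H_fun m I J A W z) W)"
  proof (rule iterate_continuous_family)
    fix v :: "nat \<times> nat" and f :: "(nat \<Rightarrow> complex) \<times> (nat \<times> nat \<Rightarrow> complex) \<Rightarrow> complex \<Rightarrow> complex"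
    assume "v \<in> V" "continuous_on ((polydisc m \<delta> \<times> PiE V supp) \<times> supp v) (\<lambda>(x, w). f x w)"
    then show "continuous_on (polydisc m \<delta> \<times> PiE V supp)
        (\<lambda>x. weighted_functional q Oc (\<lambda>v. Nc (fst v)) (fst x) v (f x))"
      by (intro weighted_functional_continuous_step continuous_on_fst continuous_on_id) auto
  next
    show "continuous_on (polydisc m \<delta> \<times> PiE V supp) (\<lambda>(z, W). H_fun m I J A W z)"
      by (rule continuous_on_subset[OF H_fun_continuous[OF supp_subset supp_no_collision]])
         (use polydisc_subset in blast)+
  qed (simp add: set_var_list)
  from continuous_on_slice_snd[OF this W0] show ?thesis
    using continuous_on_cong[OF refl extension_base[OF W0], of "polydisc m \<delta>"] by simp
qed

lemma extension_holomorphic: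
  assumes z: "z \<in> polydisc m \<delta>" and k: "k < m"
  shows "(\<lambda>s. extension (z(k := s))) holomorphic_on ball 0 (z_radius \<delta> k)"
proof -
  let ?U = "ball 0 (z_radius \<delta> k) :: complex set"
  have upd: "z(k := s) \<in> polydisc m \<delta>" if "s \<in> ?U" for s
    using z k that unfolding polydisc_def by (intro PiE_fun_upd_in) simp_all
  have updc: "continuous_on ?U (\<lambda>s. z(k := s))"
    by (intro continuous_on_fun_upd continuous_on_const continuous_on_id)
  obtain W0 where W0: "W0 \<in> PiE V supp" by (rule supp_nonempty) (rule that)
  have hz: "(\<lambda>s. (z(k := s)) i) holomorphic_on ?U" for i
    by (cases "i = k") auto
  have hhat: "(\<lambda>s. z_hat (z(k := s)) l) holomorphic_on ?U" for l
    unfolding z_hat_def by (intro holomorphic_on_prod hz)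
  have hinner: "(\<lambda>s. inner_weight (z(k := s)) l) holomorphic_on ?U" if l: "l \<in> {1..m}" for l
    unfolding inner_weight_def
  proof (cases "l = 1")
    case False
    have "1 - (z(k := s)) (l - 1) \<noteq> 0" if "s \<in> ?U" for s
      by (rule weights_nonzero(1)[OF upd[OF that] l False])
    then show "(\<lambda>s. if l = 1 then 0 else 1 / (1 - (z(k := s)) (l - 1))) holomorphic_on ?U"
      using False by (simp only: if_False, intro holomorphic_on_divide holomorphic_on_diff holomorphic_on_const hz)
  qed auto
  have houter: "(\<lambda>s. outer_weight q (z(k := s)) l w) holomorphic_on ?U"
    if l: "l \<in> {1..m}" and w: "w \<in> path_image (Oc l)" for l w
    unfolding outer_weight_def
    using weights_nonzero(2)[OF upd l w]
    by (intro holomorphic_on_divide holomorphic_on_diff holomorphic_on_const hhat hinner l)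
  have "(\<lambda>s. iterate_functionals (weighted_functional q Oc (\<lambda>v. Nc (fst v)) (z(k := s))) (var_list m n)
      (\<lambda>W. H_fun m I J A W (z(k := s))) W0) holomorphic_on ?U"
  proof (rule iterate_holomorphic_family[OF _ _ _ _ _ W0])
    fix v :: "nat \<times> nat" and f :: "complex \<times> (nat \<times> nat \<Rightarrow> complex) \<Rightarrow> complex \<Rightarrow> complex"
    assume v: "v \<in> V" and f: "continuous_on ((?U \<times> PiE V supp) \<times> supp v) (\<lambda>(x, w). f x w)"
    have "continuous_on (?U \<times> PiE V supp) (\<lambda>x. z(k := fst x))"
      by (intro continuous_on_fun_upd continuous_on_const continuous_on_fst continuous_on_id)
    then show "continuous_on (?U \<times> PiE V supp)
        (\<lambda>x. weighted_functional q Oc (\<lambda>v. Nc (fst v)) (z(k := fst x)) v (f x))"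
      using v f upd by (intro weighted_functional_continuous_step) auto
  next
    fix v :: "nat \<times> nat" and f :: "complex \<Rightarrow> complex \<Rightarrow> complex"
    assume v: "v \<in> V" and f: "continuous_on (?U \<times> supp v) (\<lambda>(s, w). f s w)"
      and hol: "\<And>w. w \<in> supp v \<Longrightarrow> (\<lambda>s. f s w) holomorphic_on ?U"
    define l where "l = fst v"
    have l: "l \<in> {1..m}" unfolding l_def by (rule V_level[OF v])
    have outer: "(\<lambda>s. contour_mean (Oc l) (\<lambda>w. outer_weight q (z(k := s)) l w * f s w)) holomorphic_on ?U"
    proof (rule bounded_functional_holomorphic_param[OF smooth_loopD(4,5)[OF Oc(1)[OF l]] open_ball])
      have fO: "continuous_on (?U \<times> path_image (Oc l)) (\<lambda>(x, w). f x w)"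
        by (rule continuous_on_subset[OF f]) (auto simp: contour_support_def l_def)
      have qc: "continuous_on (?U \<times> path_image (Oc l)) (\<lambda>x. q (snd x))"
        by (rule continuous_on_compose2[OF q_continuous[OF l]]) (auto intro!: continuous_intros)
      have zc: "continuous_on (?U \<times> path_image (Oc l)) (\<lambda>x. z_hat (z(k := fst x)) l)"
        by (rule continuous_on_compose2[OF holomorphic_on_imp_continuous_on[OF hhat]])
           (auto intro!: continuous_intros)
      have ic: "continuous_on (?U \<times> path_image (Oc l)) (\<lambda>x. inner_weight (z(k := fst x)) l)"
        by (rule continuous_on_compose2[OF holomorphic_on_imp_continuous_on[OF hinner[OF l]]])
           (auto intro!: continuous_intros)
      show "continuous_on (?U \<times> path_image (Oc l)) (\<lambda>(s, w). outer_weight q (z(k := s)) l w * f s w)"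
        unfolding outer_weight_def case_prod_beta
        using weights_nonzero(2)[OF upd l] fO
        by (intro continuous_on_mult continuous_on_diff continuous_on_divide qc zc ic) (auto simp: case_prod_beta)
      show "(\<lambda>s. outer_weight q (z(k := s)) l w * f s w) holomorphic_on ?U" if "w \<in> path_image (Oc l)" for w
        using that by (intro holomorphic_on_mult houter l hol) (auto simp: contour_support_def l_def)
    qed
    show "(\<lambda>s. weighted_functional q Oc (\<lambda>v. Nc (fst v)) (z(k := s)) v (f s)) holomorphic_on ?U"
    proof (cases "l = 1")
      case True
      then show ?thesis using outer by (simp add: weighted_functional_def l_def)
    next
      case False
      then have lN: "l \<in> {2..m}" using l by auto
      have fN: "continuous_on (?U \<times> path_image (Nc l)) (\<lambda>(x, w). f x w)"
        by (rule continuous_on_subset[OF f]) (use False in \<open>auto simp: contour_support_def l_def\<close>)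
      have ic: "continuous_on (?U \<times> path_image (Nc l)) (\<lambda>x. inner_weight (z(k := fst x)) l)"
        by (rule continuous_on_compose2[OF holomorphic_on_imp_continuous_on[OF hinner[OF l]]])
           (auto intro!: continuous_intros)
      have "(\<lambda>s. contour_mean (Nc l) (\<lambda>w. inner_weight (z(k := s)) l * f s w)) holomorphic_on ?U"
      proof (rule bounded_functional_holomorphic_param[OF smooth_loopD(4,5)[OF Nc(1)[OF lN]] open_ball])
        show "continuous_on (?U \<times> path_image (Nc l)) (\<lambda>(s, w). inner_weight (z(k := s)) l * f s w)"
          unfolding case_prod_beta using fN
          by (intro continuous_on_mult ic) (auto simp: case_prod_beta)
        show "(\<lambda>s. inner_weight (z(k := s)) l * f s w) holomorphic_on ?U" if "w \<in> path_image (Nc l)" for w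
          using that False by (intro holomorphic_on_mult hinner l hol) (auto simp: contour_support_def l_def)
      qed
      then have "(\<lambda>s. contour_mean (Nc l) (\<lambda>w. inner_weight (z(k := s)) l * f s w) +
          contour_mean (Oc l) (\<lambda>w. outer_weight q (z(k := s)) l w * f s w)) holomorphic_on ?U"
        by (intro holomorphic_on_add outer)
      then show ?thesis using False by (simp add: weighted_functional_def l_def)
    qed
  next
    show "continuous_on (?U \<times> PiE V supp) (\<lambda>(p, W). H_fun m I J A W (z(k := p)))"
    proof -
      have "continuous_on (?U \<times> PiE V supp) (\<lambda>x. (\<lambda>(z, W). H_fun m I J A W z) (z(k := fst x), snd x))"
      proof (rule continuous_on_compose2[OF H_fun_continuous[of supp]])
        show "continuous_on (?U \<times> PiE V supp) (\<lambda>x. (z(k := fst x), snd x))"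
          by (intro continuous_on_Pair continuous_on_fun_upd continuous_on_const continuous_on_fst
              continuous_on_snd continuous_on_id)
        show "(\<lambda>x. (z(k := fst x), snd x)) ` (?U \<times> PiE V supp) \<subseteq> polydisc m R \<times> PiE V supp"
          using subsetD[OF polydisc_subset upd] by (intro image_subsetI) (simp add: mem_Times_iff)
      qed (use supp_subset supp_no_collision in auto)
      then show ?thesis by (simp add: case_prod_beta)
    qed
    show "(\<lambda>s. H_fun m I J A W (z(k := s))) holomorphic_on ?U" if "W \<in> PiE V supp" for W
    proof -
      have W: "W \<in> PiE V (\<lambda>_. \<Omega> - {0})" using PiE_mono[of V supp] supp_subset that by blast
      have "?U \<subseteq> ball 0 (z_radius R k)" using \<delta> by (auto simp: z_radius_def)
      then have "(\<lambda>s. A W (z(k := s))) holomorphic_on ?U"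
        using A_holomorphic_param[OF data \<Omega>(1) W subsetD[OF polydisc_subset z] k] holomorphic_on_subset by blast
      then show ?thesis unfolding H_fun_eq by (intro holomorphic_on_mult holomorphic_on_const)
    qed
  qed (simp add: set_var_list)
  then show ?thesis by (simp add: extension_base[OF W0])
qed

theorem extension_analytic: "analytic_in {..<m} extension (polydisc m \<delta>)"
  unfolding polydisc_def
  by (rule analytic_in_if_separately_holomorphic)
     (use extension_continuous extension_holomorphic in \<open>auto simp: polydisc_def\<close>)

end


section \<open>Extending a chain by a residue\<close>

text \<open>Each link of the chain stands for a residue that removes one index from \<open>I\<close>
  at its lower end and one from \<open>J\<close> at its upper end. The last variable stays in
  \<open>I\<close>, from which the next residue arises, and the first stays in
  \<open>J\<close>.\<close>

definition chain_I :: "(nat \<Rightarrow> nat set) \<Rightarrow> nat \<Rightarrow> nat \<Rightarrow> (nat \<Rightarrow> nat) \<Rightarrow> nat \<Rightarrow> nat set" where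
  "chain_I I k k' ix l = I l - (if k \<le> l \<and> l < k' then {ix l} else {})"

definition chain_J :: "(nat \<Rightarrow> nat set) \<Rightarrow> nat \<Rightarrow> nat \<Rightarrow> (nat \<Rightarrow> nat) \<Rightarrow> nat \<Rightarrow> nat set" where
  "chain_J J k k' ix l = J l - (if k < l \<and> l \<le> k' then {ix l} else {})"

lemma chain_I_single [simp]: "chain_I I k k ix = I" and chain_J_single [simp]: "chain_J J k k ix = J"
  by (auto simp: chain_I_def chain_J_def)

text \<open>Only candidates for poles: points where the first variable of the chain may meet a
  variable of the level below.\<close>

definition low_poles :: "(nat \<Rightarrow> nat set) \<Rightarrow> nat \<Rightarrow> (nat \<times> nat \<Rightarrow> complex) \<Rightarrow> complex set" where
  "low_poles I k W = (if 2 \<le> k then (\<lambda>i. W (k - 1, i)) ` I (k - 1) else {})"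

definition high_poles ::
  "nat \<Rightarrow> (nat \<Rightarrow> nat set) \<Rightarrow> (nat \<Rightarrow> nat set) \<Rightarrow> nat \<Rightarrow> (nat \<Rightarrow> nat) \<Rightarrow> (nat \<times> nat \<Rightarrow> complex) \<Rightarrow> complex set" where
  "high_poles m I J k' ix W =
     (if k' < m \<and> ix k' \<in> I k' then (\<lambda>j. W (k' + 1, j)) ` J (k' + 1) else {})"

text \<open>Links inside the chain join equal values, but their indices have been removed from the
  Cauchy factors. Hence only the two ends of the chain can meet other variables.\<close>

lemma chain_no_collision:
  assumes chain: "cauchy_chain m n I J k k' ix" and nc: "no_collision m I J W"
    and "w \<notin> low_poles I k W" "w \<notin> high_poles m I J k' ix W"
  shows "no_collision m (chain_I I k k' ix) (chain_J J k k' ix) (set_chain k k' ix w W)"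
  unfolding no_collision_def
proof (intro ballI)
  fix l i j assume l: "l \<in> {1..<m}" and i: "i \<in> chain_I I k k' ix l" and j: "j \<in> chain_J J k k' ix (l + 1)"
  have kk: "1 \<le> k" "k \<le> k'" using chain by (auto simp: cauchy_chain_def)
  have iI: "i \<in> I l" and jJ: "j \<in> J (l + 1)" using i j by (auto simp: chain_I_def chain_J_def)
  have 1: "l = k' \<and> i = ix k'" if "(l, i) \<in> chain_slots k k' ix"
    using that i by (auto simp: chain_slots_def chain_I_def split: if_splits)
  have 2: "l + 1 = k" if "(l + 1, j) \<in> chain_slots k k' ix"
    using that j by (auto simp: chain_slots_def chain_J_def split: if_splits)
  have base: "W (l, i) \<noteq> W (l + 1, j)" using nc l iI jJ by (auto simp: no_collision_def)
  show "set_chain k k' ix w W (l, i) \<noteq> set_chain k k' ix w W (l + 1, j)"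
  proof (cases "(l, i) \<in> chain_slots k k' ix")
    case True
    with 1 have l': "l = k'" "i = ix k'" by auto
    then have n2: "(l + 1, j) \<notin> chain_slots k k' ix" using kk by (auto simp: chain_slots_def)
    have "W (l + 1, j) \<in> high_poles m I J k' ix W" using l l' iI jJ by (auto simp: high_poles_def)
    then show ?thesis using True n2 assms(4) by (auto simp: set_chain_eq)
  next
    case False
    show ?thesis
    proof (cases "(l + 1, j) \<in> chain_slots k k' ix")
      case True
      then have "k = l + 1" using 2 by auto
      then have "W (l, i) \<in> low_poles I k W" using l iI by (auto simp: low_poles_def)
      then show ?thesis using True False assms(3) by (auto simp: set_chain_eq)
    next
      case False2: False
      then show ?thesis using False base by (simp add: set_chain_eq)
    qed
  qed
qed

lemma tendsto_cauchy_factor: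
  assumes "\<And>i. i \<in> I \<Longrightarrow> ((\<lambda>x. a x i) \<longlongrightarrow> a0 i) F" "\<And>j. j \<in> J \<Longrightarrow> ((\<lambda>x. b x j) \<longlongrightarrow> b0 j) F"
    and "finite I" "finite J" "\<And>i j. i \<in> I \<Longrightarrow> j \<in> J \<Longrightarrow> a0 i \<noteq> b0 j"
  shows "((\<lambda>x. cauchy_factor I (a x) J (b x)) \<longlongrightarrow> cauchy_factor I a0 J b0) F"
  unfolding cauchy_factor_def vandermonde_def cross_prod_def case_prod_beta
  by (intro tendsto_intros assms(1,2)) (use assms(3-5) in \<open>auto simp: prod_zero_iff\<close>)

definition cauchy_rest ::
  "nat \<Rightarrow> (nat \<Rightarrow> nat set) \<Rightarrow> (nat \<Rightarrow> nat set) \<Rightarrow> nat \<Rightarrow> (nat \<times> nat \<Rightarrow> complex) \<Rightarrow> complex" where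
  "cauchy_rest m I J l0 W =
     (\<Prod>l\<in>{1..<m} - {l0}. cauchy_factor (I l) (\<lambda>i. W (l, i)) (J (l + 1)) (\<lambda>j. W (l + 1, j)))"

lemma cauchy_product_split:
  assumes "l0 \<in> {1..<m}"
  shows "cauchy_product m I J W =
    cauchy_factor (I l0) (\<lambda>i. W (l0, i)) (J (l0 + 1)) (\<lambda>j. W (l0 + 1, j)) * cauchy_rest m I J l0 W"
  unfolding cauchy_product_def cauchy_rest_def by (rule prod.remove) (use assms in auto)

lemma tendsto_cauchy_rest:
  assumes "\<And>v. ((\<lambda>x. W x v) \<longlongrightarrow> W0 v) F"
    and fin: "\<And>l. l \<in> {1..<m} \<Longrightarrow> finite (I l)" "\<And>l. l \<in> {1..<m} \<Longrightarrow> finite (J (l + 1))"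
    and nc: "\<And>l i j. l \<in> {1..<m} - {l0} \<Longrightarrow> i \<in> I l \<Longrightarrow> j \<in> J (l + 1) \<Longrightarrow> W0 (l, i) \<noteq> W0 (l + 1, j)"
  shows "((\<lambda>x. cauchy_rest m I J l0 (W x)) \<longlongrightarrow> cauchy_rest m I J l0 W0) F"
  unfolding cauchy_rest_def
  by (intro tendsto_prod tendsto_cauchy_factor assms(1) fin nc) auto

lemma tendsto_set_chain: "((\<lambda>w. set_chain k k' ix w W v) \<longlongrightarrow> set_chain k k' ix p W v) (at p)"
  by (cases "v \<in> chain_slots k k' ix") (auto simp: set_chain_eq)

lemma set_chain_extend:
  "W (k' + 1, j) = p \<Longrightarrow> k \<le> k' \<Longrightarrow>
     set_chain k (k' + 1) (ix(k' + 1 := j)) p W = set_chain k k' ix p W"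
  by (rule ext) (auto simp: set_chain_def split: prod.splits)

lemma set_chain_upd:
  "v \<in> chain_slots k k' ix \<Longrightarrow> set_chain k k' ix w (W(v := x)) = set_chain k k' ix w W"
  by (rule ext) (auto simp: set_chain_eq)

lemma cauchy_chain_extend:
  assumes "cauchy_chain m n I J k k' ix" "k' < m" "ix k' \<in> I k'" "j \<in> J (k' + 1)" "j \<in> {1..n (k' + 1)}"
  shows "cauchy_chain m n I J k (k' + 1) (ix(k' + 1 := j))"
  using assms by (auto simp: cauchy_chain_def le_Suc_eq less_Suc_eq)

text \<open>The residue of a Cauchy factor at a collision is a smaller Cauchy factor, so taking the residue
  of the chain function at a variable of the next level extends the chain by that variable.\<close>

lemma chain_residue_limit:
  assumes chain: "cauchy_chain m n I J k k' ix" and k': "k' < m" "ix k' \<in> I k'" "j \<in> J (k' + 1)"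
    and fin: "\<And>l. l \<in> {1..<m} \<Longrightarrow> finite (I l)" "\<And>l. l \<in> {1..<m} \<Longrightarrow> finite (J (l + 1))"
    and nc: "no_collision m I J W" and p: "p = W (k' + 1, j)" "p \<notin> low_poles I k W"
    and distinct: "\<And>j'. j' \<in> J (k' + 1) - {j} \<Longrightarrow> W (k' + 1, j') \<noteq> p"
  defines "ix' \<equiv> ix(k' + 1 := j)"
  shows "((\<lambda>w. cauchy_product m (chain_I I k k' ix) (chain_J J k k' ix) (set_chain k k' ix w W) * (w - p)) \<longlongrightarrow>
     residue_sign (I k') (ix k') (J (k' + 1)) j *
       cauchy_product m (chain_I I k (k' + 1) ix') (chain_J J k (k' + 1) ix') (set_chain k (k' + 1) ix' p W)) (at p)"
proof -
  have kk: "1 \<le> k" "k \<le> k'" using chain by (auto simp: cauchy_chain_def)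
  have k'm: "k' \<in> {1..<m}" using kk k' by auto
  define Wp where "Wp = set_chain k k' ix p W"
  \<comment> \<open>The new chain variable already has the value \<open>p\<close>, so extending the
    chain at \<open>w = p\<close> alters no coordinate.\<close>
  have Wp': "set_chain k (k' + 1) ix' p W = Wp"
    unfolding Wp_def ix'_def by (rule set_chain_extend) (use p kk in auto)
  let ?a = "\<lambda>i. W (k', i)" and ?b = "\<lambda>j. W (k' + 1, j)"
  let ?I = "chain_I I k k' ix" and ?J = "chain_J J k k' ix"
  have sets: "?I k' = I k'" "?J (k' + 1) = J (k' + 1)"
    "chain_I I k (k' + 1) ix' k' = I k' - {ix k'}" "chain_J J k (k' + 1) ix' (k' + 1) = J (k' + 1) - {j}"
    using kk by (auto simp: chain_I_def chain_J_def ix'_def)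
  have slot: "set_chain k k' ix w W (k', i) = (?a(ix k' := w)) i" for w i
    using kk by (auto simp: set_chain_def)
  have slot': "set_chain k k' ix w W (k' + 1, j) = ?b j" for w j
    by (auto simp: set_chain_def)
  have fac: "cauchy_product m ?I ?J (set_chain k k' ix w W) =
      cauchy_factor (I k') (?a(ix k' := w)) (J (k' + 1)) ?b * cauchy_rest m ?I ?J k' (set_chain k k' ix w W)" for w
    unfolding cauchy_product_split[OF k'm] sets
    by (intro arg_cong2[where f = "(*)"] cauchy_factor_cong refl) (simp_all only: slot slot')
  have lim1: "((\<lambda>w. cauchy_factor (I k') (?a(ix k' := w)) (J (k' + 1)) ?b * (w - p)) \<longlongrightarrow>
      residue_sign (I k') (ix k') (J (k' + 1)) j * cauchy_factor (I k' - {ix k'}) ?a (J (k' + 1) - {j}) ?b) (at p)"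
    unfolding p(1)
  proof (rule cauchy_factor_residue_limit[where w = ?a and w' = ?b])
    show "?b x \<noteq> ?b j" if "x \<in> J (k' + 1) - {j}" for x using distinct[OF that] p by simp
    show "?a x \<noteq> ?b j" if "x \<in> I k' - {ix k'}" for x
      using nc k'm k'(3) that by (auto simp: no_collision_def)
  qed (use fin k'm k' in auto)
  \<comment> \<open>The remaining Cauchy factors are regular at \<open>p\<close>: a lower variable
    meeting the chain there is excluded by \<open>p(2)\<close>, and other collisions by
    \<open>nc\<close>.\<close>
  have lim2: "((\<lambda>w. cauchy_rest m ?I ?J k' (set_chain k k' ix w W)) \<longlongrightarrow> cauchy_rest m ?I ?J k' Wp) (at p)"
    unfolding Wp_def
  proof (rule tendsto_cauchy_rest[OF tendsto_set_chain])
    fix l i j' assume l: "l \<in> {1..<m} - {k'}" and i: "i \<in> ?I l" and j': "j' \<in> ?J (l + 1)"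
    have "(l, i) \<notin> chain_slots k k' ix"
      using l i by (auto simp: chain_slots_def chain_I_def split: if_splits)
    moreover have "W (l, i) \<noteq> W (l + 1, j')"
      using nc l i j' by (auto simp: no_collision_def chain_I_def chain_J_def)
    moreover have "W (l, i) \<noteq> p" if "(l + 1, j') \<in> chain_slots k k' ix"
    proof -
      have "k = l + 1" using that j' by (auto simp: chain_slots_def chain_J_def split: if_splits)
      then have "W (l, i) \<in> low_poles I k W" using l i by (auto simp: low_poles_def chain_I_def)
      then show ?thesis using p(2) by blast
    qed
    ultimately show "set_chain k k' ix p W (l, i) \<noteq> set_chain k k' ix p W (l + 1, j')"
      by (auto simp: set_chain_eq)
  qed (use fin in \<open>auto simp: chain_I_def chain_J_def\<close>)
  have "cauchy_product m (chain_I I k (k' + 1) ix') (chain_J J k (k' + 1) ix') Wp =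
      cauchy_factor (I k' - {ix k'}) ?a (J (k' + 1) - {j}) ?b * cauchy_rest m ?I ?J k' Wp"
    unfolding cauchy_product_split[OF k'm] sets
  proof (rule arg_cong2[where f = "(*)"])
    show "cauchy_factor (I k' - {ix k'}) (\<lambda>i. Wp (k', i)) (J (k' + 1) - {j}) (\<lambda>j. Wp (k' + 1, j)) =
        cauchy_factor (I k' - {ix k'}) ?a (J (k' + 1) - {j}) ?b"
      by (rule cauchy_factor_cong) (auto simp: Wp_def set_chain_def)
    show "cauchy_rest m (chain_I I k (k' + 1) ix') (chain_J J k (k' + 1) ix') k' Wp = cauchy_rest m ?I ?J k' Wp"
      unfolding cauchy_rest_def
    proof (rule prod.cong[OF refl])
      fix l assume "l \<in> {1..<m} - {k'}"
      then have "chain_I I k (k' + 1) ix' l = ?I l" "chain_J J k (k' + 1) ix' (l + 1) = ?J (l + 1)"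
        by (auto simp: chain_I_def chain_J_def ix'_def)
      then show "cauchy_factor (chain_I I k (k' + 1) ix' l) (\<lambda>i. Wp (l, i)) (chain_J J k (k' + 1) ix' (l + 1)) (\<lambda>j. Wp (l + 1, j)) =
         cauchy_factor (?I l) (\<lambda>i. Wp (l, i)) (?J (l + 1)) (\<lambda>j. Wp (l + 1, j))" by simp
    qed
  qed
  with tendsto_mult[OF lim1 lim2] show ?thesis
    unfolding fac Wp' by (simp add: mult_ac)
qed

text \<open>A pole at a variable of the level below is at most simple. The value of the limit does
  not matter, because it will be multiplied by an outer weight that vanishes at \<open>p\<close>. If
  two lower variables share the value \<open>p\<close>, the Vandermonde product kills the whole
  factor; otherwise the residue formula applies after exchanging the two groups.\<close>

lemma low_pole_limit:
  assumes l: "2 \<le> l" "l \<le> m" "i \<in> {1..n l}" and p: "p \<in> low_poles I l W" "p \<notin> high_poles m I J l (\<lambda>_. i) W"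
    and fin: "\<And>l. l \<in> {1..<m} \<Longrightarrow> finite (I l)" "\<And>l. l \<in> {1..<m} \<Longrightarrow> finite (J (l + 1))"
    and nc: "no_collision m I J W"
  shows "\<exists>c. ((\<lambda>w. cauchy_product m I J (W((l, i) := w)) * (w - p)) \<longlongrightarrow> c) (at p)"
proof -
  define l0 where "l0 = l - 1"
  have l0: "l0 \<in> {1..<m}" "l0 + 1 = l" using l by (auto simp: l0_def)
  let ?a = "\<lambda>i'. W (l0, i')" and ?b = "\<lambda>j. W (l, j)"
  obtain i0 where i0: "i0 \<in> I l0" "p = ?a i0" using p(1) l by (auto simp: low_poles_def l0_def)
  have fac: "cauchy_product m I J (W((l, i) := w)) =
      cauchy_factor (I l0) ?a (J l) (?b(i := w)) * cauchy_rest m I J l0 (W((l, i) := w))" for w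
    unfolding cauchy_product_split[OF l0(1)] l0(2)
    by (intro arg_cong2[where f = "(*)"] cauchy_factor_cong refl) (use l0 in auto)
  have lim2: "((\<lambda>w. cauchy_rest m I J l0 (W((l, i) := w))) \<longlongrightarrow> cauchy_rest m I J l0 (W((l, i) := p))) (at p)"
  proof (rule tendsto_cauchy_rest)
    show "((\<lambda>w. (W((l, i) := w)) v) \<longlongrightarrow> (W((l, i) := p)) v) (at p)" for v
      using tendsto_set_chain[of l l "\<lambda>_. i" W v p] by (simp only: set_chain_single)
    fix l' i' j assume l': "l' \<in> {1..<m} - {l0}" and i': "i' \<in> I l'" and j: "j \<in> J (l' + 1)"
    have "(l' + 1, j) \<noteq> (l, i)" using l' l0 by auto
    moreover have "W (l', i') \<noteq> W (l' + 1, j)" using nc l' i' j by (auto simp: no_collision_def)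
    moreover have "W (l' + 1, j) \<noteq> p" if "(l', i') = (l, i)"
    proof -
      have "W (l' + 1, j) \<in> high_poles m I J l (\<lambda>_. i) W" using that l' i' j by (auto simp: high_poles_def)
      then show ?thesis using p(2) by blast
    qed
    ultimately show "(W((l, i) := p)) (l', i') \<noteq> (W((l, i) := p)) (l' + 1, j)" by auto
  qed (use fin in auto)
  have "\<exists>c. ((\<lambda>w. cauchy_factor (I l0) ?a (J l) (?b(i := w)) * (w - p)) \<longlongrightarrow> c) (at p)"
  proof (cases "i \<in> J l")
    case False
    have "cauchy_factor (I l0) ?a (J l) (?b(i := w)) = cauchy_factor (I l0) ?a (J l) ?b" for w
      by (rule cauchy_factor_cong) (use False in auto)
    then have "((\<lambda>w. cauchy_factor (I l0) ?a (J l) (?b(i := w)) * (w - p)) \<longlongrightarrow>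
        cauchy_factor (I l0) ?a (J l) ?b * (p - p)) (at p)"
      by (simp only:) (intro tendsto_intros)
    then show ?thesis by blast
  next
    case True
    show ?thesis
    proof (cases "\<exists>k\<in>I l0 - {i0}. ?a k = ?a i0")
      case True2: True
      then obtain k where "k \<in> I l0" "k \<noteq> i0" "?a k = ?a i0" by blast
      then have "cauchy_factor (I l0) ?a (J l) (?b(i := w)) = 0" for w
        using cauchy_factor_repeated[of "I l0" i0 k ?a] fin(1)[OF l0(1)] i0 by metis
      then show ?thesis by (auto intro!: exI[of _ 0])
    next
      case False2: False
      have "((\<lambda>w. cauchy_factor (J l) (?b(i := w)) (I l0) ?a * (w - ?a i0)) \<longlongrightarrow>
          residue_sign (J l) i (I l0) i0 * cauchy_factor (J l - {i}) ?b (I l0 - {i0}) ?a) (at (?a i0))"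
      proof (rule cauchy_factor_residue_limit[where w = ?b and w' = ?a])
        show "?b k \<noteq> ?a i0" if "k \<in> J l - {i}" for k
          using nc l0 i0 that unfolding no_collision_def by (metis DiffD1)
      qed (use fin[OF l0(1)] l0 i0 True False2 in auto)
      then have "((\<lambda>w. (- 1) ^ (card (I l0) * card (J l)) * (cauchy_factor (J l) (?b(i := w)) (I l0) ?a * (w - p))) \<longlongrightarrow>
          (- 1) ^ (card (I l0) * card (J l)) * (residue_sign (J l) i (I l0) i0 * cauchy_factor (J l - {i}) ?b (I l0 - {i0}) ?a)) (at p)"
        unfolding i0(2) by (rule tendsto_mult_left)
      then show ?thesis
        unfolding cauchy_factor_swap[of "I l0" ?a] mult.assoc by (rule exI)
    qed
  qed
  then obtain c where "((\<lambda>w. cauchy_factor (I l0) ?a (J l) (?b(i := w)) * (w - p)) \<longlongrightarrow> c) (at p)" ..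
  from tendsto_mult[OF this lim2] show ?thesis
    unfolding fac by (auto simp: mult_ac)
qed


section \<open>The sum over roots as an iterated contour integral\<close>

lemma winding_number_circlepath_outside:
  assumes "r < norm w" "0 \<le> r"
  shows "winding_number (circlepath 0 r) w = 0"
  by (rule winding_number_zero_outside[of _ "cball 0 r"]) (use assms in auto)

lemma residue_eq_limit:
  assumes "finite P" "open S" "f holomorphic_on S - P" "p \<in> S" "((\<lambda>w. f w * (w - p)) \<longlongrightarrow> c) (at p)"
  shows "residue f p = c"
proof (rule residue_simple')
  show "open (S - (P - {p}))" using assms(1,2) by (intro open_Diff finite_imp_closed) auto
  show "f holomorphic_on S - (P - {p}) - {p}"
    by (rule holomorphic_on_subset[OF assms(3)]) auto
qed (use assms in auto)

lemma holomorphic_tendsto_at: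
  assumes "f holomorphic_on S" "open S" "p \<in> S"
  shows "(f \<longlongrightarrow> f p) (at p)"
  using assms holomorphic_on_imp_continuous_on continuous_on_eq_continuous_at isCont_def by blast

lemma tendsto_difference_quotient_inverse:
  assumes "(q has_field_derivative d) (at p)" "d \<noteq> 0"
  shows "((\<lambda>w. (w - p) / (q w - q p)) \<longlongrightarrow> 1 / d) (at p)"
proof -
  have "((\<lambda>w. (q w - q p) / (w - p)) \<longlongrightarrow> d) (at p)"
    using assms(1) by (simp add: has_field_derivative_iff)
  from tendsto_inverse[OF this assms(2)] show ?thesis by (simp add: inverse_eq_divide)
qed

lemma (in level_curves) contour_mean_diff_residues:
  assumes "finite P" "f holomorphic_on \<Omega> - P" "smooth_loop \<gamma>" "smooth_loop \<gamma>'"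
    "path_image \<gamma> \<subseteq> \<Omega> - P" "path_image \<gamma>' \<subseteq> \<Omega> - P"
  shows "contour_mean \<gamma> f - contour_mean \<gamma>' f =
    (\<Sum>p\<in>P. (winding_number \<gamma> p - winding_number \<gamma>' p) * residue f p)"
proof -
  have res: "contour_mean g f = (\<Sum>p\<in>P. winding_number g p * residue f p)"
    if g: "smooth_loop g" "path_image g \<subseteq> \<Omega> - P" for g
  proof -
    have "\<forall>z. z \<notin> \<Omega> \<longrightarrow> winding_number g z = 0"
      using g smooth_loopD[OF g(1)] by (intro allI impI simply_connected_imp_winding_number_zero[OF \<Omega>(2)]) auto
    from Residue_theorem[OF \<Omega>(1) connected_\<Omega> assms(1,2) smooth_loopD(1,3)[OF g(1)] g(2) this]
    show ?thesis by (simp add: contour_mean_def)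
  qed
  show ?thesis
    unfolding res[OF assms(3,5)] res[OF assms(4,6)]
    by (simp add: sum_subtractf left_diff_distrib)
qed

text \<open>By Rouche's theorem \<open>q - \<zeta>\<close> has as many zeros inside a level curve
  above \<open>|\<zeta>|\<close> as \<open>q\<close>, whose zero at \<open>0\<close> has positive
  order. This provides a base point in the product of the root sets.\<close>

lemma (in level_curves) roots_at_nonempty:
  assumes "norm \<zeta> < R"
  shows "roots_at \<Omega> q \<zeta> \<noteq> {}"
proof -
  obtain r where r: "norm \<zeta> < r" "r < R" using assms dense by blast
  have r0: "0 < r" using r(1) norm_ge_zero[of \<zeta>] by linarith
  obtain \<gamma> where \<gamma>: "valid_path \<gamma>" "simple_path \<gamma>" "pathfinish \<gamma> = pathstart \<gamma>"
    "path_image \<gamma> = level_curve \<Omega> q r" using level_contour[OF r0 r(2)] by metis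
  have Z: "{p \<in> \<Omega>. q p + (- \<zeta>) = 0} = roots_at \<Omega> q \<zeta>" by (auto simp: roots_at_def)
  have Z0: "{p \<in> \<Omega>. q p = 0} = {0}" using only_zero q_0 \<Omega>(3) by auto
  have wn0: "\<forall>z. z \<notin> \<Omega> \<longrightarrow> winding_number \<gamma> z = 0"
    using \<gamma> by (intro allI impI simply_connected_imp_winding_number_zero[OF \<Omega>(2)])
      (auto simp: level_curve_def valid_path_imp_path)
  have rouche: "(\<Sum>p\<in>{p \<in> \<Omega>. q p + (- \<zeta>) = 0}. winding_number \<gamma> p * zorder (\<lambda>p. q p + (- \<zeta>)) p) =
      (\<Sum>p\<in>{p \<in> \<Omega>. q p = 0}. winding_number \<gamma> p * zorder q p)"
    by (rule Rouche_theorem[OF \<Omega>(1) connected_\<Omega> _ _ q_holomorphic _ \<gamma>(1,3) _ _ wn0])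
       (use finite_roots_at[OF assms] r in \<open>auto simp: \<gamma>(4) Z Z0 level_curve_def roots_at_def\<close>)
  have "norm (winding_number \<gamma> 0) = 1"
    using simple_closed_path_norm_winding_number_inside[OF \<gamma>(2)] zero_inside[OF r0 r(2)] \<gamma>(4) by simp
  then have wn: "winding_number \<gamma> 0 \<noteq> 0" by auto
  obtain b where b: "b \<in> \<Omega>" "q b \<noteq> 0" by (rule q_nonzero_somewhere)
  have "zorder q 0 > 0"
    using zorder_exist_zero[OF q_holomorphic \<Omega>(1) connected_\<Omega> \<Omega>(3)] b q_0 by auto
  then show ?thesis using rouche wn unfolding Z Z0 by auto
qed

text \<open>With all coordinates of \<open>z\<close> nonzero, the values \<open>z_hat z l\<close>
  are nonzero and differ between neighbouring levels. Their roots avoid \<open>0\<close>, so a disc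
  of some radius \<open>r1\<close> is free of them; the circles are placed in it.\<close>

locale chain_setup = contour_setup +
  fixes z :: "nat \<Rightarrow> complex" and r1 :: real
  assumes z: "z \<in> punctured_polydisc m \<delta>" and r1: "0 < r1" "r1 \<le> \<rho>"
    and roots_r1: "\<And>l. l \<in> {1..m} \<Longrightarrow> roots_at \<Omega> q (z_hat z l) \<inter> cball 0 r1 = {}"
begin

abbreviation "\<zeta> l \<equiv> z_hat z l"
abbreviation "Rt l \<equiv> roots_at \<Omega> q (\<zeta> l)"

text \<open>The inner contours are shrunk to circles with pairwise distinct radii, decreasing in the level.
  Distinctness within a level keeps all poles met below simple.\<close>

definition rad :: "nat \<times> nat \<Rightarrow> real" where
  "rad v = r1 / (real (fst v) + 1 + real (snd v) / (real (n (fst v)) + 1))"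

abbreviation "Cc v \<equiv> circlepath 0 (rad v)"

lemma z_polydisc: "z \<in> polydisc m \<delta>" "z \<in> polydisc m R"
  using z punctured_polydisc_subset polydisc_subset by blast+

lemma z_coordinate: "k < m \<Longrightarrow> z k \<noteq> 0" "0 < k \<Longrightarrow> k < m \<Longrightarrow> z k \<noteq> 1"
proof -
  show "k < m \<Longrightarrow> z k \<noteq> 0" using z by (auto simp: punctured_polydisc_def PiE_iff)
  assume "0 < k" "k < m"
  then have "norm (z k) < 1" using polydisc_coordinate[OF z_polydisc(1), of k] by (simp add: z_radius_def)
  then show "z k \<noteq> 1" by auto
qed

lemma \<zeta>_nonzero: "l \<le> m \<Longrightarrow> \<zeta> l \<noteq> 0"
  using z_coordinate(1) by (auto simp: z_hat_def)

lemma \<zeta>_less: "l \<in> {1..m} \<Longrightarrow> norm (\<zeta> l) < \<delta>"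
  using norm_z_hat_less[OF z_polydisc(1)] by auto

lemma \<zeta>_neq: "1 \<le> l \<Longrightarrow> l < m \<Longrightarrow> \<zeta> (l + 1) \<noteq> \<zeta> l"
  using z_coordinate(2)[of l] \<zeta>_nonzero[of l] by (simp add: z_hat_Suc)

text \<open>Because the fraction is in \<open>[0, 1)\<close>, the level decides the comparison of
  radii and the index only breaks ties within a level.\<close>

lemma rad_frac: "v \<in> V \<Longrightarrow> 0 \<le> real (snd v) / (real (n (fst v)) + 1) \<and> real (snd v) / (real (n (fst v)) + 1) < 1"
  by (auto simp: var_idx_def divide_less_eq)

lemma rad_pos: "v \<in> V \<Longrightarrow> 0 < rad v" and rad_less: "v \<in> V \<Longrightarrow> rad v < r1"
proof -
  assume v: "v \<in> V"
  have d: "real (fst v) + 1 + real (snd v) / (real (n (fst v)) + 1) > 1"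
  proof -
    have "1 \<le> real (fst v)" using V_level[OF v] by simp
    then show ?thesis using rad_frac[OF v] by linarith
  qed
  then show "0 < rad v" "rad v < r1" using r1(1) by (auto simp: rad_def divide_less_eq)
qed

lemma rad_level:
  assumes "u \<in> V" "v \<in> V" "fst u < fst v"
  shows "rad v < rad u"
proof -
  have "real (fst u) + 1 \<le> real (fst v)" using assms(3) by linarith
  then have "real (fst u) + 1 + real (snd u) / (real (n (fst u)) + 1) <
      real (fst v) + 1 + real (snd v) / (real (n (fst v)) + 1)"
    using rad_frac[OF assms(1)] rad_frac[OF assms(2)] by linarith
  moreover have "0 < real (fst u) + 1 + real (snd u) / (real (n (fst u)) + 1)"
    using rad_frac[OF assms(1)] by linarith
  ultimately show ?thesis unfolding rad_def using r1(1) by (intro divide_strict_left_mono) auto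
qed

lemma rad_inj:
  assumes "(l, i) \<in> V" "(l, j) \<in> V" "rad (l, i) = rad (l, j)"
  shows "i = j"
proof -
  have "0 < real l + 1 + real i / (real (n l) + 1)" "0 < real l + 1 + real j / (real (n l) + 1)"
    using rad_frac[OF assms(1)] rad_frac[OF assms(2)] unfolding fst_conv snd_conv by linarith+
  then have "real i / (real (n l) + 1) = real j / (real (n l) + 1)"
    using assms(3) r1(1) by (simp add: rad_def frac_eq_eq)
  moreover have "real (n l) + 1 \<noteq> 0" by linarith
  ultimately show ?thesis by simp
qed

lemma image_Cc: "v \<in> V \<Longrightarrow> path_image (Cc v) = sphere 0 (rad v)"
  using rad_pos[of v] by simp

lemma sphere_subset: "v \<in> V \<Longrightarrow> sphere 0 (rad v) \<subseteq> cball 0 r1 - {0}"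
  using rad_less[of v] rad_pos[of v] by auto

lemma r1_subset: "cball 0 r1 \<subseteq> cball 0 \<rho>"
  using r1 by auto

lemma root_facts:
  assumes "l \<in> {1..m}"
  shows "finite (Rt l)" "Rt l \<subseteq> \<Omega> - {0}" "\<And>w. w \<in> Rt l \<Longrightarrow> w \<notin> cball 0 r1"
    "\<And>w. w \<in> Rt l \<Longrightarrow> deriv q w \<noteq> 0" "\<And>w l'. w \<in> Rt l \<Longrightarrow> l' \<in> {1..m} \<Longrightarrow> winding_number (Oc l') w = 1"
    "\<And>w l'. w \<in> Rt l \<Longrightarrow> l' \<in> {1..m} \<Longrightarrow> w \<notin> path_image (Oc l')"
proof -
  have le: "norm (\<zeta> l) < R" using \<zeta>_less[OF assms] \<delta> by simp
  have nz: "\<zeta> l \<noteq> 0" using \<zeta>_nonzero assms by auto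
  show "finite (Rt l)" using finite_roots_at[OF le] .
  show "Rt l \<subseteq> \<Omega> - {0}" using nz q_0 by (auto simp: roots_at_def)
  show "w \<notin> cball 0 r1" if "w \<in> Rt l" for w using roots_r1[OF assms] that by blast
  show "deriv q w \<noteq> 0" if "w \<in> Rt l" for w
    using deriv_nonzero[of w] that le nz by (auto simp: roots_at_def)
  fix w l' assume w: "w \<in> Rt l" and l': "l' \<in> {1..m}"
  then have w': "w \<in> \<Omega>" "norm (q w) < \<delta>" using \<zeta>_less[OF assms] by (auto simp: roots_at_def)
  \<comment> \<open>At a root \<open>|q w|\<close> is below \<open>\<delta>\<close>, hence below
    \<open>|q|\<close> on the contour, so the contour surrounds \<open>w\<close> as it surrounds
    \<open>0\<close>.\<close>
  have "winding_number (Oc l') w = winding_number (Oc l') 0"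
    by (rule winding_number_sublevel[OF smooth_loopD(2,3)[OF Oc(1)[OF l']] qO[OF l'] \<delta>(2) w'])
  also have "\<dots> = 1" using Oc(3)[OF l', of 0] \<rho>(1) by simp
  finally show "winding_number (Oc l') w = 1" .
  show "w \<notin> path_image (Oc l')" using qO[OF l', of w] w'(2) by auto
qed

lemma roots_disjoint: "1 \<le> l \<Longrightarrow> l < m \<Longrightarrow> Rt l \<inter> Rt (l + 1) = {}"
  using \<zeta>_neq[of l] by (auto simp: roots_at_def)

definition KC :: "nat \<times> nat \<Rightarrow> complex set" where
  "KC v = sphere 0 (rad v) \<union> path_image (Oc (fst v))"

text \<open>Contains the supports of both functionals that act on a variable, so that one can be
  exchanged for the other over the same compact set.\<close>

definition KA :: "nat \<times> nat \<Rightarrow> complex set" where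
  "KA v = KC v \<union> Rt (fst v)"

lemma Oc_outside: "l \<in> {1..m} \<Longrightarrow> w \<in> path_image (Oc l) \<Longrightarrow> w \<notin> cball 0 r1"
  using Oc(2) r1_subset by blast

lemma compact_KC:
  assumes "v \<in> V"
  shows "compact (KC v)"
  unfolding KC_def
  by (intro compact_Un compact_sphere smooth_loopD(4)[OF Oc(1)[OF V_level[OF assms]]])

lemma compact_KA:
  assumes "v \<in> V"
  shows "compact (KA v)"
  unfolding KA_def
  by (intro compact_Un compact_KC[OF assms] finite_imp_compact root_facts(1)[OF V_level[OF assms]])

lemma KA_subset: "v \<in> V \<Longrightarrow> KA v \<subseteq> \<Omega> - {0}"
proof -
  assume v: "v \<in> V"
  have "sphere 0 (rad v) \<subseteq> \<Omega> - {0}" using sphere_subset[OF v] r1_subset \<rho>(2) by blast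
  moreover have "path_image (Oc (fst v)) \<subseteq> \<Omega> - {0}" using Oc(2)[OF V_level[OF v]] \<rho>(1) by auto
  ultimately show ?thesis using root_facts(2)[OF V_level[OF v]] by (auto simp: KA_def KC_def)
qed

lemma KA_disjoint:
  assumes "(l, i) \<in> V" "(l + 1, j) \<in> V"
  shows "KA (l, i) \<inter> KA (l + 1, j) = {}"
proof -
  have l: "1 \<le> l" "l < m" "l \<in> {1..m}" "l + 1 \<in> {1..m}" using assms by (auto simp: var_idx_def)
  have 1: "sphere 0 (rad (l, i)) \<inter> sphere 0 (rad (l + 1, j)) = {}"
    using rad_level[OF assms] by auto
  have 2: "sphere 0 (rad v) \<inter> path_image (Oc l') = {}" if "v \<in> V" "l' \<in> {1..m}" for v l'
    using sphere_subset[OF that(1)] Oc_outside[OF that(2)] by blast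
  have 3: "sphere 0 (rad v) \<inter> Rt l' = {}" if "v \<in> V" "l' \<in> {1..m}" for v l'
    using sphere_subset[OF that(1)] root_facts(3)[OF that(2)] by blast
  have 4: "path_image (Oc l') \<inter> Rt l'' = {}" if "l' \<in> {1..m}" "l'' \<in> {1..m}" for l' l''
    using root_facts(6)[OF that(2)] that(1) by blast
  show ?thesis
    using 1 2[OF assms(1) l(4)] 2[OF assms(2) l(3)] 3[OF assms(1) l(4)] 3[OF assms(2) l(3)]
      4[OF l(3) l(4)] 4[OF l(4) l(3)] OO(1)[OF l(1,2)] roots_disjoint[OF l(1,2)]
    unfolding KA_def KC_def fst_conv
    by (simp add: Int_Un_distrib Int_Un_distrib2 Int_commute)
qed

lemma KA_no_collision:
  assumes "W \<in> PiE V K" "\<And>v. v \<in> V \<Longrightarrow> K v \<subseteq> KA v"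
  shows "no_collision m I J W"
proof (rule no_collision_if_disjoint[OF assms(1)])
  fix l i j assume "(l, i) \<in> V" "(l + 1, j) \<in> V"
  then show "K (l, i) \<inter> K (l + 1, j) = {}" using KA_disjoint assms(2) by blast
qed

lemma in_\<Omega>0:
  assumes "W \<in> PiE V K" "\<And>v. v \<in> V \<Longrightarrow> K v \<subseteq> KA v"
  shows "W \<in> PiE V (\<lambda>_. \<Omega> - {0})"
proof -
  have "PiE V K \<subseteq> PiE V (\<lambda>_. \<Omega> - {0})"
    by (rule PiE_mono) (use assms(2) KA_subset in blast)
  then show ?thesis using assms(1) by blast
qed

abbreviation chain_fun ::
  "nat \<Rightarrow> nat \<Rightarrow> (nat \<Rightarrow> nat) \<Rightarrow> (nat \<times> nat \<Rightarrow> complex) \<Rightarrow> complex \<Rightarrow> complex" where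
  "chain_fun k k' ix W w \<equiv>
     H_fun m (chain_I I k k' ix) (chain_J J k k' ix) A (set_chain k k' ix w W) z"

lemma chain_product_holomorphic:
  assumes chain: "cauchy_chain m n I J k k' ix" and nc: "no_collision m I J W"
  shows "(\<lambda>w. cauchy_product m (chain_I I k k' ix) (chain_J J k k' ix) (set_chain k k' ix w W))
     holomorphic_on - (low_poles I k W \<union> high_poles m I J k' ix W)"
  by (rule holomorphic_on_cauchy_product[OF holomorphic_on_set_chain])
     (use finite_I finite_J chain_no_collision[OF chain nc] in \<open>auto simp: chain_I_def chain_J_def\<close>)

lemma chain_fun_holomorphic:
  assumes chain: "cauchy_chain m n I J k k' ix" and nc: "no_collision m I J W"
    and W: "W \<in> PiE V (\<lambda>_. \<Omega> - {0})"
  shows "chain_fun k k' ix W holomorphic_on \<Omega> - ({0} \<union> low_poles I k W \<union> high_poles m I J k' ix W)"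
  unfolding H_fun_eq
  by (intro holomorphic_on_mult holomorphic_on_subset[OF chain_product_holomorphic[OF chain nc]]
        holomorphic_on_subset[OF A_holomorphic_chain[OF data \<Omega>(1) chain W z_polydisc(2)]]) auto

lemma finite_poles:
  assumes "cauchy_chain m n I J k k' ix"
  shows "finite (low_poles I k W)" "finite (high_poles m I J k' ix W)"
proof -
  have c: "1 \<le> k" "k \<le> k'" "k' \<le> m" using assms by (auto simp: cauchy_chain_def)
  have "finite (I (k - 1))" if "2 \<le> k" by (rule finite_I) (use c that in auto)
  then show "finite (low_poles I k W)" by (simp add: low_poles_def)
  have "finite (J (k' + 1))" if "k' < m" by (rule finite_J) (use c that in auto)
  then show "finite (high_poles m I J k' ix W)" by (simp add: high_poles_def)
qed

lemma single_chain: "(l, i) \<in> V \<Longrightarrow> cauchy_chain m n I J l l (\<lambda>_. i)"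
  by (auto simp: cauchy_chain_def var_idx_def)

lemma low_polesE:
  assumes "p \<in> low_poles I k W" "k \<le> m"
  obtains i where "2 \<le> k" "(k - 1, i) \<in> V" "p = W (k - 1, i)"
proof -
  obtain i where i: "2 \<le> k" "i \<in> I (k - 1)" "p = W (k - 1, i)"
    using assms(1) by (auto simp: low_poles_def split: if_splits)
  have "I (k - 1) \<subseteq> {1..n (k - 1)}" by (rule I) (use i(1) assms(2) in auto)
  then have "(k - 1, i) \<in> V" using i(1,2) assms(2) by (auto simp: var_idx_def)
  then show thesis using that i by blast
qed

lemma high_polesE:
  assumes "p \<in> high_poles m I J k' ix W" "1 \<le> k'"
  obtains j where "k' < m" "(k' + 1, j) \<in> V" "p = W (k' + 1, j)"
proof -
  obtain j where j: "k' < m" "j \<in> J (k' + 1)" "p = W (k' + 1, j)"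
    using assms(1) by (auto simp: high_poles_def split: if_splits)
  have "(k' + 1, j) \<in> V" using J[of k'] j(1,2) assms(2) by (auto simp: var_idx_def)
  then show thesis using that j by blast
qed

text \<open>Shrinking the inner contour to the circle crosses no pole. Variables of the level below
  are outside both curves; those of the level above are either on their own smaller circles, inside
  both, or on an outer contour, outside both; \<open>0\<close> is inside both. The higher variables
  must therefore already be on their circles or outer contours.\<close>

lemma mean_inner_eq_mean_circle:
  assumes v: "(l, i) \<in> V" "2 \<le> l" and W: "W \<in> PiE V (\<lambda>_. \<Omega> - {0})" and nc: "no_collision m I J W"
    and low: "\<And>i'. (l - 1, i') \<in> V \<Longrightarrow> W (l - 1, i') \<in> supp (l - 1, i')"
    and high: "\<And>j. (l + 1, j) \<in> V \<Longrightarrow> W (l + 1, j) \<in> KC (l + 1, j)"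
  shows "contour_mean (Nc l) (\<lambda>w. H_fun m I J A (W((l, i) := w)) z) =
    contour_mean (Cc (l, i)) (\<lambda>w. H_fun m I J A (W((l, i) := w)) z)"
proof -
  have lm: "l \<in> {2..m}" "l \<in> {1..m}" using v by (auto simp: var_idx_def)
  note chain = single_chain[OF v(1)]
  define P where "P = {0} \<union> low_poles I l W \<union> high_poles m I J l (\<lambda>_. i) W"
  have hol: "(\<lambda>w. H_fun m I J A (W((l, i) := w)) z) holomorphic_on \<Omega> - P"
    using chain_fun_holomorphic[OF chain nc W] by (simp add: set_chain_single P_def)
  have fin: "finite P" using finite_poles[OF chain] by (simp add: P_def)
  have cases: "w \<notin> path_image (Nc l) \<and> w \<notin> path_image (Cc (l, i)) \<and>
      winding_number (Nc l) w = winding_number (Cc (l, i)) w" if "w \<in> P" for w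
  proof -
    consider "w = 0" | "w \<in> low_poles I l W" | "w \<in> high_poles m I J l (\<lambda>_. i) W"
      using \<open>w \<in> P\<close> by (auto simp: P_def)
    then show ?thesis
    proof cases
      case 1
      then show ?thesis
        using Nc(2)[OF lm(1)] Nc(3)[OF lm(1), of 0] \<rho>(1) rad_pos[OF v(1)] winding_number_circlepath[of 0 0 "rad (l, i)"]
        by auto
    next
      case 2
      then obtain i' where i': "(l - 1, i') \<in> V" "w = W (l - 1, i')"
        using low_polesE[of w l W] lm by auto
      have w: "w \<in> supp (l - 1, i')" using low[OF i'(1)] i'(2) by simp
      have l1: "l - 1 \<in> {1..m}" using lm by auto
      have sup: "w \<in> path_image (Oc (l - 1)) \<or> (2 \<le> l - 1 \<and> w \<in> path_image (Nc (l - 1)))"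
        using w l1 by (auto simp: contour_support_def split: if_splits)
      have "w \<notin> cball 0 \<rho>"
      proof -
        have "path_image (Nc (l - 1)) \<subseteq> \<Omega> - cball 0 \<rho>" if "2 \<le> l - 1"
          by (rule Nc(2)) (use that l1 in auto)
        then show ?thesis using sup Oc(2)[OF l1] by blast
      qed
      then have "rad (l, i) < norm w" using rad_less[OF v(1)] r1 by auto
      moreover have "w \<notin> path_image (Nc l)" "winding_number (Nc l) w = 0"
      proof -
        have "path_image (Nc (l - 1)) \<inter> path_image (Nc l) = {} \<and>
            (\<forall>w\<in>path_image (Nc (l - 1)). winding_number (Nc l) w = 0)" if "2 \<le> l - 1"
        proof -
          have e: "l - 1 + 1 = l" "l - 1 < m" using lm by auto
          show ?thesis using NN[of "l - 1", unfolded e(1), OF that e(2)] by blast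
        qed
        then show "w \<notin> path_image (Nc l)" "winding_number (Nc l) w = 0"
          using sup ON[OF l1 lm(1)] by blast+
      qed
      ultimately show ?thesis
        using winding_number_circlepath_outside[of "rad (l, i)" w] rad_pos[OF v(1)] by auto
    next
      case 3
      then obtain j where j: "(l + 1, j) \<in> V" "w = W (l + 1, j)"
        using high_polesE[of w l "\<lambda>_. i" W] lm by auto
      have l1: "l + 1 \<in> {1..m}" using j(1) by (auto simp: var_idx_def)
      have w: "w \<in> KC (l + 1, j)" using high[OF j(1)] j(2) by simp
      show ?thesis
      proof (cases "w \<in> sphere 0 (rad (l + 1, j))")
        case True
        then have nw: "norm w < rad (l, i)" using rad_level[OF v(1) j(1)] by auto
        then have "w \<in> cball 0 \<rho>" using rad_less[OF v(1)] r1 by auto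
        then show ?thesis
          using Nc(2)[OF lm(1)] Nc(3)[OF lm(1)] nw winding_number_circlepath[of w 0 "rad (l, i)"] rad_pos[OF v(1)] by auto
      next
        case False
        then have wO: "w \<in> path_image (Oc (l + 1))" using w by (simp add: KC_def)
        then have "rad (l, i) < norm w" using Oc_outside[OF l1] rad_less[OF v(1)] by fastforce
        then show ?thesis
          using winding_number_circlepath_outside[of "rad (l, i)" w] rad_pos[OF v(1)] ON[OF l1 lm(1)] wO by auto
      qed
    qed
  qed
  have "path_image (Cc (l, i)) \<subseteq> \<Omega>"
    using image_Cc[OF v(1)] sphere_subset[OF v(1)] r1_subset \<rho>(2) by auto
  moreover have "path_image (Nc l) \<subseteq> \<Omega>" using Nc(2)[OF lm(1)] by auto
  ultimately have "contour_mean (Nc l) (\<lambda>w. H_fun m I J A (W((l, i) := w)) z) -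
      contour_mean (Cc (l, i)) (\<lambda>w. H_fun m I J A (W((l, i) := w)) z) = 0"
    using cases by (subst contour_mean_diff_residues[OF fin hol Nc(1)[OF lm(1)] smooth_loop_circlepath]) auto
  then show ?thesis by simp
qed

lemma H_fun_update_continuous:
  assumes "v \<in> V" "S \<subseteq> \<Omega> - {0}" "\<And>w. w \<in> S \<Longrightarrow> W(v := w) \<in> PiE V K"
    "\<And>v. v \<in> V \<Longrightarrow> K v \<subseteq> \<Omega> - {0}" "\<And>W. W \<in> PiE V K \<Longrightarrow> no_collision m I J W"
  shows "continuous_on S (\<lambda>w. H_fun m I J A (W(v := w)) z)"
proof -
  have "continuous_on S (\<lambda>w. (\<lambda>(z, W). H_fun m I J A W z) (z, W(v := w)))"
  proof (rule continuous_on_compose2[OF H_fun_continuous[OF assms(4,5)]])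
    show "continuous_on S (\<lambda>w. (z, W(v := w)))"
      by (intro continuous_on_Pair continuous_on_fun_upd continuous_on_const continuous_on_id)
    show "(\<lambda>w. (z, W(v := w))) ` S \<subseteq> polydisc m R \<times> PiE V K"
      using assms(3) z_polydisc by (intro image_subsetI) simp
  qed auto
  then show ?thesis by simp
qed

definition root_sum :: "nat \<times> nat \<Rightarrow> (complex \<Rightarrow> complex) \<Rightarrow> complex" where
  "root_sum v f = (\<Sum>w\<in>Rt (fst v). q w / deriv q w * f w)"

text \<open>At such a root \<open>q p - z_hat z l\<close> equals
  \<open>q p * (1 - z (l - 1))\<close>, which is how \<open>inner_weight\<close> was chosen.\<close>

lemma outer_weight_low_root:
  assumes "2 \<le> l" "l \<le> m" "p \<in> Rt (l - 1)"
  shows "outer_weight q z l p = 0"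
proof -
  define k where "k = l - 1"
  have k: "l = k + 1" "1 \<le> k" "k < m" using assms by (auto simp: k_def)
  have nz: "\<zeta> k \<noteq> 0" "z k \<noteq> 1" using \<zeta>_nonzero[of k] z_coordinate(2)[of k] k by auto
  have "q p = \<zeta> k" using assms(3) k by (simp add: roots_at_def)
  moreover have "\<zeta> k - \<zeta> k * z k = \<zeta> k * (1 - z k)" by (simp add: algebra_simps)
  ultimately show ?thesis
    using nz k by (simp add: outer_weight_def inner_weight_def z_hat_Suc)
qed

text \<open>Deforming the outer contour to the circle picks up the residues of
  \<open>outer_weight * F\<close> at the roots of level \<open>l\<close>, with weights
  \<open>q / q'\<close>. Nothing else contributes: lower variables sit where the weight vanishes,
  while \<open>0\<close> and higher variables have equal winding numbers. On the circle the outer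
  and inner weights add up to \<open>q / (q - z_hat z l)\<close>.\<close>

lemma root_sum_minus_functional:
  assumes v: "(l, i) \<in> V" and W: "W \<in> PiE V K" and K: "\<And>u. u \<in> V \<Longrightarrow> K u \<subseteq> KA u" "K (l, i) = KA (l, i)"
    and low: "\<And>i'. 2 \<le> l \<Longrightarrow> (l - 1, i') \<in> V \<Longrightarrow> K (l - 1, i') \<subseteq> Rt (l - 1)"
    and high: "\<And>j. (l + 1, j) \<in> V \<Longrightarrow> K (l + 1, j) \<subseteq> KC (l + 1, j)"
  defines "F \<equiv> \<lambda>w. H_fun m I J A (W((l, i) := w)) z"
  shows "root_sum (l, i) F - weighted_functional q Oc Cc z (l, i) F =
    - contour_mean (Cc (l, i)) (\<lambda>w. q w / (q w - \<zeta> l) * F w)"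
proof -
  have lm: "l \<in> {1..m}" using V_level[OF v] by simp
  note chain = single_chain[OF v]
  have W0: "W \<in> PiE V (\<lambda>_. \<Omega> - {0})" by (rule in_\<Omega>0[OF W K(1)])
  have nc: "no_collision m I J W" by (rule KA_no_collision[OF W K(1)])
  let ?lo = "low_poles I l W" and ?hi = "high_poles m I J l (\<lambda>_. i) W"
  let ?f = "\<lambda>w. outer_weight q z l w * F w"
  define P where "P = {0} \<union> ?lo \<union> ?hi \<union> Rt l"
  have F_hol: "F holomorphic_on \<Omega> - ({0} \<union> ?lo \<union> ?hi)"
    using chain_fun_holomorphic[OF chain nc W0] by (simp add: set_chain_single F_def)
  have h_hol: "outer_weight q z l holomorphic_on \<Omega> - Rt l"
    unfolding outer_weight_def
    by (intro holomorphic_intros holomorphic_on_subset[OF q_holomorphic]) (auto simp: roots_at_def)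
  have hol: "?f holomorphic_on \<Omega> - P"
    by (intro holomorphic_on_mult holomorphic_on_subset[OF F_hol] holomorphic_on_subset[OF h_hol]) (auto simp: P_def)
  have fin: "finite P" using finite_poles[OF chain] root_facts(1)[OF lm] by (simp add: P_def)
  have lo_root: "2 \<le> l \<and> w \<in> Rt (l - 1)" if lo: "w \<in> ?lo" for w
  proof -
    have "l \<le> m" using lm by simp
    then obtain i' where i': "2 \<le> l" "(l - 1, i') \<in> V" "w = W (l - 1, i')"
      by (rule low_polesE[OF lo])
    then show ?thesis using low[OF i'(1,2)] PiE_mem[OF W i'(2)] by auto
  qed
  have hiE: "w \<in> ?hi \<Longrightarrow> \<exists>j. (l + 1, j) \<in> V \<and> w \<in> KC (l + 1, j)" for w
  proof -
    assume "w \<in> ?hi"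
    then obtain j where j: "(l + 1, j) \<in> V" "w = W (l + 1, j)"
      using high_polesE[of w l "\<lambda>_. i" W] lm by auto
    then show ?thesis using high[OF j(1)] PiE_mem[OF W j(1)] by auto
  qed
  \<comment> \<open>A variable of the level above is either on its smaller circle, hence inside both
    curves, or on the next outer contour, hence outside both.\<close>
  have hi: "w \<notin> path_image (Oc l) \<and> w \<notin> path_image (Cc (l, i)) \<and> w \<notin> KA (l, i) \<and>
      winding_number (Oc l) w = winding_number (Cc (l, i)) w" if hi: "w \<in> ?hi" for w
  proof -
    obtain j where j: "(l + 1, j) \<in> V" "w \<in> KC (l + 1, j)" using hiE[OF hi] by blast
    have l1: "l + 1 \<in> {1..m}" "1 \<le> l" "l < m" using j(1) lm by (auto simp: var_idx_def)
    have nKA: "w \<notin> KA (l, i)" using KA_disjoint[OF v j(1)] j(2) by (auto simp: KA_def)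
    have "winding_number (Oc l) w = winding_number (Cc (l, i)) w"
    proof (cases "w \<in> sphere 0 (rad (l + 1, j))")
      case True
      then have nw: "norm w < rad (l, i)" using rad_level[OF v j(1)] by auto
      then have "w \<in> cball 0 \<rho>" using rad_less[OF v] r1 by auto
      then show ?thesis
        using Oc(3)[OF lm] nw winding_number_circlepath[of w 0 "rad (l, i)"] by auto
    next
      case False
      then have wO: "w \<in> path_image (Oc (l + 1))" using j(2) by (simp add: KC_def)
      then have "rad (l, i) < norm w" using Oc_outside[OF l1(1)] rad_less[OF v] by fastforce
      then show ?thesis
        using winding_number_circlepath_outside[of "rad (l, i)" w] rad_pos[OF v] OO(2)[OF l1(2,3) wO] by auto
    qed
    then show ?thesis using nKA image_Cc[OF v] by (auto simp: KA_def KC_def)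
  qed
  have root: "w \<notin> path_image (Oc l) \<and> w \<notin> path_image (Cc (l, i)) \<and>
      winding_number (Oc l) w = 1 \<and> winding_number (Cc (l, i)) w = 0" if "w \<in> Rt l'" "l' \<in> {1..m}" for w l'
  proof -
    have "w \<notin> cball 0 r1" by (rule root_facts(3)[OF that(2,1)])
    then have "rad (l, i) < norm w" using rad_less[OF v] by auto
    then show ?thesis
      using root_facts(5,6)[OF that(2,1) lm] winding_number_circlepath_outside[of "rad (l, i)" w] rad_pos[OF v] by auto
  qed
  have zero: "0 \<notin> path_image (Oc l) \<and> 0 \<notin> path_image (Cc (l, i)) \<and>
      winding_number (Oc l) 0 = winding_number (Cc (l, i)) 0"
    using Oc(2)[OF lm] Oc(3)[OF lm, of 0] \<rho>(1) rad_pos[OF v] winding_number_circlepath[of 0 0 "rad (l, i)"] by auto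
  have lo_root': "w \<in> Rt (l - 1)" "l - 1 \<in> {1..m}" if "w \<in> ?lo" for w using lo_root[OF that] lm by auto
  have avoid: "path_image (Oc l) \<subseteq> \<Omega> - P" "path_image (Cc (l, i)) \<subseteq> \<Omega> - P"
  proof -
    have a: "w \<notin> path_image (Oc l) \<and> w \<notin> path_image (Cc (l, i))" if "w \<in> P" for w
    proof -
      consider "w = 0" | "w \<in> ?lo" | "w \<in> ?hi" | "w \<in> Rt l" using \<open>w \<in> P\<close> by (auto simp: P_def)
      then show ?thesis
      proof cases
        case 2
        show ?thesis using root[OF lo_root'[OF 2]] by blast
      next
        case 3
        show ?thesis using hi[OF 3] by blast
      next
        case 4
        show ?thesis using root[OF 4 lm] by blast
      qed (use zero in simp)
    qed
    have b: "path_image (Oc l) \<subseteq> \<Omega>" "path_image (Cc (l, i)) \<subseteq> \<Omega>"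
      using Oc(2)[OF lm] sphere_subset[OF v] r1_subset \<rho>(2) unfolding image_Cc[OF v] by blast+
    show "path_image (Oc l) \<subseteq> \<Omega> - P" "path_image (Cc (l, i)) \<subseteq> \<Omega> - P" using a b by blast+
  qed
  have disj: "Rt l \<inter> ({0} \<union> ?lo \<union> ?hi) = {}"
  proof -
    have "Rt l \<inter> ?lo = {}"
    proof -
      have False if "w \<in> Rt l" "w \<in> ?lo" for w
        using roots_disjoint[of "l - 1"] lo_root[OF that(2)] that(1) lm by (auto simp: disjoint_iff)
      then show ?thesis by blast
    qed
    moreover have "Rt l \<inter> ?hi = {}" using hi unfolding KA_def fst_conv by blast
    ultimately show ?thesis using root_facts(2)[OF lm] by blast
  qed
  have open1: "open (\<Omega> - ({0} \<union> ?lo \<union> ?hi))"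
    using \<Omega>(1) finite_poles[OF chain] by (intro open_Diff finite_imp_closed) auto
  have res_root: "residue ?f p = q p / deriv q p * F p" if p: "p \<in> Rt l" for p
  proof (rule residue_eq_limit[OF fin \<Omega>(1) hol])
    show "p \<in> \<Omega>" using root_facts(2)[OF lm] p by blast
    have qp: "q p = \<zeta> l" using p by (simp add: roots_at_def)
    have F_lim: "(F \<longlongrightarrow> F p) (at p)"
      by (rule holomorphic_tendsto_at[OF F_hol open1]) (use p disj \<open>p \<in> \<Omega>\<close> in blast)
    have q_lim: "(q \<longlongrightarrow> q p) (at p)" by (rule holomorphic_tendsto_at[OF q_holomorphic \<Omega>(1) \<open>p \<in> \<Omega>\<close>])
    have "((\<lambda>w. (w - p) / (q w - q p)) \<longlongrightarrow> 1 / deriv q p) (at p)"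
      by (rule tendsto_difference_quotient_inverse[OF holomorphic_derivI[OF q_holomorphic \<Omega>(1) \<open>p \<in> \<Omega>\<close>]
            root_facts(4)[OF lm p]])
    then have "((\<lambda>w. (q w * ((w - p) / (q w - q p)) - inner_weight z l * (w - p)) * F w) \<longlongrightarrow>
        (q p * (1 / deriv q p) - inner_weight z l * (p - p)) * F p) (at p)"
      by (intro tendsto_mult tendsto_diff tendsto_const tendsto_ident_at F_lim q_lim)
    then show "((\<lambda>w. outer_weight q z l w * F w * (w - p)) \<longlongrightarrow> q p / deriv q p * F p) (at p)"
      unfolding outer_weight_def qp by (simp add: algebra_simps)
  qed
  \<comment> \<open>A simple pole of \<open>F\<close> meets a zero of the weight, so the limit
    defining the residue is 0.\<close>
  have res_low: "residue ?f p = 0" if p: "p \<in> ?lo" for p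
  proof (rule residue_eq_limit[OF fin \<Omega>(1) hol])
    note pr = lo_root[OF p] lo_root'(2)[OF p]
    show p\<Omega>: "p \<in> \<Omega>" using root_facts(2)[OF pr(2)] pr(1) by blast
    have p_hi: "p \<notin> ?hi"
    proof
      assume "p \<in> ?hi"
      then obtain j where j: "(l + 1, j) \<in> V" "p \<in> KC (l + 1, j)" using hiE by blast
      have "l + 1 \<in> {1..m}" using j(1) by (auto simp: var_idx_def)
      then have "p \<notin> path_image (Oc (l + 1))" using root_facts(6)[OF pr(2) conjunct2[OF pr(1)]] by blast
      moreover have "p \<notin> sphere 0 (rad (l + 1, j))"
        using root_facts(3)[OF pr(2) conjunct2[OF pr(1)]] sphere_subset[OF j(1)] by blast
      ultimately show False using j(2) by (simp add: KC_def)
    qed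
    obtain c where c: "((\<lambda>w. cauchy_product m I J (W((l, i) := w)) * (w - p)) \<longlongrightarrow> c) (at p)"
      using low_pole_limit[of l m i n p I W J] pr lm v p p_hi finite_I finite_J nc
      by (auto simp: var_idx_def)
    have p0: "p \<noteq> 0" using root_facts(2)[OF pr(2)] pr(1) by blast
    have "((\<lambda>w. A (set_chain l l (\<lambda>_. i) w W) z) \<longlongrightarrow> A (set_chain l l (\<lambda>_. i) p W) z) (at p)"
      by (rule holomorphic_tendsto_at[OF A_holomorphic_chain[OF data \<Omega>(1) chain W0 z_polydisc(2)]])
         (use \<Omega>(1) p\<Omega> p0 in \<open>auto intro: open_delete\<close>)
    moreover have "p \<notin> Rt l" using disj p by blast
    then have "(outer_weight q z l \<longlongrightarrow> outer_weight q z l p) (at p)"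
      using root_facts(1)[OF lm] \<Omega>(1) p\<Omega>
      by (intro holomorphic_tendsto_at[OF h_hol]) (auto intro!: open_Diff finite_imp_closed)
    ultimately have "((\<lambda>w. outer_weight q z l w * ((cauchy_product m I J (W((l, i) := w)) * (w - p)) *
        A (set_chain l l (\<lambda>_. i) w W) z)) \<longlongrightarrow> outer_weight q z l p * (c * A (set_chain l l (\<lambda>_. i) p W) z)) (at p)"
      by (intro tendsto_mult c)
    then show "((\<lambda>w. outer_weight q z l w * F w * (w - p)) \<longlongrightarrow> 0) (at p)"
      using outer_weight_low_root[of l p] pr lm
      by (simp add: F_def H_fun_eq set_chain_single mult_ac)
  qed
  have "contour_mean (Oc l) ?f - contour_mean (Cc (l, i)) ?f =
      (\<Sum>p\<in>P. (winding_number (Oc l) p - winding_number (Cc (l, i)) p) * residue ?f p)"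
    by (rule contour_mean_diff_residues[OF fin hol Oc(1)[OF lm] smooth_loop_circlepath avoid])
  also have "\<dots> = (\<Sum>p\<in>Rt l. (winding_number (Oc l) p - winding_number (Cc (l, i)) p) * residue ?f p)"
  proof (rule sum.mono_neutral_right[OF fin])
    show "\<forall>p\<in>P - Rt l. (winding_number (Oc l) p - winding_number (Cc (l, i)) p) * residue ?f p = 0"
    proof
      fix p assume "p \<in> P - Rt l"
      then consider "p = 0" | "p \<in> ?lo" | "p \<in> ?hi" by (auto simp: P_def)
      then show "(winding_number (Oc l) p - winding_number (Cc (l, i)) p) * residue ?f p = 0"
      proof cases
        case 1
        show ?thesis unfolding 1 using zero by simp
      next
        case 2
        show ?thesis unfolding res_low[OF 2] by simp
      next
        case 3
        show ?thesis using hi[OF 3] by simp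
      qed
    qed
  qed (auto simp: P_def)
  also have "\<dots> = root_sum (l, i) F"
    unfolding root_sum_def fst_conv 
  proof (rule sum.cong[OF refl])
    fix p assume p: "p \<in> Rt l"
    show "(winding_number (Oc l) p - winding_number (Cc (l, i)) p) * residue ?f p = q p / deriv q p * F p"
      unfolding res_root[OF p] using root[OF p lm] by simp
  qed
  finally have main: "root_sum (l, i) F = contour_mean (Oc l) ?f - contour_mean (Cc (l, i)) ?f" ..
  note bC = smooth_loopD(5)[OF smooth_loop_circlepath[of 0 "rad (l, i)"]]
  have cF: "continuous_on (path_image (Cc (l, i))) F"
    by (rule continuous_on_subset[OF holomorphic_on_imp_continuous_on[OF F_hol]])
       (use avoid(2) in \<open>unfold P_def, blast\<close>)
  have ch: "continuous_on (path_image (Cc (l, i))) (outer_weight q z l)"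
    by (rule continuous_on_subset[OF holomorphic_on_imp_continuous_on[OF h_hol]])
       (use avoid(2) in \<open>unfold P_def, blast\<close>)
  have "contour_mean (Cc (l, i)) (\<lambda>w. q w / (q w - \<zeta> l) * F w) =
      contour_mean (Cc (l, i)) (\<lambda>w. ?f w + inner_weight z l * F w)"
    by (simp add: outer_weight_def algebra_simps)
  also have "\<dots> = contour_mean (Cc (l, i)) ?f + contour_mean (Cc (l, i)) (\<lambda>w. inner_weight z l * F w)"
    by (intro bounded_functional_add[OF bC] continuous_on_mult continuous_on_const cF ch)
  finally have split: "contour_mean (Cc (l, i)) (\<lambda>w. q w / (q w - \<zeta> l) * F w) =
      contour_mean (Cc (l, i)) ?f + contour_mean (Cc (l, i)) (\<lambda>w. inner_weight z l * F w)" .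
  have "weighted_functional q Oc Cc z (l, i) F =
      contour_mean (Cc (l, i)) (\<lambda>w. inner_weight z l * F w) + contour_mean (Oc l) ?f"
  proof (cases "l = 1")
    case True
    then have "contour_mean (Cc (l, i)) (\<lambda>w. inner_weight z l * F w) = 0"
      by (simp add: inner_weight_def contour_mean_def)
    then show ?thesis using True by (simp add: weighted_functional_def)
  qed (simp add: weighted_functional_def)
  then show ?thesis using main split by simp
qed

end


section \<open>Iterated residues along a chain\<close>

context chain_setup
begin

text \<open>After the residues the common value of the chain runs over the circle of its last
  variable \<open>k'\<close>, while the weight still carries the level \<open>k\<close> of the
  variable from which the chain started.\<close>

definition chain_mean :: "nat \<Rightarrow> nat \<Rightarrow> (nat \<Rightarrow> nat) \<Rightarrow> (nat \<times> nat \<Rightarrow> complex) \<Rightarrow> complex" where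
  "chain_mean k k' ix W =
     contour_mean (Cc (k', ix k')) (\<lambda>w. q w / (q w - \<zeta> k) * chain_fun k k' ix W w)"

text \<open>The residue at the variable \<open>(k' + 1, j)\<close> counts only if that variable is
  on its small circle; on the outer contour it lies outside the circle of integration.\<close>

definition chain_term :: "nat \<Rightarrow> nat \<Rightarrow> (nat \<Rightarrow> nat) \<Rightarrow> nat \<Rightarrow> (nat \<times> nat \<Rightarrow> complex) \<Rightarrow> complex" where
  "chain_term k k' ix j W =
     (if W (k' + 1, j) \<in> sphere 0 (rad (k' + 1, j))
      then residue_sign (I k') (ix k') (J (k' + 1)) j *
        (q (W (k' + 1, j)) / (q (W (k' + 1, j)) - \<zeta> k) *
         chain_fun k (k' + 1) (ix(k' + 1 := j)) W (W (k' + 1, j)))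
      else 0)"

definition chain_next :: "nat \<Rightarrow> (nat \<Rightarrow> nat) \<Rightarrow> nat set" where
  "chain_next k' ix = (if k' < m \<and> ix k' \<in> I k' then J (k' + 1) else {})"

lemma q_minus_nonzero: "l \<in> {1..m} \<Longrightarrow> w \<in> cball 0 r1 \<Longrightarrow> q w - \<zeta> l \<noteq> 0"
proof
  assume l: "l \<in> {1..m}" and w: "w \<in> cball 0 r1" and "q w - \<zeta> l = 0"
  moreover have "w \<in> \<Omega>" using w r1_subset \<rho>(2) by blast
  ultimately have "w \<in> Rt l" by (simp add: roots_at_def)
  then show False using root_facts(3)[OF l] w by blast
qed

text \<open>The situation in the middle of the exchange at level \<open>k\<close>: the level below
  already runs over roots, the levels above still over circles and outer contours.\<close>

context
  fixes K :: "nat \<times> nat \<Rightarrow> complex set" and k :: nat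
  assumes K: "\<And>u. u \<in> V \<Longrightarrow> K u \<subseteq> KA u"
    and low: "\<And>u. u \<in> V \<Longrightarrow> 2 \<le> k \<Longrightarrow> fst u = k - 1 \<Longrightarrow> K u \<subseteq> Rt (k - 1)"
    and high: "\<And>u. u \<in> V \<Longrightarrow> k < fst u \<Longrightarrow> K u \<subseteq> KC u"
begin

lemma chain_slot: "cauchy_chain m n I J k k' ix \<Longrightarrow> (k', ix k') \<in> V"
  by (auto simp: cauchy_chain_def var_idx_def)

lemma low_poles_outside:
  assumes "cauchy_chain m n I J k k' ix" "W \<in> PiE V K" "w \<in> low_poles I k W"
  shows "w \<notin> cball 0 r1"
proof -
  have km: "k \<le> m" using assms(1) by (auto simp: cauchy_chain_def)
  obtain i where i: "2 \<le> k" "(k - 1, i) \<in> V" "w = W (k - 1, i)" by (rule low_polesE[OF assms(3) km]) (rule that)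
  have "w \<in> Rt (k - 1)" using low[OF i(2,1)] PiE_mem[OF assms(2) i(2)] i(3) by auto
  moreover have "k - 1 \<in> {1..m}" using i(1) km by auto
  ultimately show ?thesis using root_facts(3) by blast
qed

lemma high_variable:
  assumes "cauchy_chain m n I J k k' ix" "W \<in> PiE V K" "(k' + 1, j) \<in> V"
  shows "W (k' + 1, j) \<in> sphere 0 (rad (k' + 1, j)) \<or> W (k' + 1, j) \<notin> cball 0 r1"
    "W (k' + 1, j) \<notin> sphere 0 (rad (k', ix k'))"
proof -
  have "W (k' + 1, j) \<in> KC (k' + 1, j)"
    using high[OF assms(3)] PiE_mem[OF assms(2,3)] assms(1) by (auto simp: cauchy_chain_def)
  then show 1: "W (k' + 1, j) \<in> sphere 0 (rad (k' + 1, j)) \<or> W (k' + 1, j) \<notin> cball 0 r1"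
    using Oc_outside[of "k' + 1"] V_level[OF assms(3)] by (auto simp: KC_def)
  show "W (k' + 1, j) \<notin> sphere 0 (rad (k', ix k'))"
    using 1 rad_level[OF chain_slot[OF assms(1)] assms(3)] rad_less[OF chain_slot[OF assms(1)]] by auto
qed

lemma chain_fun_continuous:
  assumes chain: "cauchy_chain m n I J k k' ix"
  shows "continuous_on (PiE V K \<times> sphere 0 (rad (k', ix k')))
     (\<lambda>(W, w). q w / (q w - \<zeta> k) * chain_fun k k' ix W w)"
proof -
  let ?S = "PiE V K \<times> sphere (0 :: complex) (rad (k', ix k'))"
  have slot: "(k', ix k') \<in> V" by (rule chain_slot[OF chain])
  have km: "k \<in> {1..m}" "1 \<le> k'" using chain by (auto simp: cauchy_chain_def)
  have sph: "sphere 0 (rad (k', ix k')) \<subseteq> cball 0 r1 - {0}" by (rule sphere_subset[OF slot])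
  have sph\<Omega>: "sphere 0 (rad (k', ix k')) \<subseteq> \<Omega> - {0}" using sph r1_subset \<rho>(2) by blast
  have sc: "continuous_on ?S (\<lambda>x. set_chain k k' ix (snd x) (fst x))"
    by (intro continuous_on_set_chain continuous_on_fst continuous_on_snd continuous_on_id)
  have 1: "continuous_on ?S (\<lambda>x. cauchy_product m (chain_I I k k' ix) (chain_J J k k' ix) (set_chain k k' ix (snd x) (fst x)))"
  proof (rule continuous_on_cauchy_product)
    show "continuous_on ?S (\<lambda>x. set_chain k k' ix (snd x) (fst x) v)" for v
      by (rule continuous_on_product_then_coordinatewise[OF sc])
    fix x assume "x \<in> ?S"
    then have W: "fst x \<in> PiE V K" and w: "snd x \<in> sphere 0 (rad (k', ix k'))" by auto
    show "no_collision m (chain_I I k k' ix) (chain_J J k k' ix) (set_chain k k' ix (snd x) (fst x))"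
    proof (rule chain_no_collision[OF chain KA_no_collision[OF W K]])
      show "snd x \<notin> low_poles I k (fst x)" using low_poles_outside[OF chain W] w sph by blast
      show "snd x \<notin> high_poles m I J k' ix (fst x)"
      proof
        assume "snd x \<in> high_poles m I J k' ix (fst x)"
        then obtain j where "(k' + 1, j) \<in> V" "snd x = fst x (k' + 1, j)"
          by (rule high_polesE[OF _ km(2)]) (rule that)
        then show False using high_variable(2)[OF chain W, of j] w by simp
      qed
    qed
  qed (use finite_I finite_J in \<open>auto simp: chain_I_def chain_J_def\<close>)
  have 2: "continuous_on ?S (\<lambda>x. (\<lambda>(W, z). A W z) (set_chain k k' ix (snd x) (fst x), z))"
  proof (rule continuous_on_compose2[OF A_continuous[OF data \<Omega>(1)]])
    show "continuous_on ?S (\<lambda>x. (set_chain k k' ix (snd x) (fst x), z))"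
      by (intro continuous_on_Pair sc continuous_on_const)
    have "set_chain k k' ix w W \<in> PiE V (\<lambda>_. \<Omega> - {0})" if "W \<in> PiE V K" "w \<in> sphere 0 (rad (k', ix k'))" for W w
      by (rule set_chain_in[OF chain in_\<Omega>0[OF that(1) K]]) (use sph\<Omega> that in auto)
    then show "(\<lambda>x. (set_chain k k' ix (snd x) (fst x), z)) ` ?S \<subseteq> PiE V (\<lambda>_. \<Omega> - {0}) \<times> polydisc m R"
      using z_polydisc(2) by (intro image_subsetI) (simp add: mem_Times_iff)
  qed
  have "continuous_on (sphere 0 (rad (k', ix k'))) (\<lambda>w. q w / (q w - \<zeta> k))"
    using q_minus_nonzero[OF km(1)] sph sph\<Omega>
    by (intro continuous_intros holomorphic_on_imp_continuous_on[OF holomorphic_on_subset[OF q_holomorphic]]) blast+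
  then have 3: "continuous_on ?S (\<lambda>x. q (snd x) / (q (snd x) - \<zeta> k))"
    by (rule continuous_on_compose2) (auto intro!: continuous_on_snd continuous_on_id)
  show ?thesis
    unfolding case_prod_beta H_fun_eq using 1 2 3 by (intro continuous_on_mult) simp_all
qed

lemma chain_mean_continuous:
  assumes chain: "cauchy_chain m n I J k k' ix"
  shows "continuous_on (PiE V K) (chain_mean k k' ix)"
proof -
  have im: "path_image (Cc (k', ix k')) = sphere 0 (rad (k', ix k'))"
    by (rule image_Cc[OF chain_slot[OF chain]])
  show ?thesis
    unfolding chain_mean_def
    by (rule bounded_functional_continuous_param[OF smooth_loopD(4,5)[OF smooth_loop_circlepath]])
       (unfold im, rule chain_fun_continuous[OF chain])
qed

lemma chain_nextD:
  assumes chain: "cauchy_chain m n I J k k' ix" and j: "j \<in> chain_next k' ix"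
  shows "k' < m" "ix k' \<in> I k'" "j \<in> J (k' + 1)" "(k' + 1, j) \<in> V"
    "cauchy_chain m n I J k (k' + 1) (ix(k' + 1 := j))"
proof -
  show 1: "k' < m" "ix k' \<in> I k'" "j \<in> J (k' + 1)" using j by (auto simp: chain_next_def split: if_splits)
  have "1 \<le> k'" using chain by (auto simp: cauchy_chain_def)
  then have jn: "j \<in> {1..n (k' + 1)}" using J[of k'] 1 by auto
  then show "(k' + 1, j) \<in> V" using 1 by (auto simp: var_idx_def)
  show "cauchy_chain m n I J k (k' + 1) (ix(k' + 1 := j))"
    by (rule cauchy_chain_extend[OF chain 1 jn])
qed

lemma finite_chain_next:
  assumes "cauchy_chain m n I J k k' ix"
  shows "finite (chain_next k' ix)"
  using assms finite_J[of k'] by (auto simp: chain_next_def cauchy_chain_def)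

text \<open>The case distinction is harmless because the circle and the outer contour of a variable
  are disjoint closed sets that cover its range.\<close>

lemma chain_term_continuous:
  assumes chain: "cauchy_chain m n I J k k' ix" and j: "j \<in> chain_next k' ix"
  shows "continuous_on (PiE V K) (chain_term k k' ix j)"
proof -
  note D = chain_nextD[OF chain j]
  let ?u = "(k' + 1, j)" and ?ix = "ix(k' + 1 := j)"
  let ?S = "{W \<in> PiE V K. W ?u \<in> sphere 0 (rad ?u)}" and ?T = "{W \<in> PiE V K. W ?u \<in> path_image (Oc (k' + 1))}"
  have lev: "k' + 1 \<in> {1..m}" using V_level[OF D(4)] by simp
  have KC: "W ?u \<in> KC ?u" if "W \<in> PiE V K" for W
    using high[OF D(4)] PiE_mem[OF that D(4)] chain by (auto simp: cauchy_chain_def)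
  have ST: "PiE V K = ?S \<union> ?T" using KC by (auto simp: KC_def)
  have disj: "W ?u \<notin> path_image (Oc (k' + 1))" if "W ?u \<in> sphere 0 (rad ?u)" for W :: "nat \<times> nat \<Rightarrow> complex"
    using Oc_outside[OF lev] sphere_subset[OF D(4)] that by blast
  have coord: "continuous_on (PiE V K) (\<lambda>W. W ?u)"
    by (rule continuous_on_product_then_coordinatewise[OF continuous_on_id])
  have cS: "closedin (top_of_set (PiE V K)) ?S"
    using continuous_closedin_preimage[OF coord closed_sphere, of 0 "rad ?u"] unfolding vimage_def Int_def mem_Collect_eq .
  have "closed (path_image (Oc (k' + 1)))"
    using smooth_loopD(4)[OF Oc(1)[OF lev]] by (rule compact_imp_closed)
  from continuous_closedin_preimage[OF coord this] have cT: "closedin (top_of_set (PiE V K)) ?T"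
    unfolding vimage_def Int_def mem_Collect_eq .
  have f: "continuous_on ?S (\<lambda>W. residue_sign (I k') (ix k') (J (k' + 1)) j *
      (q (W ?u) / (q (W ?u) - \<zeta> k) * chain_fun k (k' + 1) ?ix W (W ?u)))"
  proof -
    have c: "continuous_on (PiE V K \<times> sphere 0 (rad ?u))
        (\<lambda>(W, w). q w / (q w - \<zeta> k) * chain_fun k (k' + 1) ?ix W w)"
      using chain_fun_continuous[OF D(5)] unfolding fun_upd_same .
    have "continuous_on ?S (\<lambda>W. (\<lambda>(W, w). q w / (q w - \<zeta> k) * chain_fun k (k' + 1) ?ix W w) (W, W ?u))"
    proof (rule continuous_on_compose2[OF c])
      show "continuous_on ?S (\<lambda>W. (W, W ?u))"
        by (intro continuous_on_Pair continuous_on_id continuous_on_subset[OF coord]) auto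
    qed auto
    then show ?thesis unfolding prod.case by (rule continuous_on_mult_left)
  qed
  have "continuous_on (?S \<union> ?T) (\<lambda>W. if W ?u \<in> sphere 0 (rad ?u)
      then residue_sign (I k') (ix k') (J (k' + 1)) j *
        (q (W ?u) / (q (W ?u) - \<zeta> k) * chain_fun k (k' + 1) ?ix W (W ?u)) else 0)"
    by (rule continuous_on_cases_local[OF _ _ f continuous_on_const])
       (use cS cT ST disj in auto)
  then show ?thesis using ST by (simp add: chain_term_def[abs_def])
qed

text \<open>Inside the circle the integrand can be singular only at \<open>0\<close> and at
  next-level variables on their smaller circles; roots and lower variables lie beyond radius
  \<open>r1\<close>.\<close>

lemma chain_mean_residues:
  assumes chain: "cauchy_chain m n I J k k' ix" and W: "W \<in> PiE V K"
  shows "chain_mean k k' ix W = (\<Sum>j\<in>chain_next k' ix. chain_term k k' ix j W)"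
proof -
  let ?v = "(k', ix k')"
  have v: "?v \<in> V" by (rule chain_slot[OF chain])
  have km: "k \<in> {1..m}" "1 \<le> k'" using chain by (auto simp: cauchy_chain_def)
  have W0: "W \<in> PiE V (\<lambda>_. \<Omega> - {0})" by (rule in_\<Omega>0[OF W K])
  have nc: "no_collision m I J W" by (rule KA_no_collision[OF W K])
  define Js where "Js = {j \<in> chain_next k' ix. W (k' + 1, j) \<in> sphere 0 (rad (k' + 1, j))}"
  have finJs: "finite Js" using finite_chain_next[OF chain] by (simp add: Js_def)
  define pt where "pt j = W (k' + 1, j)" for j
  define P where "P = insert 0 (pt ` Js)"
  define B where "B = ball (0 :: complex) r1"
  define CP where "CP w = cauchy_product m (chain_I I k k' ix) (chain_J J k k' ix) (set_chain k k' ix w W)" for w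
  define AA where "AA w = A (set_chain k k' ix w W) z" for w
  define g where "g w = q w / (q w - \<zeta> k) * (CP w * AA w)" for w
  have B\<Omega>: "B \<subseteq> \<Omega>" using r1_subset \<rho>(2) ball_subset_cball[of 0 r1] unfolding B_def by blast
  have nz: "q w - \<zeta> k \<noteq> 0" if "w \<in> B" for w
    using q_minus_nonzero[OF km(1), of w] that by (simp add: B_def)
  have hi: "w \<in> pt ` Js" if "w \<in> high_poles m I J k' ix W" "w \<in> B" for w
  proof -
    obtain j where j: "k' < m" "ix k' \<in> I k'" "j \<in> J (k' + 1)" "w = W (k' + 1, j)"
      using \<open>w \<in> high_poles m I J k' ix W\<close> by (auto simp: high_poles_def split: if_splits)
    then have jn: "j \<in> chain_next k' ix" by (simp add: chain_next_def)
    have "w \<in> sphere 0 (rad (k' + 1, j))"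
      using high_variable(1)[OF chain W chain_nextD(4)[OF chain jn]] that(2) j(4) by (auto simp: B_def)
    then show ?thesis using jn j(4) by (auto simp: Js_def pt_def)
  qed
  have lo: "w \<notin> low_poles I k W" if "w \<in> B" for w
    using low_poles_outside[OF chain W, of w] that by (auto simp: B_def)
  have CP_hol: "CP holomorphic_on B - pt ` Js"
    unfolding CP_def
    by (rule holomorphic_on_subset[OF chain_product_holomorphic[OF chain nc]]) (use hi lo in blast)
  have AA_hol: "AA holomorphic_on \<Omega> - {0}"
    unfolding AA_def by (rule A_holomorphic_chain[OF data \<Omega>(1) chain W0 z_polydisc(2)])
  have q_hol: "q holomorphic_on B" using q_holomorphic B\<Omega> by (rule holomorphic_on_subset)
  have quot_hol: "(\<lambda>w. q w / (q w - \<zeta> k)) holomorphic_on B"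
    by (intro holomorphic_intros q_hol nz)
  have pt_sphere: "pt j \<in> sphere 0 (rad (k' + 1, j))" "(k' + 1, j) \<in> V" if "j \<in> Js" for j
    using that chain_nextD(4)[OF chain] by (auto simp: Js_def pt_def)
  have pt_norm: "norm (pt j) < rad ?v" "0 < norm (pt j)" if "j \<in> Js" for j
    using rad_level[OF v pt_sphere(2)[OF that]] rad_pos[OF pt_sphere(2)[OF that]] pt_sphere(1)[OF that] by auto
  have pt_B: "pt j \<in> B" "pt j \<noteq> 0" if "j \<in> Js" for j
    using pt_norm[OF that] rad_less[OF v] by (auto simp: B_def)
  have g_hol: "g holomorphic_on B - P"
    unfolding g_def
    by (intro holomorphic_on_mult holomorphic_on_subset[OF quot_hol] holomorphic_on_subset[OF CP_hol]
         holomorphic_on_subset[OF AA_hol]) (use B\<Omega> in \<open>auto simp: P_def\<close>)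
  have finP: "finite P" using finJs by (simp add: P_def)
  have openB: "open B" by (simp add: B_def)
  \<comment> \<open>Here domination enters: the numerator \<open>q\<close> of the weight times
    \<open>A\<close> along the chain is analytic at \<open>0\<close>, and the remaining factor
    \<open>CP w / (q w - \<zeta> k)\<close> is holomorphic near \<open>0\<close>.\<close>
  have res0: "residue g 0 = 0"
  proof -
    obtain G where G: "G analytic_on {0}" "\<forall>\<^sub>F w in at 0. q w * A (set_chain k k' ix w W) z = G w"
      using dom chain W0 z_polydisc(2) unfolding dominates_at_0_def by blast
    obtain S where S: "open S" "0 \<in> S" "G holomorphic_on S" using G(1) analytic_at by blast
    have 0: "0 \<in> B - pt ` Js" using r1(1) pt_B(2) by (auto simp: B_def)
    have "open (B - pt ` Js)" using openB finJs by (intro open_Diff finite_imp_closed) auto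
    then have "open (S \<inter> (B - pt ` Js))" using S(1) by blast
    moreover have "0 \<in> S \<inter> (B - pt ` Js)" using S(2) 0 by blast
    moreover have "(\<lambda>w. G w * (CP w / (q w - \<zeta> k))) holomorphic_on S \<inter> (B - pt ` Js)"
      using nz by (intro holomorphic_intros holomorphic_on_subset[OF S(3)] holomorphic_on_subset[OF CP_hol]
          holomorphic_on_subset[OF q_hol]) auto
    ultimately have "residue (\<lambda>w. G w * (CP w / (q w - \<zeta> k))) 0 = 0" by (rule residue_holo)
    moreover have "\<forall>\<^sub>F w in at 0. g w = G w * (CP w / (q w - \<zeta> k))"
      using G(2)
    proof eventually_elim
      case (elim w)
      have "g w = (q w * AA w) * (CP w / (q w - \<zeta> k))" by (simp add: g_def)
      then show ?case using elim by (simp add: AA_def)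
    qed
    ultimately show ?thesis using residue_cong[OF _ refl] by metis
  qed
  have res: "residue g (pt j) = chain_term k k' ix j W" if j: "j \<in> Js" for j
  proof (rule residue_eq_limit[OF finP openB g_hol pt_B(1)[OF j]])
    have jn: "j \<in> chain_next k' ix" using j by (simp add: Js_def)
    note D = chain_nextD[OF chain jn]
    let ?ix = "ix(k' + 1 := j)"
    let ?lim = "residue_sign (I k') (ix k') (J (k' + 1)) j *
       cauchy_product m (chain_I I k (k' + 1) ?ix) (chain_J J k (k' + 1) ?ix) (set_chain k (k' + 1) ?ix (pt j) W)"
    have lim1: "((\<lambda>w. CP w * (w - pt j)) \<longlongrightarrow> ?lim) (at (pt j))"
      unfolding CP_def
    proof (rule chain_residue_limit[OF chain D(1,2,3) finite_I finite_J nc])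
      show "pt j \<notin> low_poles I k W" by (rule lo[OF pt_B(1)[OF j]])
      fix j' assume j': "j' \<in> J (k' + 1) - {j}"
      then have j'n: "j' \<in> chain_next k' ix" using D(1,2) by (simp add: chain_next_def)
      have V': "(k' + 1, j') \<in> V" by (rule chain_nextD(4)[OF chain j'n])
      \<comment> \<open>Another variable of this level is either on its own circle, whose radius
        differs, or on the outer contour and thus outside \<open>B\<close>. So the pole is
        simple.\<close>
      show "W (k' + 1, j') \<noteq> pt j"
      proof
        assume eq: "W (k' + 1, j') = pt j"
        then have "pt j \<in> sphere 0 (rad (k' + 1, j'))"
          using high_variable(1)[OF chain W V'] pt_B(1)[OF j] by (auto simp: B_def)
        then have "rad (k' + 1, j') = rad (k' + 1, j)" using pt_sphere(1)[OF j] by auto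
        then show False using rad_inj[OF V' D(4)] j' by auto
      qed
    qed (auto simp: pt_def)
    have pt\<Omega>: "pt j \<in> \<Omega> - {0}" using pt_B[OF j] B\<Omega> by blast
    have lim2: "(AA \<longlongrightarrow> AA (pt j)) (at (pt j))"
      by (rule holomorphic_tendsto_at[OF AA_hol _ pt\<Omega>]) (use \<Omega>(1) in \<open>auto intro: open_delete\<close>)
    have lim3: "((\<lambda>w. q w / (q w - \<zeta> k)) \<longlongrightarrow> q (pt j) / (q (pt j) - \<zeta> k)) (at (pt j))"
      by (rule holomorphic_tendsto_at[OF quot_hol openB pt_B(1)[OF j]])
    have AAp: "AA (pt j) = A (set_chain k (k' + 1) ?ix (pt j) W) z"
    proof -
      have "set_chain k (k' + 1) ?ix (pt j) W = set_chain k k' ix (pt j) W"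
        by (rule set_chain_extend) (use chain in \<open>auto simp: pt_def cauchy_chain_def\<close>)
      then show ?thesis by (simp add: AA_def)
    qed
    have "((\<lambda>w. q w / (q w - \<zeta> k) * ((CP w * (w - pt j)) * AA w)) \<longlongrightarrow>
        q (pt j) / (q (pt j) - \<zeta> k) * (?lim * AA (pt j))) (at (pt j))"
      by (intro tendsto_mult lim1 lim2 lim3)
    moreover have "q (pt j) / (q (pt j) - \<zeta> k) * (?lim * AA (pt j)) = chain_term k k' ix j W"
      using pt_sphere(1)[OF j] unfolding chain_term_def H_fun_eq AAp pt_def[symmetric] by (simp add: mult_ac)
    ultimately show "((\<lambda>w. g w * (w - pt j)) \<longlongrightarrow> chain_term k k' ix j W) (at (pt j))"
      by (simp add: g_def mult_ac)
  qed
  have inj: "inj_on pt Js"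
  proof (rule inj_onI)
    fix a b assume ab: "a \<in> Js" "b \<in> Js" "pt a = pt b"
    then have "rad (k' + 1, a) = rad (k' + 1, b)" using pt_sphere(1)[of a] pt_sphere(1)[of b] by auto
    then show "a = b" using rad_inj pt_sphere(2) ab by blast
  qed
  have 0: "0 \<notin> pt ` Js" using pt_B(2) by auto
  have wn: "winding_number (Cc ?v) p = 1" if "p \<in> P" for p
    using that pt_norm rad_pos[OF v] by (auto simp: P_def intro!: winding_number_circlepath)
  have im: "path_image (Cc ?v) \<subseteq> B - P"
  proof -
    have "w \<notin> P" if "norm w = rad ?v" for w
      using that rad_pos[OF v] pt_norm(1) by (force simp: P_def)
    then show ?thesis using rad_less[OF v] rad_pos[OF v] by (auto simp: B_def)
  qed
  have wnB: "\<forall>w. w \<notin> B \<longrightarrow> winding_number (Cc ?v) w = 0"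
    using rad_less[OF v] rad_pos[OF v] by (auto simp: B_def intro!: winding_number_circlepath_outside)
  have conB: "connected B" by (simp add: B_def)
  have "contour_mean (Cc ?v) g = (\<Sum>p\<in>P. winding_number (Cc ?v) p * residue g p)"
    using Residue_theorem[OF openB conB finP g_hol smooth_loopD(1,3)[OF smooth_loop_circlepath] im wnB]
    by (simp add: contour_mean_def)
  also have "\<dots> = (\<Sum>p\<in>P. residue g p)" by (intro sum.cong) (use wn in auto)
  also have "\<dots> = (\<Sum>p\<in>pt ` Js. residue g p)" unfolding P_def using finJs 0 res0 by simp
  also have "\<dots> = (\<Sum>j\<in>Js. chain_term k k' ix j W)"
    unfolding sum.reindex[OF inj] by (intro sum.cong) (use res in auto)
  also have "\<dots> = (\<Sum>j\<in>chain_next k' ix. chain_term k k' ix j W)"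
    by (rule sum.mono_neutral_left[OF finite_chain_next[OF chain]]) (auto simp: Js_def chain_term_def)
  finally show ?thesis
    by (simp add: chain_mean_def g_def[abs_def] CP_def AA_def H_fun_eq)
qed

text \<open>The integral over the innermost circle of the chain is a sum of residues at variables of the
  next level (the residue at \<open>0\<close> vanishes by domination, the lower variables and the roots lie outside).
  Each of them is the same kind of integral for a chain that is longer by one, and there is no residue
  left at level \<open>m\<close>.\<close>

lemma chain_vanish:
  assumes sys: "functional_system V K L"
    and L: "\<And>u. u \<in> V \<Longrightarrow> k < fst u \<Longrightarrow> L u = weighted_functional q Oc Cc z u"
    and "cauchy_chain m n I J k k' ix" "set vs \<subseteq> V" "distinct vs"
    and "\<And>u. u \<in> V \<Longrightarrow> k' < fst u \<Longrightarrow> u \<in> set vs" and "W0 \<in> PiE V K"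
  shows "iterate_functionals L vs (chain_mean k k' ix) W0 = 0"
  using assms(3-7)
proof (induction "m - k'" arbitrary: k' ix vs rule: less_induct)
  case less
  interpret functional_system V K L by (rule sys)
  note chain = less.prems(1)
  have kk: "1 \<le> k" "k \<le> k'" using chain by (auto simp: cauchy_chain_def)
  have term0: "iterate_functionals L vs (chain_term k k' ix j) W0 = 0" if j: "j \<in> chain_next k' ix" for j
  proof -
    note D = chain_nextD[OF chain j]
    let ?u = "(k' + 1, j)" and ?ix = "ix(k' + 1 := j)"
    define c where "c = inner_weight z (k' + 1) * residue_sign (I k') (ix k') (J (k' + 1)) j"
    have u: "?u \<in> set vs" by (rule less.prems(4)[OF D(4)]) simp
    have lev: "k' + 1 \<in> {1..m}" "k' + 1 \<noteq> 1" using V_level[OF D(4)] kk by auto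
    have Lu: "L ?u = weighted_functional q Oc Cc z ?u" by (rule L[OF D(4)]) (use kk in simp)
    have slot: "?u \<in> chain_slots k (k' + 1) ?ix" using kk by (auto simp: chain_slots_def)
    \<comment> \<open>The term vanishes on the outer contour, and on the circle the weight is
      constant in \<open>w\<close>; integrating over the new chain variable therefore returns the
      mean of the longer chain times a constant.\<close>
    have inner: "L ?u (\<lambda>w. chain_term k k' ix j (W(?u := w))) = c * chain_mean k (k' + 1) ?ix W" if W: "W \<in> PiE V K" for W
    proof -
      have onO: "outer_weight q z (k' + 1) w * chain_term k k' ix j (W(?u := w)) = 0"
        if "w \<in> path_image (Oc (k' + 1))" for w
      proof -
        have "w \<notin> sphere 0 (rad ?u)" using Oc_outside[OF lev(1) that] sphere_subset[OF D(4)] by blast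
        then show ?thesis by (simp add: chain_term_def)
      qed
      have "contour_mean (Oc (k' + 1)) (\<lambda>w. outer_weight q z (k' + 1) w * chain_term k k' ix j (W(?u := w))) = 0"
        by (rule bounded_functional_zero[OF smooth_loopD(5)[OF Oc(1)[OF lev(1)]] onO])
      then have "L ?u (\<lambda>w. chain_term k k' ix j (W(?u := w))) =
          contour_mean (Cc ?u) (\<lambda>w. inner_weight z (k' + 1) * chain_term k k' ix j (W(?u := w)))"
        using lev unfolding Lu weighted_functional_def by simp
      also have "\<dots> = contour_mean (Cc ?u) (\<lambda>w. c * (q w / (q w - \<zeta> k) * chain_fun k (k' + 1) ?ix W w))"
      proof -
        have bd: "bounded_functional (path_image (Cc ?u)) (contour_mean (Cc ?u))"
          by (rule smooth_loopD(5)[OF smooth_loop_circlepath])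
        have cont: "continuous_on (path_image (Cc ?u)) (\<lambda>w. c * (q w / (q w - \<zeta> k) * chain_fun k (k' + 1) ?ix W w))"
          using continuous_on_slice_fst[OF chain_fun_continuous[OF D(5)] W] unfolding image_Cc[OF D(4)]
          by (intro continuous_on_mult_left) simp
        show ?thesis
        proof (rule bounded_functional_cong[OF bd cont, symmetric])
          fix w assume "w \<in> path_image (Cc ?u)"
          then have "w \<in> sphere 0 (rad ?u)" unfolding image_Cc[OF D(4)] .
          then show "c * (q w / (q w - \<zeta> k) * chain_fun k (k' + 1) ?ix W w) =
              inner_weight z (k' + 1) * chain_term k k' ix j (W(?u := w))"
            by (simp add: chain_term_def c_def set_chain_upd[OF slot, unfolded Suc_eq_plus1[symmetric]])
        qed
      qed
      also have "\<dots> = c * chain_mean k (k' + 1) ?ix W"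
      proof -
        have "continuous_on (path_image (Cc ?u)) (\<lambda>w. q w / (q w - \<zeta> k) * chain_fun k (k' + 1) ?ix W w)"
          using continuous_on_slice_fst[OF chain_fun_continuous[OF D(5)] W] unfolding image_Cc[OF D(4)] by simp
        from bounded_functional_cmult[OF smooth_loopD(5)[OF smooth_loop_circlepath] this]
        show ?thesis by (simp add: chain_mean_def)
      qed
      finally show ?thesis .
    qed
    have vs': "set (remove1 ?u vs) \<subseteq> V" "distinct (remove1 ?u vs)"
      using less.prems(2,3) set_remove1_subset[of ?u vs] by auto
    have cterm: "continuous_on (PiE V K) (chain_term k k' ix j)" by (rule chain_term_continuous[OF chain j])
    \<comment> \<open>The new chain variable is made innermost, absorbed into the longer chain, and
      dropped from the list; the induction hypothesis applies to what remains.\<close>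
    have "iterate_functionals L vs (chain_term k k' ix j) W0 =
        iterate_functionals L (remove1 ?u vs) (\<lambda>W. L ?u (\<lambda>w. chain_term k k' ix j (W(?u := w)))) W0"
      by (rule iterate_move_inner[OF cterm u less.prems(2,3,5)])
    also have "\<dots> = iterate_functionals L (remove1 ?u vs) (\<lambda>W. c * chain_mean k (k' + 1) ?ix W) W0"
      by (rule iterate_cong[OF continuous_apply[OF cterm D(4)] inner vs'(1) less.prems(5)])
    also have "\<dots> = c * iterate_functionals L (remove1 ?u vs) (chain_mean k (k' + 1) ?ix) W0"
      by (rule iterate_cmult[OF chain_mean_continuous[OF D(5)] vs'(1) less.prems(5)])
    also have "iterate_functionals L (remove1 ?u vs) (chain_mean k (k' + 1) ?ix) W0 = 0"
    proof (rule less.hyps[OF _ D(5) vs' _ less.prems(5)])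
      show "m - (k' + 1) < m - k'" using D(1) by simp
      show "u \<in> set (remove1 ?u vs)" if "u \<in> V" "k' + 1 < fst u" for u
      proof -
        have "u \<noteq> ?u" using that(2) by auto
        then show ?thesis using less.prems(4)[OF that(1)] that(2) by simp
      qed
    qed
    finally show ?thesis by simp
  qed
  have "iterate_functionals L vs (chain_mean k k' ix) W0 =
      iterate_functionals L vs (\<lambda>W. \<Sum>j\<in>chain_next k' ix. chain_term k k' ix j W) W0"
    by (rule iterate_cong[OF chain_mean_continuous[OF chain] chain_mean_residues[OF chain] less.prems(2,5)])
  also have "\<dots> = (\<Sum>j\<in>chain_next k' ix. iterate_functionals L vs (chain_term k k' ix j) W0)"
    by (rule iterate_sum[OF finite_chain_next[OF chain] chain_term_continuous[OF chain] less.prems(2,5)])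
  also have "\<dots> = 0" using term0 by simp
  finally show ?case .
qed

end

lemma H_continuous:
  assumes "\<And>u. u \<in> V \<Longrightarrow> K u \<subseteq> \<Omega> - {0}" "\<And>W. W \<in> PiE V K \<Longrightarrow> no_collision m I J W"
  shows "continuous_on (PiE V K) (\<lambda>W. H_fun m I J A W z)"
  using continuous_on_slice_fst[OF H_fun_continuous[OF assms] z_polydisc(2)] .

lemma bounded_root_sum: "v \<in> V \<Longrightarrow> bounded_functional (Rt (fst v)) (root_sum v)"
  unfolding root_sum_def[abs_def] by (rule bounded_functional_finite_sum[OF root_facts(1)[OF V_level]])

lemma contour_support_Cc: "v \<in> V \<Longrightarrow> contour_support Oc Cc v \<subseteq> KC v"
  using image_Cc[of v] by (auto simp: contour_support_def KC_def)

lemma bounded_circle_functional: "v \<in> V \<Longrightarrow> bounded_functional (KC v) (weighted_functional q Oc Cc z v)"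
  by (rule bounded_functional_mono[OF bounded_weighted_functional[OF z_polydisc(1)] contour_support_Cc])
     (auto intro: smooth_loop_circlepath)

section \<open>Exchanging the functionals one variable at a time\<close>

definition mixed_functional :: "(nat \<times> nat) set \<Rightarrow> nat \<times> nat \<Rightarrow> (complex \<Rightarrow> complex) \<Rightarrow> complex" where
  "mixed_functional T u = (if u \<in> T then weighted_functional q Oc Cc z u else root_sum u)"

text \<open>The set \<open>T\<close> of variables still integrated over contours is closed towards
  higher levels. Removing a variable of minimal level from it finds the level below at roots and all
  higher levels on contours, as the comparison and the vanishing of chains require.\<close>

lemma root_sums_eq_circle_functionals:
  assumes "T \<subseteq> V" "\<And>u u'. u \<in> T \<Longrightarrow> u' \<in> V \<Longrightarrow> fst u < fst u' \<Longrightarrow> u' \<in> T"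
  shows "iterate_functionals (mixed_functional T) (var_list m n) (\<lambda>W. H_fun m I J A W z) (\<lambda>_. undefined) =
    iterate_functionals root_sum (var_list m n) (\<lambda>W. H_fun m I J A W z) (\<lambda>_. undefined)"
  using assms
proof (induction "card T" arbitrary: T)
  case 0
  have "finite T" by (rule finite_subset[OF 0(2) finite_var_idx])
  then have "T = {}" using 0(1) by simp
  then show ?case by (intro iterate_functionals_cong) (simp add: mixed_functional_def)
next
  case (Suc N)
  let ?F = "\<lambda>W. H_fun m I J A W z" and ?vs = "var_list m n"
  have finT: "finite T" by (rule finite_subset[OF Suc.prems(1) finite_var_idx])
  have neT: "T \<noteq> {}" using Suc.hyps(2) by auto
  have "Min (fst ` T) \<in> fst ` T" using finT neT by (intro Min_in) auto
  then obtain v where vm: "Min (fst ` T) = fst v" and vT: "v \<in> T" by (rule imageE)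
  have v: "v \<in> T" "\<And>u. u \<in> T \<Longrightarrow> fst v \<le> fst u" using vT finT by (auto simp flip: vm)
  obtain l i where li: "v = (l, i)" by fastforce
  define T' where "T' = T - {v}"
  have vV: "v \<in> V" using v Suc.prems(1) by blast
  \<comment> \<open>Only \<open>v\<close> is acted on by both functionals, so only \<open>v\<close>
    gets the larger set.\<close>
  define K where "K u = (if u = v then KA u else if u \<in> T then KC u else Rt (fst u))" for u
  have KKA: "K u \<subseteq> KA u" for u by (auto simp: K_def KA_def)
  have K\<Omega>: "K u \<subseteq> \<Omega> - {0}" if "u \<in> V" for u using KKA KA_subset[OF that] by blast
  have Kc: "compact (K u)" if "u \<in> V" for u
    using compact_KA[OF that] compact_KC[OF that] root_facts(1)[OF V_level[OF that]]
    by (auto simp: K_def finite_imp_compact)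
  have bdT: "bounded_functional (K u) (mixed_functional T u)" if "u \<in> V" for u
  proof (cases "u \<in> T")
    case True
    then show ?thesis
      unfolding mixed_functional_def using bounded_functional_mono[OF bounded_circle_functional[OF that], of "K u"]
      by (auto simp: K_def KA_def)
  next
    case False
    then show ?thesis
      unfolding mixed_functional_def using bounded_functional_mono[OF bounded_root_sum[OF that], of "K u"] v(1)
      by (auto simp: K_def)
  qed
  have bdT': "bounded_functional (K u) (mixed_functional T' u)" if "u \<in> V" for u
  proof (cases "u = v")
    case True
    then show ?thesis
      unfolding mixed_functional_def using bounded_functional_mono[OF bounded_root_sum[OF that], of "K u"]
      by (auto simp: K_def KA_def T'_def)
  next
    case False
    then have "mixed_functional T' u = mixed_functional T u" by (simp add: mixed_functional_def T'_def)
    then show ?thesis using bdT[OF that] by simp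
  qed
  interpret S1: functional_system V K "mixed_functional T" by unfold_locales (use Kc bdT in auto)
  interpret S2: functional_system V K "mixed_functional T'" by unfold_locales (use Kc bdT' in auto)
  have nc: "no_collision m I J W" if "W \<in> PiE V K" for W by (rule KA_no_collision[OF that KKA])
  have Hc: "continuous_on (PiE V K) ?F" by (rule H_continuous[OF K\<Omega> nc])
  have low: "K u \<subseteq> Rt (l - 1)" if "u \<in> V" "2 \<le> l" "fst u = l - 1" for u
  proof -
    have "u \<notin> T" using v(2)[of u] that li by auto
    moreover have "u \<noteq> v" using that li by auto
    ultimately show ?thesis using that by (simp add: K_def)
  qed
  have high: "u \<in> T" "u \<noteq> v" if "u \<in> V" "l < fst u" for u
    using Suc.prems(2)[OF v(1) that(1)] that li by auto
  have highK: "K u \<subseteq> KC u" if "u \<in> V" "l < fst u" for u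
    using high[OF that] by (simp add: K_def)
  \<comment> \<open>The interchange lemmas start from a point of the product set; since all
    variables get overwritten, this point may replace \<open>undefined\<close>.\<close>
  have "\<exists>Wb. Wb \<in> PiE V K"
  proof -
    have "K u \<noteq> {}" if "u \<in> V" for u
    proof -
      have "norm (\<zeta> (fst u)) < R" using \<zeta>_less[OF V_level[OF that]] \<delta>(2) by simp
      then have "Rt (fst u) \<noteq> {}" by (rule roots_at_nonempty)
      then show ?thesis using path_image_nonempty[of "Oc (fst u)"] by (auto simp: K_def KA_def KC_def)
    qed
    then have "PiE V K \<noteq> {}" by (simp add: PiE_eq_empty_iff)
    then show ?thesis by blast
  qed
  then obtain Wb where Wb: "Wb \<in> PiE V K" ..
  have base: "iterate_functionals L ?vs F (\<lambda>_. undefined) = iterate_functionals L ?vs F Wb" for L F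
    by (rule iterate_functionals_base_cong) (use PiE_arb[OF Wb] in \<open>auto simp: set_var_list\<close>)
  have vvs: "v \<in> set ?vs" and sub: "set ?vs \<subseteq> V" using vV by (auto simp: set_var_list)
  let ?vs' = "remove1 v ?vs"
  have sub': "set ?vs' \<subseteq> V" and dist': "distinct ?vs'" and vnot: "v \<notin> set ?vs'"
    using sub set_remove1_subset[of v ?vs] distinct_var_list by auto
  have rem: "iterate_functionals (mixed_functional T') ?vs' X Wb = iterate_functionals (mixed_functional T) ?vs' X Wb" for X
    by (rule iterate_functionals_cong) (use vnot in \<open>auto simp: mixed_functional_def T'_def\<close>)
  have diff: "mixed_functional T' v (\<lambda>w. ?F (W(v := w))) - mixed_functional T v (\<lambda>w. ?F (W(v := w))) =
      (- 1) * chain_mean l l (\<lambda>_. i) W" if W: "W \<in> PiE V K" for W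
  proof -
    have "root_sum (l, i) (\<lambda>w. ?F (W((l, i) := w))) - weighted_functional q Oc Cc z (l, i) (\<lambda>w. ?F (W((l, i) := w))) =
        - contour_mean (Cc (l, i)) (\<lambda>w. q w / (q w - \<zeta> l) * ?F (W((l, i) := w)))"
    proof (rule root_sum_minus_functional[OF _ W KKA])
      show "(l, i) \<in> V" using vV li by simp
      show "K (l, i) = KA (l, i)" using li by (simp add: K_def)
      show "K (l - 1, i') \<subseteq> Rt (l - 1)" if "2 \<le> l" "(l - 1, i') \<in> V" for i'
        by (rule low[OF that(2,1)]) simp
      show "K (l + 1, j) \<subseteq> KC (l + 1, j)" if "(l + 1, j) \<in> V" for j
        by (rule highK[OF that]) simp
    qed
    then show ?thesis
      using v(1) by (simp add: mixed_functional_def T'_def li chain_mean_def set_chain_single)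
  qed
  have chain: "cauchy_chain m n I J l l (\<lambda>_. i)" using single_chain vV li by simp
  have cm: "continuous_on (PiE V K) (chain_mean l l (\<lambda>_. i))"
    by (rule chain_mean_continuous[OF KKA low highK chain])
  have "iterate_functionals (mixed_functional T') ?vs ?F Wb - iterate_functionals (mixed_functional T) ?vs ?F Wb =
      iterate_functionals (mixed_functional T) ?vs' (\<lambda>W. mixed_functional T' v (\<lambda>w. ?F (W(v := w)))) Wb -
      iterate_functionals (mixed_functional T) ?vs' (\<lambda>W. mixed_functional T v (\<lambda>w. ?F (W(v := w)))) Wb"
    unfolding S1.iterate_move_inner[OF Hc vvs sub distinct_var_list Wb]
      S2.iterate_move_inner[OF Hc vvs sub distinct_var_list Wb] rem ..
  also have "\<dots> = iterate_functionals (mixed_functional T) ?vs'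
      (\<lambda>W. mixed_functional T' v (\<lambda>w. ?F (W(v := w))) - mixed_functional T v (\<lambda>w. ?F (W(v := w)))) Wb"
    by (rule S1.iterate_diff[OF S2.continuous_apply[OF Hc vV] S1.continuous_apply[OF Hc vV] sub' Wb, symmetric])
  also have "\<dots> = iterate_functionals (mixed_functional T) ?vs' (\<lambda>W. (- 1) * chain_mean l l (\<lambda>_. i) W) Wb"
    by (rule S1.iterate_cong[OF continuous_on_diff[OF S2.continuous_apply[OF Hc vV] S1.continuous_apply[OF Hc vV]] diff sub' Wb])
  also have "\<dots> = (- 1) * iterate_functionals (mixed_functional T) ?vs' (chain_mean l l (\<lambda>_. i)) Wb"
    by (rule S1.iterate_cmult[OF cm sub' Wb])
  \<comment> \<open>The discrepancy of the two functionals is the mean of a one-element chain, which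
    vanishes once the other variables are integrated.\<close>
  also have "iterate_functionals (mixed_functional T) ?vs' (chain_mean l l (\<lambda>_. i)) Wb = 0"
  proof (rule chain_vanish[OF KKA low highK S1.functional_system_axioms _ chain sub' dist' _ Wb])
    show "mixed_functional T u = weighted_functional q Oc Cc z u" if "u \<in> V" "l < fst u" for u
      using high[OF that] by (simp add: mixed_functional_def)
    show "u \<in> set ?vs'" if "u \<in> V" "l < fst u" for u
      using high[OF that] that in_set_remove1[of u v ?vs] by (simp add: set_var_list)
  qed
  finally have eq: "iterate_functionals (mixed_functional T') ?vs ?F Wb = iterate_functionals (mixed_functional T) ?vs ?F Wb"
    by simp
  have "iterate_functionals (mixed_functional T') ?vs ?F (\<lambda>_. undefined) =
      iterate_functionals root_sum ?vs ?F (\<lambda>_. undefined)"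
  proof (rule Suc.hyps(1))
    show "N = card T'" using Suc.hyps(2) v(1) finT by (simp add: T'_def)
    show "T' \<subseteq> V" using Suc.prems(1) by (auto simp: T'_def)
    show "u' \<in> T'" if "u \<in> T'" "u' \<in> V" "fst u < fst u'" for u u'
      using Suc.prems(2)[of u u'] v(2)[of u] that by (auto simp: T'_def)
  qed
  then show ?case using eq unfolding base by simp
qed

definition mixed_contours :: "(nat \<times> nat) set \<Rightarrow> nat \<times> nat \<Rightarrow> real \<Rightarrow> complex" where
  "mixed_contours T u = (if u \<in> T then Nc (fst u) else Cc u)"

lemma supp_KC_disjoint:
  assumes "(l, i) \<in> V" "(l + 1, j) \<in> V"
  shows "(supp (l, i) \<union> KC (l, i)) \<inter> (supp (l + 1, j) \<union> KC (l + 1, j)) = {}"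
proof -
  have l: "1 \<le> l" "l < m" "l \<in> {1..m}" "l + 1 \<in> {1..m}" "l + 1 \<in> {2..m}" using assms by (auto simp: var_idx_def)
  have N: "l \<noteq> 1 \<Longrightarrow> l \<in> {2..m}" using l by auto
  have 1: "sphere 0 (rad v) \<inter> path_image (Nc l') = {}" if "v \<in> V" "l' \<in> {2..m}" for v l'
    using sphere_subset[OF that(1)] Nc(2)[OF that(2)] r1_subset by blast
  have 2: "KC (l, i) \<inter> KC (l + 1, j) = {}" using KA_disjoint[OF assms] by (auto simp: KA_def)
  have 3: "path_image (Oc l) \<subseteq> KC (l, i)" "path_image (Oc (l + 1)) \<subseteq> KC (l + 1, j)" by (auto simp: KC_def)
  have 4: "KC (l, i) \<inter> path_image (Nc (l + 1)) = {}"
    using 1[OF assms(1) l(5)] ON(1)[OF l(3,5)] by (auto simp: KC_def)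
  have 5: "path_image (Nc l) \<inter> KC (l + 1, j) = {}" if "l \<noteq> 1"
    using 1[OF assms(2) N[OF that]] ON(1)[OF l(4) N[OF that]] by (auto simp: KC_def)
  have 6: "path_image (Nc l) \<inter> path_image (Nc (l + 1)) = {}" if "l \<noteq> 1"
    using NN(1)[of l] N[OF that] l(2) by auto
  show ?thesis
    using 2 3 4 5 6 l(1) unfolding contour_support_def fst_conv by (cases "l = 1") auto
qed

text \<open>Here \<open>T\<close> is closed towards lower levels and a variable of maximal level is
  removed: shrinking its inner contour crosses no pole once all higher variables are on circles or
  outer contours and the lower ones still on the original contours.\<close>

lemma circle_functionals_eq_inner_functionals:
  assumes "T \<subseteq> V" "\<And>u u'. u \<in> T \<Longrightarrow> u' \<in> V \<Longrightarrow> fst u' < fst u \<Longrightarrow> u' \<in> T"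
  shows "iterate_functionals (weighted_functional q Oc (mixed_contours T) z) (var_list m n)
      (\<lambda>W. H_fun m I J A W z) (\<lambda>_. undefined) =
    iterate_functionals (weighted_functional q Oc Cc z) (var_list m n) (\<lambda>W. H_fun m I J A W z) (\<lambda>_. undefined)"
  using assms
proof (induction "card T" arbitrary: T)
  case 0
  have "finite T" by (rule finite_subset[OF 0(2) finite_var_idx])
  then have "T = {}" using 0(1) by simp
  then show ?case by (intro iterate_functionals_cong ext) (simp add: weighted_functional_def mixed_contours_def)
next
  case (Suc N)
  let ?F = "\<lambda>W. H_fun m I J A W z" and ?vs = "var_list m n"
  have finT: "finite T" by (rule finite_subset[OF Suc.prems(1) finite_var_idx])
  have neT: "T \<noteq> {}" using Suc.hyps(2) by auto
  have "Max (fst ` T) \<in> fst ` T" using finT neT by (intro Max_in) auto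
  then obtain v where vm: "Max (fst ` T) = fst v" and vT: "v \<in> T" by (rule imageE)
  have v: "v \<in> T" "\<And>u. u \<in> T \<Longrightarrow> fst u \<le> fst v" using vT finT by (auto simp flip: vm)
  obtain l i where li: "v = (l, i)" by fastforce
  define T' where "T' = T - {v}"
  have vV: "v \<in> V" using v Suc.prems(1) by blast
  have lm: "l \<in> {1..m}" using V_level[OF vV] li by simp
  define K where "K u = (if u = v then supp u \<union> KC u else if u \<in> T then supp u else KC u)" for u
  let ?L = "\<lambda>T. weighted_functional q Oc (mixed_contours T) z"
  have KU: "K u \<subseteq> supp u \<union> KC u" for u by (auto simp: K_def)
  have K\<Omega>: "K u \<subseteq> \<Omega> - {0}" if "u \<in> V" for u
    using KU[of u] KA_subset[OF that] supp_subset[OF that] by (auto simp: KA_def)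
  have smooth: "smooth_loop (mixed_contours S u)" if "u \<in> V" "fst u \<noteq> 1" for u S
    using supp_smooth[OF that] smooth_loop_circlepath by (simp add: mixed_contours_def)
  have Kc: "compact (K u)" if "u \<in> V" for u
  proof -
    have "compact (supp u)" by (rule compact_contour_support[OF that]) (rule supp_smooth[OF that])
    then show ?thesis using compact_KC[OF that] by (auto simp: K_def intro: compact_Un)
  qed
  have bd: "bounded_functional (K u) (?L S u)" if "u \<in> V" "S = T \<or> S = T'" for u S
  proof (rule bounded_functional_mono)
    show "bounded_functional (contour_support Oc (mixed_contours S) u) (?L S u)"
      by (rule bounded_weighted_functional[OF z_polydisc(1) that(1)]) (rule smooth[OF that(1)])
    show "contour_support Oc (mixed_contours S) u \<subseteq> K u"
    proof (cases "u \<in> S")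
      case True
      then have "u = v \<or> u \<in> T" using that(2) by (auto simp: T'_def)
      then have "supp u \<subseteq> K u" by (auto simp: K_def)
      then show ?thesis using True by (auto simp: contour_support_def mixed_contours_def split: if_splits)
    next
      case False
      then have "u = v \<or> u \<notin> T" using that(2) by (auto simp: T'_def)
      then have "KC u \<subseteq> K u" by (auto simp: K_def)
      moreover have "contour_support Oc (mixed_contours S) u = contour_support Oc Cc u"
        using False by (simp add: contour_support_def mixed_contours_def)
      ultimately show ?thesis using contour_support_Cc[OF that(1)] by blast
    qed
  qed
  interpret S1: functional_system V K "?L T" by unfold_locales (use Kc bd in auto)
  interpret S2: functional_system V K "?L T'" by unfold_locales (use Kc bd in auto)
  have nc: "no_collision m I J W" if "W \<in> PiE V K" for W
    by (rule no_collision_if_disjoint[OF that]) (use supp_KC_disjoint KU in blast)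
  have Hc: "continuous_on (PiE V K) ?F" by (rule H_continuous[OF K\<Omega> nc])
  have "PiE V K \<noteq> {}"
    using path_image_nonempty by (auto simp: PiE_eq_empty_iff K_def contour_support_def KC_def)
  then obtain Wb where Wb: "Wb \<in> PiE V K" by blast
  have base: "iterate_functionals L ?vs F (\<lambda>_. undefined) = iterate_functionals L ?vs F Wb" for L F
    by (rule iterate_functionals_base_cong) (use PiE_arb[OF Wb] in \<open>auto simp: set_var_list\<close>)
  have vvs: "v \<in> set ?vs" and sub: "set ?vs \<subseteq> V" using vV by (auto simp: set_var_list)
  let ?vs' = "remove1 v ?vs"
  have sub': "set ?vs' \<subseteq> V" and vnot: "v \<notin> set ?vs'"
    using sub set_remove1_subset[of v ?vs] distinct_var_list by auto
  have rem: "iterate_functionals (?L T') ?vs' X Wb = iterate_functionals (?L T) ?vs' X Wb" for X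
    by (rule iterate_functionals_cong, rule ext)
       (use vnot in \<open>auto simp: weighted_functional_def mixed_contours_def T'_def\<close>)
  have same: "?L T' v (\<lambda>w. ?F (W(v := w))) = ?L T v (\<lambda>w. ?F (W(v := w)))" if W: "W \<in> PiE V K" for W
  proof (cases "l = 1")
    case True
    then show ?thesis by (simp add: weighted_functional_def li)
  next
    case False
    then have l2: "2 \<le> l" using lm by auto
    have W0: "W \<in> PiE V (\<lambda>_. \<Omega> - {0})" using PiE_mono[of V K] K\<Omega> W by blast
    have upd: "W(v := w) \<in> PiE V K" if "w \<in> K v" for w by (rule PiE_fun_upd_in[OF W vV that])
    have cont: "continuous_on S (\<lambda>w. ?F (W(v := w)))" if "S \<subseteq> K v" for S
    proof (rule H_fun_update_continuous[OF vV _ _ K\<Omega> nc])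
      show "S \<subseteq> \<Omega> - {0}" using that K\<Omega>[OF vV] by (rule subset_trans)
      show "W(v := w) \<in> PiE V K" if "w \<in> S" for w
        by (rule upd) (use that \<open>S \<subseteq> K v\<close> in blast)
    qed
    have c1: "continuous_on (path_image (Nc l)) (\<lambda>w. ?F (W(v := w)))"
      by (rule cont) (use False li in \<open>auto simp: K_def contour_support_def\<close>)
    have c2: "continuous_on (path_image (Cc v)) (\<lambda>w. ?F (W(v := w)))"
      by (rule cont) (use image_Cc[OF vV] in \<open>auto simp: K_def KC_def\<close>)
    have "contour_mean (Nc l) (\<lambda>w. ?F (W((l, i) := w))) = contour_mean (Cc (l, i)) (\<lambda>w. ?F (W((l, i) := w)))"
    proof (rule mean_inner_eq_mean_circle[OF _ l2 W0 nc[OF W]])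
      show "(l, i) \<in> V" using vV li by simp
      show "W (l - 1, i') \<in> supp (l - 1, i')" if "(l - 1, i') \<in> V" for i'
      proof -
        have "(l - 1, i') \<noteq> v" "(l - 1, i') \<in> T" using Suc.prems(2)[OF v(1) that] l2 li by auto
        then show ?thesis using PiE_mem[OF W that] by (simp add: K_def)
      qed
      show "W (l + 1, j) \<in> KC (l + 1, j)" if "(l + 1, j) \<in> V" for j
      proof -
        have "(l + 1, j) \<noteq> v" "(l + 1, j) \<notin> T" using v(2)[of "(l + 1, j)"] li by auto
        then show ?thesis using PiE_mem[OF W that] by (simp add: K_def)
      qed
    qed
    moreover have "contour_mean (Nc l) (\<lambda>w. inner_weight z l * ?F (W(v := w))) =
        inner_weight z l * contour_mean (Nc l) (\<lambda>w. ?F (W(v := w)))"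
      using l2 lm by (intro bounded_functional_cmult[OF smooth_loopD(5)[OF Nc(1)] c1]) auto
    moreover have "contour_mean (Cc v) (\<lambda>w. inner_weight z l * ?F (W(v := w))) =
        inner_weight z l * contour_mean (Cc v) (\<lambda>w. ?F (W(v := w)))"
      by (rule bounded_functional_cmult[OF smooth_loopD(5)[OF smooth_loop_circlepath] c2])
    ultimately have "contour_mean (Nc l) (\<lambda>w. inner_weight z l * ?F (W(v := w))) =
        contour_mean (Cc v) (\<lambda>w. inner_weight z l * ?F (W(v := w)))" by (simp only: li)
    then show ?thesis using v(1) by (simp add: weighted_functional_def mixed_contours_def T'_def li)
  qed
  have "iterate_functionals (?L T') ?vs ?F Wb = iterate_functionals (?L T) ?vs' (\<lambda>W. ?L T' v (\<lambda>w. ?F (W(v := w)))) Wb"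
    unfolding S2.iterate_move_inner[OF Hc vvs sub distinct_var_list Wb] rem ..
  also have "\<dots> = iterate_functionals (?L T) ?vs' (\<lambda>W. ?L T v (\<lambda>w. ?F (W(v := w)))) Wb"
    by (rule S1.iterate_cong[OF S2.continuous_apply[OF Hc vV] same sub' Wb])
  also have "\<dots> = iterate_functionals (?L T) ?vs ?F Wb"
    by (rule S1.iterate_move_inner[OF Hc vvs sub distinct_var_list Wb, symmetric])
  finally have eq: "iterate_functionals (?L T') ?vs ?F Wb = iterate_functionals (?L T) ?vs ?F Wb" .
  have "iterate_functionals (?L T') ?vs ?F (\<lambda>_. undefined) =
      iterate_functionals (weighted_functional q Oc Cc z) ?vs ?F (\<lambda>_. undefined)"
  proof (rule Suc.hyps(1))
    show "N = card T'" using Suc.hyps(2) v(1) finT by (simp add: T'_def)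
    show "T' \<subseteq> V" using Suc.prems(1) by (auto simp: T'_def)
    show "u' \<in> T'" if "u \<in> T'" "u' \<in> V" "fst u' < fst u" for u u'
      using Suc.prems(2)[of u u'] v(2)[of u] that by (auto simp: T'_def)
  qed
  then show ?case using eq unfolding base by simp
qed

lemma G_fun_eq_root_sums:
  "G_fun \<Omega> m n I J A q z =
     iterate_functionals root_sum (var_list m n) (\<lambda>W. H_fun m I J A W z) (\<lambda>_. undefined)"
proof -
  let ?c = "\<lambda>v w. q w / deriv q w"
  have "iterate_functionals root_sum (var_list m n) (\<lambda>W. H_fun m I J A W z) (\<lambda>_. undefined) =
      iterate_functionals (\<lambda>v f. \<Sum>w\<in>Rt (fst v). ?c v w * f w) (var_list m n) (\<lambda>W. H_fun m I J A W z) (\<lambda>_. undefined)"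
    by (rule iterate_functionals_cong) (auto simp: root_sum_def)
  also have "\<dots> = (\<Sum>X\<in>PiE V (\<lambda>v. Rt (fst v)). (\<Prod>v\<in>V. ?c v (X v)) *
      H_fun m I J A (\<lambda>u. if u \<in> V then X u else undefined) z)"
    using iterate_finite_sums[OF distinct_var_list, of "\<lambda>v. Rt (fst v)" ?c "\<lambda>W. H_fun m I J A W z" "\<lambda>_. undefined"]
      root_facts(1)[OF V_level] by (simp add: set_var_list)
  also have "\<dots> = (\<Sum>X\<in>PiE V (\<lambda>v. Rt (fst v)). (\<Prod>l\<in>{1..m}. \<Prod>i\<in>{1..n l}. q (X (l, i)) / deriv q (X (l, i))) * H_fun m I J A X z)"
  proof (rule sum.cong[OF refl])
    fix X assume X: "X \<in> PiE V (\<lambda>v. Rt (fst v))"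
    have "(\<lambda>u. if u \<in> V then X u else undefined) = X" using PiE_arb[OF X] by auto
    moreover have "(\<Prod>v\<in>V. ?c v (X v)) = (\<Prod>l\<in>{1..m}. \<Prod>i\<in>{1..n l}. q (X (l, i)) / deriv q (X (l, i)))"
      unfolding var_idx_def by (subst prod.Sigma) (auto simp: case_prod_beta)
    ultimately show "(\<Prod>v\<in>V. ?c v (X v)) * H_fun m I J A (\<lambda>u. if u \<in> V then X u else undefined) z =
        (\<Prod>l\<in>{1..m}. \<Prod>i\<in>{1..n l}. q (X (l, i)) / deriv q (X (l, i))) * H_fun m I J A X z" by simp
  qed
  finally have "iterate_functionals root_sum (var_list m n) (\<lambda>W. H_fun m I J A W z) (\<lambda>_. undefined) =
      (\<Sum>X\<in>PiE V (\<lambda>v. Rt (fst v)). (\<Prod>l\<in>{1..m}. \<Prod>i\<in>{1..n l}. q (X (l, i)) / deriv q (X (l, i))) * H_fun m I J A X z)" .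
  moreover have "(\<lambda>(l, i :: nat). Rt l) = (\<lambda>v. Rt (fst v))" by (simp add: fun_eq_iff)
  ultimately show ?thesis unfolding G_fun_def by simp
qed

theorem G_fun_eq_extension: "G_fun \<Omega> m n I J A q z = extension z"
proof -
  have "extension z = iterate_functionals (weighted_functional q Oc (mixed_contours V) z) (var_list m n)
      (\<lambda>W. H_fun m I J A W z) (\<lambda>_. undefined)"
    unfolding extension_def
    by (rule iterate_functionals_cong, rule ext)
       (simp add: weighted_functional_def mixed_contours_def set_var_list)
  also have "\<dots> = iterate_functionals (weighted_functional q Oc Cc z) (var_list m n) (\<lambda>W. H_fun m I J A W z) (\<lambda>_. undefined)"
    by (rule circle_functionals_eq_inner_functionals) auto
  also have "\<dots> = iterate_functionals (mixed_functional V) (var_list m n) (\<lambda>W. H_fun m I J A W z) (\<lambda>_. undefined)"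
    by (rule iterate_functionals_cong) (simp add: mixed_functional_def set_var_list)
  also have "\<dots> = iterate_functionals root_sum (var_list m n) (\<lambda>W. H_fun m I J A W z) (\<lambda>_. undefined)"
    by (rule root_sums_eq_circle_functionals) auto
  finally show ?thesis by (simp add: G_fun_eq_root_sums)
qed

end


section \<open>Arbitrary nested contours\<close>

context contour_setup
begin

lemma H_fun_holomorphic_update:
  assumes U: "\<And>v. v \<in> V \<Longrightarrow> U v \<subseteq> \<Omega> - {0}" and nc: "\<And>W. W \<in> PiE V U \<Longrightarrow> no_collision m I J W"
    and W: "W \<in> PiE V U" and v: "v \<in> V" and z: "z \<in> polydisc m R"
  shows "(\<lambda>w. H_fun m I J A (W(v := w)) z) holomorphic_on U v"
proof -
  obtain l i where li: "v = (l, i)" by fastforce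
  have chain: "cauchy_chain m n I J l l (\<lambda>_. i)" using v li by (auto simp: cauchy_chain_def var_idx_def)
  have W0: "W \<in> PiE V (\<lambda>_. \<Omega> - {0})" using PiE_mono[of V U] U W by blast
  have "(\<lambda>w. cauchy_product m I J (W(v := w))) holomorphic_on U v"
  proof (rule holomorphic_on_cauchy_product)
    show "(\<lambda>w. (W(v := w)) u) holomorphic_on U v" for u by (cases "u = v") auto
    show "no_collision m I J (W(v := w))" if "w \<in> U v" for w
      by (rule nc[OF PiE_fun_upd_in[OF W v that]])
  qed (use finite_I finite_J in auto)
  moreover have "(\<lambda>w. A (W(v := w)) z) holomorphic_on U v"
    using holomorphic_on_subset[OF A_holomorphic_chain[OF data \<Omega>(1) chain W0 z] U[OF v]]
    by (simp add: set_chain_single li)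
  ultimately show ?thesis unfolding H_fun_eq by (rule holomorphic_on_mult)
qed

lemma G_fun_eq_extension_punctured:
  assumes z: "z \<in> punctured_polydisc m \<delta>"
  shows "G_fun \<Omega> m n I J A q z = extension z"
proof -
  define S where "S = (\<Union>l\<in>{1..m}. roots_at \<Omega> q (z_hat z l))"
  have zp: "z \<in> polydisc m \<delta>" using z punctured_polydisc_subset by blast
  have "norm (z_hat z l) < R" if "l \<in> {1..m}" for l
    using norm_z_hat_less[OF zp, of l] that \<delta>(2) by auto
  then have "finite S" unfolding S_def by (intro finite_UN_I finite_roots_at) auto
  have "z_hat z l \<noteq> 0" if "l \<in> {1..m}" for l
    using z that by (auto simp: z_hat_def punctured_polydisc_def PiE_iff)
  then have "0 \<notin> S" using q_0 by (auto simp: S_def roots_at_def)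
  then have "open (- S)" "0 \<in> - S" using \<open>finite S\<close> by (auto intro: finite_imp_closed open_Compl)
  \<comment> \<open>The finitely many roots avoid \<open>0\<close>, which leaves room for the
    circles.\<close>
  then obtain e where e: "e > 0" "cball 0 e \<subseteq> - S" using open_contains_cball by blast
  interpret chain_setup \<Omega> q R m n I J A Oc Nc \<rho> \<delta> z "min e \<rho>"
  proof unfold_locales
    show "roots_at \<Omega> q (z_hat z l) \<inter> cball 0 (min e \<rho>) = {}" if "l \<in> {1..m}" for l
      using that e(2) by (auto simp: S_def subset_iff)
  qed (use z e \<rho> in auto)
  show ?thesis by (rule G_fun_eq_extension)
qed

end

context level_curves
begin

text \<open>The bound \<open>\<delta>\<close> lies below \<open>|q|\<close> on the outer contours,
  so for \<open>z\<close> in the smaller polydisc the weights have no pole there. A single function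
  then equals \<open>G\<close> off the coordinate hyperplanes and the limit integral at
  \<open>z 0 = 0\<close>.\<close>

lemma nested_contours_extension:
  assumes m: "m \<ge> 1"
    and I: "\<And>l. 1 \<le> l \<Longrightarrow> l < m \<Longrightarrow> I l \<subseteq> {1..n l}"
    and J: "\<And>l. 1 \<le> l \<Longrightarrow> l < m \<Longrightarrow> J (l + 1) \<subseteq> {1..n (l + 1)}"
    and data: "analytic_data \<Omega> m n R A" and dom: "dominates_at_0 \<Omega> m n I J R A q"
    and nest: "nested_contours \<Omega> m Sout S1 Sin" and \<delta>: "0 < \<delta>" "\<delta> \<le> R"
    and q1: "\<And>w. w \<in> path_image S1 \<Longrightarrow> \<delta> < norm (q w)"
    and q2: "\<And>l w. l \<in> {2..m} \<Longrightarrow> w \<in> path_image (Sout l) \<Longrightarrow> \<delta> < norm (q w)"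
  obtains E where "analytic_in {..<m} E (polydisc m \<delta>)"
    "\<And>z. z \<in> punctured_polydisc m \<delta> \<Longrightarrow> E z = G_fun \<Omega> m n I J A q z"
    "\<And>z. z \<in> polydisc m \<delta> \<Longrightarrow> z 0 = 0 \<Longrightarrow> E z = limit_integral m n I J A Sout S1 Sin z"
proof -
  define \<Sigma>s where "\<Sigma>s = rev (map Sout [2..<Suc m]) @ [S1] @ map Sin [2..<Suc m]"
  define \<Sigma> where "\<Sigma> j = \<Sigma>s ! j" for j
  define M where "M = 2 * m - 1"
  have len: "length \<Sigma>s = M" using m by (simp add: \<Sigma>s_def M_def del: upt_Suc)
  have nest': "\<And>\<gamma>. \<gamma> \<in> set \<Sigma>s \<Longrightarrow> ccw_contour_around_0 \<gamma> \<and> path_image \<gamma> \<subseteq> \<Omega>"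
    "sorted_wrt (\<lambda>\<gamma> \<gamma>'. path_image \<gamma>' \<subseteq> inside (path_image \<gamma>)) \<Sigma>s"
    using nest unfolding nested_contours_def Let_def \<Sigma>s_def[symmetric] by blast+
  have mem: "\<Sigma> j \<in> set \<Sigma>s" if "j < M" for j using that len by (simp add: \<Sigma>_def)
  have ccw: "ccw_contour_around_0 (\<Sigma> j)" and im\<Omega>: "path_image (\<Sigma> j) \<subseteq> \<Omega>" if "j < M" for j
    using nest'(1)[OF mem[OF that]] by auto
  have nested_idx: "path_image (\<Sigma> j) \<subseteq> inside (path_image (\<Sigma> i))" if "i < j" "j < M" for i j
    using sorted_wrt_nth_less[OF nest'(2) that(1)] that(2) len by (simp add: \<Sigma>_def)
  \<comment> \<open>In the list of \<open>2 * m - 1\<close> contours the outer ones occupy positions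
    \<open>0\<close> to \<open>m - 2\<close> in decreasing level, \<open>S1\<close> sits at
    \<open>m - 1\<close>, and the inner ones follow in increasing level.\<close>
  have \<Sigma>O: "\<Sigma> (m - l) = Sout l" if "l \<in> {2..m}" for l
  proof -
    have "Suc (Suc (m - Suc (Suc (m - l)))) = l" using that by auto
    then show ?thesis using that by (auto simp: \<Sigma>_def \<Sigma>s_def nth_append rev_nth simp del: upt_Suc)
  qed
  have \<Sigma>1: "\<Sigma> (m - 1) = S1"
    using m by (auto simp: \<Sigma>_def \<Sigma>s_def nth_append simp del: upt_Suc)
  have \<Sigma>N: "\<Sigma> (m + l - 2) = Sin l" if "l \<in> {2..m}" for l
  proof -
    have "m + l - 2 - (m - 1) = Suc (l - 2)" "Suc (Suc (l - 2)) = l" using that m by auto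
    then show ?thesis using that by (auto simp: \<Sigma>_def \<Sigma>s_def nth_append simp del: upt_Suc)
  qed
  have O_idx: "m - l < M" "m - l < m" if "l \<in> {1..m}" for l using that by (auto simp: M_def)
  have N_idx: "m + l - 2 < M" "\<not> m + l - 2 < m" if "l \<in> {2..m}" for l using that by (auto simp: M_def)
  have qO': "\<delta> < norm (q w)" if "j < m" "w \<in> path_image (\<Sigma> j)" for j w
  proof (cases "j = m - 1")
    case True
    then show ?thesis using that q1 \<Sigma>1 by simp
  next
    case False
    then have "m - j \<in> {2..m}" "m - (m - j) = j" using that by auto
    then show ?thesis using that q2[of "m - j"] \<Sigma>O[of "m - j"] by simp
  qed
  define Z where "Z = \<Omega> \<inter> (\<Inter>j\<in>{..<M}. inside (path_image (\<Sigma> j)))"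
  have "open Z"
    unfolding Z_def
  proof (intro open_Int \<Omega>(1) open_INT ballI)
    fix j assume "j \<in> {..<M}"
    then have "simple_path (\<Sigma> j)" "pathfinish (\<Sigma> j) = pathstart (\<Sigma> j)"
      using ccw[of j] by (auto simp: ccw_contour_around_0_def simple_closed_contour_def)
    from Jordan_inside_outside[OF this] show "open (inside (path_image (\<Sigma> j)))" by blast
  qed simp
  moreover have "0 \<in> Z"
    using \<Omega>(3) ccw by (auto simp: ccw_contour_around_0_def Z_def)
  ultimately obtain \<rho> where "\<rho> > 0" "cball 0 \<rho> \<subseteq> Z"
    using open_contains_cball by blast
  then have \<rho>: "\<rho> > 0" "cball 0 \<rho> \<subseteq> \<Omega> \<inter> (\<Inter>j\<in>{..<M}. inside (path_image (\<Sigma> j)))"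
    by (simp_all only: Z_def)
  have \<rho>in: "w \<in> inside (path_image (\<Sigma> j))" if "w \<in> cball 0 \<rho>" "j < M" for w j
    using subsetD[OF \<rho>(2) that(1)] that(2) by blast
  \<comment> \<open>Smoothing must keep all contours off the disc around \<open>0\<close> and the
    first \<open>m\<close> of them where \<open>|q| > \<delta>\<close>.\<close>
  define E where "E j = (\<Omega> - cball 0 \<rho>) \<inter> (if j < m then \<Omega> \<inter> q -` (- cball 0 \<delta>) else UNIV)" for j
  have "open (\<Omega> \<inter> q -` (- cball 0 \<delta>))"
    using continuous_open_preimage[OF holomorphic_on_imp_continuous_on[OF q_holomorphic] \<Omega>(1)] by (simp add: open_Compl)
  then have E_open: "open (E j)" for j
    unfolding E_def using \<Omega>(1) by (auto intro!: open_Int open_Diff)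
  have E_im: "path_image (\<Sigma> j) \<subseteq> E j" if "j < M" for j
  proof
    fix w assume w: "w \<in> path_image (\<Sigma> j)"
    then have "w \<notin> cball 0 \<rho>" using \<rho>in[OF _ that, of w] inside_no_overlap[of "path_image (\<Sigma> j)"] by blast
    then show "w \<in> E j" using w im\<Omega>[OF that] qO'[OF _ w] by (auto simp: E_def)
  qed
  obtain U p where Up: "\<And>j. j < M \<Longrightarrow> open (U j)" "\<And>j. j < M \<Longrightarrow> U j \<subseteq> E j"
    "\<And>i j. i < j \<Longrightarrow> j < M \<Longrightarrow> U i \<inter> U j = {}"
    "\<And>j. j < M \<Longrightarrow> path_image (\<Sigma> j) \<subseteq> U j"
    "\<And>j. j < M \<Longrightarrow> valid_path (p j)" "\<And>j. j < M \<Longrightarrow> pathfinish (p j) = pathstart (p j)"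
    "\<And>j. j < M \<Longrightarrow> path_image (p j) \<subseteq> U j"
    "\<And>j. j < M \<Longrightarrow> continuous_on {0..1} (\<lambda>t. vector_derivative (p j) (at t))"
    "\<And>j f. j < M \<Longrightarrow> f holomorphic_on U j \<Longrightarrow> contour_integral (p j) f = contour_integral (\<Sigma> j) f"
    "\<And>i j w. i < j \<Longrightarrow> j < M \<Longrightarrow> w \<in> U i \<Longrightarrow> winding_number (p j) w = 0"
    "\<And>j w. j < M \<Longrightarrow> w \<notin> E j \<Longrightarrow> winding_number (p j) w = winding_number (\<Sigma> j) w"
    by (rule smooth_nested_contours[of M \<Sigma> E, OF ccw nested_idx E_open E_im]) (assumption | rule that)+
  have smooth: "smooth_loop (p j)" if "j < M" for j
    using Up(5,6,8)[OF that] by (simp add: smooth_loop_def)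
  have p_im: "path_image (p j) \<subseteq> \<Omega> - cball 0 \<rho>" if "j < M" for j
    using Up(2,7)[OF that] by (auto simp: E_def)
  have p_wn: "winding_number (p j) w = 1" if "j < M" "w \<in> cball 0 \<rho>" for j w
  proof -
    have "winding_number (p j) w = winding_number (\<Sigma> j) w" by (rule Up(11)[OF that(1)]) (use that in \<open>auto simp: E_def\<close>)
    also have "\<dots> = 1" by (rule ccw_winding_number_inside[OF ccw[OF that(1)] \<rho>in[OF that(2,1)]])
    finally show ?thesis .
  qed
  \<comment> \<open>At \<open>l = 1\<close> this is the loop replacing \<open>S1\<close>, which acts
    as the outer contour of level 1.\<close>
  define Oc where "Oc l = p (m - l)" for l
  define Nc where "Nc l = p (m + l - 2)" for l
  interpret contour_setup \<Omega> q R m n I J A Oc Nc \<rho> \<delta>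
  proof unfold_locales
    show "\<And>l. l \<in> {1..m} \<Longrightarrow> smooth_loop (Oc l)" "\<And>l. l \<in> {1..m} \<Longrightarrow> path_image (Oc l) \<subseteq> \<Omega> - cball 0 \<rho>"
      "\<And>l w. l \<in> {1..m} \<Longrightarrow> w \<in> cball 0 \<rho> \<Longrightarrow> winding_number (Oc l) w = 1"
      unfolding Oc_def using smooth p_im p_wn O_idx(1) by blast+
    show "\<And>l. l \<in> {2..m} \<Longrightarrow> smooth_loop (Nc l)" "\<And>l. l \<in> {2..m} \<Longrightarrow> path_image (Nc l) \<subseteq> \<Omega> - cball 0 \<rho>"
      "\<And>l w. l \<in> {2..m} \<Longrightarrow> w \<in> cball 0 \<rho> \<Longrightarrow> winding_number (Nc l) w = 1"
      unfolding Nc_def using smooth p_im p_wn N_idx(1) by blast+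
    fix l assume l: "1 \<le> l" "l < m"
    then have idx: "m - (l + 1) < m - l" "m - l < M" by (auto simp: M_def)
    show "path_image (Oc l) \<inter> path_image (Oc (l + 1)) = {}"
      unfolding Oc_def using Up(3)[OF idx] Up(7)[OF idx(2)] Up(7)[of "m - (l + 1)"] idx by auto
    show "winding_number (Oc l) w = 0" if "w \<in> path_image (Oc (l + 1))" for w
      unfolding Oc_def using Up(10)[OF idx] Up(7)[of "m - (l + 1)"] idx that by (auto simp: Oc_def)
  next
    fix l assume l: "2 \<le> l" "l < m"
    then have idx: "m + l - 2 < m + (l + 1) - 2" "m + (l + 1) - 2 < M" by (auto simp: M_def)
    show "path_image (Nc l) \<inter> path_image (Nc (l + 1)) = {}"
      unfolding Nc_def using Up(3)[OF idx] Up(7)[OF idx(2)] Up(7)[of "m + l - 2"] idx by auto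
    show "winding_number (Nc (l + 1)) w = 0" if "w \<in> path_image (Nc l)" for w
      unfolding Nc_def using Up(10)[OF idx] Up(7)[of "m + l - 2"] idx that by (auto simp: Nc_def)
  next
    fix l l' assume l: "l \<in> {1..m}" "l' \<in> {2..m}"
    then have idx: "m - l < m + l' - 2" "m + l' - 2 < M" by (auto simp: M_def)
    show "path_image (Oc l) \<inter> path_image (Nc l') = {}"
      unfolding Nc_def Oc_def using Up(3)[OF idx] Up(7)[OF idx(2)] Up(7)[of "m - l"] idx by auto
    show "winding_number (Nc l') w = 0" if "w \<in> path_image (Oc l)" for w
      unfolding Nc_def using Up(10)[OF idx] Up(7)[of "m - l"] idx that by (auto simp: Oc_def)
  next
    fix l w assume l: "l \<in> {1..m}" "w \<in> path_image (Oc l)"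
    then have "w \<in> E (m - l)" using Up(2,7)[OF O_idx(1)[OF l(1)]] by (auto simp: Oc_def)
    then show "\<delta> \<le> norm (q w)" using O_idx(2)[OF l(1)] by (auto simp: E_def)
  qed (use m I J data dom \<rho> \<delta> in auto)
  \<comment> \<open>Neighbourhoods of both contours of a variable: holomorphy of the integrand there
    is what the replacement of the original contours by smooth ones uses.\<close>
  define Uv where "Uv v = (if fst v = 1 then {} else U (m + fst v - 2)) \<union> U (m - fst v)" for v :: "nat \<times> nat"
  have Uv_\<Omega>: "Uv v \<subseteq> \<Omega> - {0}" if v: "v \<in> V" for v
  proof -
    have "U j \<subseteq> \<Omega> - {0}" if "j < M" for j using Up(2)[OF that] \<rho>(1) by (auto simp: E_def)
    moreover have "m - fst v < M" "fst v \<noteq> 1 \<Longrightarrow> m + fst v - 2 < M" using V_level[OF v] by (auto simp: M_def)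
    ultimately show ?thesis by (auto simp: Uv_def)
  qed
  have Uv_nc: "no_collision m I J W" if "W \<in> PiE V Uv" for W
  proof (rule no_collision_if_disjoint[OF that])
    fix l i j assume "(l, i) \<in> V" "(l + 1, j) \<in> V"
    then have l: "1 \<le> l" "l < m" by (auto simp: var_idx_def)
    have d: "U a \<inter> U b = {}" if "a \<noteq> b" "a < M" "b < M" for a b
      using Up(3)[of a b] Up(3)[of b a] that by (metis inf_commute nat_neq_iff)
    have "U (m - l) \<inter> U (m - (l + 1)) = {}" "U (m - l) \<inter> U (m + (l + 1) - 2) = {}"
      by (rule d; use l in \<open>auto simp: M_def\<close>)+
    moreover have "U (m + l - 2) \<inter> U (m - (l + 1)) = {}" "U (m + l - 2) \<inter> U (m + (l + 1) - 2) = {}" if "l \<noteq> 1"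
      by (rule d; use l that in \<open>auto simp: M_def\<close>)+
    ultimately show "Uv (l, i) \<inter> Uv (l + 1, j) = {}"
      unfolding Uv_def fst_conv by (cases "l = 1") auto
  qed
  have "extension z = limit_integral m n I J A Sout S1 Sin z" if z: "z \<in> polydisc m \<delta>" "z 0 = 0" for z
  proof -
    have zR: "z \<in> polydisc m R" using z(1) polydisc_subset by blast
    obtain W0 where W0: "W0 \<in> PiE V supp" by (rule supp_nonempty) (rule that)
    have supp_Uv: "supp v \<subseteq> Uv v" if "v \<in> V" for v
    proof -
      have "m - fst v < M" "fst v \<noteq> 1 \<Longrightarrow> m + fst v - 2 < M" using V_level[OF that] by (auto simp: M_def)
      then show ?thesis using Up(7) by (auto simp: contour_support_def Uv_def Oc_def Nc_def)
    qed
    have W0U: "W0 \<in> PiE V Uv" using PiE_mono[of V supp Uv] supp_Uv W0 by blast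
    have mean_eq: "contour_mean (p j) f = contour_mean (\<Sigma> j) f" if "j < M" "f holomorphic_on U j" for j f
      using Up(9)[OF that] by (simp add: contour_mean_def)
    have zhat: "z_hat z l = 0" if "1 \<le> l" for l
      using z(2) that by (auto simp: z_hat_def intro!: prod_zero)
    \<comment> \<open>At \<open>z 0 = 0\<close> all \<open>z_hat z l\<close> vanish, so the outer
      weight is the constant \<open>1 - inner_weight z l\<close>. It is 1 at level 1 and
      \<open>- z (l - 1) / (1 - z (l - 1))\<close> above, the coefficient of the outer integral in
      the limit formula.\<close>
    have func: "level_functional Sout S1 Sin z v f = weighted_functional q Oc (\<lambda>v. Nc (fst v)) z v f"
      if v: "v \<in> V" and f: "f holomorphic_on Uv v" for v f
    proof -
      define l where "l = fst v"
      have l: "l \<in> {1..m}" unfolding l_def by (rule V_level[OF v])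
      have fO: "f holomorphic_on U (m - l)" using f by (rule holomorphic_on_subset) (auto simp: Uv_def l_def)
      have cO: "continuous_on (path_image (Oc l)) f"
        using holomorphic_on_imp_continuous_on[OF fO] Up(7)[OF O_idx(1)[OF l]] continuous_on_subset by (auto simp: Oc_def)
      have outer: "contour_mean (Oc l) (\<lambda>w. outer_weight q z l w * f w) = (1 - inner_weight z l) * contour_mean (Oc l) f"
      proof -
        have "outer_weight q z l w * f w = (1 - inner_weight z l) * f w" if "w \<in> path_image (Oc l)" for w
        proof -
          have "q w \<noteq> 0" using qO[OF l that] \<delta>(1) by auto
          then show ?thesis using zhat l by (simp add: outer_weight_def)
        qed
        then have "contour_mean (Oc l) (\<lambda>w. outer_weight q z l w * f w) = contour_mean (Oc l) (\<lambda>w. (1 - inner_weight z l) * f w)"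
          unfolding contour_mean_def by (intro arg_cong2[where f = "(/)"] contour_integral_eq refl)
        then show ?thesis using bounded_functional_cmult[OF smooth_loopD(5)[OF Oc(1)[OF l]] cO] by simp
      qed
      have meanO: "contour_mean (Oc l) f = contour_mean (\<Sigma> (m - l)) f"
        unfolding Oc_def by (rule mean_eq[OF O_idx(1)[OF l] fO])
      show ?thesis
      proof (cases "l = 1")
        case True
        then show ?thesis
          using outer meanO \<Sigma>1 by (simp add: level_functional_def weighted_functional_def l_def inner_weight_def)
      next
        case False
        then have l2: "l \<in> {2..m}" using l by auto
        have fN: "f holomorphic_on U (m + l - 2)"
          using f by (rule holomorphic_on_subset) (use False in \<open>auto simp: Uv_def l_def\<close>)
        have cN: "continuous_on (path_image (Nc l)) f"
          using holomorphic_on_imp_continuous_on[OF fN] Up(7)[OF N_idx(1)[OF l2]] continuous_on_subset by (auto simp: Nc_def)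
        have "contour_mean (Nc l) (\<lambda>w. inner_weight z l * f w) = inner_weight z l * contour_mean (Nc l) f"
          by (rule bounded_functional_cmult[OF smooth_loopD(5)[OF Nc(1)[OF l2]] cN])
        moreover have "contour_mean (Nc l) f = contour_mean (\<Sigma> (m + l - 2)) f"
          unfolding Nc_def by (rule mean_eq[OF N_idx(1)[OF l2] fN])
        moreover have "1 - z (l - 1) \<noteq> 0" by (rule weights_nonzero(1)[OF z(1) l False])
        then have "1 - inner_weight z l = - (z (l - 1) / (1 - z (l - 1)))"
          using False by (simp add: inner_weight_def field_simps)
        ultimately show ?thesis
          using outer meanO False \<Sigma>O[OF l2] \<Sigma>N[OF l2]
          by (simp add: level_functional_def weighted_functional_def l_def inner_weight_def Let_def)
      qed
    qed
    have loc: "level_functional Sout S1 Sin z v f = level_functional Sout S1 Sin z v g"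
      if v: "v \<in> V" and fg: "\<And>w. w \<in> Uv v \<Longrightarrow> f w = g w" for v f g
    proof -
      define l where "l = fst v"
      have l: "l \<in> {1..m}" unfolding l_def by (rule V_level[OF v])
      have "contour_mean (\<Sigma> (m - l)) f = contour_mean (\<Sigma> (m - l)) g"
        unfolding contour_mean_def using Up(4)[OF O_idx(1)[OF l]]
        by (intro arg_cong2[where f = "(/)"] contour_integral_eq refl fg) (auto simp: Uv_def l_def)
      moreover have "contour_mean (\<Sigma> (m + l - 2)) f = contour_mean (\<Sigma> (m + l - 2)) g" if "l \<in> {2..m}"
        unfolding contour_mean_def using Up(4)[OF N_idx(1)[OF that]] that
        by (intro arg_cong2[where f = "(/)"] contour_integral_eq refl fg) (auto simp: Uv_def l_def)
      ultimately show ?thesis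
        using l \<Sigma>1 \<Sigma>O[of l] \<Sigma>N[of l] by (cases "l = 1") (auto simp: level_functional_def l_def Let_def)
    qed
    have "limit_integral m n I J A Sout S1 Sin z =
        iterate_functionals (level_functional Sout S1 Sin z) (var_list m n) (\<lambda>W. H_fun m I J A W z) W0"
      unfolding limit_integral_def
      by (rule iterate_functionals_base_cong) (use PiE_arb[OF W0] in \<open>auto simp: set_var_list\<close>)
    also have "\<dots> = iterate_functionals (weighted_functional q Oc (\<lambda>v. Nc (fst v)) z) (var_list m n)
        (\<lambda>W. H_fun m I J A W z) W0"
    proof (rule iterate_holomorphic_replace[where U = Uv and K = supp and V = V])
      show "open (Uv v)" if "v \<in> V" for v
        unfolding Uv_def using V_level[OF that] by (auto intro!: open_Un Up(1) simp: M_def)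
      show "compact (supp v)" if "v \<in> V" for v
        by (rule compact_contour_support[OF that]) (rule supp_smooth[OF that])
      show "bounded_functional (supp v) (weighted_functional q Oc (\<lambda>v. Nc (fst v)) z v)" if "v \<in> V" for v
        by (rule bounded_weighted_functional[OF z(1) that]) (rule supp_smooth[OF that])
      show "continuous_on (PiE V Uv) (\<lambda>W. H_fun m I J A W z)"
        by (rule continuous_on_slice_fst[OF H_fun_continuous[OF Uv_\<Omega> Uv_nc] zR])
      show "(\<lambda>w. H_fun m I J A (W(v := w)) z) holomorphic_on Uv v" if "W \<in> PiE V Uv" "v \<in> V" for W v
        by (rule H_fun_holomorphic_update[OF Uv_\<Omega> Uv_nc that zR])
      show "supp v \<subseteq> Uv v" if "v \<in> V" for v by (rule supp_Uv[OF that])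
      show "level_functional Sout S1 Sin z v f = weighted_functional q Oc (\<lambda>v. Nc (fst v)) z v f"
        if "v \<in> V" "f holomorphic_on Uv v" for v f by (rule func[OF that])
      show "level_functional Sout S1 Sin z v f = level_functional Sout S1 Sin z v g"
        if "v \<in> V" "\<And>w. w \<in> Uv v \<Longrightarrow> f w = g w" for v f g by (rule loc[OF that])
      show "set (var_list m n) \<subseteq> V" "distinct (var_list m n)" "W0 \<in> PiE V Uv"
        by (simp add: set_var_list, rule distinct_var_list, rule W0U)
    qed
    also have "\<dots> = extension z" by (rule extension_base[OF W0, symmetric])
    finally show ?thesis ..
  qed
  then show thesis
    using that[of extension] extension_analytic G_fun_eq_extension_punctured by auto
qed

section \<open>Level curves of \<open>q\<close> as nested contours\<close>

lemma level_ccw_contour: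
  assumes r: "0 < r" "r < R"
  shows "\<exists>\<gamma>. ccw_contour_around_0 \<gamma> \<and> path_image \<gamma> = level_curve \<Omega> q r"
proof -
  obtain \<gamma> where \<gamma>: "valid_path \<gamma>" "simple_path \<gamma>" "pathfinish \<gamma> = pathstart \<gamma>"
    "path_image \<gamma> = level_curve \<Omega> q r" using level_contour[OF r] by metis
  have 0: "0 \<in> inside (path_image \<gamma>)" using zero_inside[OF r] \<gamma>(4) by simp
  have "winding_number \<gamma> 0 = 1 \<or> winding_number \<gamma> 0 = - 1"
    using simple_closed_path_winding_number_inside[OF \<gamma>(2)] 0 by metis
  then show ?thesis
  proof
    assume "winding_number \<gamma> 0 = 1"
    then show ?thesis
      using \<gamma> 0 by (intro exI[of _ \<gamma>]) (auto simp: ccw_contour_around_0_def simple_closed_contour_def)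
  next
    assume "winding_number \<gamma> 0 = - 1"
    moreover have "0 \<notin> path_image \<gamma>" using 0 inside_no_overlap[of "path_image \<gamma>"] by blast
    ultimately have "winding_number (reversepath \<gamma>) 0 = 1"
      using winding_number_reversepath[of \<gamma> 0] \<gamma>(1) by (simp add: valid_path_imp_path)
    then show ?thesis
      using \<gamma> 0 by (intro exI[of _ "reversepath \<gamma>"])
        (auto simp: ccw_contour_around_0_def simple_closed_contour_def simple_path_reversepath)
  qed
qed

lemma nested_level_contours:
  assumes r: "0 < r" "r < R"
  obtains Sout S1 Sin where "nested_contours \<Omega> m Sout S1 Sin"
    "\<And>w. w \<in> path_image S1 \<Longrightarrow> r < norm (q w)"
    "\<And>l w. l \<in> {2..m} \<Longrightarrow> w \<in> path_image (Sout l) \<Longrightarrow> r < norm (q w)"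
proof -
  obtain c where c: "\<And>s. 0 < s \<Longrightarrow> s < R \<Longrightarrow> ccw_contour_around_0 (c s) \<and> path_image (c s) = level_curve \<Omega> q s"
    using level_ccw_contour by metis
  \<comment> \<open>The levels \<open>s l\<close> increase between \<open>r\<close> and
    \<open>R\<close> and serve \<open>S1\<close> and the outer contours; the levels
    \<open>t l\<close> decrease below \<open>r\<close> for \<open>l \<ge> 2\<close> and serve the
    inner ones.\<close>
  define s where "s l = r + (R - r) * (real l / real (m + 1))" for l
  define t where "t l = r / real l" for l
  have s: "r < s l" "s l < R" if "l \<in> {1..m}" for l
  proof -
    have f: "0 < real l / real (m + 1)" "real l / real (m + 1) < 1" using that by auto
    have "0 < (R - r) * (real l / real (m + 1))" using f(1) r by (intro mult_pos_pos) auto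
    then show "r < s l" by (simp add: s_def)
    have "(R - r) * (real l / real (m + 1)) < (R - r) * 1" using f(2) r by (intro mult_strict_left_mono) auto
    then show "s l < R" by (simp add: s_def)
  qed
  have s_mono: "s l < s l'" if "l < l'" for l l'
    using that r by (simp add: s_def divide_strict_right_mono)
  have t: "0 < t l" "t l < r" if "l \<in> {2..m}" for l
    using that r by (auto simp: t_def divide_less_eq)
  have t_mono: "t l' < t l" if "l < l'" "l \<in> {2..m}" for l l'
    using that r by (auto simp: t_def intro!: divide_strict_left_mono)
  have in_curves: "path_image (c a) \<subseteq> inside (path_image (c b))" if "0 < a" "a < b" "b < R" for a b
    using c[of a] c[of b] level_curve_inside[OF that] that by auto
  have good: "ccw_contour_around_0 (c a) \<and> path_image (c a) \<subseteq> \<Omega>" if "0 < a" "a < R" for a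
    using c[OF that] by (auto simp: level_curve_def)
  show thesis
  proof (cases "m = 0")
    case True
    \<comment> \<open>For \<open>m = 0\<close> the level \<open>s 1\<close> would be
      \<open>R\<close> itself, so the single contour is taken halfway between \<open>r\<close> and
      \<open>R\<close>.\<close>
    have "nested_contours \<Omega> m (\<lambda>l. c (s l)) (c ((r + R) / 2)) (\<lambda>l. c (t l))"
      using True good[of "(r + R) / 2"] r by (simp add: nested_contours_def)
    moreover have "r < norm (q w)" if "w \<in> path_image (c ((r + R) / 2))" for w
      using that c[of "(r + R) / 2"] r by (auto simp: level_curve_def)
    ultimately show thesis using that True by auto
  next
    case False
    then have m1: "1 \<in> {1..m}" by auto
    have "nested_contours \<Omega> m (\<lambda>l. c (s l)) (c (s 1)) (\<lambda>l. c (t l))"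
      unfolding nested_contours_def Let_def
    proof (intro conjI ballI)
      fix \<gamma> assume "\<gamma> \<in> set (rev (map (\<lambda>l. c (s l)) [2..<Suc m]) @ [c (s 1)] @ map (\<lambda>l. c (t l)) [2..<Suc m])"
      then consider "\<gamma> \<in> (\<lambda>l. c (s l)) ` set [2..<Suc m]" | "\<gamma> = c (s 1)" | "\<gamma> \<in> (\<lambda>l. c (t l)) ` set [2..<Suc m]"
        unfolding set_append set_rev set_map list.set by blast
      then consider l where "l \<in> {1..m}" "\<gamma> = c (s l)" | l where "l \<in> {2..m}" "\<gamma> = c (t l)"
      proof cases
        case 1
        then obtain l where "\<gamma> = c (s l)" "l \<in> set [2..<Suc m]" by (rule imageE)
        then show thesis by (intro that(1)[of l]) (auto simp del: upt_Suc)
      next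
        case 2
        then show thesis using that(1) m1 by blast
      next
        case 3
        then obtain l where "\<gamma> = c (t l)" "l \<in> set [2..<Suc m]" by (rule imageE)
        then show thesis by (intro that(2)[of l]) (auto simp del: upt_Suc)
      qed
      then have "ccw_contour_around_0 \<gamma> \<and> path_image \<gamma> \<subseteq> \<Omega>"
      proof cases
        case 1
        then show ?thesis using good[of "s l"] s[of l] r by auto
      next
        case 2
        then show ?thesis using good[of "t l"] t[of l] r by auto
      qed
      then show "ccw_contour_around_0 \<gamma>" "path_image \<gamma> \<subseteq> \<Omega>" by auto
    next
      let ?P = "\<lambda>\<gamma> \<gamma>'. path_image \<gamma>' \<subseteq> inside (path_image \<gamma>)"
      have ss: "?P (c (s l')) (c (s l))" if "l < l'" "l \<in> {1..m}" "l' \<in> {1..m}" for l l'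
        using s[OF that(2)] s[OF that(3)] s_mono[OF that(1)] r by (intro in_curves) auto
      have st: "?P (c (s l)) (c (t l'))" if "l \<in> {1..m}" "l' \<in> {2..m}" for l l'
        using s[OF that(1)] t[OF that(2)] by (intro in_curves) auto
      have tt: "?P (c (t l)) (c (t l'))" if "l < l'" "l \<in> {2..m}" "l' \<in> {2..m}" for l l'
        using t[OF that(2)] t[OF that(3)] t_mono[OF that(1,2)] r by (intro in_curves) auto
      have 1: "sorted_wrt (\<lambda>l l'. ?P (c (s l')) (c (s l))) [2..<Suc m]"
        by (rule sorted_wrt_mono_rel[OF _ sorted_wrt_upt]) (rule ss; auto simp del: upt_Suc)
      have 2: "sorted_wrt (\<lambda>l l'. ?P (c (t l)) (c (t l'))) [2..<Suc m]"
        by (rule sorted_wrt_mono_rel[OF _ sorted_wrt_upt]) (rule tt; auto simp del: upt_Suc)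
      have 3: "?P (c (s l)) (c (s 1))" if "l \<in> {2..m}" for l using that m1 by (intro ss) auto
      have 4: "?P (c (s 1)) (c (t l))" if "l \<in> {2..m}" for l by (rule st[OF m1 that])
      have 5: "?P (c (s l)) (c (t l'))" if "l \<in> {2..m}" "l' \<in> {2..m}" for l l' using that by (intro st) auto
      show "sorted_wrt ?P (rev (map (\<lambda>l. c (s l)) [2..<Suc m]) @ [c (s 1)] @ map (\<lambda>l. c (t l)) [2..<Suc m])"
        using 1 2 3 4 5
        by (auto simp: sorted_wrt_append sorted_wrt_rev sorted_wrt_map simp del: upt_Suc)
    qed
    moreover have "r < norm (q w)" if "w \<in> path_image (c (s l))" "l \<in> {1..m}" for w l
      using that c[of "s l"] s[of l] r by (auto simp: level_curve_def)
    ultimately show thesis using that m1 by auto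
  qed
qed

end

section \<open>Gluing extensions and identifying their values at \<open>z 0 = 0\<close>\<close>

lemma analytic_in_local:
  assumes "\<And>a. a \<in> S \<Longrightarrow> \<exists>d>0. \<exists>T g. analytic_in X g T \<and> a \<in> T \<and>
    (\<forall>x\<in>S. (\<forall>i\<in>X. norm (x i - a i) < d) \<longrightarrow> x \<in> T \<and> f x = g x) \<and> f a = g a"
  shows "analytic_in X f S"
  unfolding analytic_in_def
proof
  fix a assume a: "a \<in> S"
  obtain d0 T g where g: "d0 > 0" "analytic_in X g T" "a \<in> T"
    "\<forall>x\<in>S. (\<forall>i\<in>X. norm (x i - a i) < d0) \<longrightarrow> x \<in> T \<and> f x = g x" "f a = g a"
    using assms[OF a] by blast
  obtain c where c: "\<forall>e>0. \<exists>d>0. \<forall>x\<in>T. (\<forall>i\<in>X. norm (x i - a i) < d) \<longrightarrow>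
      norm (g x - g a - (\<Sum>i\<in>X. c i * (x i - a i))) \<le> e * (\<Sum>i\<in>X. norm (x i - a i))"
    using g(2,3) unfolding analytic_in_def by blast
  have "\<exists>d>0. \<forall>x\<in>S. (\<forall>i\<in>X. norm (x i - a i) < d) \<longrightarrow>
      norm (f x - f a - (\<Sum>i\<in>X. c i * (x i - a i))) \<le> e * (\<Sum>i\<in>X. norm (x i - a i))" if e: "e > 0" for e
  proof -
    obtain d where d: "d > 0" "\<forall>x\<in>T. (\<forall>i\<in>X. norm (x i - a i) < d) \<longrightarrow>
        norm (g x - g a - (\<Sum>i\<in>X. c i * (x i - a i))) \<le> e * (\<Sum>i\<in>X. norm (x i - a i))"
      using c e by blast
    show ?thesis
    proof (intro exI[of _ "min d d0"] conjI ballI impI)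
      show "min d d0 > 0" using d(1) g(1) by simp
      fix x assume x: "x \<in> S" "\<forall>i\<in>X. norm (x i - a i) < min d d0"
      then have "x \<in> T" "f x = g x" "\<forall>i\<in>X. norm (x i - a i) < d" using g(4) by auto
      then show "norm (f x - f a - (\<Sum>i\<in>X. c i * (x i - a i))) \<le> e * (\<Sum>i\<in>X. norm (x i - a i))"
        using d(2) g(5) by auto
    qed
  qed
  then show "\<exists>c. \<forall>e>0. \<exists>d>0. \<forall>x\<in>S. (\<forall>i\<in>X. norm (x i - a i) < d) \<longrightarrow>
      norm (f x - f a - (\<Sum>i\<in>X. c i * (x i - a i))) \<le> e * (\<Sum>i\<in>X. norm (x i - a i))" by blast
qed

text \<open>Only the radius of coordinate \<open>0\<close> depends on \<open>r\<close>.\<close>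

lemma polydisc_shrink:
  assumes "z \<in> polydisc m R" "norm (z 0) < r"
  shows "z \<in> polydisc m r"
proof -
  have "norm (z k) < z_radius r k" if "k < m" for k
    using polydisc_coordinate[OF assms(1) that] assms(2) by (simp add: z_radius_def split: if_splits)
  then show ?thesis using assms(1) by (auto simp: polydisc_def PiE_iff)
qed

text \<open>Each \<open>z\<close> is handled by an extension on a polydisc that contains it. Two
  such extensions agree with \<open>G\<close> on the smaller punctured polydisc, hence agree on the
  smaller polydisc, so the glued function is analytic near every point.\<close>

lemma analytic_extension_exhaustion:
  assumes m: "m \<ge> 1" and R: "R > 0"
    and ex: "\<And>r. 0 < r \<Longrightarrow> r < R \<Longrightarrow> \<exists>E. analytic_extension m r G E"
  shows "\<exists>E. analytic_extension m R G E"
proof -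
  obtain F where F: "\<And>r. 0 < r \<Longrightarrow> r < R \<Longrightarrow> analytic_extension m r G (F r)" using ex by metis
  \<comment> \<open>The midpoint between \<open>|z 0|\<close> and \<open>R\<close> leaves a margin
    around \<open>z\<close> in which the same extension can be used.\<close>
  define rad where "rad z = (norm (z 0) + R) / 2" for z :: "nat \<Rightarrow> complex"
  define E where "E z = F (rad z) z" for z
  have rad: "0 < rad z" "norm (z 0) < rad z" "rad z < R" if "z \<in> polydisc m R" for z
  proof -
    have "norm (z 0) < R" using polydisc_coordinate[OF that, of 0] m by (simp add: z_radius_def)
    then show "norm (z 0) < rad z" "rad z < R" by (auto simp: rad_def)
    show "0 < rad z" using R norm_ge_zero[of "z 0"] unfolding rad_def by (simp add: add_nonneg_pos)
  qed
  have agree: "F r z = F r' z" if r: "0 < r" "r < R" "0 < r'" "r' < R" and z: "z \<in> polydisc m r" "z \<in> polydisc m r'" for r r' z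
  proof (rule analytic_in_polydisc_unique[where m = m and r = "min r r'" and f = "F r" and g = "F r'" and z = z])
    show "analytic_in {..<m} (F r) (polydisc m (min r r'))" "analytic_in {..<m} (F r') (polydisc m (min r r'))"
      using F[OF r(1,2)] F[OF r(3,4)] polydisc_mono[of "min r r'"] unfolding analytic_extension_def
      by (meson analytic_in_subset min.cobounded1 min.cobounded2)+
    show "F r x = F r' x" if "x \<in> punctured_polydisc m (min r r')" for x
      using F[OF r(1,2)] F[OF r(3,4)] that punctured_polydisc_mono[of "min r r'" r m] punctured_polydisc_mono[of "min r r'" r' m]
      unfolding analytic_extension_def by (metis min.cobounded1 min.cobounded2 subsetD)
    show "z \<in> polydisc m (min r r')"
    proof (rule polydisc_shrink[OF z(1)])
      show "norm (z 0) < min r r'"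
        using polydisc_coordinate[OF z(1), of 0] polydisc_coordinate[OF z(2), of 0] m by (simp add: z_radius_def)
    qed
  qed (use r in auto)
  have E_eq: "E z = F r z" if "0 < r" "r < R" "z \<in> polydisc m r" for r z
  proof -
    have zR: "z \<in> polydisc m R" using that polydisc_mono[of r R m] by auto
    show ?thesis
      unfolding E_def by (rule agree[OF rad(1,3)[OF zR] that(1,2) polydisc_shrink[OF zR rad(2)[OF zR]] that(3)])
  qed
  have "analytic_in {..<m} E (polydisc m R)"
  proof (rule analytic_in_local)
    fix a assume a: "a \<in> polydisc m R"
    note ra = rad[OF a]
    have aT: "a \<in> polydisc m (rad a)" by (rule polydisc_shrink[OF a ra(2)])
    have "x \<in> polydisc m (rad a) \<and> E x = F (rad a) x"
      if x: "x \<in> polydisc m R" "\<forall>i\<in>{..<m}. norm (x i - a i) < rad a - norm (a 0)" for x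
    proof -
      have "norm (x 0 - a 0) < rad a - norm (a 0)" using x(2) m by auto
      then have "norm (x 0) < rad a" using norm_triangle_sub[of "x 0" "a 0"] by linarith
      then have "x \<in> polydisc m (rad a)" by (rule polydisc_shrink[OF x(1)])
      then show ?thesis using E_eq[OF ra(1,3)] by blast
    qed
    moreover have "analytic_in {..<m} (F (rad a)) (polydisc m (rad a))"
      using F[OF ra(1,3)] by (simp add: analytic_extension_def)
    ultimately show "\<exists>d>0. \<exists>T g. analytic_in {..<m} g T \<and> a \<in> T \<and>
        (\<forall>x\<in>polydisc m R. (\<forall>i\<in>{..<m}. norm (x i - a i) < d) \<longrightarrow> x \<in> T \<and> E x = g x) \<and> E a = g a"
      using aT E_eq[OF ra(1,3) aT] ra(2)
      by (intro exI[of _ "rad a - norm (a 0)"] conjI exI[of _ "polydisc m (rad a)"] exI[of _ "F (rad a)"]) auto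
  qed
  moreover have "E z = G z" if z: "z \<in> punctured_polydisc m R" for z
  proof -
    have zR: "z \<in> polydisc m R" using z punctured_polydisc_subset by blast
    have "z \<in> punctured_polydisc m (rad z)"
      using z polydisc_shrink[OF zR rad(2)[OF zR]] by (auto simp: punctured_polydisc_def polydisc_def PiE_iff)
    then show ?thesis using F[OF rad(1,3)[OF zR]] by (simp add: analytic_extension_def E_def)
  qed
  ultimately show ?thesis by (auto simp: analytic_extension_def)
qed

text \<open>For each \<open>r < R\<close>, level curves of \<open>q\<close> serve as contours, those
  of levels above \<open>r\<close> being the outer ones; this gives an extension up to radius
  \<open>r\<close> in \<open>z 0\<close>.\<close>

lemma (in level_curves) extension_exists:
  assumes m: "m \<ge> 1"
    and I: "\<And>l. 1 \<le> l \<Longrightarrow> l < m \<Longrightarrow> I l \<subseteq> {1..n l}"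
    and J: "\<And>l. 1 \<le> l \<Longrightarrow> l < m \<Longrightarrow> J (l + 1) \<subseteq> {1..n (l + 1)}"
    and data: "analytic_data \<Omega> m n R A" and dom: "dominates_at_0 \<Omega> m n I J R A q"
  shows "\<exists>E. analytic_extension m R (G_fun \<Omega> m n I J A q) E"
proof (rule analytic_extension_exhaustion[OF m R])
  fix r assume r: "0 < r" "r < R"
  obtain Sout S1 Sin where S: "nested_contours \<Omega> m Sout S1 Sin"
    "\<And>w. w \<in> path_image S1 \<Longrightarrow> r < norm (q w)"
    "\<And>l w. l \<in> {2..m} \<Longrightarrow> w \<in> path_image (Sout l) \<Longrightarrow> r < norm (q w)"
    by (rule nested_level_contours[OF r, of m]) (rule that)
  obtain E where "analytic_in {..<m} E (polydisc m r)"
    "\<And>z. z \<in> punctured_polydisc m r \<Longrightarrow> E z = G_fun \<Omega> m n I J A q z"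
    by (rule nested_contours_extension[OF m I J data dom S(1) r(1) less_imp_le[OF r(2)] S(2,3)]) (assumption | rule that)+
  then show "\<exists>E. analytic_extension m r (G_fun \<Omega> m n I J A q) E"
    unfolding analytic_extension_def by blast
qed

text \<open>The given contours yield an extension only over a small polydisc, but this contains
  every point of the large one with \<open>z 0 = 0\<close>. By uniqueness the given extension agrees
  with it there.\<close>

lemma (in level_curves) extension_eq_limit_integral:
  assumes m: "m \<ge> 1"
    and I: "\<And>l. 1 \<le> l \<Longrightarrow> l < m \<Longrightarrow> I l \<subseteq> {1..n l}"
    and J: "\<And>l. 1 \<le> l \<Longrightarrow> l < m \<Longrightarrow> J (l + 1) \<subseteq> {1..n (l + 1)}"
    and data: "analytic_data \<Omega> m n R A" and dom: "dominates_at_0 \<Omega> m n I J R A q"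
    and ext: "analytic_extension m R (G_fun \<Omega> m n I J A q) F"
    and z: "z \<in> polydisc m R" "z 0 = 0" and nest: "nested_contours \<Omega> m Sout S1 Sin"
  shows "F z = limit_integral m n I J A Sout S1 Sin z"
proof -
  define K where "K = path_image S1 \<union> (\<Union>l\<in>{2..m}. path_image (Sout l))"
  have contour: "compact (path_image \<gamma>)" "path_image \<gamma> \<subseteq> \<Omega> - {0}"
    if \<gamma>: "\<gamma> = S1 \<or> (\<exists>l\<in>{2..m}. \<gamma> = Sout l)" for \<gamma>
  proof -
    have "\<gamma> \<in> set (rev (map Sout [2..<Suc m]) @ [S1] @ map Sin [2..<Suc m])"
      using \<gamma> by (auto simp del: upt_Suc)
    then have g: "ccw_contour_around_0 \<gamma>" "path_image \<gamma> \<subseteq> \<Omega>"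
      using nest unfolding nested_contours_def Let_def by blast+
    show "compact (path_image \<gamma>)"
      using g(1) by (simp add: ccw_contour_around_0_def simple_closed_contour_def compact_valid_path_image)
    have "0 \<notin> path_image \<gamma>"
      using g(1) inside_no_overlap[of "path_image \<gamma>"] unfolding ccw_contour_around_0_def by blast
    then show "path_image \<gamma> \<subseteq> \<Omega> - {0}" using g(2) by blast
  qed
  have "compact K" unfolding K_def by (intro compact_Un compact_UN finite_atLeastAtMost contour(1)) blast+
  moreover have "K \<subseteq> \<Omega> - {0}" unfolding K_def by (intro Un_least UN_least contour(2)) blast+
  ultimately have K: "compact K" "K \<subseteq> \<Omega> - {0}" .
  have "continuous_on K (\<lambda>w. norm (q w))"
    using K(2) by (intro continuous_on_norm holomorphic_on_imp_continuous_on holomorphic_on_subset[OF q_holomorphic]) blast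
  moreover have "K \<noteq> {}" using path_image_nonempty[of S1] by (simp add: K_def)
  ultimately obtain x where x: "x \<in> K" "\<And>w. w \<in> K \<Longrightarrow> norm (q x) \<le> norm (q w)"
    using continuous_attains_inf[OF K(1)] by blast
  have qx: "0 < norm (q x)" using only_zero[of x] x(1) K(2) by auto
  \<comment> \<open>The minimum of \<open>|q|\<close> over \<open>S1\<close> and the outer contours
    is positive because these avoid \<open>0\<close>, the only zero of \<open>q\<close>. Halving it
    gives the strict inequality on the contours.\<close>
  define \<delta> where "\<delta> = min R (norm (q x) / 2)"
  have \<delta>: "0 < \<delta>" "\<delta> \<le> R" "\<delta> < norm (q x)" using qx R unfolding \<delta>_def by linarith+
  have q1: "\<delta> < norm (q w)" if "w \<in> path_image S1" for w
    using x(2)[of w] \<delta>(3) that by (simp add: K_def)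
  have q2: "\<delta> < norm (q w)" if "l \<in> {2..m}" "w \<in> path_image (Sout l)" for l w
  proof -
    have "w \<in> K" using that unfolding K_def by blast
    then show ?thesis using x(2)[of w] \<delta>(3) by simp
  qed
  obtain E where E: "analytic_in {..<m} E (polydisc m \<delta>)"
    "\<And>z. z \<in> punctured_polydisc m \<delta> \<Longrightarrow> E z = G_fun \<Omega> m n I J A q z"
    "\<And>z. z \<in> polydisc m \<delta> \<Longrightarrow> z 0 = 0 \<Longrightarrow> E z = limit_integral m n I J A Sout S1 Sin z"
    by (rule nested_contours_extension[OF m I J data dom nest \<delta>(1,2) q1 q2]) (assumption | rule that)+
  have z\<delta>: "z \<in> polydisc m \<delta>" by (rule polydisc_shrink[OF z(1)]) (use z(2) \<delta>(1) in simp)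
  have "F z = E z"
  proof (rule analytic_in_polydisc_unique[where m = m and r = \<delta> and f = F and g = E and z = z])
    show "analytic_in {..<m} F (polydisc m \<delta>)"
      using ext polydisc_mono[OF \<delta>(2)] analytic_in_subset unfolding analytic_extension_def by blast
    show "F w = E w" if "w \<in> punctured_polydisc m \<delta>" for w
      using ext E(2)[OF that] subsetD[OF punctured_polydisc_mono[OF \<delta>(2)] that] unfolding analytic_extension_def by simp
  qed (fact E(1) z\<delta> \<delta>(1))+
  then show ?thesis using E(3)[OF z\<delta> z(2)] by simp
qed

theorem proposition4p3:
  fixes m :: nat and n :: "nat \<Rightarrow> nat" and rmax :: real and \<Omega> :: "complex set"
    and I J :: "nat \<Rightarrow> nat set"
    and A :: "(nat \<times> nat \<Rightarrow> complex) \<Rightarrow> (nat \<Rightarrow> complex) \<Rightarrow> complex"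
    and q :: "complex \<Rightarrow> complex"
  assumes "m \<ge> 1"
    and "0 < rmax" and "rmax < 1"
    and "open \<Omega>" and "simply_connected \<Omega>" and "0 \<in> \<Omega>"
    and "\<And>l. 1 \<le> l \<Longrightarrow> l < m \<Longrightarrow> I l \<subseteq> {1..n l}"
    and "\<And>l. 1 \<le> l \<Longrightarrow> l < m \<Longrightarrow> J (l + 1) \<subseteq> {1..n (l + 1)}"
    and "analytic_data \<Omega> m n rmax A"
    and "admissible \<Omega> m n I J rmax A q"
  shows "(\<exists>Gext. analytic_extension m rmax (G_fun \<Omega> m n I J A q) Gext) \<and>
    (\<forall>Gext. analytic_extension m rmax (G_fun \<Omega> m n I J A q) Gext \<longrightarrow>
       (\<forall>z\<in>polydisc m rmax. z 0 = 0 \<longrightarrow>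
          (\<forall>q' Gext'. admissible \<Omega> m n I J rmax A q' \<longrightarrow>
             analytic_extension m rmax (G_fun \<Omega> m n I J A q') Gext' \<longrightarrow> Gext' z = Gext z) \<and>
          (\<forall>Sout S1 Sin. nested_contours \<Omega> m Sout S1 Sin \<longrightarrow>
             Gext z = limit_integral m n I J A Sout S1 Sin z)))"
proof -
  have curves: "level_curves \<Omega> q' rmax" "dominates_at_0 \<Omega> m n I J rmax A q'"
    if "admissible \<Omega> m n I J rmax A q'" for q'
    using that assms(2,4-6) by (auto simp: admissible_def level_curves_def)
  have at_0: "F z = limit_integral m n I J A Sout S1 Sin z"
    if "admissible \<Omega> m n I J rmax A q'" "analytic_extension m rmax (G_fun \<Omega> m n I J A q') F"
      "z \<in> polydisc m rmax" "z 0 = 0" "nested_contours \<Omega> m Sout S1 Sin" for q' F z Sout S1 Sin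
    by (rule level_curves.extension_eq_limit_integral[OF curves(1)[OF that(1)] assms(1,7-9) curves(2)[OF that(1)] that(2-5)])
  have "0 < rmax / 2" "rmax / 2 < rmax" using assms(2) by auto
  \<comment> \<open>Any one system of contours suffices for the independence of \<open>q\<close>:
    the limit integral over it does not mention \<open>q\<close>, and it equals the value of the
    extension for every admissible function. Here level curves of \<open>q\<close> are
    taken.\<close>
  then obtain Sout S1 Sin where S: "nested_contours \<Omega> m Sout S1 Sin"
    by (rule level_curves.nested_level_contours[OF curves(1)[OF assms(10)], where m = m])
  have "Gext' z = Gext z"
    if "analytic_extension m rmax (G_fun \<Omega> m n I J A q) Gext" "z \<in> polydisc m rmax" "z 0 = 0"
      "admissible \<Omega> m n I J rmax A q'" "analytic_extension m rmax (G_fun \<Omega> m n I J A q') Gext'"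
    for Gext Gext' q' z
    using at_0[OF that(4,5,2,3) S] at_0[OF assms(10) that(1-3) S] by simp
  moreover have "\<exists>Gext. analytic_extension m rmax (G_fun \<Omega> m n I J A q) Gext"
    by (rule level_curves.extension_exists[OF curves(1)[OF assms(10)] assms(1,7-9) curves(2)[OF assms(10)]])
  ultimately show ?thesis using at_0[OF assms(10)] by blast
qed

end
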